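(* Let $k$ be a field, let $A=kQ$ be a finite dimensional hereditary $k$-algebra, and let $A^{(1)}$ be the duplicated algebra of $A$. Let $\bar{P}_{A^{(1)}}$ be the direct sum of a complete set of pairwise non-isomorphic indecomposable projective-injective $A^{(1)}$-modules. Let $T$ and $T'$ be basic tilting $A$-modules. Then there is an arrow $T'\to T$ in the tilting quiver $\mathscr{K}(A)$ of $A$ if and only if there is an arrow $T'\oplus\bar{P}_{A^{(1)}}\to T\oplus\bar{P}_{A^{(1)}}$ in the tilting quiver $\mathscr{K}(A^{(1)})$ of $A^{(1)}$.
   Context: All modules are finitely generated left modules. Here $kQ$ is the path algebra of a finite quiver $Q$ (acyclic, since $kQ$ is finite dimensional). With $D=\mathrm{Hom}_k(-,k)$, the duplicated algebra of $A$ is the triangular matrix algebra $A^{(1)}=\begin{pmatrix} A & 0\\ DA & A\end{pmatrix}$, where $DA$ is the standard $A$-$A$-bimodule and multiplication is matrix multiplication. A left $A^{(1)}$-module is the same as a triple $(M,N,\varphi)$ with $M,N$ left $A$-modules and $\varphi: DA\otimes_A M\to N$ an $A$-linear map. The category of $A$-modules is regarded as a full subcategory of the category of $A^{(1)}$-modules via $N\mapsto(0,N,0)$, so that projective $A$-modules are projective as $A^{(1)}$-modules. For a finite dimensional $k$-algebra $\Lambda$, a $\Lambda$-module $T$ is called a tilting module if (1) $\mathrm{pd}_\Lambda T\leq 1$; (2) $\mathrm{Ext}^1_\Lambda(T,T)=0$; (3) there is an exact sequence $0\to\Lambda\to T_0\to T_1\to 0$ with $T_0,T_1\in\mathrm{add}\,T$.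 A module is basic if it is a direct sum of pairwise non-isomorphic indecomposable modules. For every tilting $A$-module $T$, the module $T\oplus\bar{P}_{A^{(1)}}$ is a tilting $A^{(1)}$-module. The tilting quiver $\mathscr{K}(\Lambda)$ has as vertices the isomorphism classes of basic tilting $\Lambda$-modules. There is an arrow $T'\to T$ if and only if $T'=M\oplus X$ and $T=M\oplus Y$ with $X$ and $Y$ indecomposable such that there is a short exact sequence $0\to X\to E\to Y\to 0$ with $E\in\mathrm{add}\,M$. *)

theory Defs
  imports
    "HOL-Algebra.Module"
    "HOL-Algebra.RingHom"
    "HOL-Library.Extended_Nat"
    "Graph_Theory.Arc_Walk"
begin

section \<open>Left modules over a not necessarily commutative ring\<close>

text \<open>
  The library locale \<^locale>\<open>module\<close> requires a commutative ring of scalars. As there, modules are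
  elements of the record type \<^typ>\<open>('a, 'm) module\<close>, whose fields \<^const>\<open>mult\<close> and \<^const>\<open>one\<close>
  play no role for modules. A \<open>k\<close>-algebra \<open>\<Lambda>\<close> is also an element of such a record type,
  \<^typ>\<open>('k, 'a) module\<close>; there \<^const>\<open>mult\<close> and \<^const>\<open>one\<close> are the ring structure and
  \<^const>\<open>smult\<close> is the action of \<open>k\<close>.
\<close>

locale left_module = R?: ring R + M?: abelian_group M for R (structure) and M (structure) +
  assumes smult_closed:
      "\<lbrakk>a \<in> carrier R; x \<in> carrier M\<rbrakk> \<Longrightarrow> a \<odot>\<^bsub>M\<^esub> x \<in> carrier M"
    and smult_l_distr:
      "\<lbrakk>a \<in> carrier R; b \<in> carrier R; x \<in> carrier M\<rbrakk> \<Longrightarrow>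
        (a \<oplus>\<^bsub>R\<^esub> b) \<odot>\<^bsub>M\<^esub> x = a \<odot>\<^bsub>M\<^esub> x \<oplus>\<^bsub>M\<^esub> b \<odot>\<^bsub>M\<^esub> x"
    and smult_r_distr:
      "\<lbrakk>a \<in> carrier R; x \<in> carrier M; y \<in> carrier M\<rbrakk> \<Longrightarrow>
        a \<odot>\<^bsub>M\<^esub> (x \<oplus>\<^bsub>M\<^esub> y) = a \<odot>\<^bsub>M\<^esub> x \<oplus>\<^bsub>M\<^esub> a \<odot>\<^bsub>M\<^esub> y"
    and smult_assoc1:
      "\<lbrakk>a \<in> carrier R; b \<in> carrier R; x \<in> carrier M\<rbrakk> \<Longrightarrow>
        (a \<otimes>\<^bsub>R\<^esub> b) \<odot>\<^bsub>M\<^esub> x = a \<odot>\<^bsub>M\<^esub> (b \<odot>\<^bsub>M\<^esub> x)"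
    and smult_one:
      "x \<in> carrier M \<Longrightarrow> \<one>\<^bsub>R\<^esub> \<odot>\<^bsub>M\<^esub> x = x"

definition fg_module :: "('a, 'c) ring_scheme \<Rightarrow> ('a, 'm) module \<Rightarrow> bool" where
  "fg_module R M \<longleftrightarrow> left_module R M \<and>
     (\<exists>S. finite S \<and> S \<subseteq> carrier M \<and>
       (\<forall>x\<in>carrier M. \<exists>c. (\<forall>s\<in>S. c s \<in> carrier R) \<and> x = (\<Oplus>\<^bsub>M\<^esub>s\<in>S. c s \<odot>\<^bsub>M\<^esub> s)))"

definition mod_hom :: "('a, 'c) ring_scheme \<Rightarrow> ('a, 'm) module \<Rightarrow> ('a, 'n) module \<Rightarrow> ('m \<Rightarrow> 'n) set" where
  "mod_hom R M N = {f. (\<forall>x\<in>carrier M. f x \<in> carrier N) \<and>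
     (\<forall>x\<in>carrier M. \<forall>y\<in>carrier M. f (x \<oplus>\<^bsub>M\<^esub> y) = f x \<oplus>\<^bsub>N\<^esub> f y) \<and>
     (\<forall>a\<in>carrier R. \<forall>x\<in>carrier M. f (a \<odot>\<^bsub>M\<^esub> x) = a \<odot>\<^bsub>N\<^esub> f x)}"

definition mod_iso :: "('a, 'c) ring_scheme \<Rightarrow> ('a, 'm) module \<Rightarrow> ('a, 'n) module \<Rightarrow> bool" where
  "mod_iso R M N \<longleftrightarrow> (\<exists>f\<in>mod_hom R M N. bij_betw f (carrier M) (carrier N))"

definition regular_module :: "('a, 'c) ring_scheme \<Rightarrow> ('a, 'a) module" where
  "regular_module R =
     \<lparr>carrier = carrier R, mult = mult R, one = one R, zero = zero R, add = add R, smult = mult R\<rparr>"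

definition dsum2 :: "('a, 'm) module \<Rightarrow> ('a, 'n) module \<Rightarrow> ('a, 'm \<times> 'n) module" where
  "dsum2 M N =
     \<lparr>carrier = carrier M \<times> carrier N, mult = undefined, one = undefined,
      zero = (\<zero>\<^bsub>M\<^esub>, \<zero>\<^bsub>N\<^esub>),
      add = (\<lambda>(x, y) (x', y'). (x \<oplus>\<^bsub>M\<^esub> x', y \<oplus>\<^bsub>N\<^esub> y')),
      smult = (\<lambda>a (x, y). (a \<odot>\<^bsub>M\<^esub> x, a \<odot>\<^bsub>N\<^esub> y))\<rparr>"

text \<open>The direct sum of a family; it is only used for finite index sets \<open>I\<close>.\<close>

definition dsum :: "'i set \<Rightarrow> ('i \<Rightarrow> ('a, 'm) module) \<Rightarrow> ('a, 'i \<Rightarrow> 'm) module" where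
  "dsum I M =
     \<lparr>carrier = (\<Pi>\<^sub>E i\<in>I. carrier (M i)), mult = undefined, one = undefined,
      zero = (\<lambda>i\<in>I. \<zero>\<^bsub>M i\<^esub>),
      add = (\<lambda>x y. \<lambda>i\<in>I. x i \<oplus>\<^bsub>M i\<^esub> y i),
      smult = (\<lambda>a x. \<lambda>i\<in>I. a \<odot>\<^bsub>M i\<^esub> x i)\<rparr>"

definition short_exact :: "('a, 'c) ring_scheme \<Rightarrow> ('a, 'x) module \<Rightarrow> ('x \<Rightarrow> 'e) \<Rightarrow> ('a, 'e) module
    \<Rightarrow> ('e \<Rightarrow> 'y) \<Rightarrow> ('a, 'y) module \<Rightarrow> bool" where
  "short_exact R X f E g Y \<longleftrightarrow>
     f \<in> mod_hom R X E \<and> g \<in> mod_hom R E Y \<and>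
     inj_on f (carrier X) \<and> f ` carrier X = a_kernel E Y g \<and> g ` carrier E = carrier Y"


section \<open>Finitely generated modules over a finite dimensional algebra\<close>

text \<open>
  A finitely generated module over a finite dimensional \<open>k\<close>-algebra is a finite dimensional vector
  space over \<open>k\<close>, hence it is isomorphic to a module whose underlying set consists of functions
  \<open>nat \<Rightarrow> k\<close>. Wherever a definition ranges over all modules, it ranges over the modules
  of the following type, which up to isomorphism are all finitely generated modules.
\<close>

type_synonym ('k, 'a) umod = "('a, nat \<Rightarrow> 'k) module"

definition indecomposable :: "('k, 'a) module \<Rightarrow> ('a, 'm) module \<Rightarrow> bool" where
  "indecomposable \<Lambda> M \<longleftrightarrow> fg_module \<Lambda> M \<and> carrier M \<noteq> {\<zero>\<^bsub>M\<^esub>} \<and>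
     (\<forall>(X :: ('k, 'a) umod) (Y :: ('k, 'a) umod).
        fg_module \<Lambda> X \<and> fg_module \<Lambda> Y \<and> mod_iso \<Lambda> M (dsum2 X Y) \<longrightarrow>
        carrier X = {\<zero>\<^bsub>X\<^esub>} \<or> carrier Y = {\<zero>\<^bsub>Y\<^esub>})"

definition pairwise_non_iso :: "('k, 'a) module \<Rightarrow> nat \<Rightarrow> (nat \<Rightarrow> ('a, 'm) module) \<Rightarrow> bool" where
  "pairwise_non_iso \<Lambda> n X \<longleftrightarrow> (\<forall>i<n. \<forall>j<n. i \<noteq> j \<longrightarrow> \<not> mod_iso \<Lambda> (X i) (X j))"

definition basic :: "('k, 'a) module \<Rightarrow> ('a, 'm) module \<Rightarrow> bool" where
  "basic \<Lambda> M \<longleftrightarrow> fg_module \<Lambda> M \<and>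
     (\<exists>n (X :: nat \<Rightarrow> ('k, 'a) umod).
        (\<forall>i<n. indecomposable \<Lambda> (X i)) \<and> pairwise_non_iso \<Lambda> n X \<and>
        mod_iso \<Lambda> M (dsum {..<n} X))"

definition in_add :: "('k, 'a) module \<Rightarrow> ('a, 'm) module \<Rightarrow> ('a, 'x) module \<Rightarrow> bool" where
  "in_add \<Lambda> M X \<longleftrightarrow> fg_module \<Lambda> X \<and>
     (\<exists>n (Y :: ('k, 'a) umod). fg_module \<Lambda> Y \<and>
        mod_iso \<Lambda> (dsum2 X Y) (dsum {..<n::nat} (\<lambda>_. M)))"

definition projective :: "('k, 'a) module \<Rightarrow> ('a, 'm) module \<Rightarrow> bool" where
  "projective \<Lambda> P \<longleftrightarrow> fg_module \<Lambda> P \<and>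
     (\<forall>(M :: ('k, 'a) umod) (N :: ('k, 'a) umod) f g.
        fg_module \<Lambda> M \<and> fg_module \<Lambda> N \<and>
        f \<in> mod_hom \<Lambda> M N \<and> f ` carrier M = carrier N \<and> g \<in> mod_hom \<Lambda> P N \<longrightarrow>
        (\<exists>h\<in>mod_hom \<Lambda> P M. \<forall>x\<in>carrier P. f (h x) = g x))"

definition injective :: "('k, 'a) module \<Rightarrow> ('a, 'm) module \<Rightarrow> bool" where
  "injective \<Lambda> J \<longleftrightarrow> fg_module \<Lambda> J \<and>
     (\<forall>(M :: ('k, 'a) umod) (N :: ('k, 'a) umod) f g.
        fg_module \<Lambda> M \<and> fg_module \<Lambda> N \<and>
        f \<in> mod_hom \<Lambda> M N \<and> inj_on f (carrier M) \<and> g \<in> mod_hom \<Lambda> M J \<longrightarrow>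
        (\<exists>h\<in>mod_hom \<Lambda> N J. \<forall>x\<in>carrier M. h (f x) = g x))"

text \<open>
  \<open>\<dots> \<longrightarrow> P 1 \<longrightarrow> P 0 \<longrightarrow> M \<longrightarrow> 0\<close> with maps \<open>d i : P (i + 1) \<longrightarrow> P i\<close> and augmentation \<open>\<epsilon>\<close>,
  such that \<open>P i = 0\<close> for \<open>i > n\<close>.
\<close>

definition proj_resolution :: "('k, 'a) module \<Rightarrow> ('a, 'm) module \<Rightarrow> nat \<Rightarrow> (nat \<Rightarrow> ('k, 'a) umod)
    \<Rightarrow> (nat \<Rightarrow> (nat \<Rightarrow> 'k) \<Rightarrow> (nat \<Rightarrow> 'k)) \<Rightarrow> ((nat \<Rightarrow> 'k) \<Rightarrow> 'm) \<Rightarrow> bool" where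
  "proj_resolution \<Lambda> M n P d \<epsilon> \<longleftrightarrow>
     (\<forall>i. projective \<Lambda> (P i)) \<and> (\<forall>i>n. carrier (P i) = {\<zero>\<^bsub>P i\<^esub>}) \<and>
     \<epsilon> \<in> mod_hom \<Lambda> (P 0) M \<and> (\<forall>i. d i \<in> mod_hom \<Lambda> (P (Suc i)) (P i)) \<and>
     \<epsilon> ` carrier (P 0) = carrier M \<and>
     d 0 ` carrier (P 1) = a_kernel (P 0) M \<epsilon> \<and>
     (\<forall>i. d (Suc i) ` carrier (P (Suc (Suc i))) = a_kernel (P (Suc i)) (P i) (d i))"

definition proj_dim :: "('k, 'a) module \<Rightarrow> ('a, 'm) module \<Rightarrow> enat" where
  "proj_dim \<Lambda> M = Inf {enat n | n. \<exists>P d \<epsilon>. proj_resolution \<Lambda> M n P d \<epsilon>}"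

text \<open>
  \<open>Ext\<^sup>1(M, N)\<close> in the sense of Yoneda: extensions \<open>0 \<longrightarrow> N \<longrightarrow> E \<longrightarrow> M \<longrightarrow> 0\<close> modulo equivalence;
  the zero element is the class of the split extension with middle term \<open>N \<oplus> M\<close>.
  The Baer sum is not needed to express the vanishing of \<open>Ext\<^sup>1(M, N)\<close>.
\<close>

definition extensions :: "('k, 'a) module \<Rightarrow> ('a, 'm) module \<Rightarrow> ('a, 'n) module
    \<Rightarrow> (('n \<Rightarrow> (nat \<Rightarrow> 'k)) \<times> ('k, 'a) umod \<times> ((nat \<Rightarrow> 'k) \<Rightarrow> 'm)) set" where
  "extensions \<Lambda> M N = {(f, E, g). fg_module \<Lambda> E \<and> short_exact \<Lambda> N f E g M}"

definition ext_equiv :: "('k, 'a) module \<Rightarrow> ('a, 'm) module \<Rightarrow> ('a, 'n) module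
    \<Rightarrow> ('n \<Rightarrow> 'e) \<times> ('a, 'e) module \<times> ('e \<Rightarrow> 'm)
    \<Rightarrow> ('n \<Rightarrow> 'f) \<times> ('a, 'f) module \<times> ('f \<Rightarrow> 'm) \<Rightarrow> bool" where
  "ext_equiv \<Lambda> M N = (\<lambda>(f, E, g) (f', E', g').
     \<exists>h\<in>mod_hom \<Lambda> E E'. bij_betw h (carrier E) (carrier E') \<and>
       (\<forall>x\<in>carrier N. h (f x) = f' x) \<and> (\<forall>y\<in>carrier E. g' (h y) = g y))"

definition Ext1 :: "('k, 'a) module \<Rightarrow> ('a, 'm) module \<Rightarrow> ('a, 'n) module
    \<Rightarrow> (('n \<Rightarrow> (nat \<Rightarrow> 'k)) \<times> ('k, 'a) umod \<times> ((nat \<Rightarrow> 'k) \<Rightarrow> 'm)) set set" where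
  "Ext1 \<Lambda> M N =
     extensions \<Lambda> M N //
       {(\<xi>, \<eta>). \<xi> \<in> extensions \<Lambda> M N \<and> \<eta> \<in> extensions \<Lambda> M N \<and> ext_equiv \<Lambda> M N \<xi> \<eta>}"

definition Ext1_zero :: "('k, 'a) module \<Rightarrow> ('a, 'm) module \<Rightarrow> ('a, 'n) module
    \<Rightarrow> (('n \<Rightarrow> (nat \<Rightarrow> 'k)) \<times> ('k, 'a) umod \<times> ((nat \<Rightarrow> 'k) \<Rightarrow> 'm)) set" where
  "Ext1_zero \<Lambda> M N =
     {\<xi> \<in> extensions \<Lambda> M N. ext_equiv \<Lambda> M N ((\<lambda>x. (x, \<zero>\<^bsub>M\<^esub>)), dsum2 N M, snd) \<xi>}"

definition tilting :: "('k, 'a) module \<Rightarrow> ('a, 'm) module \<Rightarrow> bool" where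
  "tilting \<Lambda> T \<longleftrightarrow> fg_module \<Lambda> T \<and>
     proj_dim \<Lambda> T \<le> 1 \<and>
     Ext1 \<Lambda> T T = {Ext1_zero \<Lambda> T T} \<and>
     (\<exists>(T0 :: ('k, 'a) umod) (T1 :: ('k, 'a) umod) f g.
        in_add \<Lambda> T T0 \<and> in_add \<Lambda> T T1 \<and> short_exact \<Lambda> (regular_module \<Lambda>) f T0 g T1)"


section \<open>The tilting quiver\<close>

definition iso_class :: "('k, 'a) module \<Rightarrow> ('a, 'm) module \<Rightarrow> ('k, 'a) umod set" where
  "iso_class \<Lambda> M = {N. fg_module \<Lambda> N \<and> mod_iso \<Lambda> N M}"

definition tilting_arrow :: "('k, 'a) module \<Rightarrow> ('a, 'm) module \<Rightarrow> ('a, 'n) module \<Rightarrow> bool" where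
  "tilting_arrow \<Lambda> T' T \<longleftrightarrow>
     (\<exists>(M :: ('k, 'a) umod) (X :: ('k, 'a) umod) (Y :: ('k, 'a) umod) (E :: ('k, 'a) umod) f g.
        fg_module \<Lambda> M \<and> indecomposable \<Lambda> X \<and> indecomposable \<Lambda> Y \<and>
        mod_iso \<Lambda> T' (dsum2 M X) \<and> mod_iso \<Lambda> T (dsum2 M Y) \<and>
        in_add \<Lambda> M E \<and> short_exact \<Lambda> X f E g Y)"

definition tilting_quiver ::
  "('k, 'a) module \<Rightarrow> (('k, 'a) umod set, ('k, 'a) umod set \<times> ('k, 'a) umod set) pre_digraph" where
  "tilting_quiver \<Lambda> =
     \<lparr>verts = {iso_class \<Lambda> T | T :: ('k, 'a) umod. basic \<Lambda> T \<and> tilting \<Lambda> T},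
      arcs = {(iso_class \<Lambda> T', iso_class \<Lambda> T) | (T' :: ('k, 'a) umod) (T :: ('k, 'a) umod).
                basic \<Lambda> T' \<and> tilting \<Lambda> T' \<and> basic \<Lambda> T \<and> tilting \<Lambda> T \<and> tilting_arrow \<Lambda> T' T},
      tail = fst, head = snd\<rparr>"


section \<open>Path algebras\<close>

text \<open>
  A path is a pair of its starting vertex and its list of arrows, in the order of traversal.
  The product of paths \<open>p\<close> and \<open>q\<close> is the path that traverses first \<open>p\<close> and then \<open>q\<close>
  if \<open>q\<close> starts where \<open>p\<close> ends, and zero otherwise. The opposite convention amounts to
  replacing \<open>Q\<close> by its opposite quiver.
\<close>

definition quiver_paths :: "('v, 'e) pre_digraph \<Rightarrow> ('v \<times> 'e list) set" where
  "quiver_paths Q = {(u, p). \<exists>v. pre_digraph.awalk Q u p v}"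

text \<open>
  The coefficient of \<open>f g\<close> at a path is the sum over its decompositions into an initial segment
  of length \<open>i\<close> and the remaining path, which starts at vertex number \<open>i\<close> of the path.
\<close>

definition path_algebra :: "'k ring \<Rightarrow> ('v, 'e) pre_digraph \<Rightarrow> ('k, 'v \<times> 'e list \<Rightarrow> 'k) module" where
  "path_algebra K Q =
     \<lparr>carrier = {f \<in> quiver_paths Q \<rightarrow>\<^sub>E carrier K. finite {p \<in> quiver_paths Q. f p \<noteq> \<zero>\<^bsub>K\<^esub>}},
      mult = (\<lambda>f g. restrict (\<lambda>(u, p). \<Oplus>\<^bsub>K\<^esub>i\<in>{..length p}.
                f (u, take i p) \<otimes>\<^bsub>K\<^esub> g (pre_digraph.awalk_verts Q u p ! i, drop i p)) (quiver_paths Q)),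
      one = restrict (\<lambda>(u, p). if p = [] then \<one>\<^bsub>K\<^esub> else \<zero>\<^bsub>K\<^esub>) (quiver_paths Q),
      zero = restrict (\<lambda>_. \<zero>\<^bsub>K\<^esub>) (quiver_paths Q),
      add = (\<lambda>f g. restrict (\<lambda>p. f p \<oplus>\<^bsub>K\<^esub> g p) (quiver_paths Q)),
      smult = (\<lambda>c f. restrict (\<lambda>p. c \<otimes>\<^bsub>K\<^esub> f p) (quiver_paths Q))\<rparr>"


section \<open>Duplicated algebras\<close>

text \<open>The \<open>A\<close>-\<open>A\<close>-bimodule \<open>DA = Hom\<^sub>k(A, k)\<close>: \<open>(b \<phi>)(x) = \<phi>(x b)\<close> and \<open>(\<phi> a)(x) = \<phi>(a x)\<close>.\<close>

definition dual :: "'k ring \<Rightarrow> ('k, 'a) module \<Rightarrow> ('a \<Rightarrow> 'k) set" where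
  "dual K A = mod_hom K A (regular_module K) \<inter> extensional (carrier A)"

definition dual_add :: "'k ring \<Rightarrow> ('k, 'a) module \<Rightarrow> ('a \<Rightarrow> 'k) \<Rightarrow> ('a \<Rightarrow> 'k) \<Rightarrow> 'a \<Rightarrow> 'k" where
  "dual_add K A \<phi> \<psi> = (\<lambda>x\<in>carrier A. \<phi> x \<oplus>\<^bsub>K\<^esub> \<psi> x)"

definition dual_left :: "('k, 'a) module \<Rightarrow> 'a \<Rightarrow> ('a \<Rightarrow> 'k) \<Rightarrow> 'a \<Rightarrow> 'k" where
  "dual_left A b \<phi> = (\<lambda>x\<in>carrier A. \<phi> (x \<otimes>\<^bsub>A\<^esub> b))"

definition dual_right :: "('k, 'a) module \<Rightarrow> ('a \<Rightarrow> 'k) \<Rightarrow> 'a \<Rightarrow> 'a \<Rightarrow> 'k" where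
  "dual_right A \<phi> a = (\<lambda>x\<in>carrier A. \<phi> (a \<otimes>\<^bsub>A\<^esub> x))"

text \<open>The triple \<open>(a, \<phi>, b)\<close> is the lower triangular matrix with rows \<open>(a, 0)\<close> and \<open>(\<phi>, b)\<close>.\<close>

definition duplicated_algebra ::
  "'k ring \<Rightarrow> ('k, 'a) module \<Rightarrow> ('k, 'a \<times> ('a \<Rightarrow> 'k) \<times> 'a) module" where
  "duplicated_algebra K A =
     \<lparr>carrier = carrier A \<times> dual K A \<times> carrier A,
      mult = (\<lambda>(a, \<phi>, b) (a', \<phi>', b').
        (a \<otimes>\<^bsub>A\<^esub> a', dual_add K A (dual_right A \<phi> a') (dual_left A b \<phi>'), b \<otimes>\<^bsub>A\<^esub> b')),
      one = (\<one>\<^bsub>A\<^esub>, \<lambda>x\<in>carrier A. \<zero>\<^bsub>K\<^esub>, \<one>\<^bsub>A\<^esub>),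
      zero = (\<zero>\<^bsub>A\<^esub>, \<lambda>x\<in>carrier A. \<zero>\<^bsub>K\<^esub>, \<zero>\<^bsub>A\<^esub>),
      add = (\<lambda>(a, \<phi>, b) (a', \<phi>', b'). (a \<oplus>\<^bsub>A\<^esub> a', dual_add K A \<phi> \<phi>', b \<oplus>\<^bsub>A\<^esub> b')),
      smult = (\<lambda>c (a, \<phi>, b). (c \<odot>\<^bsub>A\<^esub> a, \<lambda>x\<in>carrier A. c \<otimes>\<^bsub>K\<^esub> \<phi> x, c \<odot>\<^bsub>A\<^esub> b))\<rparr>"

text \<open>The \<open>A\<^sup>(\<^sup>1\<^sup>)\<close>-module \<open>(0, N, 0)\<close>: the matrices act on column vectors with entries in \<open>0\<close> and \<open>N\<close>.\<close>

definition dup_embed :: "('a, 'm) module \<Rightarrow> ('a \<times> ('a \<Rightarrow> 'k) \<times> 'a, 'm) module" where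
  "dup_embed N =
     \<lparr>carrier = carrier N, mult = undefined, one = undefined, zero = zero N, add = add N,
      smult = (\<lambda>(a, \<phi>, b) x. b \<odot>\<^bsub>N\<^esub> x)\<rparr>"

text \<open>
  \<open>P\<close> is the direct sum of a complete set of pairwise non-isomorphic indecomposable
  projective-injective \<open>\<Lambda>\<close>-modules. There are only finitely many of these, and \<open>P\<close> is determined
  up to isomorphism.
\<close>

definition proj_inj_sum :: "('k, 'a) module \<Rightarrow> ('a, 'm) module \<Rightarrow> bool" where
  "proj_inj_sum \<Lambda> P \<longleftrightarrow> fg_module \<Lambda> P \<and>
     (\<exists>n (X :: nat \<Rightarrow> ('k, 'a) umod).
        (\<forall>i<n. indecomposable \<Lambda> (X i) \<and> projective \<Lambda> (X i) \<and> injective \<Lambda> (X i)) \<and>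
        pairwise_non_iso \<Lambda> n X \<and>
        (\<forall>Z :: ('k, 'a) umod. indecomposable \<Lambda> Z \<and> projective \<Lambda> Z \<and> injective \<Lambda> Z \<longrightarrow>
           (\<exists>i<n. mod_iso \<Lambda> Z (X i))) \<and>
        mod_iso \<Lambda> P (dsum {..<n} X))"

end

theory Submission
  imports Defs
begin

text \<open>
  The \<open>A\<close>-modules are the \<open>A\<^sup>(\<^sup>1\<^sup>)\<close>-modules that are annihilated by the idempotent of the first row, and
  no nonzero one is injective over \<open>A\<^sup>(\<^sup>1\<^sup>)\<close>: it embeds into a power of the first column \<open>C = (A, DA)\<close>,
  from which there is no nonzero map to an \<open>A\<close>-module. Since \<open>C\<close> is projective-injective and every
  indecomposable projective is a summand of \<open>C\<close> or of \<open>A\<close>, the projective-injective modules are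
  exactly the sums of summands of \<open>C\<close>. This makes \<open>T \<oplus> P\<close> basic and tilting for every basic tilting
  \<open>A\<close>-module \<open>T\<close>, and an exchange sequence over \<open>A\<close> is one over \<open>A\<^sup>(\<^sup>1\<^sup>)\<close>.

  Conversely, let \<open>T' \<oplus> P \<cong> M \<oplus> X\<close>, \<open>T \<oplus> P \<cong> M \<oplus> Y\<close> and let \<open>0 \<rightarrow> X \<rightarrow> E \<rightarrow> Y \<rightarrow> 0\<close> be exact with
  \<open>E \<in> add M\<close>. If \<open>X\<close> or \<open>Y\<close> were a summand of \<open>P\<close>, the sequence would split and \<open>X\<close> or \<open>Y\<close> would be a
  summand of \<open>M\<close>, contradicting basicness. So \<open>X\<close>, \<open>Y\<close> and \<open>E\<close> are \<open>A\<close>-modules, and passing to the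
  largest quotient that is an \<open>A\<close>-module, which kills \<open>P\<close>, gives \<open>T' \<cong> M' \<oplus> X\<close>, \<open>T \<cong> M' \<oplus> Y\<close> and
  \<open>E \<in> add M'\<close>.
\<close>

section \<open>Modules and homomorphisms\<close>

text \<open>The tensor product of DA with a module is never formed: between \<open>lower\<close>
  modules the homomorphisms over both rings are literally the same functions. The Krull-Schmidt
  theorem is replaced by consequences of Fitting's lemma, above all this one: if the identity of an
  indecomposable module is a sum of maps through modules M_i, then the module is a summand of one of
  the M_i. For this reason summands are treated as \<open>retract\<close> and membership in add M as
  \<open>factors_through\<close>, without a choice of complements. The definitions quantify over
  modules whose elements are functions from \<open>nat\<close> to the field, while columns,
  submodules and direct sums come with other carriers; such a module is exchanged for an isomorphic
  copy whenever a definition is applied to it. That the first column is injective is a matter of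
  linear algebra: a map into it amounts to a linear functional, and functionals extend from
  subspaces of finite dimensional spaces.\<close>

lemma left_moduleI:
  assumes "ring R" "abelian_group M"
    and "\<And>a x. a \<in> carrier R \<Longrightarrow> x \<in> carrier M \<Longrightarrow> a \<odot>\<^bsub>M\<^esub> x \<in> carrier M"
    and "\<And>a b x. a \<in> carrier R \<Longrightarrow> b \<in> carrier R \<Longrightarrow> x \<in> carrier M \<Longrightarrow>
        (a \<oplus>\<^bsub>R\<^esub> b) \<odot>\<^bsub>M\<^esub> x = a \<odot>\<^bsub>M\<^esub> x \<oplus>\<^bsub>M\<^esub> b \<odot>\<^bsub>M\<^esub> x"
    and "\<And>a x y. a \<in> carrier R \<Longrightarrow> x \<in> carrier M \<Longrightarrow> y \<in> carrier M \<Longrightarrow>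
        a \<odot>\<^bsub>M\<^esub> (x \<oplus>\<^bsub>M\<^esub> y) = a \<odot>\<^bsub>M\<^esub> x \<oplus>\<^bsub>M\<^esub> a \<odot>\<^bsub>M\<^esub> y"
    and "\<And>a b x. a \<in> carrier R \<Longrightarrow> b \<in> carrier R \<Longrightarrow> x \<in> carrier M \<Longrightarrow>
        (a \<otimes>\<^bsub>R\<^esub> b) \<odot>\<^bsub>M\<^esub> x = a \<odot>\<^bsub>M\<^esub> (b \<odot>\<^bsub>M\<^esub> x)"
    and "\<And>x. x \<in> carrier M \<Longrightarrow> \<one>\<^bsub>R\<^esub> \<odot>\<^bsub>M\<^esub> x = x"
  shows "left_module R M"
  using assms by (intro left_module.intro left_module_axioms.intro) auto

lemma left_module_ring: "left_module R M \<Longrightarrow> ring R"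
  and left_module_abelian_group: "left_module R M \<Longrightarrow> abelian_group M"
  by (simp_all add: left_module_def)

context left_module
begin

lemma smult_zero_left [simp]: "x \<in> carrier M \<Longrightarrow> \<zero>\<^bsub>R\<^esub> \<odot>\<^bsub>M\<^esub> x = \<zero>\<^bsub>M\<^esub>"
  by (metis M.add.l_cancel_one' R.l_zero R.zero_closed smult_closed smult_l_distr)

lemma smult_zero_right [simp]: "a \<in> carrier R \<Longrightarrow> a \<odot>\<^bsub>M\<^esub> \<zero>\<^bsub>M\<^esub> = \<zero>\<^bsub>M\<^esub>"
  by (metis M.add.l_cancel_one' M.l_zero M.zero_closed smult_closed smult_r_distr)

lemma smult_minus_one: "x \<in> carrier M \<Longrightarrow> (\<ominus>\<^bsub>R\<^esub> \<one>\<^bsub>R\<^esub>) \<odot>\<^bsub>M\<^esub> x = \<ominus>\<^bsub>M\<^esub> x"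
  by (metis M.minus_equality R.add.inv_closed R.l_neg R.one_closed smult_closed smult_l_distr
      smult_one smult_zero_left)

lemma smult_neg_right:
  "a \<in> carrier R \<Longrightarrow> x \<in> carrier M \<Longrightarrow> a \<odot>\<^bsub>M\<^esub> (\<ominus>\<^bsub>M\<^esub> x) = \<ominus>\<^bsub>M\<^esub> (a \<odot>\<^bsub>M\<^esub> x)"
  by (metis M.add.inv_closed M.l_neg M.minus_equality smult_closed smult_r_distr smult_zero_right)

lemma minus_eq_iff:
  "x \<in> carrier M \<Longrightarrow> y \<in> carrier M \<Longrightarrow> z \<in> carrier M \<Longrightarrow> x \<ominus>\<^bsub>M\<^esub> y = z \<longleftrightarrow> x = z \<oplus>\<^bsub>M\<^esub> y"
  by (metis M.add.inv_closed M.add.m_assoc M.l_neg M.minus_eq M.r_neg M.r_zero)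

lemma diff_add: "x \<in> carrier M \<Longrightarrow> y \<in> carrier M \<Longrightarrow> (x \<ominus>\<^bsub>M\<^esub> y) \<oplus>\<^bsub>M\<^esub> y = x"
  by (metis M.minus_closed minus_eq_iff)

lemma minus_self: "x \<in> carrier M \<Longrightarrow> x \<ominus>\<^bsub>M\<^esub> x = \<zero>\<^bsub>M\<^esub>"
  by (simp add: M.minus_eq M.r_neg)

lemma finsum_smult:
  assumes "finite I" "a \<in> carrier R" "f \<in> I \<rightarrow> carrier M"
  shows "a \<odot>\<^bsub>M\<^esub> (\<Oplus>\<^bsub>M\<^esub>i\<in>I. f i) = (\<Oplus>\<^bsub>M\<^esub>i\<in>I. a \<odot>\<^bsub>M\<^esub> f i)"
  using assms
  by (induct I rule: finite_induct) (auto simp: smult_closed smult_r_distr Pi_def)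

end

lemma mod_homI:
  assumes "\<And>x. x \<in> carrier M \<Longrightarrow> f x \<in> carrier N"
    and "\<And>x y. x \<in> carrier M \<Longrightarrow> y \<in> carrier M \<Longrightarrow> f (x \<oplus>\<^bsub>M\<^esub> y) = f x \<oplus>\<^bsub>N\<^esub> f y"
    and "\<And>a x. a \<in> carrier R \<Longrightarrow> x \<in> carrier M \<Longrightarrow> f (a \<odot>\<^bsub>M\<^esub> x) = a \<odot>\<^bsub>N\<^esub> f x"
  shows "f \<in> mod_hom R M N"
  using assms unfolding mod_hom_def by blast

lemma hom_closed: "f \<in> mod_hom R M N \<Longrightarrow> x \<in> carrier M \<Longrightarrow> f x \<in> carrier N"
  and hom_add: "f \<in> mod_hom R M N \<Longrightarrow> x \<in> carrier M \<Longrightarrow> y \<in> carrier M \<Longrightarrow>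
    f (x \<oplus>\<^bsub>M\<^esub> y) = f x \<oplus>\<^bsub>N\<^esub> f y"
  and hom_smult: "f \<in> mod_hom R M N \<Longrightarrow> a \<in> carrier R \<Longrightarrow> x \<in> carrier M \<Longrightarrow>
    f (a \<odot>\<^bsub>M\<^esub> x) = a \<odot>\<^bsub>N\<^esub> f x"
  unfolding mod_hom_def by blast+

lemma hom_zero:
  assumes "f \<in> mod_hom R M N" "left_module R M" "left_module R N"
  shows "f \<zero>\<^bsub>M\<^esub> = \<zero>\<^bsub>N\<^esub>"
proof -
  interpret M: left_module R M by fact
  interpret N: left_module R N by fact
  have "f \<zero>\<^bsub>M\<^esub> \<oplus>\<^bsub>N\<^esub> f \<zero>\<^bsub>M\<^esub> = f \<zero>\<^bsub>M\<^esub>"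
    using hom_add[OF assms(1), of "\<zero>\<^bsub>M\<^esub>" "\<zero>\<^bsub>M\<^esub>"] by simp
  then show ?thesis using hom_closed[OF assms(1), of "\<zero>\<^bsub>M\<^esub>"] by (metis M.M.zero_closed N.M.add.l_cancel_one')
qed

lemma hom_neg:
  assumes "f \<in> mod_hom R M N" "left_module R M" "left_module R N" "x \<in> carrier M"
  shows "f (\<ominus>\<^bsub>M\<^esub> x) = \<ominus>\<^bsub>N\<^esub> f x"
proof -
  interpret M: left_module R M by fact
  interpret N: left_module R N by fact
  show ?thesis
    using hom_smult[OF assms(1), of "\<ominus>\<^bsub>R\<^esub> \<one>\<^bsub>R\<^esub>" x] hom_closed[OF assms(1), of x] assms(4)
    by (simp add: M.smult_minus_one N.smult_minus_one)
qed

lemma hom_minus: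
  assumes "f \<in> mod_hom R M N" "left_module R M" "left_module R N" "x \<in> carrier M" "y \<in> carrier M"
  shows "f (x \<ominus>\<^bsub>M\<^esub> y) = f x \<ominus>\<^bsub>N\<^esub> f y"
proof -
  interpret M: left_module R M by fact
  interpret N: left_module R N by fact
  show ?thesis
    using assms by (simp add: M.M.minus_eq N.M.minus_eq hom_add hom_neg)
qed

lemma hom_comp:
  "f \<in> mod_hom R M N \<Longrightarrow> g \<in> mod_hom R N L \<Longrightarrow> (\<lambda>x. g (f x)) \<in> mod_hom R M L"
  by (rule mod_homI) (auto simp: hom_closed hom_add hom_smult)

lemma hom_id: "(\<lambda>x. x) \<in> mod_hom R M M"
  by (rule mod_homI) auto

lemma hom_const_zero:
  assumes "left_module R N" shows "(\<lambda>x. \<zero>\<^bsub>N\<^esub>) \<in> mod_hom R M N"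
proof -
  interpret N: left_module R N by fact
  show ?thesis by (rule mod_homI) auto
qed

lemma hom_plus:
  assumes "f \<in> mod_hom R M N" "g \<in> mod_hom R M N" "left_module R N"
  shows "(\<lambda>x. f x \<oplus>\<^bsub>N\<^esub> g x) \<in> mod_hom R M N"
proof -
  interpret N: left_module R N by fact
  show ?thesis
    by (rule mod_homI)
      (auto simp: hom_closed[OF assms(1)] hom_add[OF assms(1)] hom_smult[OF assms(1)]
        hom_closed[OF assms(2)] hom_add[OF assms(2)] hom_smult[OF assms(2)] N.M.a_ac N.smult_r_distr)
qed

lemma hom_uminus:
  assumes "f \<in> mod_hom R M N" "left_module R N"
  shows "(\<lambda>x. \<ominus>\<^bsub>N\<^esub> f x) \<in> mod_hom R M N"
proof -
  interpret N: left_module R N by fact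
  show ?thesis
    by (rule mod_homI)
      (auto simp: hom_closed[OF assms(1)] hom_add[OF assms(1)] hom_smult[OF assms(1)]
        N.M.minus_add N.smult_neg_right)
qed

lemma hom_diff:
  assumes "f \<in> mod_hom R M N" "g \<in> mod_hom R M N" "left_module R N"
  shows "(\<lambda>x. f x \<ominus>\<^bsub>N\<^esub> g x) \<in> mod_hom R M N"
  using hom_plus[OF assms(1) hom_uminus[OF assms(2,3)] assms(3)]
  by (simp add: a_minus_def)

lemma hom_sum:
  assumes "finite I" "\<And>i. i \<in> I \<Longrightarrow> f i \<in> mod_hom R M N" "left_module R N"
  shows "(\<lambda>x. \<Oplus>\<^bsub>N\<^esub>i\<in>I. f i x) \<in> mod_hom R M N"
proof -
  interpret N: left_module R N by fact
  note c = hom_closed[OF assms(2)] hom_add[OF assms(2)] hom_smult[OF assms(2)]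
  show ?thesis
  proof (rule mod_homI)
    fix x assume x: "x \<in> carrier M"
    then show "(\<Oplus>\<^bsub>N\<^esub>i\<in>I. f i x) \<in> carrier N" using c(1) by (intro N.M.finsum_closed) auto
    show "(\<Oplus>\<^bsub>N\<^esub>i\<in>I. f i (x \<oplus>\<^bsub>M\<^esub> y)) = (\<Oplus>\<^bsub>N\<^esub>i\<in>I. f i x) \<oplus>\<^bsub>N\<^esub> (\<Oplus>\<^bsub>N\<^esub>i\<in>I. f i y)" if y: "y \<in> carrier M" for y
    proof -
      have "(\<Oplus>\<^bsub>N\<^esub>i\<in>I. f i (x \<oplus>\<^bsub>M\<^esub> y)) = (\<Oplus>\<^bsub>N\<^esub>i\<in>I. f i x \<oplus>\<^bsub>N\<^esub> f i y)"
        using x y c(1,2) by (intro N.M.finsum_cong') auto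
      then show ?thesis using x y c(1) by (simp add: N.M.finsum_addf Pi_def)
    qed
    show "(\<Oplus>\<^bsub>N\<^esub>i\<in>I. f i (a \<odot>\<^bsub>M\<^esub> x)) = a \<odot>\<^bsub>N\<^esub> (\<Oplus>\<^bsub>N\<^esub>i\<in>I. f i x)" if a: "a \<in> carrier R" for a
    proof -
      have "(\<Oplus>\<^bsub>N\<^esub>i\<in>I. f i (a \<odot>\<^bsub>M\<^esub> x)) = (\<Oplus>\<^bsub>N\<^esub>i\<in>I. a \<odot>\<^bsub>N\<^esub> f i x)"
        using x a c(1,3) by (intro N.M.finsum_cong') (auto simp: N.smult_closed)
      then show ?thesis using x a c(1) assms(1) by (simp add: N.finsum_smult Pi_def)
    qed
  qed
qed

lemma hom_finsum:
  assumes "f \<in> mod_hom R M N" "left_module R M" "left_module R N" "finite I" "u \<in> I \<rightarrow> carrier M"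
  shows "f (\<Oplus>\<^bsub>M\<^esub>i\<in>I. u i) = (\<Oplus>\<^bsub>N\<^esub>i\<in>I. f (u i))"
proof -
  interpret M: left_module R M by fact
  interpret N: left_module R N by fact
  show ?thesis using assms(4,5)
    by (induct I rule: finite_induct)
      (auto simp: hom_zero[OF assms(1-3)] hom_add[OF assms(1)] hom_closed[OF assms(1)] Pi_def)
qed

lemma hom_funpow: "f \<in> mod_hom R M M \<Longrightarrow> f ^^ n \<in> mod_hom R M M"
proof (induct n)
  case 0 then show ?case by (auto intro!: mod_homI)
next
  case (Suc n)
  then show ?case using hom_comp[of "f ^^ n" R M M f M] by (simp add: comp_def)
qed

text \<open>The axioms are equations and therefore pass to images. Nothing is known about
  \<open>N\<close> beforehand, so even the value at zero has to be assumed. In this way structures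
  transported to a new carrier are recognised as modules.\<close>

lemma left_module_surj_image:
  assumes "left_module R M" "f ` carrier M = carrier N"
    and add: "\<And>x y. x \<in> carrier M \<Longrightarrow> y \<in> carrier M \<Longrightarrow> f (x \<oplus>\<^bsub>M\<^esub> y) = f x \<oplus>\<^bsub>N\<^esub> f y"
    and zero: "f \<zero>\<^bsub>M\<^esub> = \<zero>\<^bsub>N\<^esub>"
    and smult: "\<And>a x. a \<in> carrier R \<Longrightarrow> x \<in> carrier M \<Longrightarrow> f (a \<odot>\<^bsub>M\<^esub> x) = a \<odot>\<^bsub>N\<^esub> f x"
  shows "left_module R N"
proof -
  interpret M: left_module R M by fact
  have im: "x \<in> carrier N \<longleftrightarrow> (\<exists>y\<in>carrier M. x = f y)" for x using assms(2) by auto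
  have cl: "f x \<in> carrier N" if "x \<in> carrier M" for x using that im by auto
  show ?thesis
  proof (rule left_moduleI)
    show "ring R" by (rule M.R.ring_axioms)
    show "abelian_group N"
    proof (rule abelian_groupI)
      fix x y assume "x \<in> carrier N" "y \<in> carrier N"
      then show "x \<oplus>\<^bsub>N\<^esub> y \<in> carrier N" "x \<oplus>\<^bsub>N\<^esub> y = y \<oplus>\<^bsub>N\<^esub> x"
        by (auto simp: im add[symmetric] M.M.a_comm)
    next
      fix x y z assume "x \<in> carrier N" "y \<in> carrier N" "z \<in> carrier N"
      then show "x \<oplus>\<^bsub>N\<^esub> y \<oplus>\<^bsub>N\<^esub> z = x \<oplus>\<^bsub>N\<^esub> (y \<oplus>\<^bsub>N\<^esub> z)"
        by (auto simp: im add[symmetric] M.M.a_assoc)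
    next
      show "\<zero>\<^bsub>N\<^esub> \<in> carrier N" using cl zero by (metis M.M.zero_closed)
    next
      fix x assume "x \<in> carrier N"
      then obtain y where y: "y \<in> carrier M" "x = f y" by (auto simp: im)
      show "\<zero>\<^bsub>N\<^esub> \<oplus>\<^bsub>N\<^esub> x = x" using y by (simp add: zero[symmetric] add[symmetric])
      show "\<exists>y\<in>carrier N. y \<oplus>\<^bsub>N\<^esub> x = \<zero>\<^bsub>N\<^esub>"
        by (rule bexI[of _ "f (\<ominus>\<^bsub>M\<^esub> y)"]) (use y in \<open>simp_all add: zero[symmetric] add[symmetric] cl M.M.l_neg\<close>)
    qed
  qed (auto simp: im add[symmetric] smult[symmetric] M.smult_closed M.smult_l_distr M.smult_r_distr
      M.smult_assoc1 M.smult_one)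
qed

subsection \<open>Submodules\<close>

text \<open>Closure under negatives follows from the action of minus one, see
  \<open>submodule_neg\<close>.\<close>

definition is_submodule :: "('a, 'c) ring_scheme \<Rightarrow> ('a, 'm) module \<Rightarrow> 'm set \<Rightarrow> bool" where
  "is_submodule R M U \<longleftrightarrow> U \<subseteq> carrier M \<and> \<zero>\<^bsub>M\<^esub> \<in> U \<and> (\<forall>x\<in>U. \<forall>y\<in>U. x \<oplus>\<^bsub>M\<^esub> y \<in> U) \<and>
     (\<forall>a\<in>carrier R. \<forall>x\<in>U. a \<odot>\<^bsub>M\<^esub> x \<in> U)"

definition submod :: "('a, 'm) module \<Rightarrow> 'm set \<Rightarrow> ('a, 'm) module" where
  "submod M U = M\<lparr>carrier := U\<rparr>"

lemma submod_simps [simp]: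
  "carrier (submod M U) = U" "add (submod M U) = add M" "zero (submod M U) = zero M"
  "smult (submod M U) = smult M"
  by (simp_all add: submod_def)

lemma left_module_submod:
  assumes "left_module R M" "is_submodule R M U"
  shows "left_module R (submod M U)"
proof -
  interpret M: left_module R M by fact
  have U: "\<And>x. x \<in> U \<Longrightarrow> x \<in> carrier M" "\<zero>\<^bsub>M\<^esub> \<in> U" "\<And>x y. x \<in> U \<Longrightarrow> y \<in> U \<Longrightarrow> x \<oplus>\<^bsub>M\<^esub> y \<in> U"
     "\<And>a x. a \<in> carrier R \<Longrightarrow> x \<in> U \<Longrightarrow> a \<odot>\<^bsub>M\<^esub> x \<in> U"
    using assms(2) by (auto simp: is_submodule_def)
  show ?thesis
  proof (rule left_moduleI)
    show "abelian_group (submod M U)"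
    proof (rule abelian_groupI)
      fix x assume "x \<in> carrier (submod M U)"
      then show "\<exists>y\<in>carrier (submod M U). y \<oplus>\<^bsub>submod M U\<^esub> x = \<zero>\<^bsub>submod M U\<^esub>"
        using U(4)[of "\<ominus>\<^bsub>R\<^esub> \<one>\<^bsub>R\<^esub>" x] by (auto simp: U M.smult_minus_one M.M.l_neg intro!: bexI[of _ "\<ominus>\<^bsub>M\<^esub> x"])
    qed (auto simp: U M.M.a_ac)
  qed (auto simp: U M.R.ring_axioms M.smult_l_distr M.smult_r_distr M.smult_assoc1 M.smult_one)
qed

lemma submodule_neg:
  assumes "left_module R M" "is_submodule R M U" "x \<in> U" shows "\<ominus>\<^bsub>M\<^esub> x \<in> U"
proof -
  interpret M: left_module R M by fact
  have "(\<ominus>\<^bsub>R\<^esub> \<one>\<^bsub>R\<^esub>) \<odot>\<^bsub>M\<^esub> x \<in> U" using assms(2,3) unfolding is_submodule_def by simp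
  moreover have "x \<in> carrier M" using assms(2,3) unfolding is_submodule_def by auto
  ultimately show ?thesis by (simp add: M.smult_minus_one)
qed

lemma submodule_minus:
  assumes "left_module R M" "is_submodule R M U" "x \<in> U" "y \<in> U" shows "x \<ominus>\<^bsub>M\<^esub> y \<in> U"
  using submodule_neg[OF assms(1,2,4)] assms(2,3) by (simp add: a_minus_def is_submodule_def)

lemma submodule_carrier: "left_module R M \<Longrightarrow> is_submodule R M (carrier M)"
  unfolding is_submodule_def left_module_def left_module_axioms_def
  by (auto simp: abelian_group_def abelian_monoid.zero_closed abelian_monoid.a_closed)

lemma submodule_zero: "left_module R M \<Longrightarrow> is_submodule R M {\<zero>\<^bsub>M\<^esub>}"
proof -
  assume "left_module R M"
  then interpret M: left_module R M .
  show ?thesis by (auto simp: is_submodule_def)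
qed

lemma submodule_Int: "is_submodule R M U \<Longrightarrow> is_submodule R M V \<Longrightarrow> is_submodule R M (U \<inter> V)"
  by (auto simp: is_submodule_def)

lemma submodule_ker:
  assumes "left_module R M" "left_module R N" "f \<in> mod_hom R M N"
  shows "is_submodule R M {x \<in> carrier M. f x = \<zero>\<^bsub>N\<^esub>}"
proof -
  interpret M: left_module R M by fact
  interpret N: left_module R N by fact
  show ?thesis
    by (auto simp: is_submodule_def hom_zero[OF assms(3,1,2)] hom_add[OF assms(3)] hom_smult[OF assms(3)] M.smult_closed)
qed

lemma submodule_image:
  assumes "left_module R M" "left_module R N" "f \<in> mod_hom R M N" "is_submodule R M U"
  shows "is_submodule R N (f ` U)"
proof -
  have U: "U \<subseteq> carrier M" "\<zero>\<^bsub>M\<^esub> \<in> U" "\<And>x y. x \<in> U \<Longrightarrow> y \<in> U \<Longrightarrow> x \<oplus>\<^bsub>M\<^esub> y \<in> U"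
     "\<And>a x. a \<in> carrier R \<Longrightarrow> x \<in> U \<Longrightarrow> a \<odot>\<^bsub>M\<^esub> x \<in> U"
    using assms(4) by (auto simp: is_submodule_def)
  show ?thesis
    unfolding is_submodule_def
  proof (intro conjI ballI)
    show "f ` U \<subseteq> carrier N" using U(1) hom_closed[OF assms(3)] by auto
    show "\<zero>\<^bsub>N\<^esub> \<in> f ` U" using U(2) hom_zero[OF assms(3,1,2)] by (metis image_eqI)
  next
    fix x y assume "x \<in> f ` U" "y \<in> f ` U"
    then obtain x' y' where "x' \<in> U" "x = f x'" "y' \<in> U" "y = f y'" by auto
    then show "x \<oplus>\<^bsub>N\<^esub> y \<in> f ` U" using U hom_add[OF assms(3), of x' y'] by (metis image_eqI subsetD)
  next
    fix a x assume "a \<in> carrier R" "x \<in> f ` U"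
    then obtain x' where "x' \<in> U" "x = f x'" by auto
    then show "a \<odot>\<^bsub>N\<^esub> x \<in> f ` U" using U \<open>a \<in> carrier R\<close> hom_smult[OF assms(3), of a x'] by (metis image_eqI subsetD)
  qed
qed

lemma hom_restrict: "f \<in> mod_hom R M N \<Longrightarrow> U \<subseteq> carrier M \<Longrightarrow> f \<in> mod_hom R (submod M U) N"
  by (auto intro!: mod_homI simp: hom_closed hom_add hom_smult subset_iff)

lemma hom_into_submod: "f \<in> mod_hom R M N \<Longrightarrow> f ` carrier M \<subseteq> U \<Longrightarrow> f \<in> mod_hom R M (submod N U)"
  by (auto intro!: mod_homI simp: hom_closed hom_add hom_smult subset_iff)

lemma hom_from_submod_carrier: "f \<in> mod_hom R (submod M U) N \<Longrightarrow> U = carrier M \<Longrightarrow> f \<in> mod_hom R M N"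
  by (simp add: mod_hom_def)

lemma hom_inclusion: "U \<subseteq> carrier M \<Longrightarrow> (\<lambda>x. x) \<in> mod_hom R (submod M U) M"
  by (auto intro!: mod_homI)

subsection \<open>Isomorphisms\<close>

lemma mod_isoI: "f \<in> mod_hom R M N \<Longrightarrow> bij_betw f (carrier M) (carrier N) \<Longrightarrow> mod_iso R M N"
  by (auto simp: mod_iso_def)

lemma hom_inv_into:
  assumes "f \<in> mod_hom R M N" "bij_betw f (carrier M) (carrier N)" "left_module R M"
  shows "inv_into (carrier M) f \<in> mod_hom R N M"
proof -
  interpret M: left_module R M by fact
  have inj: "inj_on f (carrier M)" and s: "f ` carrier M = carrier N"
    using assms(2) by (auto simp: bij_betw_def)
  have *: "\<exists>x'\<in>carrier M. x = f x'" if "x \<in> carrier N" for x using that s by auto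
  show ?thesis
  proof (rule mod_homI)
    fix x assume "x \<in> carrier N" then show "inv_into (carrier M) f x \<in> carrier M" using s inv_into_into by metis
  next
    fix x y assume "x \<in> carrier N" "y \<in> carrier N"
    then obtain x' y' where "x' \<in> carrier M" "x = f x'" "y' \<in> carrier M" "y = f y'" using * by metis
    then show "inv_into (carrier M) f (x \<oplus>\<^bsub>N\<^esub> y) = inv_into (carrier M) f x \<oplus>\<^bsub>M\<^esub> inv_into (carrier M) f y"
      by (metis M.M.a_closed assms(1) hom_add inj inv_into_f_f)
  next
    fix a x assume "a \<in> carrier R" "x \<in> carrier N"
    then obtain x' where "x' \<in> carrier M" "x = f x'" using * by metis
    then show "inv_into (carrier M) f (a \<odot>\<^bsub>N\<^esub> x) = a \<odot>\<^bsub>M\<^esub> inv_into (carrier M) f x"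
      by (metis M.smult_closed \<open>a \<in> carrier R\<close> assms(1) hom_smult inj inv_into_f_f)
  qed
qed

lemma mod_iso_inverse:
  assumes "mod_iso R M N" "left_module R M"
  obtains f g where "f \<in> mod_hom R M N" "g \<in> mod_hom R N M"
    "\<And>x. x \<in> carrier M \<Longrightarrow> g (f x) = x" "\<And>y. y \<in> carrier N \<Longrightarrow> f (g y) = y"
proof -
  obtain f where f: "f \<in> mod_hom R M N" "bij_betw f (carrier M) (carrier N)"
    using assms by (auto simp: mod_iso_def)
  show ?thesis
    by (rule that[OF f(1) hom_inv_into[OF f assms(2)]])
      (use f(2) in \<open>auto simp: bij_betw_inv_into_left bij_betw_inv_into_right\<close>)
qed

lemma mod_isoI':
  assumes "f \<in> mod_hom R M N" "g \<in> mod_hom R N M"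
    "\<And>x. x \<in> carrier M \<Longrightarrow> g (f x) = x" "\<And>y. y \<in> carrier N \<Longrightarrow> f (g y) = y"
  shows "mod_iso R M N"
  by (rule mod_isoI[OF assms(1)], rule bij_betw_byWitness[where f' = g])
    (use assms in \<open>auto simp: hom_closed\<close>)

lemma mod_iso_refl: "mod_iso R M M"
  by (rule mod_isoI'[OF hom_id hom_id]) auto

lemma mod_iso_sym: "mod_iso R M N \<Longrightarrow> left_module R M \<Longrightarrow> mod_iso R N M"
  by (erule mod_iso_inverse, assumption, rule mod_isoI')

lemma mod_iso_trans: "mod_iso R M N \<Longrightarrow> mod_iso R N L \<Longrightarrow> mod_iso R M L"
  unfolding mod_iso_def using hom_comp bij_betw_trans unfolding comp_def by metis

lemma left_module_iso:
  assumes "left_module R M" "f \<in> mod_hom R M N" "bij_betw f (carrier M) (carrier N)" "f \<zero>\<^bsub>M\<^esub> = \<zero>\<^bsub>N\<^esub>"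
  shows "left_module R N"
  by (rule left_module_surj_image[OF assms(1), of f])
    (use assms in \<open>auto simp: hom_add hom_smult bij_betw_def\<close>)

lemma mod_iso_zero_carrier:
  assumes "mod_iso R M N" "left_module R M" "left_module R N"
  shows "carrier M = {\<zero>\<^bsub>M\<^esub>} \<longleftrightarrow> carrier N = {\<zero>\<^bsub>N\<^esub>}"
proof -
  obtain f g where fg: "f \<in> mod_hom R M N" "g \<in> mod_hom R N M"
    "\<And>x. x \<in> carrier M \<Longrightarrow> g (f x) = x" "\<And>y. y \<in> carrier N \<Longrightarrow> f (g y) = y"
    using mod_iso_inverse[OF assms(1,2)] by blast
  have "f \<zero>\<^bsub>M\<^esub> = \<zero>\<^bsub>N\<^esub>" "g \<zero>\<^bsub>N\<^esub> = \<zero>\<^bsub>M\<^esub>" using hom_zero fg assms by metis+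
  moreover have "\<zero>\<^bsub>M\<^esub> \<in> carrier M" "\<zero>\<^bsub>N\<^esub> \<in> carrier N"
    using submodule_carrier[OF assms(2)] submodule_carrier[OF assms(3)] by (auto simp: is_submodule_def)
  moreover have "carrier N = {\<zero>\<^bsub>N\<^esub>}" if "carrier M = {\<zero>\<^bsub>M\<^esub>}" "f \<zero>\<^bsub>M\<^esub> = \<zero>\<^bsub>N\<^esub>" "\<zero>\<^bsub>N\<^esub> \<in> carrier N"
  proof -
    have "y = \<zero>\<^bsub>N\<^esub>" if "y \<in> carrier N" for y
      using fg(4)[OF that] hom_closed[OF fg(2) that] \<open>carrier M = _\<close> \<open>f _ = _\<close> by simp
    then show ?thesis using that(3) by blast
  qed
  moreover have "carrier M = {\<zero>\<^bsub>M\<^esub>}" if "carrier N = {\<zero>\<^bsub>N\<^esub>}" "g \<zero>\<^bsub>N\<^esub> = \<zero>\<^bsub>M\<^esub>" "\<zero>\<^bsub>M\<^esub> \<in> carrier M"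
  proof -
    have "y = \<zero>\<^bsub>M\<^esub>" if "y \<in> carrier M" for y
      using fg(3)[OF that] hom_closed[OF fg(1) that] \<open>carrier N = _\<close> \<open>g _ = _\<close> by simp
    then show ?thesis using that(3) by blast
  qed
  ultimately show ?thesis by blast
qed

subsection \<open>Direct sums\<close>

lemma dsum2_simps [simp]:
  "carrier (dsum2 M N) = carrier M \<times> carrier N" "zero (dsum2 M N) = (\<zero>\<^bsub>M\<^esub>, \<zero>\<^bsub>N\<^esub>)"
  "(x, y) \<oplus>\<^bsub>dsum2 M N\<^esub> (x', y') = (x \<oplus>\<^bsub>M\<^esub> x', y \<oplus>\<^bsub>N\<^esub> y')"
  "a \<odot>\<^bsub>dsum2 M N\<^esub> (x, y) = (a \<odot>\<^bsub>M\<^esub> x, a \<odot>\<^bsub>N\<^esub> y)"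
  by (simp_all add: dsum2_def)

lemma left_module_dsum2:
  assumes "left_module R M" "left_module R N" shows "left_module R (dsum2 M N)"
proof -
  interpret M: left_module R M by fact
  interpret N: left_module R N by fact
  show ?thesis
  proof (rule left_moduleI)
    show "abelian_group (dsum2 M N)"
    proof (rule abelian_groupI)
      fix x assume "x \<in> carrier (dsum2 M N)"
      then show "\<exists>y\<in>carrier (dsum2 M N). y \<oplus>\<^bsub>dsum2 M N\<^esub> x = \<zero>\<^bsub>dsum2 M N\<^esub>"
        by (cases x) (auto simp: M.M.l_neg N.M.l_neg intro!: bexI[of _ "(\<ominus>\<^bsub>M\<^esub> fst x, \<ominus>\<^bsub>N\<^esub> snd x)"])
    qed (auto simp: M.M.a_ac N.M.a_ac)
  qed (auto simp: M.R.ring_axioms M.smult_closed N.smult_closed M.smult_l_distr M.smult_r_distr M.smult_assoc1 M.smult_one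
      N.smult_l_distr N.smult_r_distr N.smult_assoc1 N.smult_one)
qed

lemma hom_fst: "fst \<in> mod_hom R (dsum2 M N) M" and hom_snd: "snd \<in> mod_hom R (dsum2 M N) N"
  by (auto intro!: mod_homI)

lemma hom_pair: "f \<in> mod_hom R L M \<Longrightarrow> g \<in> mod_hom R L N \<Longrightarrow> (\<lambda>x. (f x, g x)) \<in> mod_hom R L (dsum2 M N)"
  by (auto intro!: mod_homI simp: hom_closed hom_add hom_smult)

lemma hom_inl: "left_module R N \<Longrightarrow> (\<lambda>x. (x, \<zero>\<^bsub>N\<^esub>)) \<in> mod_hom R M (dsum2 M N)"
  by (rule hom_pair[OF hom_id hom_const_zero])

lemma hom_inr: "left_module R M \<Longrightarrow> (\<lambda>x. (\<zero>\<^bsub>M\<^esub>, x)) \<in> mod_hom R N (dsum2 M N)"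
  by (rule hom_pair[OF hom_const_zero hom_id])

lemma dsum_simps [simp]:
  "carrier (dsum I M) = (\<Pi>\<^sub>E i\<in>I. carrier (M i))" "zero (dsum I M) = (\<lambda>i\<in>I. \<zero>\<^bsub>M i\<^esub>)"
  "x \<oplus>\<^bsub>dsum I M\<^esub> y = (\<lambda>i\<in>I. x i \<oplus>\<^bsub>M i\<^esub> y i)"
  "a \<odot>\<^bsub>dsum I M\<^esub> x = (\<lambda>i\<in>I. a \<odot>\<^bsub>M i\<^esub> x i)"
  by (simp_all add: dsum_def)

lemma left_module_dsum:
  assumes "ring R" "\<And>i. i \<in> I \<Longrightarrow> left_module R (M i)" shows "left_module R (dsum I M)"
proof -
  have ab: "abelian_group (M i)" if "i \<in> I" for i using assms(2)[OF that] by (rule left_module_abelian_group)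
  note ag = abelian_group.axioms(1)[OF ab]
  note a = abelian_monoid.a_closed[OF ag] abelian_monoid.zero_closed[OF ag] abelian_monoid.a_assoc[OF ag]
    abelian_monoid.l_zero[OF ag] abelian_group.a_inv_closed[OF ab] abelian_group.l_neg[OF ab]
    left_module.smult_closed[OF assms(2)] left_module.smult_l_distr[OF assms(2)]
    left_module.smult_r_distr[OF assms(2)] left_module.smult_assoc1[OF assms(2)] left_module.smult_one[OF assms(2)]
  show ?thesis
  proof (rule left_moduleI)
    show "abelian_group (dsum I M)"
    proof (rule abelian_groupI)
      fix x assume "x \<in> carrier (dsum I M)"
      then show "\<exists>y\<in>carrier (dsum I M). y \<oplus>\<^bsub>dsum I M\<^esub> x = \<zero>\<^bsub>dsum I M\<^esub>"
        by (intro bexI[of _ "\<lambda>i\<in>I. \<ominus>\<^bsub>M i\<^esub> x i"]) (auto simp: a PiE_iff fun_eq_iff)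
    next
      fix x y assume "x \<in> carrier (dsum I M)" "y \<in> carrier (dsum I M)"
      then show "x \<oplus>\<^bsub>dsum I M\<^esub> y = y \<oplus>\<^bsub>dsum I M\<^esub> x"
        by (auto simp: PiE_iff fun_eq_iff abelian_monoid.a_comm[OF ag])
    qed (auto simp: a PiE_iff fun_eq_iff extensional_def)
  qed (auto simp: assms(1) a PiE_iff fun_eq_iff extensional_def)
qed

lemma hom_dsum_proj: "i \<in> I \<Longrightarrow> (\<lambda>x. x i) \<in> mod_hom R (dsum I M) (M i)"
  by (auto intro!: mod_homI)

lemma hom_dsum_tuple:
  "(\<And>i. i \<in> I \<Longrightarrow> f i \<in> mod_hom R L (M i)) \<Longrightarrow> (\<lambda>x. \<lambda>i\<in>I. f i x) \<in> mod_hom R L (dsum I M)"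
proof (rule mod_homI)
  assume f: "\<And>i. i \<in> I \<Longrightarrow> f i \<in> mod_hom R L (M i)"
  note h = hom_closed[OF f] hom_add[OF f] hom_smult[OF f]
  fix x assume x: "x \<in> carrier L"
  then show "(\<lambda>i\<in>I. f i x) \<in> carrier (dsum I M)" using h by auto
  show "(\<lambda>i\<in>I. f i (x \<oplus>\<^bsub>L\<^esub> y)) = (\<lambda>i\<in>I. f i x) \<oplus>\<^bsub>dsum I M\<^esub> (\<lambda>i\<in>I. f i y)" if "y \<in> carrier L" for y
    using h x that by (auto simp: fun_eq_iff)
  show "(\<lambda>i\<in>I. f i (a \<odot>\<^bsub>L\<^esub> x)) = a \<odot>\<^bsub>dsum I M\<^esub> (\<lambda>i\<in>I. f i x)" if "a \<in> carrier R" for a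
    using h x that by (auto simp: fun_eq_iff)
qed

lemma hom_dsum_inj:
  assumes "\<And>i. i \<in> I \<Longrightarrow> left_module R (M i)"
  shows "(\<lambda>x. \<lambda>i\<in>I. if i = j then x else \<zero>\<^bsub>M i\<^esub>) \<in> mod_hom R (M j) (dsum I M)"
proof (rule hom_dsum_tuple)
  fix i assume "i \<in> I"
  then show "(\<lambda>x. if i = j then x else \<zero>\<^bsub>M i\<^esub>) \<in> mod_hom R (M j) (M i)"
    by (cases "i = j") (auto simp: hom_id hom_const_zero assms)
qed

text \<open>Projections are homomorphisms, so the sum can be evaluated one coordinate at a time,
  where a single term survives.\<close>

lemma dsum_decompose:
  assumes "ring R" "\<And>i. i \<in> I \<Longrightarrow> left_module R (M i)" "finite I" "x \<in> carrier (dsum I M)"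
  shows "x = (\<Oplus>\<^bsub>dsum I M\<^esub>j\<in>I. (\<lambda>i\<in>I. if i = j then x j else \<zero>\<^bsub>M i\<^esub>))"
proof
  fix k
  let ?S = "dsum I M" and ?e = "\<lambda>j. \<lambda>i\<in>I. if i = j then x j else \<zero>\<^bsub>M i\<^esub>"
  have lm: "left_module R ?S" by (rule left_module_dsum[OF assms(1,2)])
  interpret S: left_module R ?S by fact
  have xc: "x \<in> (\<Pi>\<^sub>E i\<in>I. carrier (M i))" using assms(4) by simp
  have z: "\<zero>\<^bsub>M i\<^esub> \<in> carrier (M i)" if "i \<in> I" for i
    using submodule_carrier[OF assms(2)[OF that]] by (simp add: is_submodule_def)
  have e: "?e \<in> I \<rightarrow> carrier ?S" using xc z by auto
  show "x k = (\<Oplus>\<^bsub>?S\<^esub>j\<in>I. ?e j) k"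
  proof (cases "k \<in> I")
    case True
    interpret k: left_module R "M k" using assms(2) True .
    have "(\<Oplus>\<^bsub>?S\<^esub>j\<in>I. ?e j) k = (\<Oplus>\<^bsub>M k\<^esub>j\<in>I. (?e j) k)"
      by (rule hom_finsum[OF hom_dsum_proj[OF True] lm assms(2)[OF True] assms(3) e])
    also have "\<dots> = (\<Oplus>\<^bsub>M k\<^esub>j\<in>I. if k = j then x j else \<zero>\<^bsub>M k\<^esub>)"
      using z True by (intro k.M.finsum_cong') (use xc True in auto)
    \<comment> \<open>The rule for a sum with one nonzero term wants all values in
      \<open>M k\<close>; the constant \<open>x k\<close> satisfies this, whereas \<open>x j\<close>
      lies in \<open>M j\<close>.\<close>
    also have "\<dots> = (\<Oplus>\<^bsub>M k\<^esub>j\<in>I. if k = j then x k else \<zero>\<^bsub>M k\<^esub>)"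
      by (rule arg_cong[of _ _ "\<lambda>u. finsum (M k) u I"]) auto
    also have "\<dots> = x k"
      using xc True assms(3) by (intro k.M.finsum_singleton) auto
    finally show ?thesis by simp
  next
    \<comment> \<open>Outside \<open>I\<close> both functions are \<open>undefined\<close>, because
      elements of the direct sum are extensional.\<close>
    case False
    have "(\<Oplus>\<^bsub>?S\<^esub>j\<in>I. ?e j) \<in> carrier ?S" using e by (rule S.M.finsum_closed)
    then show ?thesis using False xc by (auto simp: PiE_iff extensional_def)
  qed
qed

lemma left_module_regular: "ring R \<Longrightarrow> left_module R (regular_module R)"
proof -
  assume "ring R"
  then interpret ring R .
  have "abelian_group (regular_module R)"
    by (rule abelian_groupI) (auto simp: regular_module_def a_ac intro!: bexI[of _ "\<ominus>\<^bsub>R\<^esub> _"] l_neg)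
  then show ?thesis using \<open>ring R\<close>
    by (intro left_moduleI) (auto simp: regular_module_def l_distr r_distr m_assoc)
qed

lemma regular_simps [simp]:
  "carrier (regular_module R) = carrier R" "add (regular_module R) = add R"
  "zero (regular_module R) = zero R" "smult (regular_module R) = mult R"
  by (simp_all add: regular_module_def)

section \<open>Finite generation\<close>

definition add_line :: "('a, 'c) ring_scheme \<Rightarrow> ('a, 'm) module \<Rightarrow> 'm set \<Rightarrow> 'm \<Rightarrow> 'm set" where
  "add_line R M W v = {w \<oplus>\<^bsub>M\<^esub> a \<odot>\<^bsub>M\<^esub> v | w a. w \<in> W \<and> a \<in> carrier R}"

text \<open>Finite generation built up one generator at a time, so that facts about it follow by
  rule induction. Repeated and dependent generators are allowed; over a field the least possible
  index is the dimension.\<close>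

inductive spanned :: "('a, 'c) ring_scheme \<Rightarrow> ('a, 'm) module \<Rightarrow> nat \<Rightarrow> 'm set \<Rightarrow> bool"
  for R M where
  spanned_0: "spanned R M 0 {\<zero>\<^bsub>M\<^esub>}"
| spanned_Suc: "spanned R M n W \<Longrightarrow> v \<in> carrier M \<Longrightarrow> spanned R M (Suc n) (add_line R M W v)"

lemma add_line_submod [simp]: "add_line R (submod M U) = add_line R M"
  by (simp add: add_line_def fun_eq_iff)

lemma submodule_add_line:
  assumes "left_module R M" "is_submodule R M W" "v \<in> carrier M"
  shows "is_submodule R M (add_line R M W v)"
proof -
  interpret M: left_module R M by fact
  have W: "\<And>x. x \<in> W \<Longrightarrow> x \<in> carrier M" "\<zero>\<^bsub>M\<^esub> \<in> W" "\<And>x y. x \<in> W \<Longrightarrow> y \<in> W \<Longrightarrow> x \<oplus>\<^bsub>M\<^esub> y \<in> W"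
     "\<And>a x. a \<in> carrier R \<Longrightarrow> x \<in> W \<Longrightarrow> a \<odot>\<^bsub>M\<^esub> x \<in> W"
    using assms(2) by (auto simp: is_submodule_def)
  show ?thesis
    unfolding is_submodule_def
  proof (intro conjI ballI)
    show "add_line R M W v \<subseteq> carrier M" using W assms(3) by (auto simp: add_line_def M.smult_closed)
    show "\<zero>\<^bsub>M\<^esub> \<in> add_line R M W v"
      unfolding add_line_def using W(2) assms(3) by (auto intro!: exI[of _ "\<zero>\<^bsub>M\<^esub>"] exI[of _ "\<zero>\<^bsub>R\<^esub>"])
  next
    fix x y assume "x \<in> add_line R M W v" "y \<in> add_line R M W v"
    then obtain w a w' b where *: "x = w \<oplus>\<^bsub>M\<^esub> a \<odot>\<^bsub>M\<^esub> v" "y = w' \<oplus>\<^bsub>M\<^esub> b \<odot>\<^bsub>M\<^esub> v" "w \<in> W" "w' \<in> W" "a \<in> carrier R" "b \<in> carrier R"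
      by (auto simp: add_line_def)
    then have "x \<oplus>\<^bsub>M\<^esub> y = (w \<oplus>\<^bsub>M\<^esub> w') \<oplus>\<^bsub>M\<^esub> (a \<oplus>\<^bsub>R\<^esub> b) \<odot>\<^bsub>M\<^esub> v"
      using W assms(3) by (simp add: M.smult_l_distr M.smult_closed M.M.a_ac)
    then show "x \<oplus>\<^bsub>M\<^esub> y \<in> add_line R M W v" unfolding add_line_def using * W by blast
  next
    fix c x assume c: "c \<in> carrier R" and "x \<in> add_line R M W v"
    then obtain w a where *: "x = w \<oplus>\<^bsub>M\<^esub> a \<odot>\<^bsub>M\<^esub> v" "w \<in> W" "a \<in> carrier R"
      by (auto simp: add_line_def)
    then have "c \<odot>\<^bsub>M\<^esub> x = c \<odot>\<^bsub>M\<^esub> w \<oplus>\<^bsub>M\<^esub> (c \<otimes>\<^bsub>R\<^esub> a) \<odot>\<^bsub>M\<^esub> v"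
      using W assms(3) c by (simp add: M.smult_r_distr M.smult_closed M.smult_assoc1)
    then show "c \<odot>\<^bsub>M\<^esub> x \<in> add_line R M W v" unfolding add_line_def using * W c by blast
  qed
qed

lemma subset_add_line:
  assumes "left_module R M" "is_submodule R M W" "v \<in> carrier M"
  shows "W \<subseteq> add_line R M W v" "v \<in> add_line R M W v"
proof -
  interpret M: left_module R M by fact
  have W: "\<And>x. x \<in> W \<Longrightarrow> x \<in> carrier M" "\<zero>\<^bsub>M\<^esub> \<in> W" using assms(2) by (auto simp: is_submodule_def)
  show "W \<subseteq> add_line R M W v"
  proof
    fix x assume "x \<in> W"
    then have "x = x \<oplus>\<^bsub>M\<^esub> \<zero>\<^bsub>R\<^esub> \<odot>\<^bsub>M\<^esub> v" using W assms(3) by simp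
    then show "x \<in> add_line R M W v" unfolding add_line_def using \<open>x \<in> W\<close> by blast
  qed
  have "v = \<zero>\<^bsub>M\<^esub> \<oplus>\<^bsub>M\<^esub> \<one>\<^bsub>R\<^esub> \<odot>\<^bsub>M\<^esub> v" using assms(3) by (simp add: M.smult_one)
  then show "v \<in> add_line R M W v" unfolding add_line_def using W(2) by blast
qed

lemma add_line_least: "is_submodule R M U \<Longrightarrow> W \<subseteq> U \<Longrightarrow> v \<in> U \<Longrightarrow> add_line R M W v \<subseteq> U"
  by (auto simp: add_line_def is_submodule_def)

lemma spanned_submodule: "spanned R M n W \<Longrightarrow> left_module R M \<Longrightarrow> is_submodule R M W"
  by (induct rule: spanned.induct) (auto simp: submodule_zero submodule_add_line)

lemma spanned_submod:
  assumes "spanned R M n W" "left_module R M" "is_submodule R M U" "W \<subseteq> U"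
  shows "spanned R (submod M U) n W"
  using assms
proof (induct rule: spanned.induct)
  case spanned_0
  show ?case using spanned.spanned_0[of R "submod M U"] by simp
next
  case (spanned_Suc n W v)
  have "W \<subseteq> add_line R M W v" "v \<in> add_line R M W v"
    using subset_add_line spanned_submodule spanned_Suc by metis+
  then have "spanned R (submod M U) n W" "v \<in> U" using spanned_Suc by auto
  then show ?case using spanned.spanned_Suc[of R "submod M U" n W v] by simp
qed

lemma spanned_image:
  assumes "spanned R M n W" "f \<in> mod_hom R M N" "left_module R M" "left_module R N"
  shows "spanned R N n (f ` W)"
  using assms(1)
proof (induct rule: spanned.induct)
  case spanned_0 then show ?case using spanned.spanned_0[of R N] hom_zero[OF assms(2-4)] by simp
next
  case (spanned_Suc n W v)
  interpret M: left_module R M by fact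
  have W: "W \<subseteq> carrier M" using spanned_submodule[OF spanned_Suc(1) assms(3)] by (simp add: is_submodule_def)
  have *: "f (w \<oplus>\<^bsub>M\<^esub> a \<odot>\<^bsub>M\<^esub> v) = f w \<oplus>\<^bsub>N\<^esub> a \<odot>\<^bsub>N\<^esub> f v" if "w \<in> W" "a \<in> carrier R" for w a
    using that W spanned_Suc(3) by (simp add: hom_add[OF assms(2)] hom_smult[OF assms(2)] M.smult_closed subset_iff)
  have "f ` add_line R M W v = add_line R N (f ` W) (f v)" (is "?L = ?R")
  proof
    show "?L \<subseteq> ?R" unfolding add_line_def using * by blast
    show "?R \<subseteq> ?L"
    proof
      fix y assume "y \<in> ?R"
      then obtain w a where "w \<in> W" "a \<in> carrier R" "y = f w \<oplus>\<^bsub>N\<^esub> a \<odot>\<^bsub>N\<^esub> f v" by (auto simp: add_line_def)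
      then show "y \<in> ?L" using * unfolding add_line_def by (intro image_eqI[of _ _ "w \<oplus>\<^bsub>M\<^esub> a \<odot>\<^bsub>M\<^esub> v"]) auto
    qed
  qed
  then show ?case using spanned.spanned_Suc[OF spanned_Suc(2), of "f v"] hom_closed[OF assms(2) spanned_Suc(3)] by simp
qed

lemma spanned_finsum:
  assumes "left_module R M" "finite S" "S \<subseteq> carrier M"
  shows "spanned R M (card S) {\<Oplus>\<^bsub>M\<^esub>s\<in>S. c s \<odot>\<^bsub>M\<^esub> s | c. \<forall>s\<in>S. c s \<in> carrier R}"
  using assms(2,3)
proof (induct rule: finite_induct)
  interpret M: left_module R M by fact
  case empty then show ?case using spanned_0[of R M] by simp
next
  interpret M: left_module R M by fact
  case (insert x F)
  have cl: "(\<lambda>s. c s \<odot>\<^bsub>M\<^esub> s) \<in> F \<rightarrow> carrier M" if "\<forall>s\<in>F. c s \<in> carrier R" for c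
    using that insert(4) by (auto simp: M.smult_closed)
  have eq: "(\<Oplus>\<^bsub>M\<^esub>s\<in>insert x F. c s \<odot>\<^bsub>M\<^esub> s) = (\<Oplus>\<^bsub>M\<^esub>s\<in>F. c s \<odot>\<^bsub>M\<^esub> s) \<oplus>\<^bsub>M\<^esub> c x \<odot>\<^bsub>M\<^esub> x"
    if "\<forall>s\<in>F. c s \<in> carrier R" "c x \<in> carrier R" for c
    using insert that cl[OF that(1)] by (simp add: M.smult_closed M.M.a_comm M.M.finsum_closed)
  have "{\<Oplus>\<^bsub>M\<^esub>s\<in>insert x F. c s \<odot>\<^bsub>M\<^esub> s | c. \<forall>s\<in>insert x F. c s \<in> carrier R}
    = add_line R M {\<Oplus>\<^bsub>M\<^esub>s\<in>F. c s \<odot>\<^bsub>M\<^esub> s | c. \<forall>s\<in>F. c s \<in> carrier R} x" (is "?L = ?R")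
  proof
    show "?L \<subseteq> ?R" unfolding add_line_def using eq by fastforce
    show "?R \<subseteq> ?L"
    proof
      fix y assume "y \<in> ?R"
      then obtain c a where c: "\<forall>s\<in>F. c s \<in> carrier R" "a \<in> carrier R" "y = (\<Oplus>\<^bsub>M\<^esub>s\<in>F. c s \<odot>\<^bsub>M\<^esub> s) \<oplus>\<^bsub>M\<^esub> a \<odot>\<^bsub>M\<^esub> x"
        by (auto simp: add_line_def)
      let ?c = "c(x := a)"
      have "(\<Oplus>\<^bsub>M\<^esub>s\<in>F. ?c s \<odot>\<^bsub>M\<^esub> s) = (\<Oplus>\<^bsub>M\<^esub>s\<in>F. c s \<odot>\<^bsub>M\<^esub> s)"
        using insert(2) cl[OF c(1)] by (intro M.M.finsum_cong') auto
      then have "y = (\<Oplus>\<^bsub>M\<^esub>s\<in>insert x F. ?c s \<odot>\<^bsub>M\<^esub> s)" using eq[of ?c] c insert(2) by auto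
      moreover have "\<forall>s\<in>insert x F. ?c s \<in> carrier R" using c by auto
      ultimately show "y \<in> ?L" by blast
    qed
  qed
  then show ?case using spanned_Suc[OF insert(3), of x] insert by simp
qed

text \<open>Converse of \<open>spanned_finsum\<close>, up to the number of generators: they are
  collected in a set, where repetitions collapse.\<close>

lemma spanned_imp_finsum:
  assumes "spanned R M n W" "left_module R M"
  shows "\<exists>S. finite S \<and> S \<subseteq> carrier M \<and>
       (\<forall>x\<in>W. \<exists>c. (\<forall>s\<in>S. c s \<in> carrier R) \<and> x = (\<Oplus>\<^bsub>M\<^esub>s\<in>S. c s \<odot>\<^bsub>M\<^esub> s))"
  using assms(1)
proof (induct rule: spanned.induct)
  interpret M: left_module R M by fact
  case spanned_0 show ?case by (intro exI[of _ "{}"]) simp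
next
  interpret M: left_module R M by fact
  case (spanned_Suc n W v)
  then obtain S where S: "finite S" "S \<subseteq> carrier M"
     "\<And>x. x \<in> W \<Longrightarrow> \<exists>c. (\<forall>s\<in>S. c s \<in> carrier R) \<and> x = (\<Oplus>\<^bsub>M\<^esub>s\<in>S. c s \<odot>\<^bsub>M\<^esub> s)"
    by blast
  let ?S = "insert v S"
  show ?case
  proof (intro exI[of _ ?S] conjI ballI)
    fix x assume "x \<in> add_line R M W v"
    then obtain w a where "w \<in> W" and a: "a \<in> carrier R" and x: "x = w \<oplus>\<^bsub>M\<^esub> a \<odot>\<^bsub>M\<^esub> v" by (auto simp: add_line_def)
    then obtain c where c: "\<forall>s\<in>S. c s \<in> carrier R" "w = (\<Oplus>\<^bsub>M\<^esub>s\<in>S. c s \<odot>\<^bsub>M\<^esub> s)" using S(3) by blast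
    \<comment> \<open>The new generator \<open>v\<close> may already lie in \<open>S\<close>; then
      its old coefficient \<open>e\<close> is added to the new one. Removing \<open>v\<close> from
      \<open>S\<close> treats both cases alike.\<close>
    define e where "e = (if v \<in> S then c v else \<zero>\<^bsub>R\<^esub>)"
    have e: "e \<in> carrier R" using c by (auto simp: e_def)
    let ?F = "S - {v}"
    let ?c = "c(v := e \<oplus>\<^bsub>R\<^esub> a)"
    have cl: "(\<lambda>s. c s \<odot>\<^bsub>M\<^esub> s) \<in> ?F \<rightarrow> carrier M" using c S(2) by (auto simp: M.smult_closed)
    have fin: "finite ?F" "v \<notin> ?F" using S by auto
    have sum: "(\<Oplus>\<^bsub>M\<^esub>s\<in>?F. c s \<odot>\<^bsub>M\<^esub> s) \<in> carrier M" using cl by (rule M.M.finsum_closed)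
    have w: "w = e \<odot>\<^bsub>M\<^esub> v \<oplus>\<^bsub>M\<^esub> (\<Oplus>\<^bsub>M\<^esub>s\<in>?F. c s \<odot>\<^bsub>M\<^esub> s)"
    proof (cases "v \<in> S")
      case True
      then have "S = insert v ?F" by auto
      then have "w = (\<Oplus>\<^bsub>M\<^esub>s\<in>insert v ?F. c s \<odot>\<^bsub>M\<^esub> s)" using c by simp
      also have "\<dots> = c v \<odot>\<^bsub>M\<^esub> v \<oplus>\<^bsub>M\<^esub> (\<Oplus>\<^bsub>M\<^esub>s\<in>?F. c s \<odot>\<^bsub>M\<^esub> s)"
        using fin cl c True spanned_Suc(3) by (intro M.M.finsum_insert) (auto simp: M.smult_closed)
      finally show ?thesis using True by (simp add: e_def)
    next
      case False
      then show ?thesis using c spanned_Suc(3) sum by (simp add: e_def)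
    qed
    have "(\<Oplus>\<^bsub>M\<^esub>s\<in>?S. ?c s \<odot>\<^bsub>M\<^esub> s) = (\<Oplus>\<^bsub>M\<^esub>s\<in>insert v ?F. ?c s \<odot>\<^bsub>M\<^esub> s)" by simp
    also have "\<dots> = (e \<oplus>\<^bsub>R\<^esub> a) \<odot>\<^bsub>M\<^esub> v \<oplus>\<^bsub>M\<^esub> (\<Oplus>\<^bsub>M\<^esub>s\<in>?F. ?c s \<odot>\<^bsub>M\<^esub> s)"
      using fin cl spanned_Suc(3) e a by (subst M.M.finsum_insert) (auto simp: M.smult_closed Pi_def)
    also have "(\<Oplus>\<^bsub>M\<^esub>s\<in>?F. ?c s \<odot>\<^bsub>M\<^esub> s) = (\<Oplus>\<^bsub>M\<^esub>s\<in>?F. c s \<odot>\<^bsub>M\<^esub> s)"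
      using cl by (intro M.M.finsum_cong') auto
    finally have "x = (\<Oplus>\<^bsub>M\<^esub>s\<in>?S. ?c s \<odot>\<^bsub>M\<^esub> s)"
      unfolding x w using sum a e spanned_Suc(3) by (simp add: M.smult_l_distr M.smult_closed M.M.a_ac)
    then show "\<exists>c. (\<forall>s\<in>?S. c s \<in> carrier R) \<and> x = (\<Oplus>\<^bsub>M\<^esub>s\<in>?S. c s \<odot>\<^bsub>M\<^esub> s)"
      using c e a by (intro exI[of _ ?c]) auto
  qed (use S spanned_Suc(3) in auto)
qed

text \<open>Passes to the inductive form, with which the closure properties of finite generation are
  proved.\<close>

lemma fg_module_iff: "fg_module R M \<longleftrightarrow> left_module R M \<and> (\<exists>n. spanned R M n (carrier M))"
proof (intro iffI conjI)
  assume fg: "fg_module R M"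
  then show lm: "left_module R M" by (simp add: fg_module_def)
  then interpret M: left_module R M .
  obtain S where S: "finite S" "S \<subseteq> carrier M"
     "\<forall>x\<in>carrier M. \<exists>c. (\<forall>s\<in>S. c s \<in> carrier R) \<and> x = (\<Oplus>\<^bsub>M\<^esub>s\<in>S. c s \<odot>\<^bsub>M\<^esub> s)"
    using fg by (auto simp: fg_module_def)
  have "{\<Oplus>\<^bsub>M\<^esub>s\<in>S. c s \<odot>\<^bsub>M\<^esub> s | c. \<forall>s\<in>S. c s \<in> carrier R} = carrier M" (is "?L = ?R")
  proof
    show "?L \<subseteq> ?R" using S(2) by (auto simp: M.smult_closed intro!: M.M.finsum_closed)
    show "?R \<subseteq> ?L" using S(3) by blast
  qed
  then show "\<exists>n. spanned R M n (carrier M)" using spanned_finsum[OF lm S(1,2)] by auto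
next
  assume "left_module R M \<and> (\<exists>n. spanned R M n (carrier M))"
  then obtain n where "left_module R M" "spanned R M n (carrier M)" by blast
  then show "fg_module R M" unfolding fg_module_def using spanned_imp_finsum[of R M n "carrier M"] by simp
qed

lemma fg_left_module: "fg_module R M \<Longrightarrow> left_module R M"
  by (simp add: fg_module_def)

lemma fg_moduleI: "left_module R M \<Longrightarrow> spanned R M n (carrier M) \<Longrightarrow> fg_module R M"
  by (auto simp: fg_module_iff)

lemma fg_module_surj:
  assumes "fg_module R M" "f \<in> mod_hom R M N" "left_module R N" "f ` carrier M = carrier N"
  shows "fg_module R N"
  using assms spanned_image[OF _ assms(2)] by (metis fg_module_iff)

lemma fg_module_iso: "fg_module R M \<Longrightarrow> mod_iso R M N \<Longrightarrow> left_module R N \<Longrightarrow> fg_module R N"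
  unfolding mod_iso_def bij_betw_def using fg_module_surj by metis

definition sum_sets :: "('a, 'm) module \<Rightarrow> 'm set \<Rightarrow> 'm set \<Rightarrow> 'm set" where
  "sum_sets M U V = {u \<oplus>\<^bsub>M\<^esub> v | u v. u \<in> U \<and> v \<in> V}"

text \<open>Induction on the generation of \<open>V\<close>: its generators are appended one by one
  to those of \<open>U\<close>.\<close>

lemma spanned_sum_sets:
  assumes "spanned R M n V" "spanned R M m U" "left_module R M"
  shows "spanned R M (m + n) (sum_sets M U V)"
  using assms(1)
proof (induct rule: spanned.induct)
  interpret M: left_module R M by fact
  case spanned_0
  have "U \<subseteq> carrier M" using spanned_submodule[OF assms(2,3)] by (simp add: is_submodule_def)
  then have "sum_sets M U {\<zero>\<^bsub>M\<^esub>} = U" by (force simp: sum_sets_def)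
  then show ?case using assms(2) by simp
next
  interpret M: left_module R M by fact
  case (spanned_Suc n W v)
  have U: "U \<subseteq> carrier M" using spanned_submodule[OF assms(2,3)] by (simp add: is_submodule_def)
  have W: "W \<subseteq> carrier M" using spanned_submodule[OF spanned_Suc(1) assms(3)] by (simp add: is_submodule_def)
  have a: "u \<oplus>\<^bsub>M\<^esub> (w \<oplus>\<^bsub>M\<^esub> a \<odot>\<^bsub>M\<^esub> v) = (u \<oplus>\<^bsub>M\<^esub> w) \<oplus>\<^bsub>M\<^esub> a \<odot>\<^bsub>M\<^esub> v" if "u \<in> U" "w \<in> W" "a \<in> carrier R" for u w a
    using that U W spanned_Suc(3) by (simp add: M.M.a_assoc M.smult_closed subset_iff)
  have "sum_sets M U (add_line R M W v) = add_line R M (sum_sets M U W) v"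
    unfolding sum_sets_def add_line_def using a by (auto; metis)
  then show ?case using spanned.spanned_Suc[OF spanned_Suc(2,3)] by simp
qed

lemma fg_dsum2:
  assumes "fg_module R M" "fg_module R N" shows "fg_module R (dsum2 M N)"
proof -
  obtain m n where *: "left_module R M" "spanned R M m (carrier M)" "left_module R N" "spanned R N n (carrier N)"
    using assms by (auto simp: fg_module_iff)
  interpret M: left_module R M by fact
  interpret N: left_module R N by fact
  have lm: "left_module R (dsum2 M N)" using * by (simp add: left_module_dsum2)
  have "spanned R (dsum2 M N) m ((\<lambda>x. (x, \<zero>\<^bsub>N\<^esub>)) ` carrier M)" "spanned R (dsum2 M N) n ((\<lambda>x. (\<zero>\<^bsub>M\<^esub>, x)) ` carrier N)"
    using spanned_image[OF *(2) hom_inl *(1) lm] spanned_image[OF *(4) hom_inr *(3) lm] * by auto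
  from spanned_sum_sets[OF this(2,1) lm]
  have "spanned R (dsum2 M N) (m + n) (sum_sets (dsum2 M N) ((\<lambda>x. (x, \<zero>\<^bsub>N\<^esub>)) ` carrier M) ((\<lambda>x. (\<zero>\<^bsub>M\<^esub>, x)) ` carrier N))" .
  moreover have "sum_sets (dsum2 M N) ((\<lambda>x. (x, \<zero>\<^bsub>N\<^esub>)) ` carrier M) ((\<lambda>x. (\<zero>\<^bsub>M\<^esub>, x)) ` carrier N) = carrier (dsum2 M N)"
    by (force simp: sum_sets_def)
  ultimately show ?thesis using lm fg_moduleI by metis
qed

lemma fg_dsum:
  assumes "ring R" "\<And>i. i < n \<Longrightarrow> fg_module R (X i)" shows "fg_module R (dsum {..<n::nat} X)"
  using assms(2)
proof (induct n)
  case 0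
  have "left_module R (dsum {..<0::nat} X)" by (rule left_module_dsum[OF assms(1)]) simp
  then show ?case using spanned_0[of R "dsum {..<0::nat} X"] by (auto intro: fg_moduleI simp: restrict_def)
next
  case (Suc n)
  have lm: "left_module R (X i)" if "i < Suc n" for i using Suc(2)[OF that] by (rule fg_left_module)
  let ?f = "\<lambda>(x, y). x(n := y)"
  have cl: "?f x \<in> carrier (dsum {..<Suc n} X)" if "x \<in> carrier (dsum2 (dsum {..<n} X) (X n))" for x
  proof -
    obtain p q where x: "x = (p, q)" by (cases x)
    have p: "p \<in> (\<Pi>\<^sub>E i\<in>{..<n}. carrier (X i))" and q: "q \<in> carrier (X n)" using that x by auto
    have "p(n := q) \<in> (\<Pi>\<^sub>E i\<in>{..<Suc n}. carrier (X i))"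
    proof (rule PiE_I)
      fix i assume "i \<in> {..<Suc n}"
      then show "(p(n := q)) i \<in> carrier (X i)" using q PiE_mem[OF p, of i] by (cases "i = n") auto
    next
      fix i assume "i \<notin> {..<Suc n}"
      then show "(p(n := q)) i = undefined" using PiE_arb[OF p, of i] by auto
    qed
    then show ?thesis using x by simp
  qed
  show ?case
  proof (rule fg_module_surj[OF fg_dsum2[OF Suc(1) Suc(2)]])
    show "?f \<in> mod_hom R (dsum2 (dsum {..<n} X) (X n)) (dsum {..<Suc n} X)"
    proof (rule mod_homI)
      fix x assume "x \<in> carrier (dsum2 (dsum {..<n} X) (X n))"
      then show "?f x \<in> carrier (dsum {..<Suc n} X)" by (rule cl)
    next
      fix x y assume "x \<in> carrier (dsum2 (dsum {..<n} X) (X n))" "y \<in> carrier (dsum2 (dsum {..<n} X) (X n))"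
      then show "?f (x \<oplus>\<^bsub>dsum2 (dsum {..<n} X) (X n)\<^esub> y) = ?f x \<oplus>\<^bsub>dsum {..<Suc n} X\<^esub> ?f y"
        by (cases x, cases y) (auto simp: fun_eq_iff)
    next
      fix a x assume "x \<in> carrier (dsum2 (dsum {..<n} X) (X n))"
      then show "?f (a \<odot>\<^bsub>dsum2 (dsum {..<n} X) (X n)\<^esub> x) = a \<odot>\<^bsub>dsum {..<Suc n} X\<^esub> ?f x"
        by (cases x) (auto simp: fun_eq_iff)
    qed
    show "left_module R (dsum {..<Suc n} X)" by (rule left_module_dsum[OF assms(1)]) (use lm in auto)
    show "?f ` carrier (dsum2 (dsum {..<n} X) (X n)) = carrier (dsum {..<Suc n} X)"
    proof
      show "carrier (dsum {..<Suc n} X) \<subseteq> ?f ` carrier (dsum2 (dsum {..<n} X) (X n))"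
      proof
        fix x assume "x \<in> carrier (dsum {..<Suc n} X)"
        then show "x \<in> ?f ` carrier (dsum2 (dsum {..<n} X) (X n))"
          by (intro image_eqI[of _ _ "(restrict x {..<n}, x n)"]) (auto simp: fun_eq_iff PiE_iff extensional_def less_Suc_eq)
      qed
    qed (use cl in blast)
  qed (use Suc in auto)
qed

section \<open>Vector spaces\<close>

text \<open>The exchange argument of linear algebra in a single induction. Either \<open>U\<close>
  lies in the smaller span, or some element u of \<open>U\<close> has an invertible coefficient at
  the last generator, and then \<open>U\<close> is the sum of its intersection with the smaller span
  and the line through u. The strict inequality in the conclusion yields both finite generation of
  subspaces and strict monotonicity of the dimension.\<close>

lemma spanned_subspace:
  assumes "field K" "left_module K V" "spanned K V n W" "is_submodule K V U" "U \<subseteq> W"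
  shows "U = W \<or> (\<exists>m<n. spanned K V m U)"
  using assms(3,4,5)
proof (induct arbitrary: U rule: spanned.induct)
  case spanned_0 then show ?case by (auto simp: is_submodule_def)
next
  interpret K: field K by fact
  interpret V: left_module K V by fact
  case (spanned_Suc n W v)
  have sW: "is_submodule K V W" using spanned_submodule[OF spanned_Suc(1) assms(2)] .
  have Wc: "\<And>x. x \<in> W \<Longrightarrow> x \<in> carrier V" using sW by (auto simp: is_submodule_def)
  have Uc: "\<And>x. x \<in> U \<Longrightarrow> x \<in> carrier V" using spanned_Suc(4) by (auto simp: is_submodule_def)
  let ?U0 = "U \<inter> W"
  have sU0: "is_submodule K V ?U0" using submodule_Int[OF spanned_Suc(4) sW] .
  have IH: "?U0 = W \<or> (\<exists>m<n. spanned K V m ?U0)" by (rule spanned_Suc(2)[OF sU0]) auto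
  show ?case
  proof (cases "U \<subseteq> W")
    case True
    then have "?U0 = U" by auto
    then show ?thesis using IH spanned_Suc(1) by (metis less_Suc_eq)
  next
    case False
    then obtain u where u: "u \<in> U" "u \<notin> W" by auto
    then obtain w a where wa: "w \<in> W" "a \<in> carrier K" "u = w \<oplus>\<^bsub>V\<^esub> a \<odot>\<^bsub>V\<^esub> v" using spanned_Suc(5) by (auto simp: add_line_def)
    have a0: "a \<noteq> \<zero>\<^bsub>K\<^esub>" using wa u(2) Wc spanned_Suc(3) by auto
    then have inv: "inv\<^bsub>K\<^esub> a \<in> carrier K" "inv\<^bsub>K\<^esub> a \<otimes>\<^bsub>K\<^esub> a = \<one>\<^bsub>K\<^esub>"
      using wa(2) K.field_Units by auto
    have U: "U = add_line K V ?U0 u"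
    proof
      show "add_line K V ?U0 u \<subseteq> U" by (rule add_line_least[OF spanned_Suc(4)]) (use u in auto)
      show "U \<subseteq> add_line K V ?U0 u"
      proof
        fix y assume y: "y \<in> U"
        then obtain w' b where wb: "w' \<in> W" "b \<in> carrier K" "y = w' \<oplus>\<^bsub>V\<^esub> b \<odot>\<^bsub>V\<^esub> v" using spanned_Suc(5) by (auto simp: add_line_def)
        \<comment> \<open>Subtracting this multiple of \<open>u\<close> from \<open>y\<close>
          cancels the contribution of \<open>v\<close>, so the difference lies in \<open>U\<close>
          and in \<open>W\<close>.\<close>
        let ?c = "b \<otimes>\<^bsub>K\<^esub> inv\<^bsub>K\<^esub> a"
        have c: "?c \<in> carrier K" using wb inv by simp
        have cu: "?c \<odot>\<^bsub>V\<^esub> u \<in> U" using c u(1) spanned_Suc(4) by (auto simp: is_submodule_def)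
        have ca: "?c \<otimes>\<^bsub>K\<^esub> a = b" using wb(2) inv wa(2) by (simp add: K.m_assoc)
        have "?c \<odot>\<^bsub>V\<^esub> u = ?c \<odot>\<^bsub>V\<^esub> w \<oplus>\<^bsub>V\<^esub> b \<odot>\<^bsub>V\<^esub> v"
          using c wa Wc spanned_Suc(3) by (simp add: V.smult_r_distr V.smult_closed V.smult_assoc1[symmetric] ca)
        moreover have cw: "?c \<odot>\<^bsub>V\<^esub> w \<in> W" using c wa(1) sW by (auto simp: is_submodule_def)
        moreover have d: "w' \<ominus>\<^bsub>V\<^esub> ?c \<odot>\<^bsub>V\<^esub> w \<in> W" using submodule_minus[OF assms(2) sW wb(1) cw] .
        ultimately have y': "y = (w' \<ominus>\<^bsub>V\<^esub> ?c \<odot>\<^bsub>V\<^esub> w) \<oplus>\<^bsub>V\<^esub> ?c \<odot>\<^bsub>V\<^esub> u"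
          using wb Wc spanned_Suc(3) V.diff_add[of w' "?c \<odot>\<^bsub>V\<^esub> w"]
          by (simp add: V.M.a_assoc[symmetric] V.smult_closed)
        then have "w' \<ominus>\<^bsub>V\<^esub> ?c \<odot>\<^bsub>V\<^esub> w = y \<ominus>\<^bsub>V\<^esub> ?c \<odot>\<^bsub>V\<^esub> u"
          using V.minus_eq_iff[of y "?c \<odot>\<^bsub>V\<^esub> u" "w' \<ominus>\<^bsub>V\<^esub> ?c \<odot>\<^bsub>V\<^esub> w"] Uc[OF y] Uc[OF cu] Wc[OF d] by simp
        then have "w' \<ominus>\<^bsub>V\<^esub> ?c \<odot>\<^bsub>V\<^esub> w \<in> U" using submodule_minus[OF assms(2) spanned_Suc(4) y cu] by simp
        then show "y \<in> add_line K V ?U0 u" using y' d c unfolding add_line_def by blast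
      qed
    qed
    from IH show ?thesis
    proof
      assume "\<exists>m<n. spanned K V m ?U0"
      then obtain m where "m < n" "spanned K V m ?U0" by auto
      then have "spanned K V (Suc m) U" using spanned.spanned_Suc[of K V m ?U0 u] u Uc U by simp
      then show ?thesis using \<open>m < n\<close> by auto
    next
      \<comment> \<open>Now \<open>W\<close> is contained in \<open>U\<close>. Dividing the
        difference of \<open>u\<close> and \<open>w\<close> by \<open>a\<close> puts
        \<open>v\<close> into \<open>U\<close> as well, so \<open>U\<close> is the whole
        span.\<close>
      assume U0: "?U0 = W"
      have "u \<ominus>\<^bsub>V\<^esub> w \<in> U" using submodule_minus[OF assms(2) spanned_Suc(4) u(1)] wa(1) U0 by auto
      moreover have "u \<ominus>\<^bsub>V\<^esub> w = a \<odot>\<^bsub>V\<^esub> v"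
        using V.minus_eq_iff wa Wc spanned_Suc(3) Uc u by (simp add: V.smult_closed V.M.a_comm)
      ultimately have "inv\<^bsub>K\<^esub> a \<odot>\<^bsub>V\<^esub> (a \<odot>\<^bsub>V\<^esub> v) \<in> U" using inv spanned_Suc(4) by (auto simp: is_submodule_def)
      then have "v \<in> U" using inv wa spanned_Suc(3) by (simp add: V.smult_assoc1[symmetric] V.smult_one)
      then have "add_line K V W v \<subseteq> U" using add_line_least[OF spanned_Suc(4)] U0 by auto
      then show ?thesis using spanned_Suc(5) by auto
    qed
  qed
qed

text \<open>The minimal number of generators. Its value is meaningful only for finitely spanned
  sets, so the lemmas below start from a \<open>spanned\<close> superset.\<close>

definition vdim :: "('a, 'c) ring_scheme \<Rightarrow> ('a, 'm) module \<Rightarrow> 'm set \<Rightarrow> nat" where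
  "vdim K V U = (LEAST n. spanned K V n U)"

lemma vdim_strict_mono:
  assumes "field K" "left_module K V" "spanned K V n W" "is_submodule K V U" "U \<subseteq> W" "U \<noteq> W"
  shows "vdim K V U < vdim K V W"
proof -
  have "spanned K V (vdim K V W) W" unfolding vdim_def using assms(3) by (rule LeastI)
  from spanned_subspace[OF assms(1,2) this assms(4,5)] assms(6)
  obtain m where "m < vdim K V W" "spanned K V m U" by auto
  then show ?thesis unfolding vdim_def by (metis Least_le le_less_trans)
qed

lemma vdim_mono:
  assumes "field K" "left_module K V" "spanned K V n W" "is_submodule K V U" "U \<subseteq> W"
  shows "vdim K V U \<le> vdim K V W"
  using vdim_strict_mono[OF assms] by (cases "U = W") auto

lemma spanned_vdim:
  assumes "field K" "left_module K V" "spanned K V n W" "is_submodule K V U" "U \<subseteq> W"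
  shows "spanned K V (vdim K V U) U"
  unfolding vdim_def using spanned_subspace[OF assms] assms(3) by (metis LeastI)

lemma fg_subspace:
  assumes "field K" "fg_module K V" "is_submodule K V U"
  shows "fg_module K (submod V U)"
proof -
  obtain n where V: "left_module K V" "spanned K V n (carrier V)" using assms(2) by (auto simp: fg_module_iff)
  have "U \<subseteq> carrier V" using assms(3) by (simp add: is_submodule_def)
  then have "spanned K V (vdim K V U) U" using spanned_vdim[OF assms(1) V assms(3)] by simp
  then have "spanned K (submod V U) (vdim K V U) U" using spanned_submod V(1) assms(3) by blast
  then show ?thesis using fg_moduleI[of K "submod V U"] left_module_submod[OF V(1) assms(3)] by simp
qed

text \<open>Linearity forces the value \<open>f u \<oplus> c t\<close> at
  \<open>u \<oplus> c v\<close>. It is well defined, because two different representations of one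
  vector would give a nonzero multiple of \<open>v\<close> in \<open>U\<close>, hence
  \<open>v\<close> itself after division.\<close>

lemma hom_extend_line:
  assumes "field K" "left_module K V" "left_module K N" "is_submodule K V U" "v \<in> carrier V" "v \<notin> U"
    "f \<in> mod_hom K (submod V U) N" "t \<in> carrier N"
  shows "\<exists>h\<in>mod_hom K (submod V (add_line K V U v)) N. (\<forall>x\<in>U. h x = f x) \<and> h v = t"
proof -
  interpret K: field K by fact
  interpret V: left_module K V by fact
  interpret N: left_module K N by fact
  have Uc: "\<And>x. x \<in> U \<Longrightarrow> x \<in> carrier V" and U0: "\<zero>\<^bsub>V\<^esub> \<in> U" and Ua: "\<And>x y. x \<in> U \<Longrightarrow> y \<in> U \<Longrightarrow> x \<oplus>\<^bsub>V\<^esub> y \<in> U"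
     and Us: "\<And>a x. a \<in> carrier K \<Longrightarrow> x \<in> U \<Longrightarrow> a \<odot>\<^bsub>V\<^esub> x \<in> U"
    using assms(4) by (auto simp: is_submodule_def)
  note f = hom_closed[OF assms(7), simplified] hom_add[OF assms(7), simplified] hom_smult[OF assms(7), simplified]
  have f0: "f \<zero>\<^bsub>V\<^esub> = \<zero>\<^bsub>N\<^esub>" using hom_zero[OF assms(7) left_module_submod[OF assms(2,4)] assms(3)] by simp
  define h where "h x = (THE y. \<exists>u\<in>U. \<exists>c\<in>carrier K. x = u \<oplus>\<^bsub>V\<^esub> c \<odot>\<^bsub>V\<^esub> v \<and> y = f u \<oplus>\<^bsub>N\<^esub> c \<odot>\<^bsub>N\<^esub> t)" for x
  have uniq: "u = u' \<and> c = c'" if "u \<in> U" "u' \<in> U" "c \<in> carrier K" "c' \<in> carrier K"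
    and eq: "u \<oplus>\<^bsub>V\<^esub> c \<odot>\<^bsub>V\<^esub> v = u' \<oplus>\<^bsub>V\<^esub> c' \<odot>\<^bsub>V\<^esub> v" for u u' c c'
  proof -
    let ?d = "c \<ominus>\<^bsub>K\<^esub> c'"
    have d: "?d \<in> carrier K" using that by simp
    have "?d \<oplus>\<^bsub>K\<^esub> c' = c" using that by (simp add: K.minus_eq K.a_assoc K.l_neg)
    then have cd: "c = c' \<oplus>\<^bsub>K\<^esub> ?d" using that d by (simp add: K.a_comm)
    have "u \<oplus>\<^bsub>V\<^esub> ?d \<odot>\<^bsub>V\<^esub> v = u'"
    proof -
      have "(u \<oplus>\<^bsub>V\<^esub> ?d \<odot>\<^bsub>V\<^esub> v) \<oplus>\<^bsub>V\<^esub> c' \<odot>\<^bsub>V\<^esub> v = u \<oplus>\<^bsub>V\<^esub> (c' \<oplus>\<^bsub>K\<^esub> ?d) \<odot>\<^bsub>V\<^esub> v"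
        using that d assms(5) Uc by (simp only: V.smult_l_distr) (simp add: V.M.a_ac V.smult_closed)
      also have "\<dots> = u' \<oplus>\<^bsub>V\<^esub> c' \<odot>\<^bsub>V\<^esub> v" using cd eq by simp
      finally show ?thesis using that d assms(5) Uc by (simp add: V.smult_closed)
    qed
    then have "?d \<odot>\<^bsub>V\<^esub> v = u' \<ominus>\<^bsub>V\<^esub> u" using that d assms(5) Uc
      by (metis V.M.a_comm V.M.a_closed V.minus_eq_iff V.smult_closed)
    then have dU: "?d \<odot>\<^bsub>V\<^esub> v \<in> U" using submodule_minus[OF assms(2,4)] that by simp
    have d0: "?d = \<zero>\<^bsub>K\<^esub>"
    proof (rule ccontr)
      assume "?d \<noteq> \<zero>\<^bsub>K\<^esub>"
      then have i: "inv\<^bsub>K\<^esub> ?d \<in> carrier K" "inv\<^bsub>K\<^esub> ?d \<otimes>\<^bsub>K\<^esub> ?d = \<one>\<^bsub>K\<^esub>" using d K.field_Units by auto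
      then have "inv\<^bsub>K\<^esub> ?d \<odot>\<^bsub>V\<^esub> (?d \<odot>\<^bsub>V\<^esub> v) \<in> U" using dU Us by blast
      then show False using i d assms(5,6) by (simp add: V.smult_assoc1[symmetric] V.smult_one)
    qed
    then have "c = c'" using cd that by simp
    then show ?thesis using eq that Uc assms(5) by (simp add: V.smult_closed)
  qed
  have h: "h (u \<oplus>\<^bsub>V\<^esub> c \<odot>\<^bsub>V\<^esub> v) = f u \<oplus>\<^bsub>N\<^esub> c \<odot>\<^bsub>N\<^esub> t" if "u \<in> U" "c \<in> carrier K" for u c
    unfolding h_def by (rule the_equality) (use that uniq in blast)+
  show ?thesis
  proof (intro bexI[of _ h] conjI ballI)
    fix x assume "x \<in> U"
    then show "h x = f x" using h[of x "\<zero>\<^bsub>K\<^esub>"] assms(5,8) Uc f by simp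
  next
    show "h v = t" using h[of "\<zero>\<^bsub>V\<^esub>" "\<one>\<^bsub>K\<^esub>"] assms(5,8) U0 f0 by (simp add: V.smult_one N.smult_one)
  next
    show "h \<in> mod_hom K (submod V (add_line K V U v)) N"
    proof (rule mod_homI)
      fix x assume "x \<in> carrier (submod V (add_line K V U v))"
      then obtain u c where x: "u \<in> U" "c \<in> carrier K" "x = u \<oplus>\<^bsub>V\<^esub> c \<odot>\<^bsub>V\<^esub> v" by (auto simp: add_line_def)
      then show "h x \<in> carrier N" using h f assms(8) by (simp add: N.smult_closed)
      show "h (x \<oplus>\<^bsub>submod V (add_line K V U v)\<^esub> y) = h x \<oplus>\<^bsub>N\<^esub> h y"
        if "y \<in> carrier (submod V (add_line K V U v))" for y
      proof -
        from that obtain u' c' where y: "u' \<in> U" "c' \<in> carrier K" "y = u' \<oplus>\<^bsub>V\<^esub> c' \<odot>\<^bsub>V\<^esub> v" by (auto simp: add_line_def)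
        have "x \<oplus>\<^bsub>V\<^esub> y = (u \<oplus>\<^bsub>V\<^esub> u') \<oplus>\<^bsub>V\<^esub> (c \<oplus>\<^bsub>K\<^esub> c') \<odot>\<^bsub>V\<^esub> v"
          using x y Uc assms(5) by (simp add: V.smult_l_distr V.smult_closed V.M.a_ac)
        then have "h (x \<oplus>\<^bsub>V\<^esub> y) = f (u \<oplus>\<^bsub>V\<^esub> u') \<oplus>\<^bsub>N\<^esub> (c \<oplus>\<^bsub>K\<^esub> c') \<odot>\<^bsub>N\<^esub> t" using h x y Ua by simp
        also have "\<dots> = h x \<oplus>\<^bsub>N\<^esub> h y" using x y h f assms(8) by (simp add: N.smult_l_distr N.smult_closed N.M.a_ac)
        finally show ?thesis by simp
      qed
      show "h (a \<odot>\<^bsub>submod V (add_line K V U v)\<^esub> x) = a \<odot>\<^bsub>N\<^esub> h x" if "a \<in> carrier K" for a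
      proof -
        have "a \<odot>\<^bsub>V\<^esub> x = a \<odot>\<^bsub>V\<^esub> u \<oplus>\<^bsub>V\<^esub> (a \<otimes>\<^bsub>K\<^esub> c) \<odot>\<^bsub>V\<^esub> v"
          using x that Uc assms(5) by (simp add: V.smult_r_distr V.smult_closed V.smult_assoc1)
        then have "h (a \<odot>\<^bsub>V\<^esub> x) = f (a \<odot>\<^bsub>V\<^esub> u) \<oplus>\<^bsub>N\<^esub> (a \<otimes>\<^bsub>K\<^esub> c) \<odot>\<^bsub>N\<^esub> t" using h x that Us by simp
        also have "\<dots> = a \<odot>\<^bsub>N\<^esub> h x" using x that h f assms(8) by (simp add: N.smult_r_distr N.smult_closed N.smult_assoc1)
        finally show ?thesis by simp
      qed
    qed
  qed
qed

text \<open>\<open>hom_extend_line\<close> is applied along a chain of generators of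
  \<open>V\<close>; those already in the domain are skipped. In the induction \<open>U'\<close> is
  the domain reached so far.\<close>

lemma hom_extend:
  assumes "field K" "fg_module K V" "left_module K N" "is_submodule K V U" "f \<in> mod_hom K (submod V U) N"
  shows "\<exists>h\<in>mod_hom K V N. \<forall>x\<in>U. h x = f x"
proof -
  obtain n where V: "left_module K V" "spanned K V n (carrier V)" using assms(2) by (auto simp: fg_module_iff)
  have "\<exists>U' h. is_submodule K V U' \<and> U \<subseteq> U' \<and> W \<subseteq> U' \<and> h \<in> mod_hom K (submod V U') N \<and> (\<forall>x\<in>U. h x = f x)"
    if "spanned K V n W" for n W
    using that
  proof (induct rule: spanned.induct)
    case spanned_0
    then show ?case using assms(4,5) by (intro exI[of _ U] exI[of _ f]) (auto simp: is_submodule_def)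
  next
    case (spanned_Suc n W v)
    then obtain U' h where *: "is_submodule K V U'" "U \<subseteq> U'" "W \<subseteq> U'" "h \<in> mod_hom K (submod V U') N" "\<forall>x\<in>U. h x = f x" by blast
    show ?case
    proof (cases "v \<in> U'")
      case True
      then have "add_line K V W v \<subseteq> U'" using add_line_least[OF *(1,3)] by simp
      then show ?thesis using * by blast
    next
      case False
      have "\<zero>\<^bsub>N\<^esub> \<in> carrier N" using submodule_carrier[OF assms(3)] by (simp add: is_submodule_def)
      from hom_extend_line[OF assms(1) V(1) assms(3) *(1) spanned_Suc(3) False *(4) this]
      obtain h' where h': "h' \<in> mod_hom K (submod V (add_line K V U' v)) N" "\<forall>x\<in>U'. h' x = h x" by blast
      have s: "is_submodule K V (add_line K V U' v)" "U' \<subseteq> add_line K V U' v"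
        using submodule_add_line[OF V(1) *(1) spanned_Suc(3)] subset_add_line[OF V(1) *(1) spanned_Suc(3)] by auto
      have "add_line K V W v \<subseteq> add_line K V U' v" using *(3) by (auto simp: add_line_def)
      then show ?thesis using h' s * by (intro exI[of _ "add_line K V U' v"] exI[of _ h']) auto
    qed
  qed
  from this[OF V(2)] obtain U' h where *: "is_submodule K V U'" "carrier V \<subseteq> U'" "h \<in> mod_hom K (submod V U') N" "\<forall>x\<in>U. h x = f x" by blast
  then have "U' = carrier V" by (auto simp: is_submodule_def)
  then show ?thesis using * hom_from_submod_carrier by blast
qed

text \<open>A basis with its coordinate functionals, of which only the expansion formula is
  recorded. It is collected along a spanning chain by leaving out generators that are already in the
  span.\<close>

lemma dual_basis:
  assumes "field K" "fg_module K V"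
  obtains n a l where "\<And>i. i < n \<Longrightarrow> a i \<in> carrier V" "\<And>i. i < n \<Longrightarrow> l i \<in> mod_hom K V (regular_module K)"
    "\<And>x. x \<in> carrier V \<Longrightarrow> x = (\<Oplus>\<^bsub>V\<^esub>i\<in>{..<n::nat}. l i x \<odot>\<^bsub>V\<^esub> a i)"
proof -
  interpret K: field K by fact
  obtain n where V: "left_module K V" "spanned K V n (carrier V)" using assms(2) by (auto simp: fg_module_iff)
  interpret V: left_module K V by fact
  have lr: "left_module K (regular_module K)" using left_module_regular K.ring_axioms .
  have "\<exists>n a l. (\<forall>i<n. a i \<in> carrier V \<and> l i \<in> mod_hom K V (regular_module K)) \<and>
      (\<forall>x\<in>W. x = (\<Oplus>\<^bsub>V\<^esub>i\<in>{..<n::nat}. l i x \<odot>\<^bsub>V\<^esub> a i))" if "spanned K V m W" for m W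
    using that
  proof (induct rule: spanned.induct)
    case spanned_0 then show ?case by (intro exI[of _ 0]) simp
  next
    case (spanned_Suc m W v)
    then obtain n a l where al: "\<And>i. i < n \<Longrightarrow> a i \<in> carrier V" "\<And>i. i < n \<Longrightarrow> l i \<in> mod_hom K V (regular_module K)"
      "\<And>x. x \<in> W \<Longrightarrow> x = (\<Oplus>\<^bsub>V\<^esub>i\<in>{..<n::nat}. l i x \<odot>\<^bsub>V\<^esub> a i)" by blast
    have sW: "is_submodule K V W" using spanned_submodule[OF spanned_Suc(1) V(1)] .
    have Wc: "\<And>x. x \<in> W \<Longrightarrow> x \<in> carrier V" using sW by (auto simp: is_submodule_def)
    show ?case
    proof (cases "v \<in> W")
      case True
      then have "add_line K V W v \<subseteq> W" using add_line_least[OF sW] by simp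
      then show ?thesis using al by (intro exI[of _ n] exI[of _ a] exI[of _ l]) auto
    next
      case False
      \<comment> \<open>The coordinate functional of the new basis vector: zero on the old span and
        one at \<open>v\<close>, afterwards extended to all of \<open>V\<close>.\<close>
      from hom_extend_line[OF assms(1) V(1) lr sW spanned_Suc(3) False hom_const_zero[OF lr], of "\<one>\<^bsub>K\<^esub>"]
      obtain h where h: "h \<in> mod_hom K (submod V (add_line K V W v)) (regular_module K)" "\<And>x. x \<in> W \<Longrightarrow> h x = \<zero>\<^bsub>K\<^esub>" "h v = \<one>\<^bsub>K\<^esub>"
        by auto
      from hom_extend[OF assms lr submodule_add_line[OF V(1) sW spanned_Suc(3)] h(1)]
      obtain \<mu> where mu: "\<mu> \<in> mod_hom K V (regular_module K)" "\<forall>x\<in>add_line K V W v. \<mu> x = h x" by blast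
      have mu': "\<mu> v = \<one>\<^bsub>K\<^esub>" "\<And>x. x \<in> W \<Longrightarrow> \<mu> x = \<zero>\<^bsub>K\<^esub>"
        using mu h subset_add_line[OF V(1) sW spanned_Suc(3)] by auto
      note muc = hom_closed[OF mu(1), simplified]
      have muh: "(\<lambda>x. \<mu> x \<odot>\<^bsub>V\<^esub> v) \<in> mod_hom K V V"
        by (rule mod_homI) (use spanned_Suc(3) muc in \<open>auto simp: V.smult_closed hom_add[OF mu(1)] hom_smult[OF mu(1)] V.smult_l_distr V.smult_assoc1\<close>)
      \<comment> \<open>\<open>r\<close> is the identity on \<open>W\<close> and kills
        \<open>v\<close>, so the old functionals composed with \<open>r\<close> keep their values on
        \<open>W\<close> and vanish at \<open>v\<close>.\<close>
      define r where "r x = x \<ominus>\<^bsub>V\<^esub> \<mu> x \<odot>\<^bsub>V\<^esub> v" for x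
      have r: "r \<in> mod_hom K V V" using hom_diff[OF hom_id muh V(1)] by (simp add: r_def[abs_def])
      define l' where "l' i = (if i < n then (\<lambda>x. l i (r x)) else \<mu>)" for i
      define a' where "a' i = (if i < n then a i else v)" for i
      show ?thesis
      proof (intro exI[of _ "Suc n"] exI[of _ a'] exI[of _ l'] conjI allI impI ballI)
        fix i assume "i < Suc n"
        then show "a' i \<in> carrier V" using al spanned_Suc(3) by (auto simp: a'_def)
        show "l' i \<in> mod_hom K V (regular_module K)" using mu(1) hom_comp[OF r al(2)] by (auto simp: l'_def)
      next
        fix x assume "x \<in> add_line K V W v"
        then obtain w c where wc: "w \<in> W" "c \<in> carrier K" "x = w \<oplus>\<^bsub>V\<^esub> c \<odot>\<^bsub>V\<^esub> v" by (auto simp: add_line_def)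
        have w: "w \<in> carrier V" and x: "x \<in> carrier V" using wc Wc spanned_Suc(3) by (auto simp: V.smult_closed)
        have "\<mu> x = c" using wc w spanned_Suc(3) mu' by (simp add: hom_add[OF mu(1)] hom_smult[OF mu(1)] V.smult_closed)
        then have rx: "r x = w" unfolding r_def using V.minus_eq_iff[of x "\<mu> x \<odot>\<^bsub>V\<^esub> v" w] wc w x spanned_Suc(3) by (simp add: V.smult_closed)
        have cl: "(\<lambda>i. l' i x \<odot>\<^bsub>V\<^esub> a' i) \<in> {..n} \<rightarrow> carrier V"
          using al hom_closed[OF al(2) w] spanned_Suc(3) muc[OF x] rx by (auto simp: l'_def a'_def intro!: V.smult_closed)
        have "(\<Oplus>\<^bsub>V\<^esub>i\<in>{..<Suc n}. l' i x \<odot>\<^bsub>V\<^esub> a' i) = (\<Oplus>\<^bsub>V\<^esub>i\<in>insert n {..<n}. l' i x \<odot>\<^bsub>V\<^esub> a' i)"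
          by (simp add: lessThan_Suc)
        also have "\<dots> = l' n x \<odot>\<^bsub>V\<^esub> a' n \<oplus>\<^bsub>V\<^esub> (\<Oplus>\<^bsub>V\<^esub>i\<in>{..<n}. l' i x \<odot>\<^bsub>V\<^esub> a' i)"
          by (rule V.M.finsum_insert) (use cl in auto)
        also have "(\<Oplus>\<^bsub>V\<^esub>i\<in>{..<n}. l' i x \<odot>\<^bsub>V\<^esub> a' i) = (\<Oplus>\<^bsub>V\<^esub>i\<in>{..<n}. l i w \<odot>\<^bsub>V\<^esub> a i)"
          by (rule V.M.finsum_cong') (use al hom_closed[OF al(2) w] rx in \<open>auto simp: l'_def a'_def intro!: V.smult_closed\<close>)
        also have "\<dots> = w" using al(3)[OF wc(1)] by simp
        finally show "x = (\<Oplus>\<^bsub>V\<^esub>i\<in>{..<Suc n}. l' i x \<odot>\<^bsub>V\<^esub> a' i)"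
          using wc w spanned_Suc(3) \<open>\<mu> x = c\<close> by (simp add: l'_def a'_def V.smult_closed V.M.a_comm)
      qed
    qed
  qed
  from this[OF V(2)] show ?thesis using that by blast
qed

section \<open>Finite dimensional algebras\<close>

text \<open>The two scalar axioms make the field act through the centre of the ring.\<close>

locale fd_algebra =
  fixes K :: "'k ring" and L :: "('k, 'a) module"
  assumes K_field: "field K" and L_ring: "ring L" and L_fg: "fg_module K L"
    and scalar_left: "\<lbrakk>c \<in> carrier K; a \<in> carrier L; b \<in> carrier L\<rbrakk> \<Longrightarrow>
        c \<odot>\<^bsub>L\<^esub> (a \<otimes>\<^bsub>L\<^esub> b) = (c \<odot>\<^bsub>L\<^esub> a) \<otimes>\<^bsub>L\<^esub> b"
    and scalar_right: "\<lbrakk>c \<in> carrier K; a \<in> carrier L; b \<in> carrier L\<rbrakk> \<Longrightarrow>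
        c \<odot>\<^bsub>L\<^esub> (a \<otimes>\<^bsub>L\<^esub> b) = a \<otimes>\<^bsub>L\<^esub> (c \<odot>\<^bsub>L\<^esub> b)"

sublocale fd_algebra \<subseteq> K: field K by (rule K_field)
sublocale fd_algebra \<subseteq> L: ring L by (rule L_ring)
sublocale fd_algebra \<subseteq> KL: left_module K L by (rule fg_left_module[OF L_fg])

definition restrict_scalars :: "('k, 'a) module \<Rightarrow> ('a, 'm) module \<Rightarrow> ('k, 'm) module" where
  "restrict_scalars L M = \<lparr>carrier = carrier M, mult = mult M, one = one M, zero = zero M, add = add M,
     smult = (\<lambda>c x. (c \<odot>\<^bsub>L\<^esub> \<one>\<^bsub>L\<^esub>) \<odot>\<^bsub>M\<^esub> x)\<rparr>"

lemma restrict_scalars_simps [simp]: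
  "carrier (restrict_scalars L M) = carrier M" "zero (restrict_scalars L M) = zero M"
  "add (restrict_scalars L M) = add M"
  "c \<odot>\<^bsub>restrict_scalars L M\<^esub> x = (c \<odot>\<^bsub>L\<^esub> \<one>\<^bsub>L\<^esub>) \<odot>\<^bsub>M\<^esub> x"
  by (simp_all add: restrict_scalars_def)

text \<open>The dimension over \<open>K\<close>, used as the induction measure when a module is
  split into summands.\<close>

definition mdim :: "'k ring \<Rightarrow> ('k, 'a) module \<Rightarrow> ('a, 'm) module \<Rightarrow> nat" where
  "mdim K L M = vdim K (restrict_scalars L M) (carrier M)"

text \<open>A direct summand up to isomorphism, without a chosen complement;
  \<open>retract_complement\<close> supplies one.\<close>

definition retract :: "('a, 'c) ring_scheme \<Rightarrow> ('a, 'm) module \<Rightarrow> ('a, 'n) module \<Rightarrow> bool" where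
  "retract R X M \<longleftrightarrow> (\<exists>i\<in>mod_hom R X M. \<exists>p\<in>mod_hom R M X. \<forall>x\<in>carrier X. p (i x) = x)"

text \<open>The identity of \<open>X\<close> is a sum of maps through the modules
  \<open>M i\<close>, which means that \<open>X\<close> is a direct summand of their direct sum. For
  a constant family this is membership in add of that module, see \<open>in_add_iff\<close>.\<close>

definition factors_through ::
  "('a, 'c) ring_scheme \<Rightarrow> ('a, 'm) module \<Rightarrow> nat \<Rightarrow> (nat \<Rightarrow> ('a, 'n) module) \<Rightarrow> bool" where
  "factors_through R X n M \<longleftrightarrow> (\<exists>q p. (\<forall>i<n. q i \<in> mod_hom R X (M i) \<and> p i \<in> mod_hom R (M i) X) \<and>
     (\<forall>x\<in>carrier X. x = (\<Oplus>\<^bsub>X\<^esub>i\<in>{..<n}. p i (q i x))))"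

lemma factors_throughE:
  assumes "factors_through R X n M"
  obtains q p where "\<And>i. i < n \<Longrightarrow> q i \<in> mod_hom R X (M i)" "\<And>i. i < n \<Longrightarrow> p i \<in> mod_hom R (M i) X"
    "\<And>x. x \<in> carrier X \<Longrightarrow> x = (\<Oplus>\<^bsub>X\<^esub>i\<in>{..<n}. p i (q i x))"
proof -
  obtain q p where "\<forall>i<n. q i \<in> mod_hom R X (M i) \<and> p i \<in> mod_hom R (M i) X"
    "\<forall>x\<in>carrier X. x = (\<Oplus>\<^bsub>X\<^esub>i\<in>{..<n}. p i (q i x))"
    using assms unfolding factors_through_def by (elim exE conjE)
  then show ?thesis by (intro that[of q p]) auto
qed

section \<open>Direct summands and decompositions\<close>

lemma mod_iso_dsum2:
  assumes "mod_iso R M M'" "mod_iso R N N'" "left_module R M" "left_module R N"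
  shows "mod_iso R (dsum2 M N) (dsum2 M' N')"
proof -
  obtain f g where f: "f \<in> mod_hom R M M'" "g \<in> mod_hom R M' M"
    "\<And>x. x \<in> carrier M \<Longrightarrow> g (f x) = x" "\<And>y. y \<in> carrier M' \<Longrightarrow> f (g y) = y"
    using mod_iso_inverse[OF assms(1,3)] by blast
  obtain f' g' where f': "f' \<in> mod_hom R N N'" "g' \<in> mod_hom R N' N"
    "\<And>x. x \<in> carrier N \<Longrightarrow> g' (f' x) = x" "\<And>y. y \<in> carrier N' \<Longrightarrow> f' (g' y) = y"
    using mod_iso_inverse[OF assms(2,4)] by blast
  have 1: "(\<lambda>x. (f (fst x), f' (snd x))) \<in> mod_hom R (dsum2 M N) (dsum2 M' N')"
    by (intro hom_pair hom_comp[OF hom_fst f(1)] hom_comp[OF hom_snd f'(1)])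
  have 2: "(\<lambda>x. (g (fst x), g' (snd x))) \<in> mod_hom R (dsum2 M' N') (dsum2 M N)"
    by (intro hom_pair hom_comp[OF hom_fst f(2)] hom_comp[OF hom_snd f'(2)])
  show ?thesis by (rule mod_isoI'[OF 1 2]) (auto simp: f f')
qed

text \<open>Every m is the sum of \<open>i (p m)\<close> and \<open>m \<ominus> i (p m)\<close>, and
  the second term lies in the kernel of \<open>p\<close>.\<close>

lemma retract_complement:
  assumes "left_module R X" "left_module R M" "i \<in> mod_hom R X M" "p \<in> mod_hom R M X"
    "\<And>x. x \<in> carrier X \<Longrightarrow> p (i x) = x"
  shows "mod_iso R (dsum2 X (submod M {m \<in> carrier M. p m = \<zero>\<^bsub>X\<^esub>})) M"
proof -
  interpret X: left_module R X by fact
  interpret M: left_module R M by fact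
  let ?Z = "{m \<in> carrier M. p m = \<zero>\<^bsub>X\<^esub>}"
  have sZ: "is_submodule R M ?Z" using submodule_ker[OF assms(2,1,4)] .
  have ic: "\<And>x. x \<in> carrier X \<Longrightarrow> i x \<in> carrier M" and pc: "\<And>x. x \<in> carrier M \<Longrightarrow> p x \<in> carrier X"
    using hom_closed assms(3,4) by metis+
  have lZ: "left_module R (submod M ?Z)" using left_module_submod[OF assms(2) sZ] .
  have h1: "(\<lambda>x. i (fst x) \<oplus>\<^bsub>M\<^esub> snd x) \<in> mod_hom R (dsum2 X (submod M ?Z)) M"
    by (rule hom_plus[OF hom_comp[OF hom_fst assms(3)] hom_comp[OF hom_snd hom_inclusion] assms(2)]) auto
  have h2: "(\<lambda>m. (p m, m \<ominus>\<^bsub>M\<^esub> i (p m))) \<in> mod_hom R M (dsum2 X (submod M ?Z))"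
  proof (intro hom_pair assms(4) hom_into_submod)
    show "(\<lambda>m. m \<ominus>\<^bsub>M\<^esub> i (p m)) \<in> mod_hom R M M" by (rule hom_diff[OF hom_id hom_comp[OF assms(4,3)] assms(2)])
    show "(\<lambda>m. m \<ominus>\<^bsub>M\<^esub> i (p m)) ` carrier M \<subseteq> ?Z"
      using ic pc by (auto simp: hom_minus[OF assms(4,2,1)] assms(5) X.minus_self)
  qed
  show ?thesis
  proof (rule mod_isoI'[OF h1 h2])
    fix x assume "x \<in> carrier (dsum2 X (submod M ?Z))"
    then obtain u z where x: "x = (u, z)" "u \<in> carrier X" "z \<in> carrier M" "p z = \<zero>\<^bsub>X\<^esub>" by auto
    have "p (i u \<oplus>\<^bsub>M\<^esub> z) = u" using x ic by (simp add: hom_add[OF assms(4)] assms(5))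
    moreover have "(i u \<oplus>\<^bsub>M\<^esub> z) \<ominus>\<^bsub>M\<^esub> i u = z" using x ic by (simp add: M.minus_eq_iff M.M.a_comm)
    ultimately show "(p (i (fst x) \<oplus>\<^bsub>M\<^esub> snd x), (i (fst x) \<oplus>\<^bsub>M\<^esub> snd x) \<ominus>\<^bsub>M\<^esub> i (p (i (fst x) \<oplus>\<^bsub>M\<^esub> snd x))) = x"
      using x by simp
  next
    fix y assume "y \<in> carrier M"
    then show "i (fst (p y, y \<ominus>\<^bsub>M\<^esub> i (p y))) \<oplus>\<^bsub>M\<^esub> snd (p y, y \<ominus>\<^bsub>M\<^esub> i (p y)) = y"
      using ic pc M.diff_add[of y "i (p y)"] by (simp add: M.M.a_comm)
  qed
qed

text \<open>The equations of a biproduct, obtained by carrying injections and projections through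
  the isomorphism. Later arguments work with these four maps instead of pairs.\<close>

lemma mod_iso_dsum2E:
  assumes "mod_iso R W (dsum2 B C)" "left_module R W" "left_module R B" "left_module R C"
  obtains iB pB iC pC where "iB \<in> mod_hom R B W" "pB \<in> mod_hom R W B" "iC \<in> mod_hom R C W" "pC \<in> mod_hom R W C"
    "\<And>b. b \<in> carrier B \<Longrightarrow> pB (iB b) = b" "\<And>c. c \<in> carrier C \<Longrightarrow> pC (iC c) = c"
    "\<And>b. b \<in> carrier B \<Longrightarrow> pC (iB b) = \<zero>\<^bsub>C\<^esub>" "\<And>c. c \<in> carrier C \<Longrightarrow> pB (iC c) = \<zero>\<^bsub>B\<^esub>"
    "\<And>w. w \<in> carrier W \<Longrightarrow> iB (pB w) \<oplus>\<^bsub>W\<^esub> iC (pC w) = w"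
proof -
  interpret B: left_module R B by fact
  interpret C: left_module R C by fact
  obtain f g where f: "f \<in> mod_hom R W (dsum2 B C)" "g \<in> mod_hom R (dsum2 B C) W"
    "\<And>x. x \<in> carrier W \<Longrightarrow> g (f x) = x" "\<And>y. y \<in> carrier (dsum2 B C) \<Longrightarrow> f (g y) = y"
    using mod_iso_inverse[OF assms(1,2)] by blast
  note fc = hom_closed[OF f(1)]
  show ?thesis
  proof (rule that[OF hom_comp[OF hom_inl[OF assms(4)] f(2)] hom_comp[OF f(1) hom_fst]
      hom_comp[OF hom_inr[OF assms(3)] f(2)] hom_comp[OF f(1) hom_snd]])
    fix w assume w: "w \<in> carrier W"
    obtain b c where bc: "f w = (b, c)" "b \<in> carrier B" "c \<in> carrier C" using fc[OF w] by auto
    have "g (b, \<zero>\<^bsub>C\<^esub>) \<oplus>\<^bsub>W\<^esub> g (\<zero>\<^bsub>B\<^esub>, c) = g (f w)" using bc by (simp add: hom_add[OF f(2), symmetric])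
    then show "g (fst (f w), \<zero>\<^bsub>C\<^esub>) \<oplus>\<^bsub>W\<^esub> g (\<zero>\<^bsub>B\<^esub>, snd (f w)) = w" using bc f(3)[OF w] by simp
  qed (auto simp: f(4))
qed

text \<open>The analogue of \<open>mod_iso_dsum2E\<close> for a finite family; the expansion of an
  element comes from \<open>dsum_decompose\<close>.\<close>

lemma mod_iso_dsum_factors:
  assumes "mod_iso R W (dsum {..<n::nat} X)" "left_module R W" "\<And>i. i < n \<Longrightarrow> left_module R (X i)"
  obtains u v where "\<And>i. i < n \<Longrightarrow> u i \<in> mod_hom R (X i) W" "\<And>i. i < n \<Longrightarrow> v i \<in> mod_hom R W (X i)"
    "\<And>i x. i < n \<Longrightarrow> x \<in> carrier (X i) \<Longrightarrow> v i (u i x) = x"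
    "\<And>w. w \<in> carrier W \<Longrightarrow> w = (\<Oplus>\<^bsub>W\<^esub>i\<in>{..<n}. u i (v i w))"
proof -
  have rR: "ring R" using assms(2) by (rule left_module_ring)
  have lD: "left_module R (dsum {..<n} X)" by (rule left_module_dsum[OF rR]) (use assms(3) in auto)
  obtain f g where f: "f \<in> mod_hom R W (dsum {..<n} X)" "g \<in> mod_hom R (dsum {..<n} X) W"
    "\<And>x. x \<in> carrier W \<Longrightarrow> g (f x) = x" "\<And>y. y \<in> carrier (dsum {..<n} X) \<Longrightarrow> f (g y) = y"
    using mod_iso_inverse[OF assms(1,2)] by blast
  define inj where "inj j = (\<lambda>x. \<lambda>i\<in>{..<n}. if i = j then x else \<zero>\<^bsub>X i\<^esub>)" for j
  have inj: "inj j \<in> mod_hom R (X j) (dsum {..<n} X)" for j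
    unfolding inj_def by (rule hom_dsum_inj) (use assms(3) in auto)
  have pr: "(\<lambda>x. x i) \<in> mod_hom R (dsum {..<n} X) (X i)" if "i < n" for i
    by (rule hom_dsum_proj) (use that in auto)
  show ?thesis
  proof (rule that[of "\<lambda>i x. g (inj i x)" "\<lambda>i w. f w i"])
    show "(\<lambda>x. g (inj i x)) \<in> mod_hom R (X i) W" for i by (rule hom_comp[OF inj f(2)])
    show "(\<lambda>w. f w i) \<in> mod_hom R W (X i)" if "i < n" for i by (rule hom_comp[OF f(1) pr[OF that]])
    show "f (g (inj i x)) i = x" if "i < n" "x \<in> carrier (X i)" for i x
      using f(4)[OF hom_closed[OF inj that(2)]] that(1) by (simp add: inj_def)
    fix w assume w: "w \<in> carrier W"
    have fw: "f w \<in> carrier (dsum {..<n} X)" using hom_closed[OF f(1) w] .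
    have c: "(\<lambda>i. inj i (f w i)) \<in> {..<n} \<rightarrow> carrier (dsum {..<n} X)"
      using hom_closed[OF inj] hom_closed[OF pr] fw by blast
    have eq: "(\<lambda>i\<in>{..<n}. if i = j then f w j else \<zero>\<^bsub>X i\<^esub>) = inj j (f w j)" for j by (simp add: inj_def)
    have "w = g (f w)" using f(3)[OF w] by simp
    also have "\<dots> = g (\<Oplus>\<^bsub>dsum {..<n} X\<^esub>j\<in>{..<n}. inj j (f w j))"
      using dsum_decompose[OF rR _ _ fw] assms(3) unfolding eq by auto
    also have "\<dots> = (\<Oplus>\<^bsub>W\<^esub>j\<in>{..<n}. g (inj j (f w j)))"
      by (rule hom_finsum[OF f(2) lD assms(2) _ c]) simp
    finally show "w = (\<Oplus>\<^bsub>W\<^esub>i\<in>{..<n}. g (inj i (f w i)))" .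
  qed
qed

section \<open>Restriction of scalars to the base field\<close>

context fd_algebra
begin

lemma scalar_one_closed: "c \<in> carrier K \<Longrightarrow> c \<odot>\<^bsub>L\<^esub> \<one>\<^bsub>L\<^esub> \<in> carrier L"
  by (rule KL.smult_closed[OF _ L.one_closed])

lemma left_module_restrict_scalars:
  assumes "left_module L M" shows "left_module K (restrict_scalars L M)"
proof -
  interpret M: left_module L M by fact
  have ab: "abelian_group (restrict_scalars L M)"
    by (rule abelian_groupI) (auto simp: M.M.a_ac intro: M.M.l_neg bexI[of _ "\<ominus>\<^bsub>M\<^esub> _"])
  have c1: "c \<odot>\<^bsub>L\<^esub> \<one>\<^bsub>L\<^esub> \<in> carrier L" if "c \<in> carrier K" for c using that by (simp add: KL.smult_closed)
  have "(a \<otimes>\<^bsub>K\<^esub> b) \<odot>\<^bsub>L\<^esub> \<one>\<^bsub>L\<^esub> = (a \<odot>\<^bsub>L\<^esub> \<one>\<^bsub>L\<^esub>) \<otimes>\<^bsub>L\<^esub> (b \<odot>\<^bsub>L\<^esub> \<one>\<^bsub>L\<^esub>)" if "a \<in> carrier K" "b \<in> carrier K" for a b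
    using that c1 scalar_left[of a "\<one>\<^bsub>L\<^esub>" "b \<odot>\<^bsub>L\<^esub> \<one>\<^bsub>L\<^esub>"] by (simp add: KL.smult_assoc1)
  then show ?thesis
    by (intro left_moduleI K.ring_axioms ab)
      (auto simp: c1 M.smult_closed M.smult_l_distr M.smult_r_distr KL.smult_l_distr M.smult_assoc1[symmetric] KL.smult_one M.smult_one)
qed

lemma hom_restrict_scalars:
  "f \<in> mod_hom L M N \<Longrightarrow> f \<in> mod_hom K (restrict_scalars L M) (restrict_scalars L N)"
  by (rule mod_homI) (auto simp: hom_closed hom_add hom_smult KL.smult_closed)

lemma submodule_restrict_scalars:
  "is_submodule L M U \<Longrightarrow> is_submodule K (restrict_scalars L M) U"
  using scalar_one_closed by (simp add: is_submodule_def)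

lemma restrict_scalars_submod: "restrict_scalars L (submod M U) = submod (restrict_scalars L M) U"
  by (simp add: restrict_scalars_def submod_def)

text \<open>Turns one generator over \<open>L\<close> into finitely many over \<open>K\<close>: its
  orbit is a linear image of the finite dimensional space \<open>L\<close>.\<close>

lemma orbit_hom:
  assumes "left_module L M" "v \<in> carrier M"
  shows "(\<lambda>a. a \<odot>\<^bsub>M\<^esub> v) \<in> mod_hom K L (restrict_scalars L M)"
proof -
  interpret M: left_module L M by fact
  have "(c \<odot>\<^bsub>L\<^esub> a) \<odot>\<^bsub>M\<^esub> v = (c \<odot>\<^bsub>L\<^esub> \<one>\<^bsub>L\<^esub>) \<odot>\<^bsub>M\<^esub> (a \<odot>\<^bsub>M\<^esub> v)" if "c \<in> carrier K" "a \<in> carrier L" for c a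
    using that assms(2) scalar_left[of c "\<one>\<^bsub>L\<^esub>" a] by (simp add: M.smult_assoc1[symmetric] KL.smult_closed)
  then show ?thesis
    by (intro mod_homI) (auto simp: assms(2) M.smult_closed M.smult_l_distr)
qed

text \<open>In one direction each generator is replaced by its orbit, which is spanned by as many
  elements as \<open>L\<close> itself. In the other direction generators over \<open>K\<close> also
  generate over \<open>L\<close>, because scalars act through \<open>L\<close>.\<close>

lemma fg_iff_fg_restrict_scalars:
  "fg_module L M \<longleftrightarrow> left_module L M \<and> fg_module K (restrict_scalars L M)"
proof (intro iffI conjI)
  assume fg: "fg_module L M"
  then show lm: "left_module L M" by (rule fg_left_module)
  then interpret M: left_module L M .
  have lr: "left_module K (restrict_scalars L M)" using lm by (rule left_module_restrict_scalars)
  obtain r where r: "spanned K L r (carrier L)" using L_fg by (auto simp: fg_module_iff)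
  have "\<exists>m. spanned K (restrict_scalars L M) m W" if "spanned L M n W" for n W
    using that
  proof (induct rule: spanned.induct)
    case spanned_0 show ?case using spanned.spanned_0[of K "restrict_scalars L M"] by auto
  next
    case (spanned_Suc n W v)
    then obtain m where m: "spanned K (restrict_scalars L M) m W" by auto
    have "spanned K (restrict_scalars L M) r ((\<lambda>a. a \<odot>\<^bsub>M\<^esub> v) ` carrier L)"
      by (rule spanned_image[OF r orbit_hom[OF lm spanned_Suc(3)] KL.left_module_axioms lr])
    from spanned_sum_sets[OF this m lr]
    have "spanned K (restrict_scalars L M) (m + r) (sum_sets (restrict_scalars L M) W ((\<lambda>a. a \<odot>\<^bsub>M\<^esub> v) ` carrier L))" .
    moreover have "sum_sets (restrict_scalars L M) W ((\<lambda>a. a \<odot>\<^bsub>M\<^esub> v) ` carrier L) = add_line L M W v"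
      by (auto simp: sum_sets_def add_line_def)
    ultimately show ?case by auto
  qed
  then show "fg_module K (restrict_scalars L M)" using fg lr by (auto simp: fg_module_iff)
next
  assume *: "left_module L M \<and> fg_module K (restrict_scalars L M)"
  then interpret M: left_module L M by simp
  have lr: "left_module K (restrict_scalars L M)" using * left_module_restrict_scalars by auto
  \<comment> \<open>Only an inclusion is carried along, since at intermediate stages the span over
    \<open>L\<close> may be larger.\<close>
  have "\<exists>W'. spanned L M n W' \<and> W \<subseteq> W'" if "spanned K (restrict_scalars L M) n W" for n W
    using that
  proof (induct rule: spanned.induct)
    case spanned_0 then show ?case using spanned.spanned_0[of L M] by auto
  next
    case (spanned_Suc n W v)
    then obtain W' where W': "spanned L M n W'" "W \<subseteq> W'" by auto
    have "spanned L M (Suc n) (add_line L M W' v)" using spanned.spanned_Suc[OF W'(1)] spanned_Suc(3) by simp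
    moreover have "add_line K (restrict_scalars L M) W v \<subseteq> add_line L M W' v"
      using W'(2) scalar_one_closed unfolding add_line_def restrict_scalars_simps by blast
    ultimately show ?case by blast
  qed
  moreover obtain n where "spanned K (restrict_scalars L M) n (carrier M)" using * by (auto simp: fg_module_iff)
  ultimately obtain W' where W': "spanned L M n W'" "carrier M \<subseteq> W'" by blast
  moreover have "W' \<subseteq> carrier M" using spanned_submodule[OF W'(1)] * by (auto simp: is_submodule_def)
  ultimately show "fg_module L M" using * fg_moduleI by (metis subset_antisym)
qed

lemma fg_submodule:
  assumes "fg_module L M" "is_submodule L M U" shows "fg_module L (submod M U)"
  using assms fg_subspace[OF K_field _ submodule_restrict_scalars]
  by (auto simp: fg_iff_fg_restrict_scalars restrict_scalars_submod left_module_submod)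

text \<open>A spanning chain of \<open>U\<close> inside \<open>M\<close> consists of elements of
  \<open>U\<close>, so the dimension of \<open>U\<close> as a module of its own is at most the one
  computed in \<open>M\<close>, where \<open>vdim_strict_mono\<close> applies.\<close>

lemma mdim_less:
  assumes "fg_module L M" "is_submodule L M U" "U \<noteq> carrier M"
  shows "mdim K L (submod M U) < mdim K L M"
proof -
  let ?V = "restrict_scalars L M"
  have V: "fg_module K ?V" "left_module K ?V" using assms(1) fg_iff_fg_restrict_scalars fg_left_module by auto
  obtain n where n: "spanned K ?V n (carrier M)" using V by (auto simp: fg_module_iff)
  have U: "is_submodule K ?V U" "U \<subseteq> carrier M"
    by (rule submodule_restrict_scalars[OF assms(2)]) (use assms(2) in \<open>simp add: is_submodule_def\<close>)
  have "spanned K ?V (vdim K ?V U) U" using spanned_vdim[OF K_field V(2) n U] .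
  then have "spanned K (submod ?V U) (vdim K ?V U) U" using spanned_submod[OF _ V(2) U(1)] by blast
  then have "mdim K L (submod M U) \<le> vdim K ?V U" unfolding mdim_def restrict_scalars_submod by (simp add: vdim_def Least_le)
  also have "\<dots> < mdim K L M" unfolding mdim_def using vdim_strict_mono[OF K_field V(2) n U assms(3)] .
  finally show ?thesis .
qed

lemma mdim_iso:
  assumes "fg_module L M" "mod_iso L M N" "left_module L N" shows "mdim K L N \<le> mdim K L M"
proof -
  obtain f where f: "f \<in> mod_hom L M N" "f ` carrier M = carrier N" using assms(2) by (auto simp: mod_iso_def bij_betw_def)
  have V: "fg_module K (restrict_scalars L M)" "left_module K (restrict_scalars L M)" "left_module K (restrict_scalars L N)"
    using assms(1,3) fg_iff_fg_restrict_scalars fg_left_module left_module_restrict_scalars by auto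
  then have "spanned K (restrict_scalars L M) (mdim K L M) (carrier M)"
    unfolding mdim_def vdim_def by (metis fg_module_iff LeastI restrict_scalars_simps(1))
  from spanned_image[OF this hom_restrict_scalars[OF f(1)] V(2,3)]
  show ?thesis unfolding mdim_def vdim_def using f(2) by (simp add: Least_le)
qed

text \<open>Coordinates with respect to \<open>dual_basis\<close> embed the carrier into the
  functions from \<open>nat\<close> to the field, and the module structure is transported along this
  injection. Definitions that quantify over \<open>umod\<close> thereby reach every finitely
  generated module.\<close>

lemma umod_exists:
  assumes "fg_module L M"
  shows "\<exists>U :: ('k, 'a) umod. fg_module L U \<and> mod_iso L M U"
proof -
  have lm: "left_module L M" and V: "fg_module K (restrict_scalars L M)" using assms fg_iff_fg_restrict_scalars by auto
  interpret M: left_module L M by fact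
  obtain n a l where *: "\<And>i. i < n \<Longrightarrow> a i \<in> carrier (restrict_scalars L M)"
    "\<And>i. i < n \<Longrightarrow> l i \<in> mod_hom K (restrict_scalars L M) (regular_module K)"
    "\<And>x. x \<in> carrier (restrict_scalars L M) \<Longrightarrow> x = (\<Oplus>\<^bsub>restrict_scalars L M\<^esub>i\<in>{..<n::nat}. l i x \<odot>\<^bsub>restrict_scalars L M\<^esub> a i)"
    by (rule dual_basis[OF K_field V]) blast
  \<comment> \<open>From index \<open>n\<close> on any fixed value would do, because the first
    \<open>n\<close> coordinates determine the element.\<close>
  define c where "c x = (\<lambda>i. if i < n then l i x else undefined)" for x
  have inj: "inj_on c (carrier M)"
  proof (rule inj_onI)
    fix x y assume x: "x \<in> carrier M" and y: "y \<in> carrier M" and e: "c x = c y"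
    have l: "l i x = l i y" if "i < n" for i using fun_cong[OF e, of i] that by (simp add: c_def)
    interpret V: left_module K "restrict_scalars L M" using V by (rule fg_left_module)
    have "(\<Oplus>\<^bsub>restrict_scalars L M\<^esub>i\<in>{..<n}. l i x \<odot>\<^bsub>restrict_scalars L M\<^esub> a i) = (\<Oplus>\<^bsub>restrict_scalars L M\<^esub>i\<in>{..<n}. l i y \<odot>\<^bsub>restrict_scalars L M\<^esub> a i)"
    proof (rule V.M.finsum_cong'[OF refl])
      show "(\<lambda>i. l i y \<odot>\<^bsub>restrict_scalars L M\<^esub> a i) \<in> {..<n} \<rightarrow> carrier (restrict_scalars L M)"
        by (intro Pi_I V.smult_closed) (use *(1) hom_closed[OF *(2)] y in auto)
    qed (use l in auto)
    then show "x = y" using *(3) x y by (metis restrict_scalars_simps(1))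
  qed
  define r where "r = inv_into (carrier M) c"
  have r: "r (c x) = x" if "x \<in> carrier M" for x using inj that by (simp add: r_def)
  define U :: "('k, 'a) umod" where "U = \<lparr>carrier = c ` carrier M, mult = undefined, one = undefined, zero = c \<zero>\<^bsub>M\<^esub>,
     add = (\<lambda>u v. c (r u \<oplus>\<^bsub>M\<^esub> r v)), smult = (\<lambda>b u. c (b \<odot>\<^bsub>M\<^esub> r u))\<rparr>"
  have h: "c \<in> mod_hom L M U" by (rule mod_homI) (auto simp: U_def r)
  have b: "bij_betw c (carrier M) (carrier U)" using inj by (simp add: bij_betw_def U_def)
  have "left_module L U" by (rule left_module_iso[OF lm h b]) (simp add: U_def)
  moreover have "mod_iso L M U" using h b by (rule mod_isoI)
  ultimately show ?thesis using fg_module_iso[OF assms] by blast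
qed

text \<open>From left to right the maps are components of the given isomorphism. Conversely the
  \<open>q i\<close> and \<open>p i\<close> assemble to a section and a retraction between
  \<open>X\<close> and a power of \<open>M\<close>; the kernel of the retraction, replaced by a copy
  of the prescribed type, is the complement.\<close>

lemma in_add_iff:
  assumes "fg_module L M"
  shows "in_add L M X \<longleftrightarrow> fg_module L X \<and> (\<exists>n. factors_through L X n (\<lambda>_. M))"
proof
  assume "in_add L M X"
  then obtain n Y where X: "fg_module L X" and Y: "fg_module L (Y :: ('k, 'a) umod)" "mod_iso L (dsum2 X Y) (dsum {..<n :: nat} (\<lambda>_. M))"
    unfolding in_add_def by blast
  have lm: "left_module L X" "left_module L Y" "left_module L M" using X Y assms fg_left_module by auto
  have lXY: "left_module L (dsum2 X Y)" using lm by (simp add: left_module_dsum2)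
  obtain u v where uv: "\<And>i. i < n \<Longrightarrow> u i \<in> mod_hom L M (dsum2 X Y)" "\<And>i. i < n \<Longrightarrow> v i \<in> mod_hom L (dsum2 X Y) M"
    "\<And>w. w \<in> carrier (dsum2 X Y) \<Longrightarrow> w = (\<Oplus>\<^bsub>dsum2 X Y\<^esub>i\<in>{..<n}. u i (v i w))"
    by (rule mod_iso_dsum_factors[OF Y(2) lXY lm(3)]) blast
  have "factors_through L X n (\<lambda>_. M)" unfolding factors_through_def
  proof (intro exI[of _ "\<lambda>i x. v i (x, \<zero>\<^bsub>Y\<^esub>)"] exI[of _ "\<lambda>i m. fst (u i m)"] conjI allI impI ballI)
    fix i assume i: "i < n"
    show "(\<lambda>x. v i (x, \<zero>\<^bsub>Y\<^esub>)) \<in> mod_hom L X M" by (rule hom_comp[OF hom_inl[OF lm(2)] uv(2)[OF i]])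
    show "(\<lambda>m. fst (u i m)) \<in> mod_hom L M X" by (rule hom_comp[OF uv(1)[OF i] hom_fst])
  next
    fix x assume x: "x \<in> carrier X"
    then have xc: "(x, \<zero>\<^bsub>Y\<^esub>) \<in> carrier (dsum2 X Y)" using submodule_carrier[OF lm(2)] by (auto simp: is_submodule_def)
    have "(\<lambda>i. u i (v i (x, \<zero>\<^bsub>Y\<^esub>))) \<in> {..<n} \<rightarrow> carrier (dsum2 X Y)"
      using hom_closed[OF uv(1)] hom_closed[OF uv(2)] xc by blast
    then have "fst (\<Oplus>\<^bsub>dsum2 X Y\<^esub>i\<in>{..<n}. u i (v i (x, \<zero>\<^bsub>Y\<^esub>))) = (\<Oplus>\<^bsub>X\<^esub>i\<in>{..<n}. fst (u i (v i (x, \<zero>\<^bsub>Y\<^esub>))))"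
      by (intro hom_finsum[OF hom_fst lXY lm(1)]) auto
    then show "x = (\<Oplus>\<^bsub>X\<^esub>i\<in>{..<n}. fst (u i (v i (x, \<zero>\<^bsub>Y\<^esub>))))" using uv(3)[OF xc] by simp
  qed
  then show "fg_module L X \<and> (\<exists>n. factors_through L X n (\<lambda>_. M))" using X by blast
next
  assume *: "fg_module L X \<and> (\<exists>n. factors_through L X n (\<lambda>_. M))"
  then obtain n where X: "fg_module L X" and f: "factors_through L X n (\<lambda>_. M)" by blast
  obtain q p where qp: "\<And>i. i < n \<Longrightarrow> q i \<in> mod_hom L X M" "\<And>i. i < n \<Longrightarrow> p i \<in> mod_hom L M X"
     "\<And>x. x \<in> carrier X \<Longrightarrow> x = (\<Oplus>\<^bsub>X\<^esub>i\<in>{..<n}. p i (q i x))"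
    by (rule factors_throughE[OF f]) blast
  have lm: "left_module L X" "left_module L M" using X assms fg_left_module by auto
  interpret X: left_module L X by fact
  let ?D = "dsum {..<n} (\<lambda>_. M)"
  have fD: "fg_module L ?D" by (rule fg_dsum[OF L_ring assms])
  have lD: "left_module L ?D" using fD by (rule fg_left_module)
  have i: "(\<lambda>x. \<lambda>i\<in>{..<n}. q i x) \<in> mod_hom L X ?D" by (rule hom_dsum_tuple) (use qp in auto)
  have pp: "(\<lambda>m. \<Oplus>\<^bsub>X\<^esub>i\<in>{..<n}. p i (m i)) \<in> mod_hom L ?D X"
    by (rule hom_sum[OF _ _ lm(1)], simp, rule hom_comp[OF hom_dsum_proj], assumption, rule qp(2), simp)
  have id: "(\<Oplus>\<^bsub>X\<^esub>i\<in>{..<n}. p i ((\<lambda>i\<in>{..<n}. q i x) i)) = x" if x: "x \<in> carrier X" for x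
  proof -
    have "(\<Oplus>\<^bsub>X\<^esub>i\<in>{..<n}. p i ((\<lambda>i\<in>{..<n}. q i x) i)) = (\<Oplus>\<^bsub>X\<^esub>i\<in>{..<n}. p i (q i x))"
      using x by (intro X.M.finsum_cong') (auto intro!: hom_closed[OF qp(2)] hom_closed[OF qp(1)])
    then show ?thesis using qp(3)[OF x] by simp
  qed
  let ?Z = "submod ?D {m \<in> carrier ?D. (\<Oplus>\<^bsub>X\<^esub>i\<in>{..<n}. p i (m i)) = \<zero>\<^bsub>X\<^esub>}"
  have iso: "mod_iso L (dsum2 X ?Z) ?D" by (rule retract_complement[OF lm(1) lD i pp]) (rule id)
  have fZ: "fg_module L ?Z" by (rule fg_submodule[OF fD submodule_ker[OF lD lm(1) pp]])
  obtain Y :: "('k, 'a) umod" where Y: "fg_module L Y" "mod_iso L ?Z Y" using umod_exists[OF fZ] by blast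
  have "mod_iso L (dsum2 X Y) (dsum2 X ?Z)"
    by (rule mod_iso_dsum2[OF mod_iso_refl mod_iso_sym[OF Y(2) fg_left_module[OF fZ]] lm(1) fg_left_module[OF Y(1)]])
  then have "mod_iso L (dsum2 X Y) ?D" using iso by (rule mod_iso_trans)
  then show "in_add L M X" unfolding in_add_def using X Y by blast
qed

end

section \<open>Local endomorphism rings\<close>

lemma hom_injI:
  assumes "f \<in> mod_hom R M N" "left_module R M" "left_module R N"
    "\<And>x. x \<in> carrier M \<Longrightarrow> f x = \<zero>\<^bsub>N\<^esub> \<Longrightarrow> x = \<zero>\<^bsub>M\<^esub>"
  shows "inj_on f (carrier M)"
proof (rule inj_onI)
  interpret M: left_module R M by fact
  interpret N: left_module R N by fact
  fix x y assume *: "x \<in> carrier M" "y \<in> carrier M" "f x = f y"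
  then have "f (x \<ominus>\<^bsub>M\<^esub> y) = \<zero>\<^bsub>N\<^esub>" using hom_closed[OF assms(1)] by (simp add: hom_minus[OF assms(1-3)] N.minus_self)
  then have "x \<ominus>\<^bsub>M\<^esub> y = \<zero>\<^bsub>M\<^esub>" using * assms(4) by simp
  then show "x = y" using * M.minus_eq_iff[of x y "\<zero>\<^bsub>M\<^esub>"] by simp
qed

lemma retractI:
  "i \<in> mod_hom R X M \<Longrightarrow> p \<in> mod_hom R M X \<Longrightarrow> (\<And>x. x \<in> carrier X \<Longrightarrow> p (i x) = x) \<Longrightarrow> retract R X M"
  unfolding retract_def by blast

lemma retract_trans: "retract R X Y \<Longrightarrow> retract R Y Z \<Longrightarrow> retract R X Z"
proof -
  assume "retract R X Y" "retract R Y Z"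
  then obtain i p j q where *: "i \<in> mod_hom R X Y" "p \<in> mod_hom R Y X" "\<And>x. x \<in> carrier X \<Longrightarrow> p (i x) = x"
    "j \<in> mod_hom R Y Z" "q \<in> mod_hom R Z Y" "\<And>x. x \<in> carrier Y \<Longrightarrow> q (j x) = x"
    unfolding retract_def by blast
  show ?thesis
    by (rule retractI[OF hom_comp[OF *(1,4)] hom_comp[OF *(5,2)]]) (simp add: *(3,6) hom_closed[OF *(1)])
qed

lemma mod_iso_retract: "mod_iso R X Y \<Longrightarrow> left_module R X \<Longrightarrow> retract R X Y"
  by (erule mod_iso_inverse, assumption) (rule retractI)

lemma retract_dsum2:
  assumes "left_module R B" "left_module R C"
  shows "retract R B (dsum2 B C)" "retract R C (dsum2 B C)"
  by (rule retractI[OF hom_inl[OF assms(2)] hom_fst], simp)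
    (rule retractI[OF hom_inr[OF assms(1)] hom_snd], simp)

lemma factors_through_retract:
  assumes "retract R X W" "factors_through R W n M" "left_module R X" "left_module R W"
    "\<And>i. i < n \<Longrightarrow> left_module R (M i)"
  shows "factors_through R X n M"
proof -
  obtain i p where ip: "i \<in> mod_hom R X W" "p \<in> mod_hom R W X" "\<And>x. x \<in> carrier X \<Longrightarrow> p (i x) = x"
    using assms(1) unfolding retract_def by blast
  obtain u v where uv: "\<And>i. i < n \<Longrightarrow> u i \<in> mod_hom R W (M i)" "\<And>i. i < n \<Longrightarrow> v i \<in> mod_hom R (M i) W"
    "\<And>x. x \<in> carrier W \<Longrightarrow> x = (\<Oplus>\<^bsub>W\<^esub>i\<in>{..<n}. v i (u i x))"
    by (rule factors_throughE[OF assms(2)]) blast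
  show ?thesis unfolding factors_through_def
  proof (intro exI[of _ "\<lambda>j x. u j (i x)"] exI[of _ "\<lambda>j m. p (v j m)"] conjI allI impI ballI)
    fix j assume "j < n"
    then show "(\<lambda>x. u j (i x)) \<in> mod_hom R X (M j)" "(\<lambda>m. p (v j m)) \<in> mod_hom R (M j) X"
      using hom_comp[OF ip(1) uv(1)] hom_comp[OF uv(2) ip(2)] by auto
  next
    fix x assume x: "x \<in> carrier X"
    have c: "(\<lambda>j. v j (u j (i x))) \<in> {..<n} \<rightarrow> carrier W"
      using hom_closed[OF uv(2)] hom_closed[OF uv(1)] hom_closed[OF ip(1) x] by blast
    have "x = p (\<Oplus>\<^bsub>W\<^esub>j\<in>{..<n}. v j (u j (i x)))" using ip(3)[OF x] uv(3)[OF hom_closed[OF ip(1) x]] by simp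
    also have "\<dots> = (\<Oplus>\<^bsub>X\<^esub>j\<in>{..<n}. p (v j (u j (i x))))"
      by (rule hom_finsum[OF ip(2) assms(4,3) _ c]) simp
    finally show "x = (\<Oplus>\<^bsub>X\<^esub>j\<in>{..<n}. p (v j (u j (i x))))" .
  qed
qed

lemma factors_through_dsum:
  assumes "mod_iso R W (dsum {..<n::nat} X)" "left_module R W" "\<And>i. i < n \<Longrightarrow> left_module R (X i)"
  shows "factors_through R W n X"
proof -
  obtain u v where "\<And>i. i < n \<Longrightarrow> u i \<in> mod_hom R (X i) W" "\<And>i. i < n \<Longrightarrow> v i \<in> mod_hom R W (X i)"
    "\<And>w. w \<in> carrier W \<Longrightarrow> w = (\<Oplus>\<^bsub>W\<^esub>i\<in>{..<n}. u i (v i w))"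
    by (rule mod_iso_dsum_factors[OF assms]; blast)
  then show ?thesis unfolding factors_through_def by (intro exI[of _ v] exI[of _ u] conjI) auto
qed

lemma factors_through_dsum2:
  assumes "mod_iso R W (dsum2 B C)" "left_module R W" "left_module R B" "left_module R C"
  shows "factors_through R W 2 (\<lambda>i. if i = 0 then B else C)"
proof -
  interpret W: left_module R W by fact
  obtain iB pB iC pC where *: "iB \<in> mod_hom R B W" "pB \<in> mod_hom R W B" "iC \<in> mod_hom R C W" "pC \<in> mod_hom R W C"
    "\<And>w. w \<in> carrier W \<Longrightarrow> iB (pB w) \<oplus>\<^bsub>W\<^esub> iC (pC w) = w" using mod_iso_dsum2E[OF assms] by metis
  have c: "iB (pB x) \<in> carrier W" "iC (pC x) \<in> carrier W" if "x \<in> carrier W" for x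
    using hom_closed[OF hom_comp[OF *(2,1)]] hom_closed[OF hom_comp[OF *(4,3)]] that by auto
  have e: "{..<2::nat} = {0, 1}" by auto
  show ?thesis unfolding factors_through_def
    by (intro exI[of _ "\<lambda>i. if i = 0 then pB else pC"] exI[of _ "\<lambda>i. if i = 0 then iB else iC"])
      (use * c in \<open>auto simp: e\<close>)
qed

lemma finsum_lessThan_add:
  assumes "abelian_monoid G" "\<And>i. i < n + m \<Longrightarrow> f i \<in> carrier G"
  shows "(\<Oplus>\<^bsub>G\<^esub>i\<in>{..<n + m::nat}. f i) = (\<Oplus>\<^bsub>G\<^esub>i\<in>{..<n}. f i) \<oplus>\<^bsub>G\<^esub> (\<Oplus>\<^bsub>G\<^esub>i\<in>{..<m}. f (n + i))"
proof -
  interpret G: abelian_monoid G by fact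
  show ?thesis using assms(2)
  proof (induct m)
    case 0 then show ?case by (auto intro: G.finsum_closed)
  next
    case (Suc m)
    have "(\<Oplus>\<^bsub>G\<^esub>i\<in>{..<n + Suc m}. f i) = f (n + m) \<oplus>\<^bsub>G\<^esub> (\<Oplus>\<^bsub>G\<^esub>i\<in>{..<n + m}. f i)"
      using Suc(2) by (simp add: lessThan_Suc Pi_def)
    moreover have "(\<Oplus>\<^bsub>G\<^esub>i\<in>{..<Suc m}. f (n + i)) = f (n + m) \<oplus>\<^bsub>G\<^esub> (\<Oplus>\<^bsub>G\<^esub>i\<in>{..<m}. f (n + i))"
      using Suc(2) by (simp add: lessThan_Suc Pi_def)
    moreover have "(\<Oplus>\<^bsub>G\<^esub>i\<in>{..<n}. f i) \<in> carrier G" "(\<Oplus>\<^bsub>G\<^esub>i\<in>{..<m}. f (n + i)) \<in> carrier G"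
      using Suc(2) by (auto intro!: G.finsum_closed)
    ultimately show ?case using Suc by (simp add: G.a_ac)
  qed
qed

lemma factors_through_sum:
  assumes "mod_iso R W (dsum2 B C)" "left_module R W" "left_module R B" "left_module R C" "left_module R M"
    "factors_through R B n (\<lambda>_. M)" "factors_through R C m (\<lambda>_. M)"
  shows "factors_through R W (n + m) (\<lambda>_. M)"
proof -
  interpret W: left_module R W by fact
  obtain iB pB iC pC where *: "iB \<in> mod_hom R B W" "pB \<in> mod_hom R W B" "iC \<in> mod_hom R C W" "pC \<in> mod_hom R W C"
    "\<And>w. w \<in> carrier W \<Longrightarrow> iB (pB w) \<oplus>\<^bsub>W\<^esub> iC (pC w) = w" using mod_iso_dsum2E[OF assms(1-4)] by metis
  obtain q p where qp: "\<And>i. i < n \<Longrightarrow> q i \<in> mod_hom R B M" "\<And>i. i < n \<Longrightarrow> p i \<in> mod_hom R M B"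
    "\<And>x. x \<in> carrier B \<Longrightarrow> x = (\<Oplus>\<^bsub>B\<^esub>i\<in>{..<n}. p i (q i x))"
    by (rule factors_throughE[OF assms(6)]) blast
  obtain q' p' where qp': "\<And>i. i < m \<Longrightarrow> q' i \<in> mod_hom R C M" "\<And>i. i < m \<Longrightarrow> p' i \<in> mod_hom R M C"
    "\<And>x. x \<in> carrier C \<Longrightarrow> x = (\<Oplus>\<^bsub>C\<^esub>i\<in>{..<m}. p' i (q' i x))"
    by (rule factors_throughE[OF assms(7)]) blast
  \<comment> \<open>The two families are concatenated: indices below \<open>n\<close> belong to
    \<open>B\<close>, the others, shifted by \<open>n\<close>, to \<open>C\<close>.\<close>
  define s where "s i = (if i < n then (\<lambda>x. q i (pB x)) else (\<lambda>x. q' (i - n) (pC x)))" for i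
  define t where "t i = (if i < n then (\<lambda>x. iB (p i x)) else (\<lambda>x. iC (p' (i - n) x)))" for i
  have s: "s i \<in> mod_hom R W M" "t i \<in> mod_hom R M W" if "i < n + m" for i
    using that hom_comp[OF *(2) qp(1)] hom_comp[OF *(4) qp'(1)] hom_comp[OF qp(2) *(1)] hom_comp[OF qp'(2) *(3)]
    by (auto simp: s_def t_def)
  show ?thesis unfolding factors_through_def
  proof (intro exI[of _ s] exI[of _ t] conjI allI impI ballI)
    fix x assume x: "x \<in> carrier W"
    have c1: "(\<lambda>i. p i (q i (pB x))) \<in> {..<n} \<rightarrow> carrier B"
      using hom_closed[OF qp(1)] hom_closed[OF qp(2)] hom_closed[OF *(2) x] by blast
    have c2: "(\<lambda>i. p' i (q' i (pC x))) \<in> {..<m} \<rightarrow> carrier C"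
      using hom_closed[OF qp'(1)] hom_closed[OF qp'(2)] hom_closed[OF *(4) x] by blast
    have tsc: "t i (s i x) \<in> carrier W" if "i < n + m" for i
      by (rule hom_closed[OF s(2)[OF that] hom_closed[OF s(1)[OF that] x]])
    have tsc1: "iB (p i (q i (pB x))) = t i (s i x)" if "i < n" for i using that by (simp add: s_def t_def)
    have tsc2: "iC (p' i (q' i (pC x))) = t (n + i) (s (n + i) x)" if "i < m" for i using that by (simp add: s_def t_def)
    have "iB (pB x) = iB (\<Oplus>\<^bsub>B\<^esub>i\<in>{..<n}. p i (q i (pB x)))" using qp(3)[OF hom_closed[OF *(2) x]] by simp
    also have "\<dots> = (\<Oplus>\<^bsub>W\<^esub>i\<in>{..<n}. iB (p i (q i (pB x))))"
      by (rule hom_finsum[OF *(1) assms(3,2) _ c1]) simp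
    also have "\<dots> = (\<Oplus>\<^bsub>W\<^esub>i\<in>{..<n}. t i (s i x))"
      by (rule W.M.finsum_cong'[OF refl]) (use tsc in \<open>auto simp: tsc1 tsc2\<close>)
    finally have 1: "iB (pB x) = (\<Oplus>\<^bsub>W\<^esub>i\<in>{..<n}. t i (s i x))" .
    have "iC (pC x) = iC (\<Oplus>\<^bsub>C\<^esub>i\<in>{..<m}. p' i (q' i (pC x)))" using qp'(3)[OF hom_closed[OF *(4) x]] by simp
    also have "\<dots> = (\<Oplus>\<^bsub>W\<^esub>i\<in>{..<m}. iC (p' i (q' i (pC x))))"
      by (rule hom_finsum[OF *(3) assms(4,2) _ c2]) simp
    also have "\<dots> = (\<Oplus>\<^bsub>W\<^esub>i\<in>{..<m}. t (n + i) (s (n + i) x))"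
      by (rule W.M.finsum_cong'[OF refl]) (use tsc in \<open>auto simp: tsc1 tsc2\<close>)
    finally have 2: "iC (pC x) = (\<Oplus>\<^bsub>W\<^esub>i\<in>{..<m}. t (n + i) (s (n + i) x))" .
    have "(\<Oplus>\<^bsub>W\<^esub>i\<in>{..<n + m}. t i (s i x)) = iB (pB x) \<oplus>\<^bsub>W\<^esub> iC (pC x)"
      unfolding 1 2 by (rule finsum_lessThan_add[OF W.M.abelian_monoid_axioms]) (rule hom_closed[OF s(2) hom_closed[OF s(1) x]])
    then show "x = (\<Oplus>\<^bsub>W\<^esub>i\<in>{..<n + m}. t i (s i x))" using *(5)[OF x] by simp
  qed (use s in auto)
qed

lemma factors_through_comp_retract:
  assumes "factors_through R X n (\<lambda>_. M)" "retract R M M'" "left_module R X"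
  shows "factors_through R X n (\<lambda>_. M')"
proof -
  interpret X: left_module R X by fact
  obtain i r where ir: "i \<in> mod_hom R M M'" "r \<in> mod_hom R M' M" "\<And>x. x \<in> carrier M \<Longrightarrow> r (i x) = x"
    using assms(2) unfolding retract_def by blast
  obtain q p where qp: "\<And>i. i < n \<Longrightarrow> q i \<in> mod_hom R X M" "\<And>i. i < n \<Longrightarrow> p i \<in> mod_hom R M X"
    "\<And>x. x \<in> carrier X \<Longrightarrow> x = (\<Oplus>\<^bsub>X\<^esub>i\<in>{..<n}. p i (q i x))"
    by (rule factors_throughE[OF assms(1)]) blast
  show ?thesis unfolding factors_through_def
  proof (intro exI[of _ "\<lambda>j x. i (q j x)"] exI[of _ "\<lambda>j m. p j (r m)"] conjI allI impI ballI)
    fix x assume x: "x \<in> carrier X"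
    have "(\<Oplus>\<^bsub>X\<^esub>j\<in>{..<n}. p j (r (i (q j x)))) = (\<Oplus>\<^bsub>X\<^esub>j\<in>{..<n}. p j (q j x))"
      by (rule X.M.finsum_cong')
        (use ir(3) hom_closed[OF qp(1) x] in \<open>auto intro: hom_closed[OF qp(2)]\<close>)
    then show "x = (\<Oplus>\<^bsub>X\<^esub>j\<in>{..<n}. p j (r (i (q j x))))" using qp(3)[OF x] by simp
  qed (use hom_comp[OF qp(1) ir(1)] hom_comp[OF ir(2) qp(2)] in auto)
qed

section \<open>Fitting's lemma and its consequences\<close>

context fd_algebra
begin

lemma indecomposable_dsum2D:
  fixes A B :: "('k, 'a) umod"
  assumes "indecomposable L M" "fg_module L A" "fg_module L B" "mod_iso L M (dsum2 A B)"
  shows "carrier A = {\<zero>\<^bsub>A\<^esub>} \<or> carrier B = {\<zero>\<^bsub>B\<^esub>}"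
  using assms unfolding indecomposable_def by blast

text \<open>For some positive \<open>k\<close> the \<open>k\<close>-th power and the
  \<open>2k\<close>-th power of \<open>f\<close> have the same image and the same kernel. Then
  \<open>X\<close> is the direct sum of this kernel and this image, and one of them is zero by
  indecomposability.\<close>

lemma fitting:
  fixes X :: "('k, 'a) umod"
  assumes "indecomposable L X" "f \<in> mod_hom L X X"
  shows "bij_betw f (carrier X) (carrier X) \<or> (\<exists>n. \<forall>x\<in>carrier X. (f ^^ n) x = \<zero>\<^bsub>X\<^esub>)"
proof -
  have fg: "fg_module L X" using assms(1) by (simp add: indecomposable_def)
  then have lm: "left_module L X" by (rule fg_left_module)
  interpret X: left_module L X by fact
  let ?V = "restrict_scalars L X"
  have V: "fg_module K ?V" "left_module K ?V" using fg fg_iff_fg_restrict_scalars fg_left_module by auto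
  obtain N where N: "spanned K ?V N (carrier X)" using V by (auto simp: fg_module_iff)
  define im where "im k = (f ^^ k) ` carrier X" for k
  define ker where "ker k = {x \<in> carrier X. (f ^^ k) x = \<zero>\<^bsub>X\<^esub>}" for k
  note hp = hom_funpow[OF assms(2)]
  have s: "is_submodule L X (im k)" "is_submodule L X (ker k)" for k
    unfolding im_def ker_def using submodule_image[OF lm lm hp submodule_carrier[OF lm]] submodule_ker[OF lm lm hp] by auto
  have sub: "im k \<subseteq> carrier X" "ker k \<subseteq> carrier X" for k using s by (auto simp: is_submodule_def)
  note sK = submodule_restrict_scalars[OF s(1)] submodule_restrict_scalars[OF s(2)]
  let ?d = "vdim K ?V"
  have sp: "spanned K ?V (?d (im k)) (im k)" "spanned K ?V (?d (ker k)) (ker k)" for k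
    using spanned_vdim[OF K_field V(2) N] sK sub by auto
  \<comment> \<open>Dimension of the image plus codimension of the kernel. Both terms can only
    decrease from \<open>k\<close> to \<open>k + k\<close>, so at a minimum of the sum neither of
    them changes.\<close>
  define m where "m k = ?d (im k) + (?d (carrier X) - ?d (ker k))" for k
  \<comment> \<open>The bound excludes the identity, the power zero, from which nothing could be
    concluded about \<open>f\<close>.\<close>
  obtain k where k: "1 \<le> k" "\<And>j. 1 \<le> j \<Longrightarrow> m k \<le> m j"
    using ex_has_least_nat[of "\<lambda>k. 1 \<le> k" 1 m] by auto
  have le: "m k \<le> m (k + k)" using k(2)[of "k + k"] k(1) by auto
  have fkk: "(f ^^ (k + k)) x = (f ^^ k) ((f ^^ k) x)" for x by (simp add: funpow_add)
  have gc: "(f ^^ k) x \<in> carrier X" if "x \<in> carrier X" for x using hom_closed[OF hp that] .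
  have g0: "(f ^^ k) \<zero>\<^bsub>X\<^esub> = \<zero>\<^bsub>X\<^esub>" using hom_zero[OF hp lm lm] .
  have imsub: "im (k + k) \<subseteq> im k" using gc fkk by (auto simp: im_def)
  have kersub: "ker k \<subseteq> ker (k + k)" using fkk g0 by (auto simp: ker_def)
  have d1: "?d (im (k + k)) \<le> ?d (im k)" using vdim_mono[OF K_field V(2) sp(1) sK(1) imsub] .
  have d2: "?d (ker k) \<le> ?d (ker (k + k))" using vdim_mono[OF K_field V(2) sp(2) sK(2) kersub] .
  have d3: "?d (ker (k + k)) \<le> ?d (carrier X)" using vdim_mono[OF K_field V(2) N sK(2) sub(2)] .
  have im_eq: "im (k + k) = im k"
  proof (rule ccontr)
    assume "im (k + k) \<noteq> im k"
    from vdim_strict_mono[OF K_field V(2) sp(1) sK(1) imsub this] show False using le d2 d3 by (simp add: m_def)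
  qed
  have ker_eq: "ker (k + k) = ker k"
  proof (rule ccontr)
    assume "ker (k + k) \<noteq> ker k"
    then have "?d (ker k) < ?d (ker (k + k))" using vdim_strict_mono[OF K_field V(2) sp(2) sK(2) kersub] by auto
    then show False using le d1 d3 by (simp add: m_def)
  qed
  let ?A = "submod X (ker k)" and ?B = "submod X (im k)"
  have lAB: "left_module L ?A" "left_module L ?B" using left_module_submod[OF lm] s by auto
  have fAB: "fg_module L ?A" "fg_module L ?B" using fg_submodule[OF fg] s by auto
  define h where "h z = fst z \<oplus>\<^bsub>X\<^esub> snd z" for z
  have h: "h \<in> mod_hom L (dsum2 ?A ?B) X"
    unfolding h_def
    by (rule hom_plus[OF hom_comp[OF hom_fst hom_inclusion[OF sub(2)]] hom_comp[OF hom_snd hom_inclusion[OF sub(1)]] lm])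
  have lD: "left_module L (dsum2 ?A ?B)" using left_module_dsum2 lAB by blast
  have inj: "inj_on h (carrier (dsum2 ?A ?B))"
  proof (rule hom_injI[OF h lD lm])
    fix z assume z: "z \<in> carrier (dsum2 ?A ?B)" "h z = \<zero>\<^bsub>X\<^esub>"
    obtain x y where xy: "z = (x, y)" "x \<in> ker k" "y \<in> im k" using z by auto
    have c: "x \<in> carrier X" "y \<in> carrier X" using xy sub by auto
    obtain u where u: "u \<in> carrier X" "y = (f ^^ k) u" using xy(3) by (auto simp: im_def)
    have "(f ^^ k) x \<oplus>\<^bsub>X\<^esub> (f ^^ k) y = \<zero>\<^bsub>X\<^esub>" using z xy c g0 by (simp add: h_def hom_add[OF hp, symmetric])
    then have "(f ^^ k) y = \<zero>\<^bsub>X\<^esub>" using xy(2) gc c by (simp add: ker_def)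
    then have "u \<in> ker (k + k)" using u fkk by (simp add: ker_def)
    then have "u \<in> ker k" using ker_eq by simp
    then have "y = \<zero>\<^bsub>X\<^esub>" using u by (simp add: ker_def)
    then show "z = \<zero>\<^bsub>dsum2 ?A ?B\<^esub>" using z xy c by (simp add: h_def)
  qed
  have surj: "\<exists>x\<in>ker k. \<exists>y\<in>im k. z = x \<oplus>\<^bsub>X\<^esub> y" if z: "z \<in> carrier X" for z
  proof -
    \<comment> \<open>Stability of the image writes \<open>(f ^^ k) z\<close> as
      \<open>(f ^^ k) ((f ^^ k) u)\<close>, so \<open>z\<close> and \<open>(f ^^ k) u\<close> differ
      by an element of the kernel.\<close>
    have "(f ^^ k) z \<in> im (k + k)" using z im_eq by (auto simp: im_def)
    then obtain u where u: "u \<in> carrier X" "(f ^^ k) z = (f ^^ k) ((f ^^ k) u)" using fkk by (auto simp: im_def)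
    have "z \<ominus>\<^bsub>X\<^esub> (f ^^ k) u \<in> ker k" using u z gc by (simp add: ker_def hom_minus[OF hp lm lm] X.minus_self)
    moreover have "(f ^^ k) u \<in> im k" using u by (simp add: im_def)
    moreover have "z = (z \<ominus>\<^bsub>X\<^esub> (f ^^ k) u) \<oplus>\<^bsub>X\<^esub> (f ^^ k) u" using X.diff_add z u gc by simp
    ultimately show ?thesis by blast
  qed
  have "h ` carrier (dsum2 ?A ?B) = carrier X"
  proof
    show "h ` carrier (dsum2 ?A ?B) \<subseteq> carrier X" using hom_closed[OF h] by auto
    show "carrier X \<subseteq> h ` carrier (dsum2 ?A ?B)"
    proof
      fix z assume "z \<in> carrier X"
      then obtain x y where "x \<in> ker k" "y \<in> im k" "z = x \<oplus>\<^bsub>X\<^esub> y" using surj by blast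
      then show "z \<in> h ` carrier (dsum2 ?A ?B)" by (intro image_eqI[of _ _ "(x, y)"]) (auto simp: h_def)
    qed
  qed
  then have "mod_iso L (dsum2 ?A ?B) X" using mod_isoI[OF h] inj by (simp add: bij_betw_def)
  then have "mod_iso L X (dsum2 ?A ?B)" using mod_iso_sym lD by blast
  then have "ker k = {\<zero>\<^bsub>X\<^esub>} \<or> im k = {\<zero>\<^bsub>X\<^esub>}"
    using indecomposable_dsum2D[OF assms(1) fAB] by simp
  then show ?thesis
  proof
    assume "im k = {\<zero>\<^bsub>X\<^esub>}"
    then show ?thesis unfolding im_def by blast
  next
    assume k0: "ker k = {\<zero>\<^bsub>X\<^esub>}"
    obtain j where j: "k = Suc j" using k(1) by (cases k) auto
    have "inj_on f (carrier X)"
    proof (rule hom_injI[OF assms(2) lm lm])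
      fix x assume x: "x \<in> carrier X" "f x = \<zero>\<^bsub>X\<^esub>"
      have "(f ^^ k) x = (f ^^ j) (f x)" unfolding j by (simp only: funpow_Suc_right comp_def)
      then have "x \<in> ker k" using x hom_zero[OF hp lm lm] by (simp add: ker_def)
      then show "x = \<zero>\<^bsub>X\<^esub>" using k0 by simp
    qed
    moreover have "carrier X \<subseteq> f ` carrier X"
    proof
      fix z assume "z \<in> carrier X"
      from surj[OF this] obtain x y where "x \<in> ker k" "y \<in> im k" "z = x \<oplus>\<^bsub>X\<^esub> y" by blast
      then have "y \<in> im k" "z = \<zero>\<^bsub>X\<^esub> \<oplus>\<^bsub>X\<^esub> y" using k0 by auto
      then have "z \<in> im k" using subsetD[OF sub(1)] by simp
      then obtain u where "u \<in> carrier X" "z = f ((f ^^ j) u)" by (auto simp: im_def j)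
      then show "z \<in> f ` carrier X" using hom_closed[OF hp] by blast
    qed
    moreover have "f ` carrier X \<subseteq> carrier X" using hom_closed[OF assms(2)] by auto
    ultimately show ?thesis by (auto simp: bij_betw_def)
  qed
qed

text \<open>Otherwise both maps are nilpotent by \<open>fitting\<close>. On the kernel of
  \<open>g\<close> the map \<open>f\<close> is the identity, so nilpotency of \<open>f\<close> makes
  \<open>g\<close> injective, and an injective nilpotent map exists only on the zero module.\<close>

lemma local_sum_id:
  fixes X :: "('k, 'a) umod"
  assumes "indecomposable L X" "f \<in> mod_hom L X X" "g \<in> mod_hom L X X"
    "\<And>x. x \<in> carrier X \<Longrightarrow> f x \<oplus>\<^bsub>X\<^esub> g x = x"
  shows "bij_betw f (carrier X) (carrier X) \<or> bij_betw g (carrier X) (carrier X)"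
proof -
  have lm: "left_module L X" using assms(1) fg_left_module by (auto simp: indecomposable_def)
  interpret X: left_module L X by fact
  have nz: "carrier X \<noteq> {\<zero>\<^bsub>X\<^esub>}" using assms(1) by (simp add: indecomposable_def)
  show ?thesis
  proof (rule ccontr)
    assume "\<not> ?thesis"
    then obtain n m where n: "\<forall>x\<in>carrier X. (f ^^ n) x = \<zero>\<^bsub>X\<^esub>" and m: "\<forall>x\<in>carrier X. (g ^^ m) x = \<zero>\<^bsub>X\<^esub>"
      using fitting[OF assms(1,2)] fitting[OF assms(1,3)] by blast
    have gi: "x = \<zero>\<^bsub>X\<^esub>" if x: "x \<in> carrier X" "g x = \<zero>\<^bsub>X\<^esub>" for x
    proof -
      have "f x = x" using assms(4)[OF x(1)] x hom_closed[OF assms(2)] by simp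
      then have "(f ^^ n) x = x" by (induct n) auto
      then show ?thesis using n x by simp
    qed
    have "\<forall>x\<in>carrier X. (g ^^ m) x = \<zero>\<^bsub>X\<^esub> \<longrightarrow> x = \<zero>\<^bsub>X\<^esub>"
    proof (induct m)
      case (Suc m)
      show ?case
      proof (intro ballI impI)
        fix x assume x: "x \<in> carrier X" "(g ^^ Suc m) x = \<zero>\<^bsub>X\<^esub>"
        have "(g ^^ m) x \<in> carrier X" by (rule hom_closed[OF hom_funpow[OF assms(3)] x(1)])
        then have "(g ^^ m) x = \<zero>\<^bsub>X\<^esub>" using gi[of "(g ^^ m) x"] x(2) by simp
        then show "x = \<zero>\<^bsub>X\<^esub>" using Suc x(1) by blast
      qed
    qed simp
    then have "carrier X \<subseteq> {\<zero>\<^bsub>X\<^esub>}" using m by blast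
    then show False using nz by auto
  qed
qed

text \<open>Composition with the inverse of \<open>h\<close> reduces the claim to
  \<open>local_sum_id\<close>.\<close>

lemma local_sum:
  fixes X :: "('k, 'a) umod"
  assumes "indecomposable L X" "f \<in> mod_hom L X X" "g \<in> mod_hom L X X" "h \<in> mod_hom L X X"
    "bij_betw h (carrier X) (carrier X)" "\<And>x. x \<in> carrier X \<Longrightarrow> f x \<oplus>\<^bsub>X\<^esub> g x = h x"
  shows "bij_betw f (carrier X) (carrier X) \<or> bij_betw g (carrier X) (carrier X)"
proof -
  have lm: "left_module L X" using assms(1) fg_left_module by (auto simp: indecomposable_def)
  define r where "r = inv_into (carrier X) h"
  have r: "r \<in> mod_hom L X X" unfolding r_def by (rule hom_inv_into[OF assms(4,5) lm])
  have rh: "r (h x) = x" "h (r x) = x" if "x \<in> carrier X" for x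
    unfolding r_def using assms(5) that by (auto simp: bij_betw_inv_into_left bij_betw_inv_into_right)
  have bij: "bij_betw u (carrier X) (carrier X)"
    if "bij_betw (\<lambda>x. r (u x)) (carrier X) (carrier X)" "u \<in> mod_hom L X X" for u
  proof -
    have "bij_betw (h \<circ> (\<lambda>x. r (u x))) (carrier X) (carrier X)" by (rule bij_betw_trans[OF that(1) assms(5)])
    then show ?thesis using rh(2) hom_closed[OF that(2)] by (subst bij_betw_cong[where g = "h \<circ> (\<lambda>x. r (u x))"]) auto
  qed
  have "r (f x) \<oplus>\<^bsub>X\<^esub> r (g x) = x" if "x \<in> carrier X" for x
    using that hom_add[OF r hom_closed[OF assms(2) that] hom_closed[OF assms(3) that]] assms(6)[OF that] rh(1) by simp
  from local_sum_id[OF assms(1) hom_comp[OF assms(2) r] hom_comp[OF assms(3) r] this]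
  show ?thesis using bij assms(2,3) by blast
qed

lemma local_finsum:
  fixes X :: "('k, 'a) umod"
  assumes "indecomposable L X" "\<And>i. i < n \<Longrightarrow> f i \<in> mod_hom L X X" "h \<in> mod_hom L X X"
    "bij_betw h (carrier X) (carrier X)" "\<And>x. x \<in> carrier X \<Longrightarrow> (\<Oplus>\<^bsub>X\<^esub>i\<in>{..<n::nat}. f i x) = h x"
  shows "\<exists>i<n. bij_betw (f i) (carrier X) (carrier X)"
  using assms(2-)
\<comment> \<open>The bijection is generalised, because the partial sum takes its place in the
  induction hypothesis.\<close>
proof (induct n arbitrary: h)
  case 0
  have lm: "left_module L X" using assms(1) fg_left_module by (auto simp: indecomposable_def)
  interpret X: left_module L X by fact
  have "h ` carrier X \<subseteq> {\<zero>\<^bsub>X\<^esub>}" using 0(4) by auto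
  then have "carrier X = {\<zero>\<^bsub>X\<^esub>}" using 0(3) by (auto simp: bij_betw_def)
  then show ?case using assms(1) by (simp add: indecomposable_def)
next
  case (Suc n)
  have lm: "left_module L X" using assms(1) fg_left_module by (auto simp: indecomposable_def)
  interpret X: left_module L X by fact
  define g where "g x = (\<Oplus>\<^bsub>X\<^esub>i\<in>{..<n}. f i x)" for x
  have g: "g \<in> mod_hom L X X" unfolding g_def by (rule hom_sum[OF _ _ lm]) (use Suc(2) in auto)
  have fn: "f n \<in> mod_hom L X X" using Suc(2) by simp
  have sum: "g x \<oplus>\<^bsub>X\<^esub> f n x = h x" if x: "x \<in> carrier X" for x
  proof -
    have c: "f i x \<in> carrier X" if "i < Suc n" for i by (rule hom_closed[OF Suc(2)[OF that] x])
    have "(\<Oplus>\<^bsub>X\<^esub>i\<in>{..<Suc n}. f i x) = f n x \<oplus>\<^bsub>X\<^esub> g x" unfolding g_def lessThan_Suc using c by (subst X.M.finsum_insert) auto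
    then show ?thesis using Suc(5)[OF x] X.M.a_comm hom_closed[OF g x] c by simp
  qed
  from local_sum[OF assms(1) g fn Suc(3,4) sum]
  show ?case
  proof
    assume "bij_betw g (carrier X) (carrier X)"
    then show ?thesis using Suc(1)[OF _ g] Suc(2) g_def by (metis less_Suc_eq)
  qed auto
qed

lemma factors_through_bij:
  fixes X :: "('k, 'a) umod"
  assumes "indecomposable L X" "\<And>i. i < n \<Longrightarrow> q i \<in> mod_hom L X (M i)" "\<And>i. i < n \<Longrightarrow> p i \<in> mod_hom L (M i) X"
    "\<And>x. x \<in> carrier X \<Longrightarrow> (\<Oplus>\<^bsub>X\<^esub>i\<in>{..<n::nat}. p i (q i x)) = x"
  shows "\<exists>i<n. bij_betw (\<lambda>x. p i (q i x)) (carrier X) (carrier X)"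
proof (rule local_finsum[OF assms(1) _ hom_id _ assms(4)])
  show "(\<lambda>x. p i (q i x)) \<in> mod_hom L X X" if "i < n" for i by (rule hom_comp[OF assms(2,3)]) (use that in auto)
  show "bij_betw (\<lambda>x. x) (carrier X) (carrier X)" by (simp add: bij_betw_def)
qed

text \<open>The inverse of the bijection corrects \<open>p\<close> to a left inverse of
  \<open>q\<close>.\<close>

lemma bij_comp_retract:
  assumes "left_module L X" "q \<in> mod_hom L X M" "p \<in> mod_hom L M X"
    "bij_betw (\<lambda>x. p (q x)) (carrier X) (carrier X)"
  shows "\<exists>r\<in>mod_hom L M X. \<forall>x\<in>carrier X. r (q x) = x"
proof -
  define r where "r = inv_into (carrier X) (\<lambda>x. p (q x))"
  have r: "r \<in> mod_hom L X X" unfolding r_def by (rule hom_inv_into[OF hom_comp[OF assms(2,3)] assms(4,1)])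
  have "r (p (q x)) = x" if "x \<in> carrier X" for x
    using bij_betw_inv_into_left[OF assms(4) that] by (simp add: r_def)
  then show ?thesis by (intro bexI[OF _ hom_comp[OF assms(3) r]]) simp
qed

text \<open>By locality one summand of the identity is bijective, and it passes through a single
  \<open>M i\<close>. This takes the place of the Krull-Schmidt theorem; the modules
  \<open>M i\<close> may be decomposable.\<close>

lemma indecomposable_retract_of_factor:
  fixes X :: "('k, 'a) umod"
  assumes "indecomposable L X" "factors_through L X n M"
  shows "\<exists>i<n. retract L X (M i)"
proof -
  have lm: "left_module L X" using assms(1) fg_left_module by (auto simp: indecomposable_def)
  obtain q p where qp: "\<And>i. i < n \<Longrightarrow> q i \<in> mod_hom L X (M i)" "\<And>i. i < n \<Longrightarrow> p i \<in> mod_hom L (M i) X"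
    "\<And>x. x \<in> carrier X \<Longrightarrow> x = (\<Oplus>\<^bsub>X\<^esub>i\<in>{..<n}. p i (q i x))"
    by (rule factors_throughE[OF assms(2)]) blast
  obtain i where i: "i < n" "bij_betw (\<lambda>x. p i (q i x)) (carrier X) (carrier X)"
    using factors_through_bij[OF assms(1) qp(1,2) qp(3)[symmetric]] by blast
  show ?thesis using bij_comp_retract[where q = "q i" and p = "p i", OF lm qp(1)[OF i(1)] qp(2)[OF i(1)] i(2)] i(1) qp(1)[OF i(1)] unfolding retract_def by blast
qed

text \<open>The complement of \<open>X\<close> in \<open>Y\<close> is zero, because \<open>Y\<close>
  is indecomposable and \<open>X\<close> is nonzero.\<close>

lemma indecomposable_section_bij:
  fixes X Y :: "('k, 'a) umod"
  assumes "indecomposable L X" "indecomposable L Y" "q \<in> mod_hom L X Y" "p \<in> mod_hom L Y X"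
    "bij_betw (\<lambda>x. p (q x)) (carrier X) (carrier X)"
  shows "bij_betw q (carrier X) (carrier Y)"
proof -
  have fg: "fg_module L X" "fg_module L Y" using assms(1,2) by (auto simp: indecomposable_def)
  have lm: "left_module L X" "left_module L Y" using fg fg_left_module by auto
  interpret X: left_module L X by fact
  interpret Y: left_module L Y by fact
  obtain r where r: "r \<in> mod_hom L Y X" "\<And>x. x \<in> carrier X \<Longrightarrow> r (q x) = x" using bij_comp_retract[where q = q and p = p, OF lm(1) assms(3-5)] by blast
  let ?Z = "submod Y {y \<in> carrier Y. r y = \<zero>\<^bsub>X\<^esub>}"
  have sZ: "is_submodule L Y {y \<in> carrier Y. r y = \<zero>\<^bsub>X\<^esub>}" by (rule submodule_ker[OF lm(2,1) r(1)])
  have "mod_iso L (dsum2 X ?Z) Y" by (rule retract_complement[OF lm assms(3) r(1)]) (rule r(2))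
  then have "mod_iso L Y (dsum2 X ?Z)" by (rule mod_iso_sym) (rule left_module_dsum2[OF lm(1) left_module_submod[OF lm(2) sZ]])
  then have Z: "{y \<in> carrier Y. r y = \<zero>\<^bsub>X\<^esub>} = {\<zero>\<^bsub>Y\<^esub>}"
    using indecomposable_dsum2D[OF assms(2) fg(1) fg_submodule[OF fg(2) sZ]] assms(1) by (auto simp: indecomposable_def)
  have qc: "q x \<in> carrier Y" if "x \<in> carrier X" for x using hom_closed[OF assms(3) that] .
  have rc: "r y \<in> carrier X" if "y \<in> carrier Y" for y using hom_closed[OF r(1) that] .
  show ?thesis
  proof (rule bij_betw_byWitness[where f' = r])
    show "\<forall>y\<in>carrier Y. q (r y) = y"
    proof
      fix y assume y: "y \<in> carrier Y"
      have "y \<ominus>\<^bsub>Y\<^esub> q (r y) \<in> {y \<in> carrier Y. r y = \<zero>\<^bsub>X\<^esub>}"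
        using y qc rc r(2) by (simp add: hom_minus[OF r(1) lm(2,1)] X.minus_self)
      then have "y \<ominus>\<^bsub>Y\<^esub> q (r y) = \<zero>\<^bsub>Y\<^esub>" using Z by blast
      then show "q (r y) = y" using y qc rc Y.minus_eq_iff[of y "q (r y)" "\<zero>\<^bsub>Y\<^esub>"] by simp
    qed
  qed (use r qc rc in auto)
qed

text \<open>If \<open>X\<close> occurred twice in \<open>\<Oplus> X\<^sub>j\<close>, then both copies would be isomorphic to the same \<open>X\<^sub>i\<close>; subtracting
  a multiple of one projection from the other removes the contribution of \<open>X\<^sub>i\<close>, so that \<open>X\<close> is also
  isomorphic to some \<open>X\<^sub>j\<close> with \<open>j \<noteq> i\<close>.\<close>

lemma basic_multiplicity_free:
  fixes X :: "('k, 'a) umod"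
  assumes "basic L W" "indecomposable L X"
    "i1 \<in> mod_hom L X W" "i2 \<in> mod_hom L X W" "p1 \<in> mod_hom L W X" "p2 \<in> mod_hom L W X"
    "\<And>x. x \<in> carrier X \<Longrightarrow> p1 (i1 x) = x" "\<And>x. x \<in> carrier X \<Longrightarrow> p2 (i2 x) = x"
    "\<And>x. x \<in> carrier X \<Longrightarrow> p1 (i2 x) = \<zero>\<^bsub>X\<^esub>"
  shows False
proof -
  have fgX: "fg_module L X" and fgW: "fg_module L W" using assms(1,2) by (auto simp: indecomposable_def basic_def)
  have lm: "left_module L X" "left_module L W" using fgX fgW fg_left_module by auto
  interpret X: left_module L X by fact
  have nz: "carrier X \<noteq> {\<zero>\<^bsub>X\<^esub>}" using assms(2) by (simp add: indecomposable_def)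
  obtain n and Z :: "nat \<Rightarrow> ('k, 'a) umod" where Z: "\<And>i. i < n \<Longrightarrow> indecomposable L (Z i)" "pairwise_non_iso L n Z"
    "mod_iso L W (dsum {..<n} Z)" using assms(1) unfolding basic_def by blast
  have lZ: "left_module L (Z i)" if "i < n" for i using Z(1)[OF that] fg_left_module by (auto simp: indecomposable_def)
  obtain u v where uv: "\<And>i. i < n \<Longrightarrow> u i \<in> mod_hom L (Z i) W" "\<And>i. i < n \<Longrightarrow> v i \<in> mod_hom L W (Z i)"
    "\<And>w. w \<in> carrier W \<Longrightarrow> w = (\<Oplus>\<^bsub>W\<^esub>i\<in>{..<n}. u i (v i w))"
    by (rule mod_iso_dsum_factors[OF Z(3) lm(2) lZ]; blast)
  have main: "\<exists>j<n. bij_betw (\<lambda>x. p (u j (v j (i x)))) (carrier X) (carrier X)"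
    if i: "i \<in> mod_hom L X W" and p: "p \<in> mod_hom L W X" and pi: "\<And>x. x \<in> carrier X \<Longrightarrow> p (i x) = x" for i p
  proof (rule factors_through_bij[OF assms(2), of n "\<lambda>j x. v j (i x)" Z "\<lambda>j z. p (u j z)"])
    fix x assume x: "x \<in> carrier X"
    have c: "(\<lambda>j. u j (v j (i x))) \<in> {..<n} \<rightarrow> carrier W"
      using hom_closed[OF uv(1)] hom_closed[OF uv(2)] hom_closed[OF i x] by blast
    have "(\<Oplus>\<^bsub>X\<^esub>j\<in>{..<n}. p (u j (v j (i x)))) = p (\<Oplus>\<^bsub>W\<^esub>j\<in>{..<n}. u j (v j (i x)))"
      by (rule hom_finsum[OF p lm(2,1) _ c, symmetric]) simp
    then show "(\<Oplus>\<^bsub>X\<^esub>j\<in>{..<n}. p (u j (v j (i x)))) = x" using uv(3)[OF hom_closed[OF i x]] pi[OF x] by simp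
  qed (use hom_comp[OF i uv(2)] hom_comp[OF uv(1) p] in auto)
  have same: "j = k" if "j < n" "k < n" "mod_iso L X (Z j)" "mod_iso L X (Z k)" for j k
    using that mod_iso_trans[OF mod_iso_sym[OF that(3) lm(1)] that(4)] Z(2) unfolding pairwise_non_iso_def by blast
  have bq: "bij_betw (\<lambda>x. v j (i x)) (carrier X) (carrier (Z j))"
    if "j < n" "i \<in> mod_hom L X W" "p \<in> mod_hom L W X" "bij_betw (\<lambda>x. p (u j (v j (i x)))) (carrier X) (carrier X)" for j i p
    by (rule indecomposable_section_bij[where p = "\<lambda>z. p (u j z)", OF assms(2) Z(1)[OF that(1)] hom_comp[OF that(2) uv(2)[OF that(1)]] hom_comp[OF uv(1)[OF that(1)] that(3)] that(4)])
  obtain j where j: "j < n" "bij_betw (\<lambda>x. p1 (u j (v j (i1 x)))) (carrier X) (carrier X)" using main[OF assms(3,5,7)] by blast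
  obtain k where k: "k < n" "bij_betw (\<lambda>x. p2 (u k (v k (i2 x)))) (carrier X) (carrier X)" using main[OF assms(4,6,8)] by blast
  have b1: "bij_betw (\<lambda>x. v j (i1 x)) (carrier X) (carrier (Z j))" using bq[OF j(1) assms(3,5) j(2)] .
  have b2: "bij_betw (\<lambda>x. v k (i2 x)) (carrier X) (carrier (Z k))" using bq[OF k(1) assms(4,6) k(2)] .
  have i1: "mod_iso L X (Z j)" using mod_isoI[OF hom_comp[OF assms(3) uv(2)[OF j(1)]] b1] .
  have i2: "mod_iso L X (Z k)" using mod_isoI[OF hom_comp[OF assms(4) uv(2)[OF k(1)]] b2] .
  have jk: "k = j" using same[OF k(1) j(1) i2 i1] .
  have b3: "bij_betw (\<lambda>z. p1 (u j z)) (carrier (Z j)) (carrier X)"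
  proof -
    have "(\<lambda>x. p1 (u j (v j (i1 x)))) = (\<lambda>z. p1 (u j z)) \<circ> (\<lambda>x. v j (i1 x))" by auto
    then show ?thesis using bij_betw_comp_iff[OF b1, of "\<lambda>z. p1 (u j z)" "carrier X"] j(2) by simp
  qed
  \<comment> \<open>The part of the composite of \<open>i2\<close> and \<open>p1\<close> that passes
    through \<open>Z j\<close>. It is bijective, as a composite of two isomorphisms just found,
    although the whole composite is zero.\<close>
  define s where "s x = p1 (u j (v j (i2 x)))" for x
  have s: "s \<in> mod_hom L X X" unfolding s_def
    by (rule hom_comp[OF hom_comp[OF hom_comp[OF assms(4) uv(2)[OF j(1)]] uv(1)[OF j(1)]] assms(5)])
  have "s = (\<lambda>z. p1 (u j z)) \<circ> (\<lambda>x. v j (i2 x))" by (auto simp: s_def)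
  then have sb: "bij_betw s (carrier X) (carrier X)" using bij_betw_trans b2 b3 jk by metis
  define r where "r = inv_into (carrier X) s"
  have r: "r \<in> mod_hom L X X" unfolding r_def by (rule hom_inv_into[OF s sb lm(1)])
  have rs: "r (s x) = x" if "x \<in> carrier X" for x unfolding r_def using bij_betw_inv_into_left[OF sb that] .
  define c where "c y = p2 (u j (v j (i2 (r y))))" for y
  have c: "c \<in> mod_hom L X X" unfolding c_def
    by (rule hom_comp[OF hom_comp[OF hom_comp[OF hom_comp[OF r assms(4)] uv(2)[OF j(1)]] uv(1)[OF j(1)]] assms(6)])
  define p where "p w = p2 w \<ominus>\<^bsub>X\<^esub> c (p1 w)" for w
  have p: "p \<in> mod_hom L W X" unfolding p_def by (rule hom_diff[OF assms(6) hom_comp[OF assms(5) c] lm(1)])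
  \<comment> \<open>The correction term vanishes on the image of \<open>i2\<close>, because
    \<open>p1\<close> does.\<close>
  have pi: "p (i2 x) = x" if "x \<in> carrier X" for x
    using that assms(8,9) hom_zero[OF c lm(1,1)] X.minus_eq_iff[of x "\<zero>\<^bsub>X\<^esub>" x] by (simp add: p_def)
  obtain l where l: "l < n" "bij_betw (\<lambda>x. p (u l (v l (i2 x)))) (carrier X) (carrier X)" using main[OF assms(4) p pi] by blast
  have i3: "mod_iso L X (Z l)" using mod_isoI[OF hom_comp[OF assms(4) uv(2)[OF l(1)]] bq[OF l(1) assms(4) p l(2)]] .
  have lj: "l = j" using same[OF l(1) j(1) i3 i1] .
  have "p (u j (v j (i2 x))) = \<zero>\<^bsub>X\<^esub>" if "x \<in> carrier X" for x
  proof -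
    have "c (p1 (u j (v j (i2 x)))) = p2 (u j (v j (i2 x)))" using rs[OF that] by (simp add: c_def s_def[symmetric])
    moreover have "p2 (u j (v j (i2 x))) \<in> carrier X"
      using hom_closed[OF assms(6)] hom_closed[OF uv(1)[OF j(1)]] hom_closed[OF uv(2)[OF j(1)]] hom_closed[OF assms(4) that] by blast
    ultimately show ?thesis by (simp add: p_def X.minus_self)
  qed
  then have "(\<lambda>x. p (u l (v l (i2 x)))) ` carrier X \<subseteq> {\<zero>\<^bsub>X\<^esub>}" using lj by auto
  then have "carrier X \<subseteq> {\<zero>\<^bsub>X\<^esub>}" using l(2) unfolding bij_betw_def by simp
  then show False using nz X.M.zero_closed by blast
qed

end

section \<open>Projective, injective and tilting modules\<close>

lemma short_exactD:
  assumes "short_exact R X f E g Y"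
  shows "f \<in> mod_hom R X E" "g \<in> mod_hom R E Y" "inj_on f (carrier X)"
    "f ` carrier X = {e \<in> carrier E. g e = \<zero>\<^bsub>Y\<^esub>}" "g ` carrier E = carrier Y"
  using assms by (auto simp: short_exact_def a_kernel_def')

lemma short_exactI:
  assumes "f \<in> mod_hom R X E" "g \<in> mod_hom R E Y" "inj_on f (carrier X)"
    "f ` carrier X = {e \<in> carrier E. g e = \<zero>\<^bsub>Y\<^esub>}" "g ` carrier E = carrier Y"
  shows "short_exact R X f E g Y"
  using assms by (auto simp: short_exact_def a_kernel_def')

lemma factors_through_of_retract:
  assumes "retract R X M" "left_module R X"
  shows "factors_through R X 1 (\<lambda>_. M)"
proof -
  interpret X: left_module R X by fact
  obtain i p where ip: "i \<in> mod_hom R X M" "p \<in> mod_hom R M X" "\<And>x. x \<in> carrier X \<Longrightarrow> p (i x) = x"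
    using assms(1) unfolding retract_def by blast
  show ?thesis unfolding factors_through_def
    by (intro exI[of _ "\<lambda>_. i"] exI[of _ "\<lambda>_. p"]) (use ip in \<open>auto simp: lessThan_Suc\<close>)
qed

lemma fg_module_regular:
  assumes "ring L" shows "fg_module L (regular_module L)"
proof -
  interpret L: ring L by fact
  have lr: "left_module L (regular_module L)" using left_module_regular[OF assms] .
  have "spanned L (regular_module L) (Suc 0) (add_line L (regular_module L) {\<zero>\<^bsub>L\<^esub>} \<one>\<^bsub>L\<^esub>)"
    using spanned_Suc[OF spanned_0, of "\<one>\<^bsub>L\<^esub>" "regular_module L" L] by simp
  moreover have "add_line L (regular_module L) {\<zero>\<^bsub>L\<^esub>} \<one>\<^bsub>L\<^esub> = carrier L"
  proof
    show "carrier L \<subseteq> add_line L (regular_module L) {\<zero>\<^bsub>L\<^esub>} \<one>\<^bsub>L\<^esub>"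
    proof
      fix x assume x: "x \<in> carrier L"
      then have "x = \<zero>\<^bsub>L\<^esub> \<oplus>\<^bsub>L\<^esub> x \<otimes>\<^bsub>L\<^esub> \<one>\<^bsub>L\<^esub>" by simp
      then show "x \<in> add_line L (regular_module L) {\<zero>\<^bsub>L\<^esub>} \<one>\<^bsub>L\<^esub>" unfolding add_line_def using x by (auto intro!: exI[of _ x])
    qed
  qed (auto simp: add_line_def)
  ultimately show ?thesis using fg_moduleI[OF lr] by auto
qed

context fd_algebra
begin

lemma projective_fg: "projective L P \<Longrightarrow> fg_module L P"
  and injective_fg: "injective L P \<Longrightarrow> fg_module L P"
  and indecomposable_fg: "indecomposable L P \<Longrightarrow> fg_module L P"
  by (auto simp: projective_def injective_def indecomposable_def)

lemma projective_lift:
  fixes M N :: "('k, 'a) umod"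
  assumes "projective L P" "fg_module L M" "fg_module L N" "f \<in> mod_hom L M N" "f ` carrier M = carrier N" "g \<in> mod_hom L P N"
  shows "\<exists>h\<in>mod_hom L P M. \<forall>x\<in>carrier P. f (h x) = g x"
  using assms unfolding projective_def by blast

lemma injective_extend:
  fixes M N :: "('k, 'a) umod"
  assumes "injective L J" "fg_module L M" "fg_module L N" "f \<in> mod_hom L M N" "inj_on f (carrier M)" "g \<in> mod_hom L M J"
  shows "\<exists>h\<in>mod_hom L N J. \<forall>x\<in>carrier M. h (f x) = g x"
  using assms unfolding injective_def by blast

text \<open>The maps \<open>g \<circ> p i\<close> are lifted separately, and their lifts composed
  with the \<open>q i\<close> add up to a lift of \<open>g\<close>. The carrier type of the
  \<open>M i\<close> is arbitrary, so the regular module and the columns are covered.\<close>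

lemma projective_factors_through:
  assumes "fg_module L X" "factors_through L X n M" "\<And>i. i < n \<Longrightarrow> projective L (M i)"
  shows "projective L X"
  unfolding projective_def
proof (intro conjI allI impI assms(1))
  fix A B :: "('k, 'a) umod" and f g
  assume *: "fg_module L A \<and> fg_module L B \<and> f \<in> mod_hom L A B \<and> f ` carrier A = carrier B \<and> g \<in> mod_hom L X B"
  have lm: "left_module L X" "left_module L A" "left_module L B" using assms(1) * fg_left_module by auto
  interpret B: left_module L B by fact
  obtain q p where qp: "\<And>i. i < n \<Longrightarrow> q i \<in> mod_hom L X (M i)" "\<And>i. i < n \<Longrightarrow> p i \<in> mod_hom L (M i) X"
    "\<And>x. x \<in> carrier X \<Longrightarrow> x = (\<Oplus>\<^bsub>X\<^esub>i\<in>{..<n}. p i (q i x))"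
    by (rule factors_throughE[OF assms(2)]) blast
  have "\<exists>h\<in>mod_hom L (M i) A. \<forall>x\<in>carrier (M i). f (h x) = g (p i x)" if "i < n" for i
    using projective_lift[OF assms(3)[OF that], of A B f "\<lambda>x. g (p i x)"] * hom_comp[OF qp(2)[OF that]] by blast
  then obtain h where h: "\<And>i. i < n \<Longrightarrow> h i \<in> mod_hom L (M i) A" "\<And>i x. i < n \<Longrightarrow> x \<in> carrier (M i) \<Longrightarrow> f (h i x) = g (p i x)"
    by metis
  show "\<exists>h\<in>mod_hom L X A. \<forall>x\<in>carrier X. f (h x) = g x"
  proof (intro bexI[of _ "\<lambda>x. \<Oplus>\<^bsub>A\<^esub>i\<in>{..<n}. h i (q i x)"] ballI)
    show "(\<lambda>x. \<Oplus>\<^bsub>A\<^esub>i\<in>{..<n}. h i (q i x)) \<in> mod_hom L X A"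
      by (rule hom_sum[OF _ _ lm(2)]) (use hom_comp[OF qp(1) h(1)] in auto)
    fix x assume x: "x \<in> carrier X"
    have qc: "q i x \<in> carrier (M i)" if "i < n" for i using hom_closed[OF qp(1)[OF that] x] .
    have pc: "p i (q i x) \<in> carrier X" if "i < n" for i using hom_closed[OF qp(2)[OF that] qc[OF that]] .
    have hc: "h i (q i x) \<in> carrier A" if "i < n" for i using hom_closed[OF h(1)[OF that] qc[OF that]] .
    have gh: "g \<in> mod_hom L X B" and fh: "f \<in> mod_hom L A B" using * by auto
    have "f (\<Oplus>\<^bsub>A\<^esub>i\<in>{..<n}. h i (q i x)) = (\<Oplus>\<^bsub>B\<^esub>i\<in>{..<n}. f (h i (q i x)))"
      by (rule hom_finsum[OF fh lm(2,3)]) (use hc in auto)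
    also have "\<dots> = (\<Oplus>\<^bsub>B\<^esub>i\<in>{..<n}. g (p i (q i x)))"
      by (rule B.M.finsum_cong') (use h(2) qc pc hom_closed[OF gh] in auto)
    also have "\<dots> = g (\<Oplus>\<^bsub>X\<^esub>i\<in>{..<n}. p i (q i x))"
      by (rule hom_finsum[OF gh lm(1,3), symmetric]) (use pc in auto)
    finally show "f (\<Oplus>\<^bsub>A\<^esub>i\<in>{..<n}. h i (q i x)) = g x" using qp(3)[OF x] by simp
  qed
qed

text \<open>Dual to \<open>projective_factors_through\<close>: the maps \<open>q i \<circ> g\<close>
  are extended separately, and the extensions are recombined by the \<open>p i\<close>.\<close>

lemma injective_factors_through:
  assumes "fg_module L X" "factors_through L X n M" "\<And>i. i < n \<Longrightarrow> injective L (M i)"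
  shows "injective L X"
  unfolding injective_def
proof (intro conjI allI impI assms(1))
  fix A B :: "('k, 'a) umod" and f g
  assume *: "fg_module L A \<and> fg_module L B \<and> f \<in> mod_hom L A B \<and> inj_on f (carrier A) \<and> g \<in> mod_hom L A X"
  have lm: "left_module L X" "left_module L A" "left_module L B" using assms(1) * fg_left_module by auto
  interpret X: left_module L X by fact
  obtain q p where qp: "\<And>i. i < n \<Longrightarrow> q i \<in> mod_hom L X (M i)" "\<And>i. i < n \<Longrightarrow> p i \<in> mod_hom L (M i) X"
    "\<And>x. x \<in> carrier X \<Longrightarrow> x = (\<Oplus>\<^bsub>X\<^esub>i\<in>{..<n}. p i (q i x))"
    by (rule factors_throughE[OF assms(2)]) blast
  have gh: "g \<in> mod_hom L A X" and fh: "f \<in> mod_hom L A B" using * by auto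
  have "\<exists>h\<in>mod_hom L B (M i). \<forall>x\<in>carrier A. h (f x) = q i (g x)" if "i < n" for i
    using injective_extend[OF assms(3)[OF that], of A B f "\<lambda>x. q i (g x)"] * hom_comp[OF gh qp(1)[OF that]] by blast
  then obtain h where h: "\<And>i. i < n \<Longrightarrow> h i \<in> mod_hom L B (M i)" "\<And>i x. i < n \<Longrightarrow> x \<in> carrier A \<Longrightarrow> h i (f x) = q i (g x)"
    by metis
  show "\<exists>h\<in>mod_hom L B X. \<forall>x\<in>carrier A. h (f x) = g x"
  proof (intro bexI[of _ "\<lambda>x. \<Oplus>\<^bsub>X\<^esub>i\<in>{..<n}. p i (h i x)"] ballI)
    show "(\<lambda>x. \<Oplus>\<^bsub>X\<^esub>i\<in>{..<n}. p i (h i x)) \<in> mod_hom L B X"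
      by (rule hom_sum[OF _ _ lm(1)]) (use hom_comp[OF h(1) qp(2)] in auto)
    fix x assume x: "x \<in> carrier A"
    have gx: "g x \<in> carrier X" using hom_closed[OF gh x] .
    have pc: "p i (q i (g x)) \<in> carrier X" if "i < n" for i using hom_closed[OF qp(2)[OF that] hom_closed[OF qp(1)[OF that] gx]] .
    have "(\<Oplus>\<^bsub>X\<^esub>i\<in>{..<n}. p i (h i (f x))) = (\<Oplus>\<^bsub>X\<^esub>i\<in>{..<n}. p i (q i (g x)))"
      by (rule X.M.finsum_cong') (use h(2) x pc in auto)
    then show "(\<Oplus>\<^bsub>X\<^esub>i\<in>{..<n}. p i (h i (f x))) = g x" using qp(3)[OF gx] by simp
  qed
qed

lemma projective_retract: "projective L M \<Longrightarrow> retract L X M \<Longrightarrow> fg_module L X \<Longrightarrow> projective L X"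
  using projective_factors_through[OF _ factors_through_of_retract] fg_left_module by blast

lemma injective_retract: "injective L M \<Longrightarrow> retract L X M \<Longrightarrow> fg_module L X \<Longrightarrow> injective L X"
  using injective_factors_through[OF _ factors_through_of_retract] fg_left_module by blast

lemmas fg_regular = fg_module_regular[OF L_ring]

text \<open>A homomorphism from the regular module is determined by the image of the unit, which can
  be lifted.\<close>

lemma projective_regular: "projective L (regular_module L)"
  unfolding projective_def
proof (intro conjI allI impI fg_regular)
  fix A B :: "('k, 'a) umod" and f g
  assume *: "fg_module L A \<and> fg_module L B \<and> f \<in> mod_hom L A B \<and> f ` carrier A = carrier B \<and> g \<in> mod_hom L (regular_module L) B"
  have lm: "left_module L A" using * fg_left_module by auto
  interpret A: left_module L A by fact
  have g: "g \<in> mod_hom L (regular_module L) B" and f: "f \<in> mod_hom L A B" using * by auto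
  have "g \<one>\<^bsub>L\<^esub> \<in> carrier B" using hom_closed[OF g] by simp
  then obtain a where a: "a \<in> carrier A" "f a = g \<one>\<^bsub>L\<^esub>" using * by (metis imageE)
  show "\<exists>h\<in>mod_hom L (regular_module L) A. \<forall>x\<in>carrier (regular_module L). f (h x) = g x"
  proof (intro bexI[of _ "\<lambda>x. x \<odot>\<^bsub>A\<^esub> a"] ballI)
    show "(\<lambda>x. x \<odot>\<^bsub>A\<^esub> a) \<in> mod_hom L (regular_module L) A"
      by (rule mod_homI) (use a in \<open>auto simp: A.smult_closed A.smult_l_distr A.smult_assoc1\<close>)
    fix x assume "x \<in> carrier (regular_module L)"
    then show "f (x \<odot>\<^bsub>A\<^esub> a) = g x" using a hom_smult[OF g, of x "\<one>\<^bsub>L\<^esub>"] by (simp add: hom_smult[OF f])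
  qed
qed

text \<open>A finite list of generators gives an epimorphism from a free module, and projectivity
  splits it.\<close>

lemma projective_factors_through_regular:
  assumes "projective L X"
  shows "\<exists>n. factors_through L X n (\<lambda>_. regular_module L)"
proof -
  have fg: "fg_module L X" using assms by (rule projective_fg)
  have lm: "left_module L X" using fg by (rule fg_left_module)
  interpret X: left_module L X by fact
  let ?R = "regular_module L"
  have lR: "left_module L ?R" using left_module_regular[OF L_ring] .
  \<comment> \<open>The generators are listed as a sequence, possibly with repetitions, to match the
    index set of the free module.\<close>
  have cover: "\<exists>v. (\<forall>i<n. v i \<in> carrier X) \<and> (\<forall>x\<in>W. \<exists>c. (\<forall>i<n. c i \<in> carrier L) \<and> x = (\<Oplus>\<^bsub>X\<^esub>i\<in>{..<n}. c i \<odot>\<^bsub>X\<^esub> v i))"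
    if "spanned L X n W" for n W
    using that
  proof (induct rule: spanned.induct)
    case spanned_0 show ?case by auto
  next
    case (spanned_Suc n W w)
    then obtain v where v: "\<And>i. i < n \<Longrightarrow> v i \<in> carrier X"
      "\<And>x. x \<in> W \<Longrightarrow> \<exists>c. (\<forall>i<n. c i \<in> carrier L) \<and> x = (\<Oplus>\<^bsub>X\<^esub>i\<in>{..<n}. c i \<odot>\<^bsub>X\<^esub> v i)" by blast
    show ?case
    proof (intro exI[of _ "v(n := w)"] conjI ballI)
      fix x assume "x \<in> add_line L X W w"
      then obtain u a where ua: "u \<in> W" "a \<in> carrier L" "x = u \<oplus>\<^bsub>X\<^esub> a \<odot>\<^bsub>X\<^esub> w" by (auto simp: add_line_def)
      obtain c where c: "\<forall>i<n. c i \<in> carrier L" "u = (\<Oplus>\<^bsub>X\<^esub>i\<in>{..<n}. c i \<odot>\<^bsub>X\<^esub> v i)" using v(2)[OF ua(1)] by blast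
      have cv: "(\<lambda>i. c i \<odot>\<^bsub>X\<^esub> v i) \<in> {..<n} \<rightarrow> carrier X" using c(1) v(1) by (auto simp: X.smult_closed)
      have "(\<Oplus>\<^bsub>X\<^esub>i\<in>{..<Suc n}. (c(n := a)) i \<odot>\<^bsub>X\<^esub> (v(n := w)) i) = a \<odot>\<^bsub>X\<^esub> w \<oplus>\<^bsub>X\<^esub> (\<Oplus>\<^bsub>X\<^esub>i\<in>{..<n}. (c(n := a)) i \<odot>\<^bsub>X\<^esub> (v(n := w)) i)"
        unfolding lessThan_Suc using cv ua spanned_Suc(3) by (subst X.M.finsum_insert) (auto simp: X.smult_closed Pi_def)
      also have "(\<Oplus>\<^bsub>X\<^esub>i\<in>{..<n}. (c(n := a)) i \<odot>\<^bsub>X\<^esub> (v(n := w)) i) = u"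
        unfolding c(2) using cv by (intro X.M.finsum_cong') auto
      finally have "x = (\<Oplus>\<^bsub>X\<^esub>i\<in>{..<Suc n}. (c(n := a)) i \<odot>\<^bsub>X\<^esub> (v(n := w)) i)"
        using ua c cv spanned_Suc(3) X.M.finsum_closed[OF cv] by (simp add: X.M.a_comm X.smult_closed)
      then show "\<exists>c. (\<forall>i<Suc n. c i \<in> carrier L) \<and> x = (\<Oplus>\<^bsub>X\<^esub>i\<in>{..<Suc n}. c i \<odot>\<^bsub>X\<^esub> (v(n := w)) i)"
        using c ua by (intro exI[of _ "c(n := a)"]) (auto simp: less_Suc_eq)
    qed (use v spanned_Suc(3) in \<open>auto simp: less_Suc_eq\<close>)
  qed
  obtain n where "spanned L X n (carrier X)" using fg by (auto simp: fg_module_iff)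
  from cover[OF this] obtain v where v: "\<And>i. i < n \<Longrightarrow> v i \<in> carrier X"
    "\<And>x. x \<in> carrier X \<Longrightarrow> \<exists>c. (\<forall>i<n. c i \<in> carrier L) \<and> x = (\<Oplus>\<^bsub>X\<^esub>i\<in>{..<n}. c i \<odot>\<^bsub>X\<^esub> v i)" by blast
  have o: "(\<lambda>a. a \<odot>\<^bsub>X\<^esub> v i) \<in> mod_hom L ?R X" if "i < n" for i
    by (rule mod_homI) (use v(1)[OF that] in \<open>auto simp: X.smult_closed X.smult_l_distr X.smult_assoc1\<close>)
  let ?D = "dsum {..<n} (\<lambda>_. ?R)"
  have fD: "fg_module L ?D" by (rule fg_dsum[OF L_ring fg_regular])
  have lD: "left_module L ?D" using fD by (rule fg_left_module)
  define s where "s m = (\<Oplus>\<^bsub>X\<^esub>i\<in>{..<n}. m i \<odot>\<^bsub>X\<^esub> v i)" for m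
  have s: "s \<in> mod_hom L ?D X" unfolding s_def
    by (rule hom_sum[OF _ _ lm], simp, rule hom_comp[OF hom_dsum_proj], assumption, rule o, simp)
  have surj: "s ` carrier ?D = carrier X"
  proof
    show "s ` carrier ?D \<subseteq> carrier X" using hom_closed[OF s] by blast
    show "carrier X \<subseteq> s ` carrier ?D"
    proof
      fix x assume "x \<in> carrier X"
      then obtain c where c: "\<forall>i<n. c i \<in> carrier L" "x = (\<Oplus>\<^bsub>X\<^esub>i\<in>{..<n}. c i \<odot>\<^bsub>X\<^esub> v i)" using v(2) by blast
      have "s (restrict c {..<n}) = x" unfolding s_def c(2) using c(1) v(1) by (intro X.M.finsum_cong') (auto simp: X.smult_closed)
      moreover have "restrict c {..<n} \<in> carrier ?D" using c(1) by auto
      ultimately show "x \<in> s ` carrier ?D" by blast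
    qed
  qed
  \<comment> \<open>Lifting is available for modules of the type used in the definition, so the
    epimorphism is moved to copies of the free module and of \<open>X\<close>, and the lift is moved
    back.\<close>
  obtain U :: "('k, 'a) umod" where U: "fg_module L U" "mod_iso L ?D U" using umod_exists[OF fD] by blast
  obtain V :: "('k, 'a) umod" where V: "fg_module L V" "mod_iso L X V" using umod_exists[OF fg] by blast
  obtain f g where f: "f \<in> mod_hom L ?D U" "g \<in> mod_hom L U ?D" "\<And>x. x \<in> carrier ?D \<Longrightarrow> g (f x) = x" "\<And>y. y \<in> carrier U \<Longrightarrow> f (g y) = y"
    by (rule mod_iso_inverse[OF U(2) lD]) blast
  obtain f' g' where f': "f' \<in> mod_hom L X V" "g' \<in> mod_hom L V X" "\<And>x. x \<in> carrier X \<Longrightarrow> g' (f' x) = x" "\<And>y. y \<in> carrier V \<Longrightarrow> f' (g' y) = y"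
    by (rule mod_iso_inverse[OF V(2) lm]) blast
  have t: "(\<lambda>u. f' (s (g u))) \<in> mod_hom L U V" by (rule hom_comp[OF hom_comp[OF f(2) s] f'(1)])
  have "(\<lambda>u. f' (s (g u))) ` carrier U = carrier V"
  proof
    show "(\<lambda>u. f' (s (g u))) ` carrier U \<subseteq> carrier V" using hom_closed[OF t] by blast
    show "carrier V \<subseteq> (\<lambda>u. f' (s (g u))) ` carrier U"
    proof
      fix y assume y: "y \<in> carrier V"
      then have "g' y \<in> s ` carrier ?D" using hom_closed[OF f'(2)] surj by blast
      then obtain m where m: "m \<in> carrier ?D" "g' y = s m" by blast
      have "f' (s (g (f m))) = y" using f(3)[OF m(1)] m(2) f'(4)[OF y] by simp
      then show "y \<in> (\<lambda>u. f' (s (g u))) ` carrier U" using hom_closed[OF f(1) m(1)] by blast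
    qed
  qed
  from projective_lift[OF assms U(1) V(1) t this f'(1)]
  obtain h where h: "h \<in> mod_hom L X U" "\<And>x. x \<in> carrier X \<Longrightarrow> f' (s (g (h x))) = f' x" by blast
  have sh: "s (g (h x)) = x" if "x \<in> carrier X" for x
    using arg_cong[OF h(2)[OF that], of g'] f'(3)[OF that] f'(3)[of "s (g (h x))"] hom_closed[OF s hom_closed[OF f(2) hom_closed[OF h(1) that]]] by simp
  have "retract L X ?D" by (rule retractI[OF hom_comp[OF h(1) f(2)] s]) (rule sh)
  from factors_through_retract[OF this factors_through_dsum[OF mod_iso_refl lD] lm lD] lR
  show ?thesis by blast
qed

text \<open>The retraction extends the identity of \<open>X\<close> along \<open>f\<close>.\<close>

lemma split_mono_injective:
  fixes X E :: "('k, 'a) umod"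
  assumes "short_exact L X f E g Y" "injective L X" "fg_module L E"
  shows "retract L X E"
  using injective_extend[OF assms(2) injective_fg[OF assms(2)] assms(3) short_exactD(1)[OF assms(1)] short_exactD(3)[OF assms(1)] hom_id]
    retractI[OF short_exactD(1)[OF assms(1)]] by blast

lemma split_epi_projective:
  fixes E Y :: "('k, 'a) umod"
  assumes "short_exact L X f E g Y" "projective L Y" "fg_module L E"
  shows "retract L Y E"
  using projective_lift[OF assms(2,3) projective_fg[OF assms(2)] short_exactD(2)[OF assms(1)] short_exactD(5)[OF assms(1)] hom_id]
    retractI[OF _ short_exactD(2)[OF assms(1)]] by blast

text \<open>Serves to continue a two-term resolution by zeros.\<close>

lemma zero_umod_exists: "\<exists>Z :: ('k, 'a) umod. projective L Z \<and> carrier Z = {\<zero>\<^bsub>Z\<^esub>}"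
proof -
  have lR: "left_module L (regular_module L)" using left_module_regular[OF L_ring] .
  let ?Z = "submod (regular_module L) {\<zero>\<^bsub>L\<^esub>}"
  have s: "is_submodule L (regular_module L) {\<zero>\<^bsub>L\<^esub>}" using submodule_zero[OF lR] by simp
  have fZ: "fg_module L ?Z" using fg_submodule[OF fg_regular s] .
  obtain U :: "('k, 'a) umod" where U: "fg_module L U" "mod_iso L ?Z U" using umod_exists[OF fZ] by blast
  have lU: "left_module L U" using U(1) by (rule fg_left_module)
  have c: "carrier U = {\<zero>\<^bsub>U\<^esub>}" using mod_iso_zero_carrier[OF U(2) fg_left_module[OF fZ] lU] by simp
  interpret U: left_module L U by fact
  have "factors_through L U 0 (\<lambda>_. regular_module L)" unfolding factors_through_def using c by simp
  then have "projective L U" using projective_factors_through[OF U(1)] by blast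
  then show ?thesis using c by blast
qed

definition pd_le_1 :: "('a, 'm) module \<Rightarrow> bool" where
  "pd_le_1 M \<longleftrightarrow> (\<exists>(P0 :: ('k, 'a) umod) (P1 :: ('k, 'a) umod) f g.
     projective L P0 \<and> projective L P1 \<and> short_exact L P1 f P0 g M)"

text \<open>An infimum of extended naturals that is at most one is attained, and in the
  corresponding resolution the vanishing of the term in degree two makes the first differential
  injective. Conversely a short exact sequence is padded with zero modules.\<close>

lemma proj_dim_le_1_iff:
  assumes "left_module L M"
  shows "proj_dim L M \<le> 1 \<longleftrightarrow> pd_le_1 M"
proof
  assume *: "proj_dim L M \<le> 1"
  let ?S = "{enat n | n. \<exists>P d \<epsilon>. proj_resolution L M n P d \<epsilon>}"
  \<comment> \<open>The infimum of the empty set would be infinite.\<close>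
  have "?S \<noteq> {}" using * unfolding proj_dim_def Inf_enat_def by (auto split: if_splits)
  then have "Inf ?S \<in> ?S" unfolding Inf_enat_def by (metis (no_types, lifting) LeastI ex_in_conv)
  then obtain n P d \<epsilon> where n: "Inf ?S = enat n" and r: "proj_resolution L M n P d \<epsilon>" by blast
  have n1: "n \<le> 1" using * n unfolding proj_dim_def by (simp add: one_enat_def)
  have P: "projective L (P i)" for i using r by (simp add: proj_resolution_def)
  have lP: "left_module L (P i)" for i using P projective_fg fg_left_module by blast
  have r1: "\<epsilon> \<in> mod_hom L (P 0) M" "d i \<in> mod_hom L (P (Suc i)) (P i)" "\<epsilon> ` carrier (P 0) = carrier M"
    "d 0 ` carrier (P 1) = {x \<in> carrier (P 0). \<epsilon> x = \<zero>\<^bsub>M\<^esub>}"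
    "d (Suc i) ` carrier (P (Suc (Suc i))) = {x \<in> carrier (P (Suc i)). d i x = \<zero>\<^bsub>P i\<^esub>}" for i
    using r unfolding proj_resolution_def a_kernel_def' by blast+
  have z: "carrier (P (Suc (Suc 0))) = {\<zero>\<^bsub>P (Suc (Suc 0))\<^esub>}" using r n1 by (simp add: proj_resolution_def)
  have d0: "d 0 \<in> mod_hom L (P 1) (P 0)" using r1(2)[of 0] by simp
  have "d (Suc 0) \<zero>\<^bsub>P (Suc (Suc 0))\<^esub> = \<zero>\<^bsub>P 1\<^esub>" using hom_zero[OF r1(2) lP lP] by simp
  then have "{x \<in> carrier (P 1). d 0 x = \<zero>\<^bsub>P 0\<^esub>} = {\<zero>\<^bsub>P 1\<^esub>}" using r1(5)[of 0] z by simp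
  then have inj: "inj_on (d 0) (carrier (P 1))" by (intro hom_injI[OF d0 lP lP]) blast
  show "pd_le_1 M" unfolding pd_le_1_def using P short_exactI[OF d0 r1(1) inj r1(4,3)] by blast
next
  assume "pd_le_1 M"
  then obtain P0 P1 :: "('k, 'a) umod" and f g where P: "projective L P0" "projective L P1" and e: "short_exact L P1 f P0 g M"
    unfolding pd_le_1_def by blast
  obtain Z :: "('k, 'a) umod" where Z: "projective L Z" "carrier Z = {\<zero>\<^bsub>Z\<^esub>}" using zero_umod_exists by blast
  have lP: "left_module L P0" "left_module L P1" "left_module L Z" using P Z projective_fg fg_left_module by blast+
  interpret P0: left_module L P0 by fact
  interpret P1: left_module L P1 by fact
  define P where "P i = (if i = 0 then P0 else if i = 1 then P1 else Z)" for i :: nat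
  define d where "d i = (if i = 0 then f else (\<lambda>_. \<zero>\<^bsub>P i\<^esub>))" for i :: nat
  have f0: "f x = \<zero>\<^bsub>P0\<^esub> \<longleftrightarrow> x = \<zero>\<^bsub>P1\<^esub>" if "x \<in> carrier P1" for x
    using hom_zero[OF short_exactD(1)[OF e] lP(2,1)] short_exactD(3)[OF e] that by (metis P1.M.zero_closed inj_onD)
  have lPi: "left_module L (P i)" for i using lP by (simp add: P_def)
  have "proj_resolution L M 1 P d g" unfolding proj_resolution_def a_kernel_def'
  proof (intro conjI allI impI)
    show "d i \<in> mod_hom L (P (Suc i)) (P i)" for i
      using short_exactD(1)[OF e] hom_const_zero[OF lPi[of i]] by (auto simp: d_def P_def)
    show "d (Suc i) ` carrier (P (Suc (Suc i))) = {x \<in> carrier (P (Suc i)). d i x = \<zero>\<^bsub>P i\<^esub>}" for i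
      using Z(2) f0 by (auto simp: d_def P_def)
  qed (use P Z short_exactD[OF e] in \<open>auto simp: P_def d_def\<close>)
  then have "proj_dim L M \<le> enat 1" unfolding proj_dim_def by (intro Inf_lower) blast
  then show "proj_dim L M \<le> 1" by (simp add: one_enat_def)
qed

section \<open>Vanishing of the first extension group\<close>

definition ext_vanishes :: "('a, 'm) module \<Rightarrow> ('a, 'n) module \<Rightarrow> bool" where
  "ext_vanishes M N \<longleftrightarrow> (\<forall>(E :: ('k, 'a) umod) f g. fg_module L E \<and> short_exact L N f E g M \<longrightarrow>
     (\<exists>r\<in>mod_hom L E N. \<forall>x\<in>carrier N. r (f x) = x))"

lemma ext_equivI:
  assumes "h \<in> mod_hom L E E'" "bij_betw h (carrier E) (carrier E')"
    "\<And>x. x \<in> carrier N \<Longrightarrow> h (f x) = f' x" "\<And>y. y \<in> carrier E \<Longrightarrow> g' (h y) = g y"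
  shows "ext_equiv L M N (f, E, g) (f', E', g')"
  using assms unfolding ext_equiv_def by auto

text \<open>A retraction \<open>r\<close> of the inclusion gives the isomorphism
  \<open>y \<mapsto> (r y, g y)\<close> onto the split extension, so all extensions are equivalent.
  Conversely an equivalence with the split extension yields the retraction as the first coordinate
  of its inverse.\<close>

lemma Ext1_zero_iff:
  assumes "fg_module L M" "fg_module L N"
  shows "Ext1 L M N = {Ext1_zero L M N} \<longleftrightarrow> ext_vanishes M N"
proof
  have lm: "left_module L M" "left_module L N" using assms fg_left_module by auto
  assume *: "Ext1 L M N = {Ext1_zero L M N}"
  show "ext_vanishes M N"
    unfolding ext_vanishes_def
  proof (intro allI impI)
    fix E :: "('k, 'a) umod" and f g assume E: "fg_module L E \<and> short_exact L N f E g M"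
    let ?R = "{(\<xi>, \<eta>). \<xi> \<in> extensions L M N \<and> \<eta> \<in> extensions L M N \<and> ext_equiv L M N \<xi> \<eta>}"
    have x: "(f, E, g) \<in> extensions L M N" using E by (simp add: extensions_def)
    have "ext_equiv L M N (f, E, g) (f, E, g)" unfolding ext_equiv_def
      by (auto intro!: bexI[OF _ hom_id] simp: bij_betw_def)
    then have m: "(f, E, g) \<in> ?R `` {(f, E, g)}" using x by blast
    have "?R `` {(f, E, g)} \<in> Ext1 L M N" unfolding Ext1_def using x by (rule quotientI)
    then have "?R `` {(f, E, g)} = Ext1_zero L M N" unfolding * by (rule singletonD)
    then have "(f, E, g) \<in> Ext1_zero L M N" using m by (rule subst)
    then have "ext_equiv L M N ((\<lambda>x. (x, \<zero>\<^bsub>M\<^esub>)), dsum2 N M, snd) (f, E, g)" unfolding Ext1_zero_def by blast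
    then obtain h where h: "h \<in> mod_hom L (dsum2 N M) E" "bij_betw h (carrier (dsum2 N M)) (carrier E)"
      "\<And>x. x \<in> carrier N \<Longrightarrow> h (x, \<zero>\<^bsub>M\<^esub>) = f x" unfolding ext_equiv_def by blast
    interpret M: left_module L M using lm by simp
    have r: "inv_into (carrier (dsum2 N M)) h \<in> mod_hom L E (dsum2 N M)"
      by (rule hom_inv_into[OF h(1,2) left_module_dsum2[OF lm(2,1)]])
    show "\<exists>r\<in>mod_hom L E N. \<forall>x\<in>carrier N. r (f x) = x"
    proof (intro bexI[OF _ hom_comp[OF r hom_fst]] ballI)
      fix x assume "x \<in> carrier N"
      then show "fst (inv_into (carrier (dsum2 N M)) h (f x)) = x"
        using bij_betw_inv_into_left[OF h(2), of "(x, \<zero>\<^bsub>M\<^esub>)"] h(3)[of x] by simp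
    qed
  qed
next
  have lm: "left_module L M" "left_module L N" using assms fg_left_module by auto
  interpret M: left_module L M using lm by simp
  interpret N: left_module L N using lm by simp
  let ?D = "dsum2 N M" and ?s = "((\<lambda>x. (x, \<zero>\<^bsub>M\<^esub>)), dsum2 N M, snd)"
  have lD: "left_module L ?D" using lm left_module_dsum2 by blast
  assume v: "ext_vanishes M N"
  have "\<exists>h k. h \<in> mod_hom L ?D E \<and> k \<in> mod_hom L E ?D \<and> (\<forall>z\<in>carrier ?D. k (h z) = z) \<and> (\<forall>y\<in>carrier E. h (k y) = y) \<and>
      (\<forall>x\<in>carrier N. h (x, \<zero>\<^bsub>M\<^esub>) = f x) \<and> (\<forall>z\<in>carrier ?D. g (h z) = snd z)"
    if "(f, E, g) \<in> extensions L M N" for f E g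
  proof -
    have E: "fg_module L E" "short_exact L N f E g M" using that by (auto simp: extensions_def)
    note e = short_exactD[OF E(2)]
    have lE: "left_module L E" using E(1) by (rule fg_left_module)
    interpret E: left_module L E by fact
    obtain r where r: "r \<in> mod_hom L E N" "\<And>x. x \<in> carrier N \<Longrightarrow> r (f x) = x" using v E unfolding ext_vanishes_def by blast
    define k where "k y = (r y, g y)" for y
    have k: "k \<in> mod_hom L E ?D" unfolding k_def by (rule hom_pair[OF r(1) e(2)])
    have gf: "g (f x) = \<zero>\<^bsub>M\<^esub>" if "x \<in> carrier N" for x using e(4) that by blast
    have inj: "inj_on k (carrier E)"
    proof (rule hom_injI[OF k lE lD])
      fix y assume y: "y \<in> carrier E" "k y = \<zero>\<^bsub>?D\<^esub>"
      then have "y \<in> f ` carrier N" using e(4) by (auto simp: k_def)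
      then obtain x where "x \<in> carrier N" "y = f x" by blast
      then show "y = \<zero>\<^bsub>E\<^esub>" using r(2)[of x] y(2) hom_zero[OF e(1) lm(2) lE] by (simp add: k_def)
    qed
    have "carrier ?D \<subseteq> k ` carrier E"
    proof
      fix z assume "z \<in> carrier ?D"
      then obtain n m where z: "z = (n, m)" "n \<in> carrier N" "m \<in> carrier M" by auto
      obtain y where y: "y \<in> carrier E" "m = g y" using z(3) e(5) by blast
      have c: "f (r y) \<in> carrier E" "f n \<in> carrier E" "r y \<in> carrier N" using hom_closed[OF e(1)] hom_closed[OF r(1)] y z by auto
      \<comment> \<open>The difference of \<open>y\<close> and \<open>f (r y)\<close> has second
        coordinate \<open>m\<close> and first coordinate zero; adding \<open>f n\<close> sets the
        first one to \<open>n\<close>.\<close>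
      have "k ((y \<ominus>\<^bsub>E\<^esub> f (r y)) \<oplus>\<^bsub>E\<^esub> f n) = z" unfolding k_def z
        using y z c hom_closed[OF e(2)] by (simp add: hom_add[OF r(1)] hom_add[OF e(2)] hom_minus[OF r(1) lE lm(2)] hom_minus[OF e(2) lE lm(1)] r(2) gf N.minus_self M.M.minus_eq)
      then show "z \<in> k ` carrier E" using y c by (metis E.M.a_closed E.M.minus_closed image_eqI)
    qed
    moreover have "k ` carrier E \<subseteq> carrier ?D" using hom_closed[OF k] by blast
    ultimately have b: "bij_betw k (carrier E) (carrier ?D)" using inj unfolding bij_betw_def by blast
    define h where "h = inv_into (carrier E) k"
    have h: "h \<in> mod_hom L ?D E" unfolding h_def by (rule hom_inv_into[OF k b lE])
    have kh: "k (h z) = z" if "z \<in> carrier ?D" for z unfolding h_def using bij_betw_inv_into_right[OF b that] .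
    have hk: "h (k y) = y" if "y \<in> carrier E" for y unfolding h_def using bij_betw_inv_into_left[OF b that] .
    have "h (x, \<zero>\<^bsub>M\<^esub>) = f x" if "x \<in> carrier N" for x
      using hk[OF hom_closed[OF e(1) that]] r(2)[OF that] gf[OF that] by (simp add: k_def)
    moreover have "g (h z) = snd z" if "z \<in> carrier ?D" for z using kh[OF that] by (metis k_def snd_conv)
    ultimately show ?thesis using h k kh hk by blast
  qed
  note split = this
  have eqv: "ext_equiv L M N \<xi> \<eta>" if \<xi>: "\<xi> \<in> extensions L M N" and \<eta>: "\<eta> \<in> extensions L M N" for \<xi> \<eta>
  proof -
    obtain f E g f' E' g' where x: "\<xi> = (f, E, g)" "\<eta> = (f', E', g')" by (cases \<xi>, cases \<eta>)
    obtain h k where hk: "h \<in> mod_hom L ?D E" "k \<in> mod_hom L E ?D" "\<And>z. z \<in> carrier ?D \<Longrightarrow> k (h z) = z" "\<And>y. y \<in> carrier E \<Longrightarrow> h (k y) = y"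
      "\<And>x. x \<in> carrier N \<Longrightarrow> h (x, \<zero>\<^bsub>M\<^esub>) = f x" "\<And>z. z \<in> carrier ?D \<Longrightarrow> g (h z) = snd z" using split \<xi> x by metis
    obtain h' k' where hk': "h' \<in> mod_hom L ?D E'" "k' \<in> mod_hom L E' ?D" "\<And>z. z \<in> carrier ?D \<Longrightarrow> k' (h' z) = z" "\<And>y. y \<in> carrier E' \<Longrightarrow> h' (k' y) = y"
      "\<And>x. x \<in> carrier N \<Longrightarrow> h' (x, \<zero>\<^bsub>M\<^esub>) = f' x" "\<And>z. z \<in> carrier ?D \<Longrightarrow> g' (h' z) = snd z" using split \<eta> x by metis
    have kf: "k (f x) = (x, \<zero>\<^bsub>M\<^esub>)" if "x \<in> carrier N" for x using hk(3)[of "(x, \<zero>\<^bsub>M\<^esub>)"] hk(5)[OF that] that by simp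
    have kc: "k y \<in> carrier ?D" if "y \<in> carrier E" for y using hom_closed[OF hk(2) that] .
    have "bij_betw (\<lambda>y. h' (k y)) (carrier E) (carrier E')"
    proof (rule bij_betw_byWitness[where f' = "\<lambda>y. h (k' y)"])
      show "\<forall>y\<in>carrier E. h (k' (h' (k y))) = y"
        using hk'(3)[OF kc] hk(4) by (simp del: dsum2_simps)
      show "\<forall>y\<in>carrier E'. h' (k (h (k' y))) = y"
        using hk(3)[OF hom_closed[OF hk'(2)]] hk'(4) by (simp del: dsum2_simps)
      show "(\<lambda>y. h' (k y)) ` carrier E \<subseteq> carrier E'"
        using hom_closed[OF hom_comp[OF hk(2) hk'(1)]] by blast
      show "(\<lambda>y. h (k' y)) ` carrier E' \<subseteq> carrier E"
        using hom_closed[OF hom_comp[OF hk'(2) hk(1)]] by blast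
    qed
    moreover have "h' (k (f x)) = f' x" if "x \<in> carrier N" for x using kf[OF that] hk'(5)[OF that] by simp
    moreover have "g' (h' (k y)) = g y" if "y \<in> carrier E" for y using hk'(6)[OF kc[OF that]] hk(6)[OF kc[OF that]] hk(4)[OF that] by simp
    ultimately show ?thesis unfolding x by (intro ext_equivI[OF hom_comp[OF hk(2) hk'(1)]])
  qed
  obtain U :: "('k, 'a) umod" where U: "fg_module L U" "mod_iso L ?D U" using umod_exists[OF fg_dsum2[OF assms(2,1)]] by blast
  obtain u w where uw: "u \<in> mod_hom L ?D U" "w \<in> mod_hom L U ?D" "\<And>x. x \<in> carrier ?D \<Longrightarrow> w (u x) = x" "\<And>y. y \<in> carrier U \<Longrightarrow> u (w y) = y"
    by (rule mod_iso_inverse[OF U(2) lD]) blast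
  have "short_exact L N (\<lambda>x. u (x, \<zero>\<^bsub>M\<^esub>)) U (\<lambda>y. snd (w y)) M"
  proof (rule short_exactI[OF hom_comp[OF hom_inl[OF lm(1)] uw(1)] hom_comp[OF uw(2) hom_snd]])
    show "inj_on (\<lambda>x. u (x, \<zero>\<^bsub>M\<^esub>)) (carrier N)"
    proof (rule inj_onI)
      fix x y assume *: "x \<in> carrier N" "y \<in> carrier N" "u (x, \<zero>\<^bsub>M\<^esub>) = u (y, \<zero>\<^bsub>M\<^esub>)"
      have "w (u (x, \<zero>\<^bsub>M\<^esub>)) = w (u (y, \<zero>\<^bsub>M\<^esub>))" using *(3) by simp
      then show "x = y" using uw(3)[of "(x, \<zero>\<^bsub>M\<^esub>)"] uw(3)[of "(y, \<zero>\<^bsub>M\<^esub>)"] *(1,2) by simp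
    qed
    show "(\<lambda>x. u (x, \<zero>\<^bsub>M\<^esub>)) ` carrier N = {y \<in> carrier U. snd (w y) = \<zero>\<^bsub>M\<^esub>}"
    proof
      show "(\<lambda>x. u (x, \<zero>\<^bsub>M\<^esub>)) ` carrier N \<subseteq> {y \<in> carrier U. snd (w y) = \<zero>\<^bsub>M\<^esub>}"
        using hom_closed[OF uw(1)] uw(3) by auto
      show "{y \<in> carrier U. snd (w y) = \<zero>\<^bsub>M\<^esub>} \<subseteq> (\<lambda>x. u (x, \<zero>\<^bsub>M\<^esub>)) ` carrier N"
      proof
        fix y assume y: "y \<in> {y \<in> carrier U. snd (w y) = \<zero>\<^bsub>M\<^esub>}"
        obtain a b where ab: "w y = (a, b)" by (cases "w y")
        then have "a \<in> carrier N" "b = \<zero>\<^bsub>M\<^esub>" using y hom_closed[OF uw(2), of y] by auto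
        then show "y \<in> (\<lambda>x. u (x, \<zero>\<^bsub>M\<^esub>)) ` carrier N" using uw(4)[of y] y ab by (metis (mono_tags, lifting) image_eqI mem_Collect_eq)
      qed
    qed
    show "(\<lambda>y. snd (w y)) ` carrier U = carrier M"
    proof
      show "(\<lambda>y. snd (w y)) ` carrier U \<subseteq> carrier M" using hom_closed[OF hom_comp[OF uw(2) hom_snd]] by blast
      show "carrier M \<subseteq> (\<lambda>y. snd (w y)) ` carrier U"
      proof
        fix m assume "m \<in> carrier M"
        then have "(\<zero>\<^bsub>N\<^esub>, m) \<in> carrier ?D" by simp
        then show "m \<in> (\<lambda>y. snd (w y)) ` carrier U" using uw(3) hom_closed[OF uw(1)] by (metis image_eqI snd_conv)
      qed
    qed
  qed
  \<comment> \<open>Without any extension of the prescribed type the quotient would be empty instead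
    of the singleton of the zero class.\<close>
  then have ne: "((\<lambda>x. u (x, \<zero>\<^bsub>M\<^esub>)), U, (\<lambda>y. snd (w y))) \<in> extensions L M N" using U(1) by (simp add: extensions_def)
  have zero: "Ext1_zero L M N = extensions L M N"
  proof
    show "extensions L M N \<subseteq> Ext1_zero L M N"
    proof
      fix \<xi> assume \<xi>: "\<xi> \<in> extensions L M N"
      obtain f E g where x: "\<xi> = (f, E, g)" by (cases \<xi>)
      obtain h k where hk: "h \<in> mod_hom L ?D E" "k \<in> mod_hom L E ?D" "\<And>z. z \<in> carrier ?D \<Longrightarrow> k (h z) = z" "\<And>y. y \<in> carrier E \<Longrightarrow> h (k y) = y"
        "\<And>x. x \<in> carrier N \<Longrightarrow> h (x, \<zero>\<^bsub>M\<^esub>) = f x" "\<And>z. z \<in> carrier ?D \<Longrightarrow> g (h z) = snd z" using split \<xi> x by metis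
      have "bij_betw h (carrier ?D) (carrier E)"
      proof (rule bij_betw_byWitness[where f' = k])
        show "h ` carrier ?D \<subseteq> carrier E" using hom_closed[OF hk(1)] by blast
        show "k ` carrier E \<subseteq> carrier ?D" using hom_closed[OF hk(2)] by blast
      qed (use hk(3,4) in blast)+
      then have "ext_equiv L M N ?s \<xi>" unfolding x by (intro ext_equivI[OF hk(1)] hk(5,6))
      then show "\<xi> \<in> Ext1_zero L M N" using \<xi> by (simp add: Ext1_zero_def)
    qed
  qed (auto simp: Ext1_zero_def)
  let ?R = "{(\<xi>, \<eta>). \<xi> \<in> extensions L M N \<and> \<eta> \<in> extensions L M N \<and> ext_equiv L M N \<xi> \<eta>}"
  have cl: "?R `` {\<xi>} = extensions L M N" if "\<xi> \<in> extensions L M N" for \<xi> using eqv[OF that] that by blast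
  have "(\<Union>\<xi>\<in>extensions L M N. {?R `` {\<xi>}}) = (\<Union>\<xi>\<in>extensions L M N. {extensions L M N})"
    using cl by (intro SUP_cong refl) simp
  also have "\<dots> = {extensions L M N}" using ne by (auto simp del: split_paired_All split_paired_Ex)
  finally show "Ext1 L M N = {Ext1_zero L M N}" unfolding Ext1_def zero quotient_def .
qed

section \<open>Tilting modules up to isomorphism\<close>

lemma tilting_iff:
  "tilting L T \<longleftrightarrow> fg_module L T \<and> pd_le_1 T \<and> ext_vanishes T T \<and>
     (\<exists>(T0 :: ('k, 'a) umod) (T1 :: ('k, 'a) umod) f g.
        in_add L T T0 \<and> in_add L T T1 \<and> short_exact L (regular_module L) f T0 g T1)"
proof (cases "fg_module L T")
  case True
  show ?thesis unfolding tilting_def proj_dim_le_1_iff[OF fg_left_module[OF True]] Ext1_zero_iff[OF True True] by (rule refl)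
qed (simp add: tilting_def)

lemma in_add_iso:
  assumes "fg_module L T" "fg_module L T'" "mod_iso L T T'" "in_add L T X"
  shows "in_add L T' X"
  using assms in_add_iff[OF assms(1)] in_add_iff[OF assms(2)]
    factors_through_comp_retract[OF _ mod_iso_retract[OF assms(3) fg_left_module[OF assms(1)]]] fg_left_module by metis

text \<open>All data are conjugated by the isomorphism. The given tilting modules may have any
  carrier type, while vertices of the tilting quiver are represented by modules of one fixed
  type.\<close>

lemma tilting_iso:
  assumes "tilting L T" "mod_iso L T T'" "fg_module L T'"
  shows "tilting L T'"
proof -
  have T: "fg_module L T" "pd_le_1 T" "ext_vanishes T T" using assms(1) tilting_iff by blast+
  have lm: "left_module L T" "left_module L T'" using T(1) assms(3) fg_left_module by auto
  obtain u w where uw: "u \<in> mod_hom L T T'" "w \<in> mod_hom L T' T" "\<And>x. x \<in> carrier T \<Longrightarrow> w (u x) = x" "\<And>y. y \<in> carrier T' \<Longrightarrow> u (w y) = y"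
    by (rule mod_iso_inverse[OF assms(2) lm(1)]) blast
  have u0: "u x = \<zero>\<^bsub>T'\<^esub> \<longleftrightarrow> x = \<zero>\<^bsub>T\<^esub>" if "x \<in> carrier T" for x
    using uw(3)[OF that] hom_zero[OF uw(1) lm] hom_zero[OF uw(2) lm(2,1)] by metis
  have w0: "w x = \<zero>\<^bsub>T\<^esub> \<longleftrightarrow> x = \<zero>\<^bsub>T'\<^esub>" if "x \<in> carrier T'" for x
    using uw(4)[OF that] hom_zero[OF uw(1) lm] hom_zero[OF uw(2) lm(2,1)] by metis
  have us: "u ` carrier T = carrier T'" "w ` carrier T' = carrier T"
    using uw(3,4) hom_closed[OF uw(1)] hom_closed[OF uw(2)] by (force simp: image_iff)+
  have pd: "pd_le_1 T'"
  proof -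
    obtain P0 P1 :: "('k, 'a) umod" and f g where P: "projective L P0" "projective L P1" and e: "short_exact L P1 f P0 g T"
      using T(2) unfolding pd_le_1_def by blast
    note e = short_exactD[OF e]
    have "short_exact L P1 f P0 (\<lambda>x. u (g x)) T'"
    proof (rule short_exactI[OF e(1) hom_comp[OF e(2) uw(1)] e(3)])
      show "f ` carrier P1 = {x \<in> carrier P0. u (g x) = \<zero>\<^bsub>T'\<^esub>}" using e(4) u0 hom_closed[OF e(2)] by auto
      show "(\<lambda>x. u (g x)) ` carrier P0 = carrier T'" using e(5) us(1) by (metis image_image)
    qed
    then show ?thesis unfolding pd_le_1_def using P by blast
  qed
  have ext: "ext_vanishes T' T'" unfolding ext_vanishes_def
  proof (intro allI impI)
    fix E :: "('k, 'a) umod" and f g assume E: "fg_module L E \<and> short_exact L T' f E g T'"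
    note e = short_exactD[OF conjunct2[OF E]]
    have inj: "inj_on (\<lambda>x. f (u x)) (carrier T)"
    proof (rule inj_onI)
      fix x y assume *: "x \<in> carrier T" "y \<in> carrier T" "f (u x) = f (u y)"
      then have "u x = u y" using e(3) hom_closed[OF uw(1)] by (meson inj_onD)
      then show "x = y" using uw(3) * by metis
    qed
    have "short_exact L T (\<lambda>x. f (u x)) E (\<lambda>x. w (g x)) T"
    proof (rule short_exactI[OF hom_comp[OF uw(1) e(1)] hom_comp[OF e(2) uw(2)] inj])
      show "(\<lambda>x. f (u x)) ` carrier T = {x \<in> carrier E. w (g x) = \<zero>\<^bsub>T\<^esub>}"
        using e(4) w0 hom_closed[OF e(2)] us(1) by (auto simp: image_image[symmetric, of f u])
      show "(\<lambda>x. w (g x)) ` carrier E = carrier T" using e(5) us(2) by (metis image_image)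
    qed
    then obtain r where r: "r \<in> mod_hom L E T" "\<And>x. x \<in> carrier T \<Longrightarrow> r (f (u x)) = x" using T(3) E unfolding ext_vanishes_def by blast
    show "\<exists>r\<in>mod_hom L E T'. \<forall>x\<in>carrier T'. r (f x) = x"
    proof (intro bexI[OF _ hom_comp[OF r(1) uw(1)]] ballI)
      fix x assume x: "x \<in> carrier T'"
      show "u (r (f x)) = x" using r(2)[OF hom_closed[OF uw(2) x]] uw(4)[OF x] by simp
    qed
  qed
  show ?thesis using assms(1,3) pd ext in_add_iso[OF T(1) assms(3,2)] unfolding tilting_iff by blast
qed

lemma basic_iso: "basic L T \<Longrightarrow> mod_iso L T T' \<Longrightarrow> fg_module L T' \<Longrightarrow> basic L T'"
  using mod_iso_trans[OF mod_iso_sym] fg_left_module unfolding basic_def by metis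

end

section \<open>Path algebras\<close>

text \<open>Both sides run over the pairs \<open>i \<le> j\<close>, the inner index on the right
  being the difference of \<open>j\<close> and \<open>i\<close>. This exchange of summations is what
  associativity in a path algebra amounts to.\<close>

lemma (in abelian_monoid) finsum_triangle:
  assumes "\<And>i j. i \<le> j \<Longrightarrow> j \<le> n \<Longrightarrow> F i j \<in> carrier G"
  shows "(\<Oplus>j\<in>{..n::nat}. \<Oplus>i\<in>{..j}. F i j) = (\<Oplus>i\<in>{..n}. \<Oplus>k\<in>{..n - i}. F i (i + k))"
  using assms
proof (induct n)
  case 0 then show ?case by simp
next
  case (Suc n)
  have c1: "(\<Oplus>i\<in>{..j}. F i j) \<in> carrier G" if "j \<le> Suc n" for j
    using Suc(2) that by (intro finsum_closed) auto
  have c2: "(\<Oplus>k\<in>{..n - i}. F i (i + k)) \<in> carrier G" if "i \<le> n" for i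
    using Suc(2) that by (intro finsum_closed) auto
  have c3: "(\<Oplus>k\<in>{..Suc n - i}. F i (i + k)) \<in> carrier G" if "i \<le> Suc n" for i
    using Suc(2) that by (intro finsum_closed) auto
  have c4: "(\<Oplus>i\<in>{..n}. F i (Suc n)) \<in> carrier G" "(\<Oplus>i\<in>{..n}. \<Oplus>k\<in>{..n - i}. F i (i + k)) \<in> carrier G"
    using Suc(2) c2 by (auto intro!: finsum_closed)
  have "(\<Oplus>j\<in>{..Suc n}. \<Oplus>i\<in>{..j}. F i j) = (\<Oplus>i\<in>{..Suc n}. F i (Suc n)) \<oplus> (\<Oplus>j\<in>{..n}. \<Oplus>i\<in>{..j}. F i j)"
    using c1 by (intro finsum_Suc) auto
  also have "(\<Oplus>i\<in>{..Suc n}. F i (Suc n)) = F (Suc n) (Suc n) \<oplus> (\<Oplus>i\<in>{..n}. F i (Suc n))"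
    using Suc(2) by (intro finsum_Suc) auto
  also have "(\<Oplus>j\<in>{..n}. \<Oplus>i\<in>{..j}. F i j) = (\<Oplus>i\<in>{..n}. \<Oplus>k\<in>{..n - i}. F i (i + k))"
    using Suc by simp
  finally have 1: "(\<Oplus>j\<in>{..Suc n}. \<Oplus>i\<in>{..j}. F i j) = F (Suc n) (Suc n) \<oplus> (\<Oplus>i\<in>{..n}. F i (Suc n)) \<oplus> (\<Oplus>i\<in>{..n}. \<Oplus>k\<in>{..n - i}. F i (i + k))" .
  have "(\<Oplus>i\<in>{..Suc n}. \<Oplus>k\<in>{..Suc n - i}. F i (i + k)) = (\<Oplus>k\<in>{..Suc n - Suc n}. F (Suc n) (Suc n + k)) \<oplus> (\<Oplus>i\<in>{..n}. \<Oplus>k\<in>{..Suc n - i}. F i (i + k))"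
    using c3 by (intro finsum_Suc) auto
  also have "(\<Oplus>k\<in>{..Suc n - Suc n}. F (Suc n) (Suc n + k)) = F (Suc n) (Suc n)"
    using Suc(2) by simp
  also have "(\<Oplus>i\<in>{..n}. \<Oplus>k\<in>{..Suc n - i}. F i (i + k)) = (\<Oplus>i\<in>{..n}. F i (Suc n) \<oplus> (\<Oplus>k\<in>{..n - i}. F i (i + k)))"
  proof (rule finsum_cong'[OF refl])
    show "(\<lambda>i. F i (Suc n) \<oplus> (\<Oplus>k\<in>{..n - i}. F i (i + k))) \<in> {..n} \<rightarrow> carrier G" using c2 Suc(2) by auto
    fix i assume "i \<in> {..n}"
    then have i: "i \<le> n" "Suc n - i = Suc (n - i)" "i + Suc (n - i) = Suc n" by auto
    have "(\<Oplus>k\<in>{..Suc (n - i)}. F i (i + k)) = F i (i + Suc (n - i)) \<oplus> (\<Oplus>k\<in>{..n - i}. F i (i + k))"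
      using Suc(2) i by (intro finsum_Suc) auto
    then show "(\<Oplus>k\<in>{..Suc n - i}. F i (i + k)) = F i (Suc n) \<oplus> (\<Oplus>k\<in>{..n - i}. F i (i + k))" using i by simp
  qed
  also have "\<dots> = (\<Oplus>i\<in>{..n}. F i (Suc n)) \<oplus> (\<Oplus>i\<in>{..n}. \<Oplus>k\<in>{..n - i}. F i (i + k))"
    using Suc(2) c2 by (intro finsum_addf) auto
  finally show ?case using 1 c4 Suc(2) by (simp add: a_assoc)
qed

section \<open>Cutting walks at a vertex\<close>

context wf_digraph
begin

lemma awalk_split:
  assumes "awalk u p v" "i \<le> length p"
  shows "awalk u (take i p) (awalk_verts u p ! i)" "awalk (awalk_verts u p ! i) (drop i p) v"
proof -
  have "awalk u (take i p) (awalk_verts u p ! i) \<and> awalk (awalk_verts u p ! i) (drop i p) v"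
    using assms
  proof (induct p arbitrary: u i)
    case Nil then show ?case by (auto simp: awalk_Nil_iff)
  next
    case (Cons e p)
    have e: "u \<in> verts G" "e \<in> arcs G" "tail G e = u" "awalk (head G e) p v" using Cons(2) by (auto simp: awalk_Cons_iff)
    show ?case
    proof (cases i)
      case 0 then show ?thesis using Cons(2) e by (simp add: awalk_Nil_iff)
    next
      case (Suc j)
      then show ?thesis using Cons(1)[OF e(4), of j] Cons(3) e by (simp add: awalk_Cons_iff)
    qed
  qed
  then show "awalk u (take i p) (awalk_verts u p ! i)" "awalk (awalk_verts u p ! i) (drop i p) v" by auto
qed

lemma awalk_verts_0: "awalk u p v \<Longrightarrow> awalk_verts u p ! 0 = u"
  by (cases p) (auto simp: awalk_Cons_iff)

lemma awalk_verts_take: "awalk u p v \<Longrightarrow> i \<le> j \<Longrightarrow> j \<le> length p \<Longrightarrow> awalk_verts u (take j p) ! i = awalk_verts u p ! i"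
proof (induct p arbitrary: u i j)
  case (Cons e p)
  then show ?case
    by (cases j; cases i) (auto simp: awalk_Cons_iff)
qed simp

lemma awalk_verts_drop: "awalk u p v \<Longrightarrow> i + k \<le> length p \<Longrightarrow>
    awalk_verts (awalk_verts u p ! i) (drop i p) ! k = awalk_verts u p ! (i + k)"
proof (induct p arbitrary: u i)
  case (Cons e p)
  then show ?case by (cases i) (auto simp: awalk_Cons_iff)
qed simp

end

lemma path_algebra_simps:
  "carrier (path_algebra K Q) = {f \<in> quiver_paths Q \<rightarrow>\<^sub>E carrier K. finite {p \<in> quiver_paths Q. f p \<noteq> \<zero>\<^bsub>K\<^esub>}}"
  "f \<otimes>\<^bsub>path_algebra K Q\<^esub> g = restrict (\<lambda>(u, p). \<Oplus>\<^bsub>K\<^esub>i\<in>{..length p}.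
      f (u, take i p) \<otimes>\<^bsub>K\<^esub> g (pre_digraph.awalk_verts Q u p ! i, drop i p)) (quiver_paths Q)"
  "\<one>\<^bsub>path_algebra K Q\<^esub> = restrict (\<lambda>(u, p). if p = [] then \<one>\<^bsub>K\<^esub> else \<zero>\<^bsub>K\<^esub>) (quiver_paths Q)"
  "f \<oplus>\<^bsub>path_algebra K Q\<^esub> g = restrict (\<lambda>p. f p \<oplus>\<^bsub>K\<^esub> g p) (quiver_paths Q)"
  "c \<odot>\<^bsub>path_algebra K Q\<^esub> f = restrict (\<lambda>p. c \<otimes>\<^bsub>K\<^esub> f p) (quiver_paths Q)"
  by (simp_all add: path_algebra_def)

text \<open>The additive structure comes from the hypothesis \<open>fg_module\<close>, so only the
  multiplication remains. At a path, a product of three elements is a sum over all ways to cut the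
  path twice, and the two bracketings choose the cuts in different order. Since \<open>Q\<close> has
  finitely many vertices, the unit has finite support.\<close>

lemma fd_algebra_path_algebra:
  assumes "field K" "fin_digraph Q" "fg_module K (path_algebra K Q)"
  shows "fd_algebra K (path_algebra K Q)"
proof -
  interpret K: field K by fact
  interpret Q: fin_digraph Q by fact
  let ?A = "path_algebra K Q" and ?P = "quiver_paths Q"
  interpret KA: left_module K ?A using assms(3) by (rule fg_left_module)
  have P: "(u, p) \<in> ?P \<longleftrightarrow> (\<exists>v. Q.awalk u p v)" for u p by (simp add: quiver_paths_def)
  have val: "f x \<in> carrier K" if "f \<in> carrier ?A" "x \<in> ?P" for f x
    using that by (auto simp: path_algebra_simps)
  have ext: "f x = undefined" if "f \<in> carrier ?A" "x \<notin> ?P" for f x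
  proof -
    have "f \<in> ?P \<rightarrow>\<^sub>E carrier K" using that(1) by (simp add: path_algebra_simps)
    then show ?thesis using PiE_arb that(2) by metis
  qed
  have fin: "finite {p \<in> ?P. f p \<noteq> \<zero>\<^bsub>K\<^esub>}" if "f \<in> carrier ?A" for f
    using that by (auto simp: path_algebra_simps)
  have mem: "f \<in> carrier ?A" if "\<And>x. x \<in> ?P \<Longrightarrow> f x \<in> carrier K" "\<And>x. x \<notin> ?P \<Longrightarrow> f x = undefined" "finite {p \<in> ?P. f p \<noteq> \<zero>\<^bsub>K\<^esub>}" for f
    using that by (simp add: path_algebra_simps PiE_iff extensional_def)
  \<comment> \<open>Elements are \<open>undefined\<close> outside the set of paths, so equality can
    be tested on paths.\<close>
  have eqI: "f = g" if "f \<in> carrier ?A" "g \<in> carrier ?A" "\<And>u p. (u, p) \<in> ?P \<Longrightarrow> f (u, p) = g (u, p)" for f g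
  proof
    fix x show "f x = g x"
    proof (cases "x \<in> ?P")
      case True then show ?thesis using that(3)[of "fst x" "snd x"] by simp
    next
      case False then show ?thesis using ext[OF that(1)] ext[OF that(2)] by simp
    qed
  qed
  have sp: "(u, take i p) \<in> ?P" "(Q.awalk_verts u p ! i, drop i p) \<in> ?P" if "(u, p) \<in> ?P" "i \<le> length p" for u p i
    using that Q.awalk_split P by blast+
  have mult: "(f \<otimes>\<^bsub>?A\<^esub> g) (u, p) = (\<Oplus>\<^bsub>K\<^esub>i\<in>{..length p}. f (u, take i p) \<otimes>\<^bsub>K\<^esub> g (Q.awalk_verts u p ! i, drop i p))" if "(u, p) \<in> ?P" for f g u p
    using that by (simp add: path_algebra_simps)
  have tc: "f (u, take i p) \<otimes>\<^bsub>K\<^esub> g (Q.awalk_verts u p ! i, drop i p) \<in> carrier K"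
    if "f \<in> carrier ?A" "g \<in> carrier ?A" "(u, p) \<in> ?P" "i \<le> length p" for f g u p i
    using val[OF that(1) sp(1)[OF that(3,4)]] val[OF that(2) sp(2)[OF that(3,4)]] by simp
  have mc: "f \<otimes>\<^bsub>?A\<^esub> g \<in> carrier ?A" if f: "f \<in> carrier ?A" and g: "g \<in> carrier ?A" for f g
  proof (rule mem)
    fix x assume x: "x \<in> ?P"
    obtain u p where up: "x = (u, p)" by (cases x)
    show "(f \<otimes>\<^bsub>?A\<^esub> g) x \<in> carrier K" unfolding up using tc[OF f g] x up by (subst mult) (auto intro!: K.finsum_closed)
  next
    fix x assume "x \<notin> ?P" then show "(f \<otimes>\<^bsub>?A\<^esub> g) x = undefined" by (simp add: path_algebra_simps)
  next
    let ?S = "{p \<in> ?P. f p \<noteq> \<zero>\<^bsub>K\<^esub>}" and ?T = "{p \<in> ?P. g p \<noteq> \<zero>\<^bsub>K\<^esub>}"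
    \<comment> \<open>A nonzero coefficient has a nonzero term, so its path is a concatenation of
      paths from the two supports.\<close>
    have "{p \<in> ?P. (f \<otimes>\<^bsub>?A\<^esub> g) p \<noteq> \<zero>\<^bsub>K\<^esub>} \<subseteq> (\<lambda>((u, p), (v, q)). (u, p @ q)) ` (?S \<times> ?T)"
    proof
      fix x assume x: "x \<in> {p \<in> ?P. (f \<otimes>\<^bsub>?A\<^esub> g) p \<noteq> \<zero>\<^bsub>K\<^esub>}"
      obtain u p where up: "x = (u, p)" by (cases x)
      have upP: "(u, p) \<in> ?P" using x up by simp
      have "\<exists>i\<le>length p. f (u, take i p) \<otimes>\<^bsub>K\<^esub> g (Q.awalk_verts u p ! i, drop i p) \<noteq> \<zero>\<^bsub>K\<^esub>"
      proof (rule ccontr)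
        assume "\<not> ?thesis"
        then have "(\<Oplus>\<^bsub>K\<^esub>i\<in>{..length p}. f (u, take i p) \<otimes>\<^bsub>K\<^esub> g (Q.awalk_verts u p ! i, drop i p)) = (\<Oplus>\<^bsub>K\<^esub>i\<in>{..length p}. \<zero>\<^bsub>K\<^esub>)"
          by (intro K.finsum_cong') auto
        then show False using x up mult[OF upP] by simp
      qed
      then obtain i where i: "i \<le> length p" "f (u, take i p) \<otimes>\<^bsub>K\<^esub> g (Q.awalk_verts u p ! i, drop i p) \<noteq> \<zero>\<^bsub>K\<^esub>" by blast
      note s = sp[OF upP i(1)]
      have "f (u, take i p) \<noteq> \<zero>\<^bsub>K\<^esub>" "g (Q.awalk_verts u p ! i, drop i p) \<noteq> \<zero>\<^bsub>K\<^esub>"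
        using i(2) val[OF f s(1)] val[OF g s(2)] by auto
      then show "x \<in> (\<lambda>((u, p), (v, q)). (u, p @ q)) ` (?S \<times> ?T)"
        using s up by (intro image_eqI[of _ _ "((u, take i p), (Q.awalk_verts u p ! i, drop i p))"]) auto
    qed
    then show "finite {p \<in> ?P. (f \<otimes>\<^bsub>?A\<^esub> g) p \<noteq> \<zero>\<^bsub>K\<^esub>}"
      by (rule finite_subset) (use fin[OF f] fin[OF g] in blast)
  qed
  have oc: "\<one>\<^bsub>?A\<^esub> \<in> carrier ?A"
  proof (rule mem)
    have "{p \<in> ?P. \<one>\<^bsub>?A\<^esub> p \<noteq> \<zero>\<^bsub>K\<^esub>} \<subseteq> (\<lambda>u. (u, [])) ` verts Q"
      by (auto simp: path_algebra_simps P Q.awalk_Nil_iff split: if_splits)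
    then show "finite {p \<in> ?P. \<one>\<^bsub>?A\<^esub> p \<noteq> \<zero>\<^bsub>K\<^esub>}" by (rule finite_subset) simp
  qed (auto simp: path_algebra_simps)
  have assoc: "(f \<otimes>\<^bsub>?A\<^esub> g) \<otimes>\<^bsub>?A\<^esub> h = f \<otimes>\<^bsub>?A\<^esub> (g \<otimes>\<^bsub>?A\<^esub> h)"
    if f: "f \<in> carrier ?A" and g: "g \<in> carrier ?A" and h: "h \<in> carrier ?A" for f g h
  proof (rule eqI)
    fix u p assume up: "(u, p) \<in> ?P"
    then obtain w where w: "Q.awalk u p w" using P by blast
    define v where "v i = Q.awalk_verts u p ! i" for i
    \<comment> \<open>The term of the triple product that belongs to cuts at the vertices number
      \<open>i\<close> and \<open>j\<close>.\<close>
    define F where "F i j = f (u, take i p) \<otimes>\<^bsub>K\<^esub> (g (v i, take (j - i) (drop i p)) \<otimes>\<^bsub>K\<^esub> h (v j, drop j p))" for i j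
    have fi: "f (u, take i p) \<in> carrier K" if "i \<le> length p" for i using val[OF f sp(1)[OF up that]] .
    have hj: "h (v j, drop j p) \<in> carrier K" if "j \<le> length p" for j using val[OF h sp(2)[OF up that]] by (simp add: v_def)
    have gij: "g (v i, take (j - i) (drop i p)) \<in> carrier K" if "i \<le> j" "j \<le> length p" for i j
    proof (rule val[OF g])
      have "(v i, drop i p) \<in> ?P" using sp(2)[OF up, of i] that by (simp add: v_def)
      from sp(1)[OF this, of "j - i"] show "(v i, take (j - i) (drop i p)) \<in> ?P" using that by simp
    qed
    have Fc: "F i j \<in> carrier K" if "i \<le> j" "j \<le> length p" for i j
      using fi[of i] gij[OF that] hj[of j] that by (simp add: F_def)
    have L: "(f \<otimes>\<^bsub>?A\<^esub> g) (u, take j p) \<otimes>\<^bsub>K\<^esub> h (v j, drop j p) = (\<Oplus>\<^bsub>K\<^esub>i\<in>{..j}. F i j)" if j: "j \<le> length p" for j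
    proof -
      have t: "f (u, take i (take j p)) \<otimes>\<^bsub>K\<^esub> g (Q.awalk_verts u (take j p) ! i, drop i (take j p)) = f (u, take i p) \<otimes>\<^bsub>K\<^esub> g (v i, take (j - i) (drop i p))" if "i \<le> j" for i
        using that j Q.awalk_verts_take[OF w that j] by (simp add: v_def drop_take min_absorb1)
      have c: "f (u, take i p) \<otimes>\<^bsub>K\<^esub> g (v i, take (j - i) (drop i p)) \<in> carrier K" if "i \<le> j" for i
        using fi[of i] gij[OF that j] that j by simp
      have "(f \<otimes>\<^bsub>?A\<^esub> g) (u, take j p) = (\<Oplus>\<^bsub>K\<^esub>i\<in>{..j}. f (u, take i (take j p)) \<otimes>\<^bsub>K\<^esub> g (Q.awalk_verts u (take j p) ! i, drop i (take j p)))"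
        using mult[OF sp(1)[OF up j]] j by (simp add: min_absorb2)
      also have "\<dots> = (\<Oplus>\<^bsub>K\<^esub>i\<in>{..j}. f (u, take i p) \<otimes>\<^bsub>K\<^esub> g (v i, take (j - i) (drop i p)))"
        by (rule K.finsum_cong'[OF refl]) (use t c in auto)
      finally have "(f \<otimes>\<^bsub>?A\<^esub> g) (u, take j p) \<otimes>\<^bsub>K\<^esub> h (v j, drop j p) = (\<Oplus>\<^bsub>K\<^esub>i\<in>{..j}. f (u, take i p) \<otimes>\<^bsub>K\<^esub> g (v i, take (j - i) (drop i p)) \<otimes>\<^bsub>K\<^esub> h (v j, drop j p))"
        using c hj[OF j] by (simp add: K.finsum_ldistr Pi_def)
      also have "\<dots> = (\<Oplus>\<^bsub>K\<^esub>i\<in>{..j}. F i j)"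
        by (rule K.finsum_cong'[OF refl]) (use Fc j fi gij hj in \<open>auto simp: F_def K.m_assoc\<close>)
      finally show ?thesis .
    qed
    have R: "f (u, take i p) \<otimes>\<^bsub>K\<^esub> (g \<otimes>\<^bsub>?A\<^esub> h) (v i, drop i p) = (\<Oplus>\<^bsub>K\<^esub>k\<in>{..length p - i}. F i (i + k))" if i: "i \<le> length p" for i
    proof -
      have t: "g (v i, take k (drop i p)) \<otimes>\<^bsub>K\<^esub> h (Q.awalk_verts (v i) (drop i p) ! k, drop k (drop i p)) = g (v i, take k (drop i p)) \<otimes>\<^bsub>K\<^esub> h (v (i + k), drop (i + k) p)" if "k \<le> length p - i" for k
        using that i Q.awalk_verts_drop[OF w, of i k] by (simp add: v_def add.commute)
      have c: "g (v i, take k (drop i p)) \<otimes>\<^bsub>K\<^esub> h (v (i + k), drop (i + k) p) \<in> carrier K" if "k \<le> length p - i" for k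
        using gij[of i "i + k"] hj[of "i + k"] i that by simp
      have "(g \<otimes>\<^bsub>?A\<^esub> h) (v i, drop i p) = (\<Oplus>\<^bsub>K\<^esub>k\<in>{..length p - i}. g (v i, take k (drop i p)) \<otimes>\<^bsub>K\<^esub> h (Q.awalk_verts (v i) (drop i p) ! k, drop k (drop i p)))"
        using mult[OF sp(2)[OF up i]] by (simp add: v_def)
      also have "\<dots> = (\<Oplus>\<^bsub>K\<^esub>k\<in>{..length p - i}. g (v i, take k (drop i p)) \<otimes>\<^bsub>K\<^esub> h (v (i + k), drop (i + k) p))"
        by (rule K.finsum_cong'[OF refl]) (use t c in auto)
      finally have "f (u, take i p) \<otimes>\<^bsub>K\<^esub> (g \<otimes>\<^bsub>?A\<^esub> h) (v i, drop i p) = (\<Oplus>\<^bsub>K\<^esub>k\<in>{..length p - i}. f (u, take i p) \<otimes>\<^bsub>K\<^esub> (g (v i, take k (drop i p)) \<otimes>\<^bsub>K\<^esub> h (v (i + k), drop (i + k) p)))"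
        using c fi[OF i] by (simp add: K.finsum_rdistr Pi_def)
      then show ?thesis by (simp add: F_def)
    qed
    have "((f \<otimes>\<^bsub>?A\<^esub> g) \<otimes>\<^bsub>?A\<^esub> h) (u, p) = (\<Oplus>\<^bsub>K\<^esub>j\<in>{..length p}. (f \<otimes>\<^bsub>?A\<^esub> g) (u, take j p) \<otimes>\<^bsub>K\<^esub> h (v j, drop j p))"
      using mult[OF up] by (simp add: v_def)
    also have "\<dots> = (\<Oplus>\<^bsub>K\<^esub>j\<in>{..length p}. \<Oplus>\<^bsub>K\<^esub>i\<in>{..j}. F i j)"
      by (rule K.finsum_cong'[OF refl]) (use L Fc in \<open>auto intro!: K.finsum_closed\<close>)
    also have "\<dots> = (\<Oplus>\<^bsub>K\<^esub>i\<in>{..length p}. \<Oplus>\<^bsub>K\<^esub>k\<in>{..length p - i}. F i (i + k))"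
      by (rule K.finsum_triangle) (rule Fc)
    also have "\<dots> = (\<Oplus>\<^bsub>K\<^esub>i\<in>{..length p}. f (u, take i p) \<otimes>\<^bsub>K\<^esub> (g \<otimes>\<^bsub>?A\<^esub> h) (v i, drop i p))"
    proof (rule K.finsum_cong'[OF refl])
      show "(\<lambda>i. f (u, take i p) \<otimes>\<^bsub>K\<^esub> (g \<otimes>\<^bsub>?A\<^esub> h) (v i, drop i p)) \<in> {..length p} \<rightarrow> carrier K"
        using tc[OF f mc[OF g h] up] by (auto simp: v_def)
    qed (use R in auto)
    also have "\<dots> = (f \<otimes>\<^bsub>?A\<^esub> (g \<otimes>\<^bsub>?A\<^esub> h)) (u, p)" using mult[OF up] by (simp add: v_def)
    finally show "((f \<otimes>\<^bsub>?A\<^esub> g) \<otimes>\<^bsub>?A\<^esub> h) (u, p) = (f \<otimes>\<^bsub>?A\<^esub> (g \<otimes>\<^bsub>?A\<^esub> h)) (u, p)" .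
  qed (use mc f g h in auto)
  \<comment> \<open>Only the cut in front of the first arrow contributes, since the unit is
    supported on trivial paths.\<close>
  have one_l: "\<one>\<^bsub>?A\<^esub> \<otimes>\<^bsub>?A\<^esub> f = f" if f: "f \<in> carrier ?A" for f
  proof (rule eqI)
    fix u p assume up: "(u, p) \<in> ?P"
    then obtain w where w: "Q.awalk u p w" using P by blast
    have "(\<one>\<^bsub>?A\<^esub> \<otimes>\<^bsub>?A\<^esub> f) (u, p) = (\<Oplus>\<^bsub>K\<^esub>i\<in>{..length p}. if 0 = i then f (u, p) else \<zero>\<^bsub>K\<^esub>)"
      unfolding mult[OF up]
    proof (rule K.finsum_cong'[OF refl])
      fix i assume i: "i \<in> {..length p}"
      show "\<one>\<^bsub>?A\<^esub> (u, take i p) \<otimes>\<^bsub>K\<^esub> f (Q.awalk_verts u p ! i, drop i p) = (if 0 = i then f (u, p) else \<zero>\<^bsub>K\<^esub>)"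
        using i sp[OF up, of i] val[OF f sp(2)[OF up, of i]] Q.awalk_verts_0[OF w] val[OF f up] by (auto simp: path_algebra_simps)
    qed (use val[OF f up] in auto)
    also have "\<dots> = f (u, p)" using val[OF f up] by (intro K.finsum_singleton) auto
    finally show "(\<one>\<^bsub>?A\<^esub> \<otimes>\<^bsub>?A\<^esub> f) (u, p) = f (u, p)" .
  qed (use mc oc f in auto)
  have one_r: "f \<otimes>\<^bsub>?A\<^esub> \<one>\<^bsub>?A\<^esub> = f" if f: "f \<in> carrier ?A" for f
  proof (rule eqI)
    fix u p assume up: "(u, p) \<in> ?P"
    have "(f \<otimes>\<^bsub>?A\<^esub> \<one>\<^bsub>?A\<^esub>) (u, p) = (\<Oplus>\<^bsub>K\<^esub>i\<in>{..length p}. if length p = i then f (u, p) else \<zero>\<^bsub>K\<^esub>)"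
      unfolding mult[OF up]
    proof (rule K.finsum_cong'[OF refl])
      fix i assume i: "i \<in> {..length p}"
      show "f (u, take i p) \<otimes>\<^bsub>K\<^esub> \<one>\<^bsub>?A\<^esub> (Q.awalk_verts u p ! i, drop i p) = (if length p = i then f (u, p) else \<zero>\<^bsub>K\<^esub>)"
        using i sp[OF up, of i] val[OF f sp(1)[OF up, of i]] val[OF f up] by (auto simp: path_algebra_simps)
    qed (use val[OF f up] in auto)
    also have "\<dots> = f (u, p)" using val[OF f up] by (intro K.finsum_singleton) auto
    finally show "(f \<otimes>\<^bsub>?A\<^esub> \<one>\<^bsub>?A\<^esub>) (u, p) = f (u, p)" .
  qed (use mc oc f in auto)
  have plus: "(f \<oplus>\<^bsub>?A\<^esub> g) x = f x \<oplus>\<^bsub>K\<^esub> g x" if "x \<in> ?P" for f g x using that by (simp add: path_algebra_simps)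
  have sm: "(c \<odot>\<^bsub>?A\<^esub> f) x = c \<otimes>\<^bsub>K\<^esub> f x" if "x \<in> ?P" for c f x using that by (simp add: path_algebra_simps)
  have dl: "(f \<oplus>\<^bsub>?A\<^esub> g) \<otimes>\<^bsub>?A\<^esub> h = f \<otimes>\<^bsub>?A\<^esub> h \<oplus>\<^bsub>?A\<^esub> g \<otimes>\<^bsub>?A\<^esub> h"
    if f: "f \<in> carrier ?A" and g: "g \<in> carrier ?A" and h: "h \<in> carrier ?A" for f g h
  proof (rule eqI)
    fix u p assume up: "(u, p) \<in> ?P"
    show "((f \<oplus>\<^bsub>?A\<^esub> g) \<otimes>\<^bsub>?A\<^esub> h) (u, p) = (f \<otimes>\<^bsub>?A\<^esub> h \<oplus>\<^bsub>?A\<^esub> g \<otimes>\<^bsub>?A\<^esub> h) (u, p)"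
      unfolding plus[OF up] mult[OF up]
    proof (subst K.finsum_addf[symmetric])
      show "(\<Oplus>\<^bsub>K\<^esub>i\<in>{..length p}. (f \<oplus>\<^bsub>?A\<^esub> g) (u, take i p) \<otimes>\<^bsub>K\<^esub> h (Q.awalk_verts u p ! i, drop i p)) =
        (\<Oplus>\<^bsub>K\<^esub>i\<in>{..length p}. f (u, take i p) \<otimes>\<^bsub>K\<^esub> h (Q.awalk_verts u p ! i, drop i p) \<oplus>\<^bsub>K\<^esub> g (u, take i p) \<otimes>\<^bsub>K\<^esub> h (Q.awalk_verts u p ! i, drop i p))"
        by (rule K.finsum_cong'[OF refl]) (use sp[OF up] tc[OF f h up] tc[OF g h up] val[OF f] val[OF g] val[OF h] in \<open>auto simp: plus K.l_distr\<close>)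
    qed (use tc[OF f h up] tc[OF g h up] in auto)
  qed (use mc f g h in auto)
  have dr: "h \<otimes>\<^bsub>?A\<^esub> (f \<oplus>\<^bsub>?A\<^esub> g) = h \<otimes>\<^bsub>?A\<^esub> f \<oplus>\<^bsub>?A\<^esub> h \<otimes>\<^bsub>?A\<^esub> g"
    if f: "f \<in> carrier ?A" and g: "g \<in> carrier ?A" and h: "h \<in> carrier ?A" for f g h
  proof (rule eqI)
    fix u p assume up: "(u, p) \<in> ?P"
    show "(h \<otimes>\<^bsub>?A\<^esub> (f \<oplus>\<^bsub>?A\<^esub> g)) (u, p) = (h \<otimes>\<^bsub>?A\<^esub> f \<oplus>\<^bsub>?A\<^esub> h \<otimes>\<^bsub>?A\<^esub> g) (u, p)"
      unfolding plus[OF up] mult[OF up]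
    proof (subst K.finsum_addf[symmetric])
      show "(\<Oplus>\<^bsub>K\<^esub>i\<in>{..length p}. h (u, take i p) \<otimes>\<^bsub>K\<^esub> (f \<oplus>\<^bsub>?A\<^esub> g) (Q.awalk_verts u p ! i, drop i p)) =
        (\<Oplus>\<^bsub>K\<^esub>i\<in>{..length p}. h (u, take i p) \<otimes>\<^bsub>K\<^esub> f (Q.awalk_verts u p ! i, drop i p) \<oplus>\<^bsub>K\<^esub> h (u, take i p) \<otimes>\<^bsub>K\<^esub> g (Q.awalk_verts u p ! i, drop i p))"
        by (rule K.finsum_cong'[OF refl]) (use sp[OF up] tc[OF h f up] tc[OF h g up] val[OF f] val[OF g] val[OF h] in \<open>auto simp: plus K.r_distr\<close>)
    qed (use tc[OF h f up] tc[OF h g up] in auto)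
  qed (use mc f g h in auto)
  have ring: "ring ?A"
    by (rule ringI[OF KA.M.abelian_group_axioms]) (auto intro!: monoidI mc oc assoc one_l one_r dl dr)
  have s1: "c \<odot>\<^bsub>?A\<^esub> (f \<otimes>\<^bsub>?A\<^esub> g) = (c \<odot>\<^bsub>?A\<^esub> f) \<otimes>\<^bsub>?A\<^esub> g" "c \<odot>\<^bsub>?A\<^esub> (f \<otimes>\<^bsub>?A\<^esub> g) = f \<otimes>\<^bsub>?A\<^esub> (c \<odot>\<^bsub>?A\<^esub> g)"
    if c: "c \<in> carrier K" and f: "f \<in> carrier ?A" and g: "g \<in> carrier ?A" for c f g
  proof -
    have main: "(c \<odot>\<^bsub>?A\<^esub> (f \<otimes>\<^bsub>?A\<^esub> g)) (u, p) = (\<Oplus>\<^bsub>K\<^esub>i\<in>{..length p}. c \<otimes>\<^bsub>K\<^esub> (f (u, take i p) \<otimes>\<^bsub>K\<^esub> g (Q.awalk_verts u p ! i, drop i p)))"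
      if up: "(u, p) \<in> ?P" for u p
      unfolding sm[OF up] mult[OF up] by (rule K.finsum_rdistr) (use tc[OF f g up] c in auto)
    show "c \<odot>\<^bsub>?A\<^esub> (f \<otimes>\<^bsub>?A\<^esub> g) = (c \<odot>\<^bsub>?A\<^esub> f) \<otimes>\<^bsub>?A\<^esub> g"
    proof (rule eqI)
      fix u p assume up: "(u, p) \<in> ?P"
      show "(c \<odot>\<^bsub>?A\<^esub> (f \<otimes>\<^bsub>?A\<^esub> g)) (u, p) = ((c \<odot>\<^bsub>?A\<^esub> f) \<otimes>\<^bsub>?A\<^esub> g) (u, p)"
        unfolding main[OF up] mult[OF up]
        by (rule K.finsum_cong'[OF refl]) (use sp[OF up] val[OF f] val[OF g] c in \<open>auto simp: sm K.m_assoc\<close>)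
    qed (use mc f g c in \<open>auto intro!: KA.smult_closed\<close>)
    show "c \<odot>\<^bsub>?A\<^esub> (f \<otimes>\<^bsub>?A\<^esub> g) = f \<otimes>\<^bsub>?A\<^esub> (c \<odot>\<^bsub>?A\<^esub> g)"
    proof (rule eqI)
      fix u p assume up: "(u, p) \<in> ?P"
      show "(c \<odot>\<^bsub>?A\<^esub> (f \<otimes>\<^bsub>?A\<^esub> g)) (u, p) = (f \<otimes>\<^bsub>?A\<^esub> (c \<odot>\<^bsub>?A\<^esub> g)) (u, p)"
        unfolding main[OF up] mult[OF up]
        by (rule K.finsum_cong'[OF refl]) (use sp[OF up] val[OF f] val[OF g] c in \<open>auto simp: sm K.m_lcomm\<close>)
    qed (use mc f g c in \<open>auto intro!: KA.smult_closed\<close>)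
  qed
  show ?thesis
    by (rule fd_algebra.intro[OF assms(1) ring assms(3)]) (use s1 in auto)
qed

section \<open>Duplicated algebras\<close>

text \<open>Packs the dual space into a record, so that the results on modules and vector spaces
  apply to it.\<close>

definition dual_module :: "'k ring \<Rightarrow> ('k, 'a) module \<Rightarrow> ('k, 'a \<Rightarrow> 'k) module" where
  "dual_module K A = \<lparr>carrier = dual K A, mult = undefined, one = undefined,
     zero = (\<lambda>x\<in>carrier A. \<zero>\<^bsub>K\<^esub>), add = dual_add K A, smult = (\<lambda>c \<phi>. \<lambda>x\<in>carrier A. c \<otimes>\<^bsub>K\<^esub> \<phi> x)\<rparr>"

lemma dual_module_simps [simp]:
  "carrier (dual_module K A) = dual K A" "zero (dual_module K A) = (\<lambda>x\<in>carrier A. \<zero>\<^bsub>K\<^esub>)"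
  "add (dual_module K A) = dual_add K A" "c \<odot>\<^bsub>dual_module K A\<^esub> \<phi> = (\<lambda>x\<in>carrier A. c \<otimes>\<^bsub>K\<^esub> \<phi> x)"
  by (simp_all add: dual_module_def)

lemma duplicated_algebra_simps:
  "carrier (duplicated_algebra K A) = carrier A \<times> dual K A \<times> carrier A"
  "(a, \<phi>, b) \<otimes>\<^bsub>duplicated_algebra K A\<^esub> (a', \<phi>', b') =
     (a \<otimes>\<^bsub>A\<^esub> a', dual_add K A (dual_right A \<phi> a') (dual_left A b \<phi>'), b \<otimes>\<^bsub>A\<^esub> b')"
  "\<one>\<^bsub>duplicated_algebra K A\<^esub> = (\<one>\<^bsub>A\<^esub>, \<lambda>x\<in>carrier A. \<zero>\<^bsub>K\<^esub>, \<one>\<^bsub>A\<^esub>)"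
  "\<zero>\<^bsub>duplicated_algebra K A\<^esub> = (\<zero>\<^bsub>A\<^esub>, \<lambda>x\<in>carrier A. \<zero>\<^bsub>K\<^esub>, \<zero>\<^bsub>A\<^esub>)"
  "(a, \<phi>, b) \<oplus>\<^bsub>duplicated_algebra K A\<^esub> (a', \<phi>', b') = (a \<oplus>\<^bsub>A\<^esub> a', dual_add K A \<phi> \<phi>', b \<oplus>\<^bsub>A\<^esub> b')"
  "c \<odot>\<^bsub>duplicated_algebra K A\<^esub> (a, \<phi>, b) = (c \<odot>\<^bsub>A\<^esub> a, \<lambda>x\<in>carrier A. c \<otimes>\<^bsub>K\<^esub> \<phi> x, c \<odot>\<^bsub>A\<^esub> b)"
  by (simp_all add: duplicated_algebra_def)

lemma dual_ext:
  assumes "\<phi> \<in> dual K A" "\<psi> \<in> dual K A" "\<And>x. x \<in> carrier A \<Longrightarrow> \<phi> x = \<psi> x"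
  shows "\<phi> = \<psi>"
  using assms unfolding dual_def by (auto intro: extensionalityI)

lemma dual_closed: "\<phi> \<in> dual K A \<Longrightarrow> x \<in> carrier A \<Longrightarrow> \<phi> x \<in> carrier K"
  and dual_plus: "\<phi> \<in> dual K A \<Longrightarrow> x \<in> carrier A \<Longrightarrow> y \<in> carrier A \<Longrightarrow> \<phi> (x \<oplus>\<^bsub>A\<^esub> y) = \<phi> x \<oplus>\<^bsub>K\<^esub> \<phi> y"
  and dual_smult: "\<phi> \<in> dual K A \<Longrightarrow> c \<in> carrier K \<Longrightarrow> x \<in> carrier A \<Longrightarrow> \<phi> (c \<odot>\<^bsub>A\<^esub> x) = c \<otimes>\<^bsub>K\<^esub> \<phi> x"
  unfolding dual_def using hom_closed[of \<phi> K A "regular_module K"] hom_add[of \<phi> K A "regular_module K"] hom_smult[of \<phi> K A "regular_module K"] by auto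

lemma dual_apply [simp]:
  "x \<in> carrier A \<Longrightarrow> dual_add K A \<phi> \<psi> x = \<phi> x \<oplus>\<^bsub>K\<^esub> \<psi> x"
  "x \<in> carrier A \<Longrightarrow> dual_left A b \<phi> x = \<phi> (x \<otimes>\<^bsub>A\<^esub> b)"
  "x \<in> carrier A \<Longrightarrow> dual_right A \<phi> a x = \<phi> (a \<otimes>\<^bsub>A\<^esub> x)"
  by (simp_all add: dual_add_def dual_left_def dual_right_def)

context fd_algebra
begin

lemma dualI:
  assumes "\<And>x. x \<in> carrier L \<Longrightarrow> f x \<in> carrier K"
    "\<And>x y. x \<in> carrier L \<Longrightarrow> y \<in> carrier L \<Longrightarrow> f (x \<oplus>\<^bsub>L\<^esub> y) = f x \<oplus>\<^bsub>K\<^esub> f y"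
    "\<And>c x. c \<in> carrier K \<Longrightarrow> x \<in> carrier L \<Longrightarrow> f (c \<odot>\<^bsub>L\<^esub> x) = c \<otimes>\<^bsub>K\<^esub> f x"
  shows "(\<lambda>x\<in>carrier L. f x) \<in> dual K L"
  unfolding dual_def using assms by (auto intro!: mod_homI simp: KL.smult_closed)

lemma dual_ops_closed:
  "\<phi> \<in> dual K L \<Longrightarrow> \<psi> \<in> dual K L \<Longrightarrow> dual_add K L \<phi> \<psi> \<in> dual K L"
  "b \<in> carrier L \<Longrightarrow> \<phi> \<in> dual K L \<Longrightarrow> dual_left L b \<phi> \<in> dual K L"
  "a \<in> carrier L \<Longrightarrow> \<phi> \<in> dual K L \<Longrightarrow> dual_right L \<phi> a \<in> dual K L"
  "c \<in> carrier K \<Longrightarrow> \<phi> \<in> dual K L \<Longrightarrow> (\<lambda>x\<in>carrier L. c \<otimes>\<^bsub>K\<^esub> \<phi> x) \<in> dual K L"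
  "(\<lambda>x\<in>carrier L. \<zero>\<^bsub>K\<^esub>) \<in> dual K L"
  unfolding dual_add_def dual_left_def dual_right_def
  by (rule dualI; simp add: dual_closed dual_plus dual_smult K.a_ac K.m_ac K.r_distr L.l_distr L.r_distr
      scalar_left[symmetric] scalar_right[symmetric] KL.smult_closed)+

lemma left_module_dual: "left_module K (dual_module K L)"
proof (rule left_moduleI[OF K.ring_axioms])
  show "abelian_group (dual_module K L)"
  proof (rule abelian_groupI)
    fix \<phi> assume p: "\<phi> \<in> carrier (dual_module K L)"
    then show "\<exists>\<psi>\<in>carrier (dual_module K L). \<psi> \<oplus>\<^bsub>dual_module K L\<^esub> \<phi> = \<zero>\<^bsub>dual_module K L\<^esub>"
    proof (intro bexI[of _ "\<lambda>x\<in>carrier L. (\<ominus>\<^bsub>K\<^esub> \<one>\<^bsub>K\<^esub>) \<otimes>\<^bsub>K\<^esub> \<phi> x"])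
      show "(\<lambda>x\<in>carrier L. (\<ominus>\<^bsub>K\<^esub> \<one>\<^bsub>K\<^esub>) \<otimes>\<^bsub>K\<^esub> \<phi> x) \<oplus>\<^bsub>dual_module K L\<^esub> \<phi> = \<zero>\<^bsub>dual_module K L\<^esub>"
        using p dual_closed[of \<phi> K L] unfolding dual_module_simps dual_add_def by (auto simp: fun_eq_iff K.l_minus K.l_neg)
    qed (use p in \<open>simp add: dual_ops_closed\<close>)
  qed (auto simp: dual_ops_closed dual_closed K.a_ac intro!: dual_ext[of _ K L])
next
  fix a b \<phi> assume "a \<in> carrier K" "b \<in> carrier K" "\<phi> \<in> carrier (dual_module K L)"
  then show "(a \<otimes>\<^bsub>K\<^esub> b) \<odot>\<^bsub>dual_module K L\<^esub> \<phi> = a \<odot>\<^bsub>dual_module K L\<^esub> (b \<odot>\<^bsub>dual_module K L\<^esub> \<phi>)"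
    by (auto simp: fun_eq_iff restrict_def dual_closed K.m_assoc)
qed (auto simp: dual_ops_closed dual_closed K.l_distr K.r_distr intro!: dual_ext[of _ K L])

lemma dual_eval_hom: "x \<in> carrier L \<Longrightarrow> (\<lambda>\<phi>. \<phi> x) \<in> mod_hom K (dual_module K L) (regular_module K)"
  by (rule mod_homI) (auto simp: dual_closed)

text \<open>Evaluation at an element reduces the expansion of a functional to that of the element.
  Finite dimension of the dual, separation of points and reflexivity are read off from these
  formulas.\<close>

lemma dual_basis_expansion:
  obtains n a l where "\<And>i. i < n \<Longrightarrow> a i \<in> carrier L" "\<And>i. i < n \<Longrightarrow> l i \<in> dual K L"
    "\<And>\<phi>. \<phi> \<in> dual K L \<Longrightarrow> \<phi> = (\<Oplus>\<^bsub>dual_module K L\<^esub>i\<in>{..<n::nat}. \<phi> (a i) \<odot>\<^bsub>dual_module K L\<^esub> l i)"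
    "\<And>x. x \<in> carrier L \<Longrightarrow> x = (\<Oplus>\<^bsub>L\<^esub>i\<in>{..<n}. l i x \<odot>\<^bsub>L\<^esub> a i)"
proof -
  obtain n a l where al: "\<And>i. i < n \<Longrightarrow> a i \<in> carrier L" "\<And>i. i < n \<Longrightarrow> l i \<in> mod_hom K L (regular_module K)"
    "\<And>x. x \<in> carrier L \<Longrightarrow> x = (\<Oplus>\<^bsub>L\<^esub>i\<in>{..<n::nat}. l i x \<odot>\<^bsub>L\<^esub> a i)"
    by (rule dual_basis[OF K_field L_fg]) blast
  interpret DL: left_module K "dual_module K L" by (rule left_module_dual)
  have lr: "left_module K (regular_module K)" by (rule left_module_regular[OF K.ring_axioms])
  \<comment> \<open>Elements of the dual have to be \<open>undefined\<close> outside the carrier,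
    which \<open>dual_basis\<close> does not guarantee.\<close>
  define l' where "l' i = restrict (l i) (carrier L)" for i
  have l': "l' i \<in> dual K L" if "i < n" for i
    unfolding l'_def using hom_closed[OF al(2)[OF that]] hom_add[OF al(2)[OF that]] hom_smult[OF al(2)[OF that]]
    by (intro dualI) auto
  have x': "x = (\<Oplus>\<^bsub>L\<^esub>i\<in>{..<n}. l' i x \<odot>\<^bsub>L\<^esub> a i)" if "x \<in> carrier L" for x
    using al(3)[OF that] that by (simp add: l'_def)
  have c: "l' i x \<odot>\<^bsub>L\<^esub> a i \<in> carrier L" if "i < n" "x \<in> carrier L" for i x
    using dual_closed[OF l'[OF that(1)] that(2)] al(1)[OF that(1)] by (rule KL.smult_closed)
  show ?thesis
  proof (rule that[OF al(1) l' _ x'])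
    fix \<phi> assume p: "\<phi> \<in> dual K L"
    have c2: "(\<lambda>i. \<phi> (a i) \<odot>\<^bsub>dual_module K L\<^esub> l' i) \<in> {..<n} \<rightarrow> carrier (dual_module K L)"
      using DL.smult_closed[OF dual_closed[OF p al(1)]] l' by auto
    show "\<phi> = (\<Oplus>\<^bsub>dual_module K L\<^esub>i\<in>{..<n}. \<phi> (a i) \<odot>\<^bsub>dual_module K L\<^esub> l' i)"
    proof (rule dual_ext[OF p])
      show "(\<Oplus>\<^bsub>dual_module K L\<^esub>i\<in>{..<n}. \<phi> (a i) \<odot>\<^bsub>dual_module K L\<^esub> l' i) \<in> dual K L"
        using DL.M.finsum_closed[OF c2] by simp
      fix x assume x: "x \<in> carrier L"
      have ph: "\<phi> \<in> mod_hom K L (regular_module K)" using p by (simp add: dual_def)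
      have "\<phi> x = \<phi> (\<Oplus>\<^bsub>L\<^esub>i\<in>{..<n}. l' i x \<odot>\<^bsub>L\<^esub> a i)" using x'[OF x] by simp
      also have "\<dots> = (\<Oplus>\<^bsub>regular_module K\<^esub>i\<in>{..<n}. \<phi> (l' i x \<odot>\<^bsub>L\<^esub> a i))"
        by (rule hom_finsum[OF ph KL.left_module_axioms lr]) (use c x in auto)
      also have "\<dots> = (\<Oplus>\<^bsub>regular_module K\<^esub>i\<in>{..<n}. (\<phi> (a i) \<odot>\<^bsub>dual_module K L\<^esub> l' i) x)"
      proof (rule abelian_monoid.finsum_cong'[OF _ refl])
        show "abelian_monoid (regular_module K)" using lr unfolding left_module_def abelian_group_def by blast
        have lx: "l' i x \<in> carrier K" "\<phi> (a i) \<in> carrier K" if "i < n" for i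
          using dual_closed[OF l'[OF that] x] dual_closed[OF p al(1)[OF that]] by auto
        show "(\<lambda>i. (\<phi> (a i) \<odot>\<^bsub>dual_module K L\<^esub> l' i) x) \<in> {..<n} \<rightarrow> carrier (regular_module K)"
          using lx x by auto
        fix i assume i: "i \<in> {..<n}"
        then show "\<phi> (l' i x \<odot>\<^bsub>L\<^esub> a i) = (\<phi> (a i) \<odot>\<^bsub>dual_module K L\<^esub> l' i) x"
          using lx x al(1) by (simp add: dual_smult[OF p] K.m_comm)
      qed
      also have "\<dots> = (\<Oplus>\<^bsub>dual_module K L\<^esub>i\<in>{..<n}. \<phi> (a i) \<odot>\<^bsub>dual_module K L\<^esub> l' i) x"
        by (rule hom_finsum[OF dual_eval_hom[OF x] left_module_dual lr _ c2, symmetric]) simp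
      finally show "\<phi> x = (\<Oplus>\<^bsub>dual_module K L\<^esub>i\<in>{..<n}. \<phi> (a i) \<odot>\<^bsub>dual_module K L\<^esub> l' i) x" .
    qed
  qed
qed

lemma fg_dual: "fg_module K (dual_module K L)"
proof -
  obtain n a l where al: "\<And>i. i < n \<Longrightarrow> a i \<in> carrier L" "\<And>i. i < n \<Longrightarrow> l i \<in> dual K L"
    "\<And>\<phi>. \<phi> \<in> dual K L \<Longrightarrow> \<phi> = (\<Oplus>\<^bsub>dual_module K L\<^esub>i\<in>{..<n::nat}. \<phi> (a i) \<odot>\<^bsub>dual_module K L\<^esub> l i)"
    by (rule dual_basis_expansion) blast
  interpret DL: left_module K "dual_module K L" by (rule left_module_dual)
  let ?D = "dsum {..<n} (\<lambda>_. regular_module K)"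
  have o: "(\<lambda>c. c \<odot>\<^bsub>dual_module K L\<^esub> l i) \<in> mod_hom K (regular_module K) (dual_module K L)" if "i < n" for i
  proof (rule mod_homI)
    fix c assume "c \<in> carrier (regular_module K)"
    then show "c \<odot>\<^bsub>dual_module K L\<^esub> l i \<in> carrier (dual_module K L)" using DL.smult_closed al(2)[OF that] by (simp del: dual_module_simps(4))
  qed (use al(2)[OF that] DL.smult_l_distr DL.smult_assoc1 in \<open>simp_all del: dual_module_simps(3,4)\<close>)
  have s: "(\<lambda>m. \<Oplus>\<^bsub>dual_module K L\<^esub>i\<in>{..<n}. m i \<odot>\<^bsub>dual_module K L\<^esub> l i) \<in> mod_hom K ?D (dual_module K L)"
    by (rule hom_sum[OF _ _ left_module_dual], simp, rule hom_comp[OF hom_dsum_proj], assumption, rule o, simp)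
  show ?thesis
  proof (rule fg_module_surj[OF fg_dsum[OF K.ring_axioms fg_module_regular[OF K.ring_axioms]] s left_module_dual])
    show "(\<lambda>m. \<Oplus>\<^bsub>dual_module K L\<^esub>i\<in>{..<n}. m i \<odot>\<^bsub>dual_module K L\<^esub> l i) ` carrier ?D = carrier (dual_module K L)"
    proof
      show "(\<lambda>m. \<Oplus>\<^bsub>dual_module K L\<^esub>i\<in>{..<n}. m i \<odot>\<^bsub>dual_module K L\<^esub> l i) ` carrier ?D \<subseteq> carrier (dual_module K L)"
        using hom_closed[OF s] by blast
      show "carrier (dual_module K L) \<subseteq> (\<lambda>m. \<Oplus>\<^bsub>dual_module K L\<^esub>i\<in>{..<n}. m i \<odot>\<^bsub>dual_module K L\<^esub> l i) ` carrier ?D"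
      proof
        fix \<phi> assume p: "\<phi> \<in> carrier (dual_module K L)"
        then have pa: "\<phi> (a i) \<in> carrier K" if "i < n" for i using dual_closed al(1)[OF that] by auto
        have "(\<Oplus>\<^bsub>dual_module K L\<^esub>i\<in>{..<n}. (\<lambda>i\<in>{..<n}. \<phi> (a i)) i \<odot>\<^bsub>dual_module K L\<^esub> l i) = (\<Oplus>\<^bsub>dual_module K L\<^esub>i\<in>{..<n}. \<phi> (a i) \<odot>\<^bsub>dual_module K L\<^esub> l i)"
          by (rule DL.M.finsum_cong'[OF refl]) (use DL.smult_closed pa al(2) in \<open>auto simp del: dual_module_simps(4) simp: dual_module_simps(1)\<close>)
        then have "\<phi> = (\<Oplus>\<^bsub>dual_module K L\<^esub>i\<in>{..<n}. (\<lambda>i\<in>{..<n}. \<phi> (a i)) i \<odot>\<^bsub>dual_module K L\<^esub> l i)" using al(3)[of \<phi>] p by simp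
        moreover have "(\<lambda>i\<in>{..<n}. \<phi> (a i)) \<in> carrier ?D" using pa by auto
        ultimately show "\<phi> \<in> (\<lambda>m. \<Oplus>\<^bsub>dual_module K L\<^esub>i\<in>{..<n}. m i \<odot>\<^bsub>dual_module K L\<^esub> l i) ` carrier ?D" by (rule image_eqI)
      qed
    qed
  qed
qed

text \<open>The coordinates of an element are values of functionals.\<close>

lemma dual_separates:
  assumes "x \<in> carrier L" "y \<in> carrier L" "\<And>\<phi>. \<phi> \<in> dual K L \<Longrightarrow> \<phi> x = \<phi> y"
  shows "x = y"
proof -
  obtain n a l where al: "\<And>i. i < n \<Longrightarrow> a i \<in> carrier L" "\<And>i. i < n \<Longrightarrow> l i \<in> dual K L"
    "\<And>x. x \<in> carrier L \<Longrightarrow> x = (\<Oplus>\<^bsub>L\<^esub>i\<in>{..<n::nat}. l i x \<odot>\<^bsub>L\<^esub> a i)"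
    by (rule dual_basis_expansion) blast
  have "(\<Oplus>\<^bsub>L\<^esub>i\<in>{..<n}. l i x \<odot>\<^bsub>L\<^esub> a i) = (\<Oplus>\<^bsub>L\<^esub>i\<in>{..<n}. l i y \<odot>\<^bsub>L\<^esub> a i)"
  proof (rule L.finsum_cong'[OF refl])
    show "(\<lambda>i. l i y \<odot>\<^bsub>L\<^esub> a i) \<in> {..<n} \<rightarrow> carrier L"
      using dual_closed[OF al(2) assms(2)] al(1) by (auto intro!: KL.smult_closed)
    show "l i x \<odot>\<^bsub>L\<^esub> a i = l i y \<odot>\<^bsub>L\<^esub> a i" if "i \<in> {..<n}" for i
      using assms(3)[OF al(2)[of i]] that by simp
  qed
  then show ?thesis using al(3)[OF assms(1)] al(3)[OF assms(2)] by simp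
qed

text \<open>Surjectivity of the canonical map to the double dual. The preimage has the values of
  \<theta> at the dual basis as its coordinates.\<close>

lemma dual_reflexive:
  assumes "\<theta> \<in> mod_hom K (dual_module K L) (regular_module K)"
  shows "\<exists>a\<in>carrier L. \<forall>\<phi>\<in>dual K L. \<phi> a = \<theta> \<phi>"
proof -
  obtain n a l where al: "\<And>i. i < n \<Longrightarrow> a i \<in> carrier L" "\<And>i. i < n \<Longrightarrow> l i \<in> dual K L"
    "\<And>\<phi>. \<phi> \<in> dual K L \<Longrightarrow> \<phi> = (\<Oplus>\<^bsub>dual_module K L\<^esub>i\<in>{..<n::nat}. \<phi> (a i) \<odot>\<^bsub>dual_module K L\<^esub> l i)"
    by (rule dual_basis_expansion) blast
  interpret DL: left_module K "dual_module K L" by (rule left_module_dual)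
  have lr: "left_module K (regular_module K)" by (rule left_module_regular[OF K.ring_axioms])
  have tc: "\<theta> (l i) \<in> carrier K" if "i < n" for i using hom_closed[OF assms] al(2)[OF that] by simp
  define x where "x = (\<Oplus>\<^bsub>L\<^esub>i\<in>{..<n}. \<theta> (l i) \<odot>\<^bsub>L\<^esub> a i)"
  have c: "(\<lambda>i. \<theta> (l i) \<odot>\<^bsub>L\<^esub> a i) \<in> {..<n} \<rightarrow> carrier L" using tc al(1) by (auto intro!: KL.smult_closed)
  show ?thesis
  proof (intro bexI[of _ x] ballI)
    show "x \<in> carrier L" unfolding x_def using c by (rule L.finsum_closed)
    fix \<phi> assume p: "\<phi> \<in> dual K L"
    then have ph: "\<phi> \<in> mod_hom K L (regular_module K)" by (simp add: dual_def)
    have pa: "\<phi> (a i) \<in> carrier K" if "i < n" for i using dual_closed[OF p al(1)[OF that]] .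
    have "\<phi> x = (\<Oplus>\<^bsub>regular_module K\<^esub>i\<in>{..<n}. \<phi> (\<theta> (l i) \<odot>\<^bsub>L\<^esub> a i))" unfolding x_def
      by (rule hom_finsum[OF ph KL.left_module_axioms lr _ c]) simp
    also have "\<dots> = (\<Oplus>\<^bsub>regular_module K\<^esub>i\<in>{..<n}. \<theta> (\<phi> (a i) \<odot>\<^bsub>dual_module K L\<^esub> l i))"
    proof (rule abelian_monoid.finsum_cong'[OF _ refl])
      show "abelian_monoid (regular_module K)" using lr unfolding left_module_def abelian_group_def by blast
      show "(\<lambda>i. \<theta> (\<phi> (a i) \<odot>\<^bsub>dual_module K L\<^esub> l i)) \<in> {..<n} \<rightarrow> carrier (regular_module K)"
        using hom_closed[OF assms DL.smult_closed[OF pa]] al(2) by auto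
      fix i assume "i \<in> {..<n}"
      then have i: "i < n" by simp
      show "\<phi> (\<theta> (l i) \<odot>\<^bsub>L\<^esub> a i) = \<theta> (\<phi> (a i) \<odot>\<^bsub>dual_module K L\<^esub> l i)"
        using hom_smult[OF assms pa[OF i], of "l i"] al(2)[OF i] dual_smult[OF p tc[OF i] al(1)[OF i]] tc[OF i] pa[OF i] by (simp add: K.m_comm)
    qed
    also have "\<dots> = \<theta> (\<Oplus>\<^bsub>dual_module K L\<^esub>i\<in>{..<n}. \<phi> (a i) \<odot>\<^bsub>dual_module K L\<^esub> l i)"
      by (rule hom_finsum[OF assms left_module_dual lr, symmetric]) (use DL.smult_closed[OF pa] al(2) in auto)
    also have "\<dots> = \<theta> \<phi>" using al(3)[OF p] by simp
    finally show "\<phi> x = \<theta> \<phi>" .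
  qed
qed

text \<open>As a vector space this is the direct sum of \<open>L\<close>, its dual and
  \<open>L\<close>, compared by the identity function. In the middle entry the ring laws are the
  bimodule laws of the dual, which are checked at each argument.\<close>

lemma fd_algebra_duplicated: "fd_algebra K (duplicated_algebra K L)"
proof -
  let ?D = "duplicated_algebra K L"
  let ?S = "dsum2 L (dsum2 (dual_module K L) L)"
  have lS: "left_module K ?S" using left_module_dsum2[OF KL.left_module_axioms left_module_dsum2[OF left_module_dual KL.left_module_axioms]] .
  have fS: "fg_module K ?S" by (intro fg_dsum2 L_fg fg_dual)
  have lD: "left_module K ?D"
    by (rule left_module_surj_image[OF lS, where f = "\<lambda>x. x"]) (auto simp: duplicated_algebra_simps)
  have "mod_iso K ?S ?D"
    by (rule mod_isoI[where f = "\<lambda>x. x"]) (auto intro!: mod_homI simp: duplicated_algebra_simps bij_betw_def)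
  then have fD: "fg_module K ?D" using fg_module_iso[OF fS _ lD] by blast
  interpret KD: left_module K ?D by fact
  note d = dual_ops_closed dual_closed dual_plus dual_smult
  have ring: "ring ?D"
  proof (rule ringI)
    show "abelian_group ?D" by (rule KD.M.abelian_group_axioms)
    show "monoid ?D"
    proof (rule monoidI)
      fix x y z assume "x \<in> carrier ?D" "y \<in> carrier ?D" "z \<in> carrier ?D"
      then show "x \<otimes>\<^bsub>?D\<^esub> y \<otimes>\<^bsub>?D\<^esub> z = x \<otimes>\<^bsub>?D\<^esub> (y \<otimes>\<^bsub>?D\<^esub> z)"
        by (cases x; cases y; cases z) (auto simp: duplicated_algebra_simps L.m_assoc d K.a_assoc intro!: dual_ext[of _ K L])
    next
      fix x assume "x \<in> carrier ?D"
      then show "\<one>\<^bsub>?D\<^esub> \<otimes>\<^bsub>?D\<^esub> x = x" "x \<otimes>\<^bsub>?D\<^esub> \<one>\<^bsub>?D\<^esub> = x"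
        by (cases x; auto simp: duplicated_algebra_simps d intro!: dual_ext[of _ K L])+
    next
      fix x y assume "x \<in> carrier ?D" "y \<in> carrier ?D"
      then show "x \<otimes>\<^bsub>?D\<^esub> y \<in> carrier ?D"
        by (cases x; cases y) (auto simp: duplicated_algebra_simps d)
    qed (auto simp: duplicated_algebra_simps d)
    fix x y z assume "x \<in> carrier ?D" "y \<in> carrier ?D" "z \<in> carrier ?D"
    then show "(x \<oplus>\<^bsub>?D\<^esub> y) \<otimes>\<^bsub>?D\<^esub> z = x \<otimes>\<^bsub>?D\<^esub> z \<oplus>\<^bsub>?D\<^esub> y \<otimes>\<^bsub>?D\<^esub> z"
      "z \<otimes>\<^bsub>?D\<^esub> (x \<oplus>\<^bsub>?D\<^esub> y) = z \<otimes>\<^bsub>?D\<^esub> x \<oplus>\<^bsub>?D\<^esub> z \<otimes>\<^bsub>?D\<^esub> y"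
      by (cases x; cases y; cases z; auto simp: duplicated_algebra_simps L.l_distr L.r_distr d K.a_ac intro!: dual_ext[of _ K L])+
  qed
  show ?thesis
  proof (rule fd_algebra.intro[OF K_field ring fD])
    fix c x y assume "c \<in> carrier K" "x \<in> carrier ?D" "y \<in> carrier ?D"
    then show "c \<odot>\<^bsub>?D\<^esub> (x \<otimes>\<^bsub>?D\<^esub> y) = (c \<odot>\<^bsub>?D\<^esub> x) \<otimes>\<^bsub>?D\<^esub> y" "c \<odot>\<^bsub>?D\<^esub> (x \<otimes>\<^bsub>?D\<^esub> y) = x \<otimes>\<^bsub>?D\<^esub> (c \<odot>\<^bsub>?D\<^esub> y)"
      by (cases x; cases y; auto simp: duplicated_algebra_simps scalar_left scalar_right d K.r_distr KL.smult_closed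
          scalar_left[symmetric] scalar_right[symmetric] simp del: scalar_left scalar_right intro!: dual_ext[of _ K L])+
  qed
qed

end

section \<open>Modules over a duplicated algebra\<close>

text \<open>Used to identify \<open>corner (dup_embed N)\<close> with \<open>N\<close>: they agree
  in carrier and operations but need not be equal as records.\<close>

lemma mod_hom_cong:
  assumes "carrier M = carrier M'" "carrier N = carrier N'"
    "\<And>x y. x \<in> carrier M \<Longrightarrow> y \<in> carrier M \<Longrightarrow> x \<oplus>\<^bsub>M\<^esub> y = x \<oplus>\<^bsub>M'\<^esub> y"
    "\<And>x y. x \<in> carrier N \<Longrightarrow> y \<in> carrier N \<Longrightarrow> x \<oplus>\<^bsub>N\<^esub> y = x \<oplus>\<^bsub>N'\<^esub> y"
    "\<And>a x. a \<in> carrier R \<Longrightarrow> x \<in> carrier M \<Longrightarrow> a \<odot>\<^bsub>M\<^esub> x = a \<odot>\<^bsub>M'\<^esub> x"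
    "\<And>a x. a \<in> carrier R \<Longrightarrow> x \<in> carrier N \<Longrightarrow> a \<odot>\<^bsub>N\<^esub> x = a \<odot>\<^bsub>N'\<^esub> x"
  shows "mod_hom R M N = mod_hom R M' N'"
  unfolding mod_hom_def using assms by auto

lemma submodule_subset: "is_submodule R M U \<Longrightarrow> U \<subseteq> carrier M"
  by (simp add: is_submodule_def)

locale duplicated = A: fd_algebra K A for K :: "'k ring" and A :: "('k, 'a) module"

sublocale duplicated \<subseteq> D: fd_algebra K "duplicated_algebra K A"
  by (rule A.fd_algebra_duplicated)

lemma dup_embed_simps [simp]:
  "carrier (dup_embed N) = carrier N" "zero (dup_embed N) = zero N" "add (dup_embed N) = add N"
  "(a, \<phi>, b) \<odot>\<^bsub>dup_embed N\<^esub> x = b \<odot>\<^bsub>N\<^esub> x"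
  by (simp_all add: dup_embed_def)

context duplicated
begin

abbreviation D :: "('k, 'a \<times> ('a \<Rightarrow> 'k) \<times> 'a) module" where "D \<equiv> duplicated_algebra K A"

section \<open>Matrix units of the duplicated algebra\<close>

definition e1 :: "'a \<times> ('a \<Rightarrow> 'k) \<times> 'a" where "e1 = (\<one>\<^bsub>A\<^esub>, \<lambda>x\<in>carrier A. \<zero>\<^bsub>K\<^esub>, \<zero>\<^bsub>A\<^esub>)"

definition low :: "('a \<Rightarrow> 'k) \<Rightarrow> 'a \<times> ('a \<Rightarrow> 'k) \<times> 'a" where "low \<phi> = (\<zero>\<^bsub>A\<^esub>, \<phi>, \<zero>\<^bsub>A\<^esub>)"

text \<open>Embeds \<open>A\<close> as the lower right corner; at the unit it is the idempotent
  complementary to \<open>e1\<close>.\<close>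

definition bot :: "'a \<Rightarrow> 'a \<times> ('a \<Rightarrow> 'k) \<times> 'a" where "bot b = (\<zero>\<^bsub>A\<^esub>, \<lambda>x\<in>carrier A. \<zero>\<^bsub>K\<^esub>, b)"

lemmas dual_facts = A.dual_ops_closed dual_closed dual_plus dual_smult

lemma dual_zero [simp]: "\<phi> \<in> dual K A \<Longrightarrow> \<phi> \<zero>\<^bsub>A\<^esub> = \<zero>\<^bsub>K\<^esub>"
  using hom_zero[of \<phi> K A "regular_module K"] A.KL.left_module_axioms left_module_regular[OF A.K.ring_axioms]
  by (simp add: dual_def)

lemma elements_closed [simp]:
  "e1 \<in> carrier D" "\<phi> \<in> dual K A \<Longrightarrow> low \<phi> \<in> carrier D" "b \<in> carrier A \<Longrightarrow> bot b \<in> carrier D"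
  by (auto simp: e1_def low_def bot_def duplicated_algebra_simps A.dual_ops_closed)

lemma e1_plus_bot_one: "e1 \<oplus>\<^bsub>D\<^esub> bot \<one>\<^bsub>A\<^esub> = \<one>\<^bsub>D\<^esub>"
  by (auto simp: e1_def bot_def duplicated_algebra_simps dual_facts intro!: dual_ext[of _ K A])

lemma bot_mult: "b \<in> carrier A \<Longrightarrow> b' \<in> carrier A \<Longrightarrow> bot b \<otimes>\<^bsub>D\<^esub> bot b' = bot (b \<otimes>\<^bsub>A\<^esub> b')"
  by (auto simp: bot_def duplicated_algebra_simps dual_facts intro!: dual_ext[of _ K A])

lemma bot_add: "b \<in> carrier A \<Longrightarrow> b' \<in> carrier A \<Longrightarrow> bot (b \<oplus>\<^bsub>A\<^esub> b') = bot b \<oplus>\<^bsub>D\<^esub> bot b'"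
  by (auto simp: bot_def duplicated_algebra_simps dual_facts intro!: dual_ext[of _ K A])

lemma mult_bot_one:
  "a \<in> carrier A \<Longrightarrow> \<phi> \<in> dual K A \<Longrightarrow> b \<in> carrier A \<Longrightarrow> (a, \<phi>, b) \<otimes>\<^bsub>D\<^esub> bot \<one>\<^bsub>A\<^esub> = bot b"
  by (auto simp: bot_def duplicated_algebra_simps dual_facts intro!: dual_ext[of _ K A])

lemma mult_e1:
  "a \<in> carrier A \<Longrightarrow> \<phi> \<in> dual K A \<Longrightarrow> b \<in> carrier A \<Longrightarrow> (a, \<phi>, b) \<otimes>\<^bsub>D\<^esub> e1 = (a, \<phi>, \<zero>\<^bsub>A\<^esub>)"
  by (auto simp: e1_def duplicated_algebra_simps dual_facts intro!: dual_ext[of _ K A])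

lemma low_mult:
  "a \<in> carrier A \<Longrightarrow> \<phi> \<in> dual K A \<Longrightarrow> b \<in> carrier A \<Longrightarrow> \<psi> \<in> dual K A \<Longrightarrow>
    low \<psi> \<otimes>\<^bsub>D\<^esub> (a, \<phi>, b) = low (dual_right A \<psi> a)"
  by (auto simp: low_def duplicated_algebra_simps dual_facts intro!: dual_ext[of _ K A])

lemma bot_mult_left:
  "a \<in> carrier A \<Longrightarrow> \<phi> \<in> dual K A \<Longrightarrow> b \<in> carrier A \<Longrightarrow> b' \<in> carrier A \<Longrightarrow>
    bot b' \<otimes>\<^bsub>D\<^esub> (a, \<phi>, b) = low (dual_left A b' \<phi>) \<oplus>\<^bsub>D\<^esub> bot (b' \<otimes>\<^bsub>A\<^esub> b)"
  by (auto simp: low_def bot_def duplicated_algebra_simps dual_facts intro!: dual_ext[of _ K A])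

lemma low_add: "\<phi> \<in> dual K A \<Longrightarrow> \<psi> \<in> dual K A \<Longrightarrow> low (dual_add K A \<phi> \<psi>) = low \<phi> \<oplus>\<^bsub>D\<^esub> low \<psi>"
  by (auto simp: low_def duplicated_algebra_simps)

text \<open>Compares two actions of the field: on a \<open>D\<close>-module it acts through the unit
  of \<open>D\<close>, on the corner of that module through \<open>bot\<close>.\<close>

lemma scalar_bot: "c \<in> carrier K \<Longrightarrow> b \<in> carrier A \<Longrightarrow> bot (c \<odot>\<^bsub>A\<^esub> b) = (c \<odot>\<^bsub>D\<^esub> \<one>\<^bsub>D\<^esub>) \<otimes>\<^bsub>D\<^esub> bot b"
  using A.KL.smult_zero_right[of c] by (subst D.scalar_left[symmetric]) (auto simp: bot_def duplicated_algebra_simps dual_facts intro!: dual_ext[of _ K A])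

lemma scalar_low: "c \<in> carrier K \<Longrightarrow> \<phi> \<in> dual K A \<Longrightarrow> low (\<lambda>x\<in>carrier A. c \<otimes>\<^bsub>K\<^esub> \<phi> x) = (c \<odot>\<^bsub>D\<^esub> \<one>\<^bsub>D\<^esub>) \<otimes>\<^bsub>D\<^esub> low \<phi>"
  using A.KL.smult_zero_right[of c] D.L.l_one[OF elements_closed(2)] by (subst D.scalar_left[symmetric]) (auto simp: low_def duplicated_algebra_simps A.dual_ops_closed)

text \<open>The modules \<open>(0, N, 0)\<close> are those that are annihilated by the idempotent \<open>e1\<close> of the first row.\<close>

definition lower :: "('a \<times> ('a \<Rightarrow> 'k) \<times> 'a, 'm) module \<Rightarrow> bool" where
  "lower M \<longleftrightarrow> (\<forall>x\<in>carrier M. e1 \<odot>\<^bsub>M\<^esub> x = \<zero>\<^bsub>M\<^esub>)"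

text \<open>The part fixed by the second idempotent, an \<open>A\<close>-module by way of
  \<open>bot\<close>. It is right adjoint to \<open>dup_embed\<close>, and on \<open>lower\<close>
  modules it inverts \<open>dup_embed\<close> up to isomorphism.\<close>

definition corner :: "('a \<times> ('a \<Rightarrow> 'k) \<times> 'a, 'm) module \<Rightarrow> ('a, 'm) module" where
  "corner M = \<lparr>carrier = {x \<in> carrier M. bot \<one>\<^bsub>A\<^esub> \<odot>\<^bsub>M\<^esub> x = x}, mult = undefined, one = undefined,
     zero = zero M, add = add M, smult = (\<lambda>b x. bot b \<odot>\<^bsub>M\<^esub> x)\<rparr>"

lemma corner_simps [simp]:
  "carrier (corner M) = {x \<in> carrier M. bot \<one>\<^bsub>A\<^esub> \<odot>\<^bsub>M\<^esub> x = x}" "zero (corner M) = zero M" "add (corner M) = add M"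
  "b \<odot>\<^bsub>corner M\<^esub> x = bot b \<odot>\<^bsub>M\<^esub> x"
  by (simp_all add: corner_def)

lemma left_module_corner:
  assumes "left_module D M" shows "left_module A (corner M)"
proof -
  interpret M: left_module D M by fact
  have n: "bot \<one>\<^bsub>A\<^esub> \<odot>\<^bsub>M\<^esub> (\<ominus>\<^bsub>M\<^esub> x) = \<ominus>\<^bsub>M\<^esub> x" if "x \<in> carrier M" "bot \<one>\<^bsub>A\<^esub> \<odot>\<^bsub>M\<^esub> x = x" for x
    using that by (simp add: M.smult_neg_right)
  have ab: "abelian_group (corner M)"
  proof (rule abelian_groupI)
    fix x assume "x \<in> carrier (corner M)"
    then show "\<exists>y\<in>carrier (corner M). y \<oplus>\<^bsub>corner M\<^esub> x = \<zero>\<^bsub>corner M\<^esub>"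
      using n[of x] by (intro bexI[of _ "\<ominus>\<^bsub>M\<^esub> x"]) (auto simp: M.M.l_neg)
  qed (auto simp: M.M.a_ac M.smult_r_distr)
  show ?thesis
    by (rule left_moduleI[OF A.L.ring_axioms ab])
      (auto simp: M.smult_closed bot_add M.smult_l_distr M.smult_r_distr bot_mult[symmetric] M.smult_assoc1[symmetric],
        simp_all add: bot_mult M.smult_assoc1)
qed

text \<open>Since \<open>e1\<close> acts as zero, the complementary idempotent acts as the identity,
  and multiplying a matrix by that idempotent from the right leaves only the lower right
  entry.\<close>

lemma lower_act:
  assumes "left_module D M" "lower M" "x \<in> carrier M"
  shows "bot \<one>\<^bsub>A\<^esub> \<odot>\<^bsub>M\<^esub> x = x"
    "a \<in> carrier A \<Longrightarrow> \<phi> \<in> dual K A \<Longrightarrow> b \<in> carrier A \<Longrightarrow> (a, \<phi>, b) \<odot>\<^bsub>M\<^esub> x = bot b \<odot>\<^bsub>M\<^esub> x"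
proof -
  interpret M: left_module D M by fact
  have "x = (e1 \<oplus>\<^bsub>D\<^esub> bot \<one>\<^bsub>A\<^esub>) \<odot>\<^bsub>M\<^esub> x" using assms(3) by (simp only: e1_plus_bot_one M.smult_one)
  also have "\<dots> = bot \<one>\<^bsub>A\<^esub> \<odot>\<^bsub>M\<^esub> x" using assms(2,3) by (simp add: M.smult_l_distr lower_def M.smult_closed)
  finally show 1: "bot \<one>\<^bsub>A\<^esub> \<odot>\<^bsub>M\<^esub> x = x" by simp
  assume *: "a \<in> carrier A" "\<phi> \<in> dual K A" "b \<in> carrier A"
  then have "(a, \<phi>, b) \<odot>\<^bsub>M\<^esub> (bot \<one>\<^bsub>A\<^esub> \<odot>\<^bsub>M\<^esub> x) = ((a, \<phi>, b) \<otimes>\<^bsub>D\<^esub> bot \<one>\<^bsub>A\<^esub>) \<odot>\<^bsub>M\<^esub> x"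
    using assms(3) *(1-3) by (subst M.smult_assoc1[OF _ elements_closed(3)[OF A.L.one_closed]]) (auto simp: duplicated_algebra_simps)
  then show "(a, \<phi>, b) \<odot>\<^bsub>M\<^esub> x = bot b \<odot>\<^bsub>M\<^esub> x" using 1 mult_bot_one[OF *] by simp
qed

lemma corner_lower: "left_module D M \<Longrightarrow> lower M \<Longrightarrow> carrier (corner M) = carrier M"
  using lower_act(1) by auto

lemma left_module_dup_embed:
  assumes "left_module A N" shows "left_module D (dup_embed N)"
proof -
  interpret N: left_module A N by fact
  have ab: "abelian_group (dup_embed N)"
    by (rule abelian_groupI) (auto simp: N.M.a_ac intro: N.M.l_neg bexI[of _ "\<ominus>\<^bsub>N\<^esub> _"])
  show ?thesis
    by (rule left_moduleI[OF D.L.ring_axioms ab])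
      (auto simp: duplicated_algebra_simps N.smult_closed N.smult_l_distr N.smult_r_distr N.smult_assoc1 N.smult_one)
qed

lemma lower_dup_embed: "left_module A N \<Longrightarrow> lower (dup_embed N)"
  by (auto simp: lower_def e1_def left_module.smult_zero_left)

lemma lower_retract:
  assumes "retract D X M" "lower M" "left_module D X" "left_module D M"
  shows "lower X"
proof -
  obtain i p where ip: "i \<in> mod_hom D X M" "p \<in> mod_hom D M X" "\<And>x. x \<in> carrier X \<Longrightarrow> p (i x) = x"
    using assms(1) unfolding retract_def by blast
  interpret X: left_module D X by fact
  show ?thesis unfolding lower_def
  proof
    fix x assume x: "x \<in> carrier X"
    have "i (e1 \<odot>\<^bsub>X\<^esub> x) = \<zero>\<^bsub>M\<^esub>" using assms(2) hom_closed[OF ip(1) x] x by (simp add: lower_def hom_smult[OF ip(1)])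
    then have "p (i (e1 \<odot>\<^bsub>X\<^esub> x)) = \<zero>\<^bsub>X\<^esub>" using hom_zero[OF ip(2) assms(4,3)] by simp
    then show "e1 \<odot>\<^bsub>X\<^esub> x = \<zero>\<^bsub>X\<^esub>" using ip(3)[of "e1 \<odot>\<^bsub>X\<^esub> x"] x by (simp add: X.smult_closed)
  qed
qed

text \<open>Elements of a \<open>lower\<close> module are fixed by the second idempotent, hence so
  are their images; therefore the target can be any \<open>D\<close>-module. Conversely, as
  \<open>f x\<close> is fixed, the action of a matrix on it depends only on the lower right
  entry.\<close>

lemma mod_hom_corner:
  assumes "left_module D M" "left_module D N" "lower M"
  shows "mod_hom D M N = mod_hom A (corner M) (corner N)"
proof -
  interpret M: left_module D M by fact
  interpret N: left_module D N by fact
  note c = corner_lower[OF assms(1,3)]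
  have "f \<in> mod_hom A (corner M) (corner N)" if f: "f \<in> mod_hom D M N" for f
  proof (rule mod_homI)
    fix x assume "x \<in> carrier (corner M)"
    then have x: "x \<in> carrier M" "bot \<one>\<^bsub>A\<^esub> \<odot>\<^bsub>M\<^esub> x = x" by auto
    then show "f x \<in> carrier (corner N)" using hom_closed[OF f x(1)] hom_smult[OF f _ x(1), of "bot \<one>\<^bsub>A\<^esub>"] by simp
  qed (use c in \<open>auto simp: hom_add[OF f] hom_smult[OF f]\<close>)
  moreover have "f \<in> mod_hom D M N" if f: "f \<in> mod_hom A (corner M) (corner N)" for f
  proof -
    have fc: "f x \<in> carrier N" "bot \<one>\<^bsub>A\<^esub> \<odot>\<^bsub>N\<^esub> f x = f x" if "x \<in> carrier M" for x using hom_closed[OF f, of x] that c by auto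
    show "f \<in> mod_hom D M N"
    proof (rule mod_homI)
      fix x y assume "x \<in> carrier M" "y \<in> carrier M"
      then show "f (x \<oplus>\<^bsub>M\<^esub> y) = f x \<oplus>\<^bsub>N\<^esub> f y" using hom_add[OF f, unfolded c, of x y] by simp
    next
      fix d x assume d: "d \<in> carrier D" and x: "x \<in> carrier M"
      obtain a \<phi> b where d': "d = (a, \<phi>, b)" "a \<in> carrier A" "\<phi> \<in> dual K A" "b \<in> carrier A"
        using d by (cases d) (auto simp: duplicated_algebra_simps)
      have "f (d \<odot>\<^bsub>M\<^esub> x) = bot b \<odot>\<^bsub>N\<^esub> f x"
        using lower_act(2)[OF assms(1,3) x d'(2-4)] lower_act(1)[OF assms(1,3) x] hom_smult[OF f d'(4), of x] x d' by simp
      also have "\<dots> = (d \<otimes>\<^bsub>D\<^esub> bot \<one>\<^bsub>A\<^esub>) \<odot>\<^bsub>N\<^esub> f x" using mult_bot_one[OF d'(2-4)] d'(1) by simp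
      also have "\<dots> = d \<odot>\<^bsub>N\<^esub> f x" using fc[OF x] d by (simp add: N.smult_assoc1)
      finally show "f (d \<odot>\<^bsub>M\<^esub> x) = d \<odot>\<^bsub>N\<^esub> f x" .
    qed (use fc in auto)
  qed
  ultimately show ?thesis by blast
qed

text \<open>The adjunction between \<open>dup_embed\<close> and \<open>corner\<close>, as an
  equality of sets of functions.\<close>

lemma corner_dup_embed_hom:
  assumes "left_module A N" "left_module D M"
  shows "mod_hom D (dup_embed N) M = mod_hom A N (corner M)"
proof -
  interpret N: left_module A N by fact
  have "mod_hom D (dup_embed N) M = mod_hom A (corner (dup_embed N)) (corner M)"
    by (rule mod_hom_corner[OF left_module_dup_embed[OF assms(1)] assms(2) lower_dup_embed[OF assms(1)]])
  also have "\<dots> = mod_hom A N (corner M)"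
    by (rule mod_hom_cong) (auto simp: bot_def N.smult_one)
  finally show ?thesis .
qed

lemma mod_hom_dup_embed:
  assumes "left_module A M" "left_module A N"
  shows "mod_hom D (dup_embed M) (dup_embed N) = mod_hom A M N"
proof -
  interpret N: left_module A N by fact
  have "mod_hom A M (corner (dup_embed N)) = mod_hom A M N"
    by (rule mod_hom_cong) (auto simp: bot_def N.smult_one)
  then show ?thesis using corner_dup_embed_hom[OF assms(1) left_module_dup_embed[OF assms(2)]] by simp
qed

lemma mod_iso_dup_embed:
  "left_module A M \<Longrightarrow> left_module A N \<Longrightarrow> mod_iso D (dup_embed M) (dup_embed N) \<longleftrightarrow> mod_iso A M N"
  by (simp add: mod_iso_def mod_hom_dup_embed)

lemma mod_iso_dup_embed_corner:
  assumes "left_module D M" "lower M" shows "mod_iso D M (dup_embed (corner M))"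
  by (rule mod_isoI[where f = "\<lambda>x. x"])
    (auto intro!: mod_homI simp: lower_act[OF assms] duplicated_algebra_simps bij_betw_def
      left_module.smult_closed[OF assms(1)] abelian_monoid.a_closed[OF abelian_group.axioms(1)[OF left_module_abelian_group[OF assms(1)]]])

text \<open>Over the base field \<open>N\<close> and \<open>dup_embed N\<close> are the same vector
  space.\<close>

lemma fg_dup_embed:
  assumes "fg_module A N" shows "fg_module D (dup_embed N)"
proof -
  have lN: "left_module A N" using assms by (rule fg_left_module)
  interpret N: left_module A N by fact
  have lE: "left_module D (dup_embed N)" using left_module_dup_embed[OF lN] .
  have "fg_module K (restrict_scalars A N)" using assms A.fg_iff_fg_restrict_scalars by blast
  moreover have "mod_iso K (restrict_scalars A N) (restrict_scalars D (dup_embed N))"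
    by (rule mod_isoI[where f = "\<lambda>x. x"])
      (auto intro!: mod_homI simp: bij_betw_def duplicated_algebra_simps)
  ultimately have "fg_module K (restrict_scalars D (dup_embed N))"
    using fg_module_iso D.left_module_restrict_scalars[OF lE] by blast
  then show ?thesis using lE D.fg_iff_fg_restrict_scalars by blast
qed

lemma fg_corner:
  assumes "fg_module D M" shows "fg_module A (corner M)"
proof -
  have lM: "left_module D M" using assms by (rule fg_left_module)
  interpret M: left_module D M by fact
  have lC: "left_module A (corner M)" using left_module_corner[OF lM] .
  let ?U = "carrier (corner M)"
  have fM: "fg_module K (restrict_scalars D M)" using assms D.fg_iff_fg_restrict_scalars by blast
  have lr: "left_module K (restrict_scalars D M)" using fM by (rule fg_left_module)
  \<comment> \<open>On the corner the field acts in the same way through \<open>D\<close> and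
    through \<open>A\<close>, so the corner is a subspace of a finite dimensional space.\<close>
  have sm: "(c \<odot>\<^bsub>D\<^esub> \<one>\<^bsub>D\<^esub>) \<odot>\<^bsub>M\<^esub> x = bot (c \<odot>\<^bsub>A\<^esub> \<one>\<^bsub>A\<^esub>) \<odot>\<^bsub>M\<^esub> x" if c: "c \<in> carrier K" and x: "x \<in> ?U" for c x
  proof -
    have "(c \<odot>\<^bsub>D\<^esub> \<one>\<^bsub>D\<^esub>) \<odot>\<^bsub>M\<^esub> x = (c \<odot>\<^bsub>D\<^esub> \<one>\<^bsub>D\<^esub>) \<odot>\<^bsub>M\<^esub> (bot \<one>\<^bsub>A\<^esub> \<odot>\<^bsub>M\<^esub> x)" using x by simp
    also have "\<dots> = ((c \<odot>\<^bsub>D\<^esub> \<one>\<^bsub>D\<^esub>) \<otimes>\<^bsub>D\<^esub> bot \<one>\<^bsub>A\<^esub>) \<odot>\<^bsub>M\<^esub> x"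
      using x c D.scalar_one_closed[OF c] by (subst M.smult_assoc1) auto
    finally show ?thesis using scalar_bot[OF c A.L.one_closed] by simp
  qed
  have lrc: "left_module K (restrict_scalars A (corner M))" using A.left_module_restrict_scalars[OF lC] .
  interpret C: left_module K "restrict_scalars A (corner M)" by fact
  have sU: "is_submodule K (restrict_scalars D M) ?U"
    unfolding is_submodule_def
  proof (intro conjI ballI)
    show "\<zero>\<^bsub>restrict_scalars D M\<^esub> \<in> ?U" using C.M.zero_closed by simp
    show "x \<oplus>\<^bsub>restrict_scalars D M\<^esub> y \<in> ?U" if "x \<in> ?U" "y \<in> ?U" for x y using C.M.a_closed[of x y] that by simp
    show "c \<odot>\<^bsub>restrict_scalars D M\<^esub> x \<in> ?U" if "c \<in> carrier K" "x \<in> ?U" for c x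
      using C.smult_closed[of c x] that sm[OF that] by simp
  qed auto
  have f: "fg_module K (submod (restrict_scalars D M) ?U)" using fg_subspace[OF A.K_field fM sU] .
  have "mod_iso K (submod (restrict_scalars D M) ?U) (restrict_scalars A (corner M))"
    by (rule mod_isoI[where f = "\<lambda>x. x"]) (use sm in \<open>auto intro!: mod_homI simp: bij_betw_def\<close>)
  then have "fg_module K (restrict_scalars A (corner M))" using fg_module_iso[OF f] lrc by blast
  then show ?thesis using lC A.fg_iff_fg_restrict_scalars by blast
qed

text \<open>Summands of a \<open>lower\<close> module are \<open>lower\<close>, so a decomposition
  over \<open>D\<close> is already one over \<open>A\<close>.\<close>

lemma indecomposable_dup_embed:
  fixes X :: "('k, 'a) umod"
  assumes "indecomposable A X" shows "indecomposable D (dup_embed X)"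
  unfolding indecomposable_def
proof (intro conjI allI impI)
  have fX: "fg_module A X" using assms by (rule A.indecomposable_fg)
  have lX: "left_module A X" using fX by (rule fg_left_module)
  show "fg_module D (dup_embed X)" by (rule fg_dup_embed[OF fX])
  show "carrier (dup_embed X) \<noteq> {\<zero>\<^bsub>dup_embed X\<^esub>}" using assms by (simp add: indecomposable_def)
  fix U V :: "('k, 'a \<times> ('a \<Rightarrow> 'k) \<times> 'a) umod"
  assume *: "fg_module D U \<and> fg_module D V \<and> mod_iso D (dup_embed X) (dsum2 U V)"
  have lm: "left_module D U" "left_module D V" "left_module D (dup_embed X)" using * fg_left_module left_module_dup_embed[OF lX] by auto
  have lUV: "left_module D (dsum2 U V)" using lm left_module_dsum2 by blast
  have r: "retract D (dsum2 U V) (dup_embed X)" using mod_iso_retract[OF mod_iso_sym[OF _ lm(3)] lUV] * by blast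
  have low: "lower U" "lower V" "lower (dsum2 U V)"
    using lower_retract[OF retract_trans[OF retract_dsum2(1)[OF lm(1,2)] r] lower_dup_embed[OF lX] lm(1,3)]
      lower_retract[OF retract_trans[OF retract_dsum2(2)[OF lm(1,2)] r] lower_dup_embed[OF lX] lm(2,3)]
      lower_retract[OF r lower_dup_embed[OF lX] lUV lm(3)] by auto
  have c: "carrier (corner (dsum2 U V)) = carrier (dsum2 (corner U) (corner V))"
    using corner_lower[OF lm(1) low(1)] corner_lower[OF lm(2) low(2)] corner_lower[OF lUV low(3)] by (simp del: corner_simps)
  have "mod_hom A X (corner (dsum2 U V)) = mod_hom A X (dsum2 (corner U) (corner V))"
    by (rule mod_hom_cong[OF refl c]) auto
  then have "mod_hom D (dup_embed X) (dsum2 U V) = mod_hom A X (dsum2 (corner U) (corner V))"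
    using corner_dup_embed_hom[OF lX lUV] by simp
  moreover have "carrier (dsum2 U V) = carrier (dsum2 (corner U) (corner V))" using c corner_lower[OF lUV low(3)] by simp
  ultimately have "mod_iso A X (dsum2 (corner U) (corner V))" using * unfolding mod_iso_def dup_embed_simps by metis
  then have "carrier (corner U) = {\<zero>\<^bsub>corner U\<^esub>} \<or> carrier (corner V) = {\<zero>\<^bsub>corner V\<^esub>}"
    using A.indecomposable_dsum2D[OF assms] fg_corner * by blast
  then show "carrier U = {\<zero>\<^bsub>U\<^esub>} \<or> carrier V = {\<zero>\<^bsub>V\<^esub>}"
    using corner_lower[OF lm(1) low(1)] corner_lower[OF lm(2) low(2)] by (simp del: corner_simps(1))
qed

lemma mod_iso_dup_embed_dsum2:
  "mod_iso D (dup_embed (dsum2 U V)) (dsum2 (dup_embed U) (dup_embed V))"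
  by (rule mod_isoI[where f = "\<lambda>x. x"]) (auto intro!: mod_homI simp: bij_betw_def duplicated_algebra_simps)

lemma mod_iso_dup_embed_dsum:
  "mod_iso D (dup_embed (dsum I U)) (dsum I (\<lambda>i. dup_embed (U i)))"
  by (rule mod_isoI[where f = "\<lambda>x. x"]) (auto intro!: mod_homI simp: bij_betw_def duplicated_algebra_simps)

lemma indecomposable_corner:
  fixes X :: "('k, 'a \<times> ('a \<Rightarrow> 'k) \<times> 'a) umod"
  assumes "indecomposable D X" "lower X" shows "indecomposable A (corner X)"
  unfolding indecomposable_def
proof (intro conjI allI impI)
  have fX: "fg_module D X" using assms(1) by (rule D.indecomposable_fg)
  have lX: "left_module D X" using fX by (rule fg_left_module)
  show fc: "fg_module A (corner X)" by (rule fg_corner[OF fX])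
  show "carrier (corner X) \<noteq> {\<zero>\<^bsub>corner X\<^esub>}" using assms(1) corner_lower[OF lX assms(2)] by (simp add: indecomposable_def)
  fix U V :: "('k, 'a) umod"
  assume *: "fg_module A U \<and> fg_module A V \<and> mod_iso A (corner X) (dsum2 U V)"
  have lUV: "left_module A U" "left_module A V" using * fg_left_module by auto
  note lm = lUV left_module_dsum2[OF lUV]
  have "mod_iso D (dup_embed (corner X)) (dup_embed (dsum2 U V))"
    using mod_iso_dup_embed[OF left_module_corner[OF lX] lm(3)] * by blast
  then have "mod_iso D X (dsum2 (dup_embed U) (dup_embed V))"
    using mod_iso_trans[OF mod_iso_trans[OF mod_iso_dup_embed_corner[OF lX assms(2)]] mod_iso_dup_embed_dsum2] by blast
  then show "carrier U = {\<zero>\<^bsub>U\<^esub>} \<or> carrier V = {\<zero>\<^bsub>V\<^esub>}"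
    using D.indecomposable_dsum2D[OF assms(1) fg_dup_embed fg_dup_embed] * by fastforce
qed

text \<open>By the adjunction it suffices that \<open>corner\<close> preserves surjections: a
  preimage of a fixed element becomes fixed when the second idempotent is applied to it.\<close>

lemma projective_dup_embed:
  fixes N :: "('a, 'm) module"
  assumes "projective A N" shows "projective D (dup_embed N)"
  unfolding projective_def
proof (intro conjI allI impI)
  have fN: "fg_module A N" using assms by (rule A.projective_fg)
  have lN: "left_module A N" using fN by (rule fg_left_module)
  show "fg_module D (dup_embed N)" by (rule fg_dup_embed[OF fN])
  fix U V :: "('k, 'a \<times> ('a \<Rightarrow> 'k) \<times> 'a) umod" and f g
  assume *: "fg_module D U \<and> fg_module D V \<and> f \<in> mod_hom D U V \<and> f ` carrier U = carrier V \<and> g \<in> mod_hom D (dup_embed N) V"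
  have f: "f \<in> mod_hom D U V" and lm: "left_module D U" "left_module D V" using * fg_left_module by auto
  interpret U: left_module D U by fact
  have fc: "f \<in> mod_hom A (corner U) (corner V)"
  proof (rule mod_homI)
    fix x assume "x \<in> carrier (corner U)"
    then show "f x \<in> carrier (corner V)" using hom_closed[OF f, of x] hom_smult[OF f, of "bot \<one>\<^bsub>A\<^esub>" x] by simp
  qed (auto simp: hom_add[OF f] hom_smult[OF f])
  have s: "f ` carrier (corner U) = carrier (corner V)"
  proof
    show "f ` carrier (corner U) \<subseteq> carrier (corner V)" using hom_closed[OF fc] by blast
    show "carrier (corner V) \<subseteq> f ` carrier (corner U)"
    proof
      fix y assume "y \<in> carrier (corner V)"
      then have y: "y \<in> carrier V" "bot \<one>\<^bsub>A\<^esub> \<odot>\<^bsub>V\<^esub> y = y" by auto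
      then obtain x where x: "x \<in> carrier U" "y = f x" using * by blast
      have "bot \<one>\<^bsub>A\<^esub> \<odot>\<^bsub>U\<^esub> (bot \<one>\<^bsub>A\<^esub> \<odot>\<^bsub>U\<^esub> x) = bot \<one>\<^bsub>A\<^esub> \<odot>\<^bsub>U\<^esub> x"
        using x by (simp add: U.smult_assoc1[symmetric] bot_mult)
      then have "bot \<one>\<^bsub>A\<^esub> \<odot>\<^bsub>U\<^esub> x \<in> carrier (corner U)" using x by (simp add: U.smult_closed)
      moreover have "f (bot \<one>\<^bsub>A\<^esub> \<odot>\<^bsub>U\<^esub> x) = y" using x y by (simp add: hom_smult[OF f])
      ultimately show "y \<in> f ` carrier (corner U)" by blast
    qed
  qed
  have "g \<in> mod_hom A N (corner V)" using * corner_dup_embed_hom[OF lN lm(2)] by blast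
  then obtain h where "h \<in> mod_hom A N (corner U)" "\<forall>x\<in>carrier N. f (h x) = g x"
    using A.projective_lift[OF assms fg_corner fg_corner fc s] * by blast
  then show "\<exists>h\<in>mod_hom D (dup_embed N) U. \<forall>x\<in>carrier (dup_embed N). f (h x) = g x"
    using corner_dup_embed_hom[OF lN lm(1)] by auto
qed

end

section \<open>Projective-injective modules\<close>

lemma mod_iso_dsum_append:
  fixes n m :: nat
  shows "mod_iso R (dsum2 (dsum {..<n} X) (dsum {..<m} Y)) (dsum {..<n + m} (\<lambda>i. if i < n then X i else Y (i - n)))"
proof -
  let ?Z = "\<lambda>i. if i < n then X i else Y (i - n)"
  have "(\<lambda>z. \<lambda>i\<in>{..<n + m}. if i < n then fst z i else snd z (i - n)) \<in> mod_hom R (dsum2 (dsum {..<n} X) (dsum {..<m} Y)) (dsum {..<n + m} ?Z)"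
  proof (rule hom_dsum_tuple)
    fix i assume i: "i \<in> {..<n + m}"
    show "(\<lambda>z. if i < n then fst z i else snd z (i - n)) \<in> mod_hom R (dsum2 (dsum {..<n} X) (dsum {..<m} Y)) (?Z i)"
    proof (cases "i < n")
      case True
      then show ?thesis using hom_comp[OF hom_fst hom_dsum_proj[of i "{..<n}" R X], of "dsum {..<m} Y"] by simp
    next
      case False
      then show ?thesis using i hom_comp[OF hom_snd hom_dsum_proj[of "i - n" "{..<m}" R Y], of "dsum {..<n} X"] by simp
    qed
  qed
  moreover have "(\<lambda>z. (\<lambda>i\<in>{..<n}. z i, \<lambda>j\<in>{..<m}. z (n + j))) \<in> mod_hom R (dsum {..<n + m} ?Z) (dsum2 (dsum {..<n} X) (dsum {..<m} Y))"
  proof (intro hom_pair hom_dsum_tuple)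
    fix i assume "i \<in> {..<n}"
    then show "(\<lambda>z. z i) \<in> mod_hom R (dsum {..<n + m} ?Z) (X i)" using hom_dsum_proj[of i "{..<n + m}" R ?Z] by simp
  next
    fix j assume "j \<in> {..<m}"
    then show "(\<lambda>z. z (n + j)) \<in> mod_hom R (dsum {..<n + m} ?Z) (Y j)" using hom_dsum_proj[of "n + j" "{..<n + m}" R ?Z] by simp
  qed
  ultimately show ?thesis
  proof (rule mod_isoI')
    fix z assume z: "z \<in> carrier (dsum2 (dsum {..<n} X) (dsum {..<m} Y))"
    obtain x y where xy: "z = (x, y)" by (cases z)
    have x: "x \<in> (\<Pi>\<^sub>E i\<in>{..<n}. carrier (X i))" and y: "y \<in> (\<Pi>\<^sub>E i\<in>{..<m}. carrier (Y i))" using z xy by auto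
    show "(\<lambda>i\<in>{..<n}. (\<lambda>i\<in>{..<n + m}. if i < n then fst z i else snd z (i - n)) i,
        \<lambda>j\<in>{..<m}. (\<lambda>i\<in>{..<n + m}. if i < n then fst z i else snd z (i - n)) (n + j)) = z"
      using PiE_arb[OF x] PiE_arb[OF y] by (auto simp: xy fun_eq_iff restrict_def)
  next
    fix z assume "z \<in> carrier (dsum {..<n + m} ?Z)"
    then have z: "z \<in> (\<Pi>\<^sub>E i\<in>{..<n + m}. carrier (?Z i))" by simp
    show "(\<lambda>i\<in>{..<n + m}. if i < n then fst (\<lambda>i\<in>{..<n}. z i, \<lambda>j\<in>{..<m}. z (n + j)) i else snd (\<lambda>i\<in>{..<n}. z i, \<lambda>j\<in>{..<m}. z (n + j)) (i - n)) = z"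
      using PiE_arb[OF z] by (auto simp: fun_eq_iff restrict_def)
  qed
qed

text \<open>The image of \<open>X\<close> is a proper submodule, since it meets the image of the
  nonzero module \<open>Y\<close> only in zero.\<close>

lemma (in fd_algebra) mdim_summand_less:
  assumes "fg_module L N" "mod_iso L N (dsum2 X Y)" "left_module L X" "left_module L Y" "carrier Y \<noteq> {\<zero>\<^bsub>Y\<^esub>}"
  shows "mdim K L X < mdim K L N"
proof -
  have lN: "left_module L N" using assms(1) by (rule fg_left_module)
  interpret Y: left_module L Y by fact
  obtain iX pX iY pY where *: "iX \<in> mod_hom L X N" "pX \<in> mod_hom L N X" "iY \<in> mod_hom L Y N" "pY \<in> mod_hom L N Y"
    "\<And>b. b \<in> carrier X \<Longrightarrow> pX (iX b) = b" "\<And>c. c \<in> carrier Y \<Longrightarrow> pY (iY c) = c"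
    "\<And>b. b \<in> carrier X \<Longrightarrow> pY (iX b) = \<zero>\<^bsub>Y\<^esub>" "\<And>c. c \<in> carrier Y \<Longrightarrow> pX (iY c) = \<zero>\<^bsub>X\<^esub>"
    by (rule mod_iso_dsum2E[OF assms(2) lN assms(3,4)]) blast
  let ?U = "iX ` carrier X"
  have sU: "is_submodule L N ?U" by (rule submodule_image[OF assms(3) lN *(1) submodule_carrier[OF assms(3)]])
  have Uc: "?U \<subseteq> carrier N" using sU by (simp add: is_submodule_def)
  have ne: "?U \<noteq> carrier N"
  proof
    assume U: "?U = carrier N"
    have "carrier Y \<subseteq> {\<zero>\<^bsub>Y\<^esub>}"
    proof
      fix y assume y: "y \<in> carrier Y"
      then have "iY y \<in> ?U" using U hom_closed[OF *(3)] by simp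
      then obtain x where x: "x \<in> carrier X" "iY y = iX x" by blast
      then have "y = \<zero>\<^bsub>Y\<^esub>" using *(6)[OF y] *(7)[OF x(1)] by simp
      then show "y \<in> {\<zero>\<^bsub>Y\<^esub>}" by simp
    qed
    then show False using assms(5) Y.M.zero_closed by blast
  qed
  have "mod_iso L (submod N ?U) X"
    by (rule mod_isoI'[OF hom_restrict[OF *(2) Uc] hom_into_submod[OF *(1)]]) (use *(5) in auto)
  then have "mdim K L X \<le> mdim K L (submod N ?U)" by (rule mdim_iso[OF fg_submodule[OF assms(1) sU] _ assms(3)])
  also have "\<dots> < mdim K L N" by (rule mdim_less[OF assms(1) sU ne])
  finally show ?thesis .
qed

section \<open>The two columns of the duplicated algebra\<close>

context duplicated
begin

text \<open>The left ideal generated by \<open>e1\<close>, made of the matrices with zero second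
  column. As a triple it is (A, DA) with the canonical isomorphism as structure map.\<close>

definition col1 :: "('a \<times> ('a \<Rightarrow> 'k) \<times> 'a, 'a \<times> ('a \<Rightarrow> 'k) \<times> 'a) module" where
  "col1 = submod (regular_module D) ((\<lambda>x. x \<otimes>\<^bsub>D\<^esub> e1) ` carrier D)"

definition col2 :: "('a \<times> ('a \<Rightarrow> 'k) \<times> 'a, 'a \<times> ('a \<Rightarrow> 'k) \<times> 'a) module" where
  "col2 = submod (regular_module D) ((\<lambda>x. x \<otimes>\<^bsub>D\<^esub> bot \<one>\<^bsub>A\<^esub>) ` carrier D)"

lemma col_simps [simp]:
  "add col1 = add D" "zero col1 = zero D" "smult col1 = mult D"
  "add col2 = add D" "zero col2 = zero D" "smult col2 = mult D"
  by (simp_all add: col1_def col2_def)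

lemma carrier_D: "carrier D = carrier A \<times> dual K A \<times> carrier A"
  by (simp add: duplicated_algebra_simps)

lemma mem_col1: "x \<in> carrier col1 \<longleftrightarrow> (\<exists>a\<in>carrier A. \<exists>\<phi>\<in>dual K A. x = (a, \<phi>, \<zero>\<^bsub>A\<^esub>))"
proof
  assume "x \<in> carrier col1"
  then obtain d where d: "d \<in> carrier D" "x = d \<otimes>\<^bsub>D\<^esub> e1" by (auto simp: col1_def)
  then obtain a \<phi> b where "d = (a, \<phi>, b)" "a \<in> carrier A" "\<phi> \<in> dual K A" "b \<in> carrier A" by (auto simp: carrier_D)
  then show "\<exists>a\<in>carrier A. \<exists>\<phi>\<in>dual K A. x = (a, \<phi>, \<zero>\<^bsub>A\<^esub>)" using d mult_e1 by blast
next
  assume "\<exists>a\<in>carrier A. \<exists>\<phi>\<in>dual K A. x = (a, \<phi>, \<zero>\<^bsub>A\<^esub>)"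
  then obtain a \<phi> where x: "a \<in> carrier A" "\<phi> \<in> dual K A" "x = (a, \<phi>, \<zero>\<^bsub>A\<^esub>)" by blast
  then have "x = x \<otimes>\<^bsub>D\<^esub> e1" "x \<in> carrier D" using mult_e1[of a \<phi> "\<zero>\<^bsub>A\<^esub>"] by (auto simp: carrier_D)
  then show "x \<in> carrier col1" unfolding col1_def by auto
qed

lemma left_module_regular_D: "left_module D (regular_module D)"
  by (rule left_module_regular[OF D.L.ring_axioms])

lemma hom_right_mult: "c \<in> carrier D \<Longrightarrow> (\<lambda>x. x \<otimes>\<^bsub>D\<^esub> c) \<in> mod_hom D (regular_module D) (regular_module D)"
  by (rule mod_homI) (auto simp: D.L.l_distr D.L.m_assoc)

lemma submodule_cols:
  "is_submodule D (regular_module D) ((\<lambda>x. x \<otimes>\<^bsub>D\<^esub> e1) ` carrier D)"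
  "is_submodule D (regular_module D) ((\<lambda>x. x \<otimes>\<^bsub>D\<^esub> bot \<one>\<^bsub>A\<^esub>) ` carrier D)"
  using submodule_image[OF left_module_regular_D left_module_regular_D hom_right_mult submodule_carrier[OF left_module_regular_D]]
  by auto

lemma fg_cols: "fg_module D col1" "fg_module D col2"
  unfolding col1_def col2_def by (rule D.fg_submodule[OF D.fg_regular submodule_cols(1)], rule D.fg_submodule[OF D.fg_regular submodule_cols(2)])

lemma left_module_cols: "left_module D col1" "left_module D col2"
  using fg_cols fg_left_module by auto

text \<open>The maps are right multiplications by the two idempotents, which add up to the
  unit.\<close>

lemma factors_through_cols: "factors_through D (regular_module D) 2 (\<lambda>i. if i = 0 then col1 else col2)"
  unfolding factors_through_def
proof (rule exI[of _ "\<lambda>i x. x \<otimes>\<^bsub>D\<^esub> (if i = 0 then e1 else bot \<one>\<^bsub>A\<^esub>)"], rule exI[of _ "\<lambda>i x. x"], intro conjI allI impI ballI)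
  fix i :: nat
  show "(\<lambda>x. x \<otimes>\<^bsub>D\<^esub> (if i = 0 then e1 else bot \<one>\<^bsub>A\<^esub>)) \<in> mod_hom D (regular_module D) (if i = 0 then col1 else col2)"
    unfolding col1_def col2_def using hom_into_submod[OF hom_right_mult] by auto
  show "(\<lambda>x. x) \<in> mod_hom D (if i = 0 then col1 else col2) (regular_module D)"
    using hom_inclusion[OF submodule_subset[OF submodule_cols(1)], of D] hom_inclusion[OF submodule_subset[OF submodule_cols(2)], of D]
    unfolding col1_def col2_def by simp
next
  fix x assume "x \<in> carrier (regular_module D)"
  then have x: "x \<in> carrier D" by simp
  interpret RD: left_module D "regular_module D" by (rule left_module_regular_D)
  have "(\<Oplus>\<^bsub>regular_module D\<^esub>i\<in>{0, 1::nat}. x \<otimes>\<^bsub>D\<^esub> (if i = 0 then e1 else bot \<one>\<^bsub>A\<^esub>)) = x \<otimes>\<^bsub>D\<^esub> e1 \<oplus>\<^bsub>D\<^esub> x \<otimes>\<^bsub>D\<^esub> bot \<one>\<^bsub>A\<^esub>"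
    using x by simp
  also have "\<dots> = x" using x by (simp add: D.L.r_distr[symmetric] e1_plus_bot_one)
  moreover have "{..<2::nat} = {0, 1}" by auto
  ultimately show "x = (\<Oplus>\<^bsub>regular_module D\<^esub>i\<in>{..<2::nat}. x \<otimes>\<^bsub>D\<^esub> (if i = 0 then e1 else bot \<one>\<^bsub>A\<^esub>))" by simp
qed

text \<open>Elements of the second column have the form \<open>bot b\<close>, and \<open>e1\<close>
  annihilates these from the left.\<close>

lemma lower_col2: "lower col2"
  unfolding lower_def
proof
  fix x assume "x \<in> carrier col2"
  then obtain d where d: "d \<in> carrier D" "x = d \<otimes>\<^bsub>D\<^esub> bot \<one>\<^bsub>A\<^esub>" by (auto simp: col2_def)
  obtain a \<phi> b where "d = (a, \<phi>, b)" "a \<in> carrier A" "\<phi> \<in> dual K A" "b \<in> carrier A" using d(1) by (auto simp: carrier_D)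
  then have b: "x = bot b" "b \<in> carrier A" using d mult_bot_one by auto
  have "e1 \<otimes>\<^bsub>D\<^esub> bot b = \<zero>\<^bsub>D\<^esub>"
    using b(2) by (auto simp: e1_def bot_def duplicated_algebra_simps dual_facts intro!: dual_ext[of _ K A])
  then show "e1 \<odot>\<^bsub>col2\<^esub> x = \<zero>\<^bsub>col2\<^esub>" using b by simp
qed

lemma projective_col1: "projective D col1"
proof (rule D.projective_retract[OF D.projective_regular _ fg_cols(1)])
  have "(\<lambda>x. x) \<in> mod_hom D col1 (regular_module D)"
    unfolding col1_def by (rule hom_inclusion[OF submodule_subset[OF submodule_cols(1)]])
  moreover have "(\<lambda>x. x \<otimes>\<^bsub>D\<^esub> e1) \<in> mod_hom D (regular_module D) col1"
    unfolding col1_def using hom_into_submod[OF hom_right_mult] by auto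
  ultimately show "retract D col1 (regular_module D)"
    by (rule retractI) (auto simp: mem_col1 mult_e1)
qed

text \<open>Such a map is determined by its value at the generator \<open>e1\<close>. That value is
  fixed by \<open>e1\<close>, hence zero in a \<open>lower\<close> module.\<close>

lemma hom_col1_lower:
  assumes "h \<in> mod_hom D col1 N" "left_module D N" "lower N" "c \<in> carrier col1"
  shows "h c = \<zero>\<^bsub>N\<^esub>"
proof -
  interpret N: left_module D N by fact
  have ee: "e1 \<otimes>\<^bsub>D\<^esub> e1 = e1" using mult_e1[of "\<one>\<^bsub>A\<^esub>" "\<lambda>x\<in>carrier A. \<zero>\<^bsub>K\<^esub>" "\<zero>\<^bsub>A\<^esub>"] A.dual_ops_closed(5) by (simp add: e1_def)
  have e: "e1 \<in> carrier col1" unfolding mem_col1 using A.dual_ops_closed(5) by (auto simp: e1_def)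
  have "h e1 = e1 \<odot>\<^bsub>N\<^esub> h e1" using hom_smult[OF assms(1) elements_closed(1) e] ee by simp
  then have h0: "h e1 = \<zero>\<^bsub>N\<^esub>" using assms(3) hom_closed[OF assms(1) e] by (simp add: lower_def)
  have c: "c \<in> carrier D" "c \<otimes>\<^bsub>D\<^esub> e1 = c" using assms(4) by (auto simp: mem_col1 carrier_D mult_e1)
  have "h c = c \<odot>\<^bsub>N\<^esub> h e1" using hom_smult[OF assms(1) c(1) e] c(2) by simp
  then show ?thesis using h0 c(1) by simp
qed

text \<open>The first column is \<open>D(e\<^sub>2 A\<^sup>(\<^sup>1\<^sup>))\<close>, so homomorphisms \<open>g\<close> into it correspond to functionals \<open>\<lambda>\<close>:
  the functional of \<open>g = (\<alpha>, \<delta>)\<close> is \<open>\<lambda> x = \<delta> x 1\<close>, and conversely \<open>\<lambda>\<close> determines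
  \<open>\<delta> x b = \<lambda> (b x)\<close> and \<open>\<psi> (\<alpha> x) = \<lambda> (\<psi> x)\<close> for \<open>\<psi> \<in> DA\<close>, where \<open>\<alpha> x\<close> exists by reflexivity of \<open>A\<close>.\<close>

lemma functional_extends_to_hom_col1:
  assumes "left_module D N" "\<mu> \<in> mod_hom K (restrict_scalars D N) (regular_module K)"
  shows "\<exists>h\<in>mod_hom D N col1. \<forall>x\<in>carrier N. \<forall>a \<phi>. h x = (a, \<phi>, \<zero>\<^bsub>A\<^esub>) \<longrightarrow>
     (\<forall>b\<in>carrier A. \<phi> b = \<mu> (bot b \<odot>\<^bsub>N\<^esub> x)) \<and> (\<forall>\<psi>\<in>dual K A. \<psi> a = \<mu> (low \<psi> \<odot>\<^bsub>N\<^esub> x))"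
proof -
  interpret N: left_module D N by fact
  have muc: "\<mu> x \<in> carrier K" if "x \<in> carrier N" for x using hom_closed[OF assms(2)] that by simp
  have mua: "\<mu> (x \<oplus>\<^bsub>N\<^esub> y) = \<mu> x \<oplus>\<^bsub>K\<^esub> \<mu> y" if "x \<in> carrier N" "y \<in> carrier N" for x y
    using hom_add[OF assms(2)] that by simp
  have mus: "\<mu> ((c \<odot>\<^bsub>D\<^esub> \<one>\<^bsub>D\<^esub>) \<odot>\<^bsub>N\<^esub> x) = c \<otimes>\<^bsub>K\<^esub> \<mu> x" if "c \<in> carrier K" "x \<in> carrier N" for c x
    using hom_smult[OF assms(2)] that by simp
  have dphi: "(\<lambda>b\<in>carrier A. \<mu> (bot b \<odot>\<^bsub>N\<^esub> x)) \<in> dual K A" if x: "x \<in> carrier N" for x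
  proof (rule A.dualI)
    fix c b assume "c \<in> carrier K" "b \<in> carrier A"
    then show "\<mu> (bot (c \<odot>\<^bsub>A\<^esub> b) \<odot>\<^bsub>N\<^esub> x) = c \<otimes>\<^bsub>K\<^esub> \<mu> (bot b \<odot>\<^bsub>N\<^esub> x)"
      using x D.scalar_one_closed by (simp add: scalar_bot N.smult_assoc1 N.smult_closed mus)
  qed (use x in \<open>auto simp: muc mua N.smult_closed bot_add N.smult_l_distr\<close>)
  have "\<exists>a\<in>carrier A. \<forall>\<psi>\<in>dual K A. \<psi> a = \<mu> (low \<psi> \<odot>\<^bsub>N\<^esub> x)" if x: "x \<in> carrier N" for x
  proof (rule A.dual_reflexive, rule mod_homI)
    fix c \<psi> assume "c \<in> carrier K" "\<psi> \<in> carrier (dual_module K A)"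
    then show "\<mu> (low (c \<odot>\<^bsub>dual_module K A\<^esub> \<psi>) \<odot>\<^bsub>N\<^esub> x) = c \<odot>\<^bsub>regular_module K\<^esub> \<mu> (low \<psi> \<odot>\<^bsub>N\<^esub> x)"
      using x D.scalar_one_closed by (simp add: scalar_low N.smult_assoc1 N.smult_closed mus)
  qed (use x in \<open>auto simp: muc mua N.smult_closed low_add N.smult_l_distr\<close>)
  then obtain \<alpha> where al: "\<And>x. x \<in> carrier N \<Longrightarrow> \<alpha> x \<in> carrier A" "\<And>x \<psi>. x \<in> carrier N \<Longrightarrow> \<psi> \<in> dual K A \<Longrightarrow> \<psi> (\<alpha> x) = \<mu> (low \<psi> \<odot>\<^bsub>N\<^esub> x)"
    by metis
  define h where "h x = (\<alpha> x, (\<lambda>b\<in>carrier A. \<mu> (bot b \<odot>\<^bsub>N\<^esub> x)), \<zero>\<^bsub>A\<^esub>)" for x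
  have "h \<in> mod_hom D N col1"
  proof (rule mod_homI)
    fix x assume x: "x \<in> carrier N"
    then show "h x \<in> carrier col1" unfolding mem_col1 h_def using al(1) dphi by blast
    show "h (x \<oplus>\<^bsub>N\<^esub> y) = h x \<oplus>\<^bsub>col1\<^esub> h y" if y: "y \<in> carrier N" for y
    proof -
      have "\<alpha> (x \<oplus>\<^bsub>N\<^esub> y) = \<alpha> x \<oplus>\<^bsub>A\<^esub> \<alpha> y"
      proof (rule A.dual_separates)
        fix \<psi> assume p: "\<psi> \<in> dual K A"
        have "\<psi> (\<alpha> (x \<oplus>\<^bsub>N\<^esub> y)) = \<mu> (low \<psi> \<odot>\<^bsub>N\<^esub> (x \<oplus>\<^bsub>N\<^esub> y))" using al(2) x y p by simp
        also have "\<dots> = \<mu> (low \<psi> \<odot>\<^bsub>N\<^esub> x) \<oplus>\<^bsub>K\<^esub> \<mu> (low \<psi> \<odot>\<^bsub>N\<^esub> y)"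
          using x y p by (simp add: N.smult_r_distr mua N.smult_closed)
        also have "\<dots> = \<psi> (\<alpha> x) \<oplus>\<^bsub>K\<^esub> \<psi> (\<alpha> y)" using al(2)[OF x p] al(2)[OF y p] by simp
        also have "\<dots> = \<psi> (\<alpha> x \<oplus>\<^bsub>A\<^esub> \<alpha> y)" using dual_plus[OF p al(1)[OF x] al(1)[OF y]] by simp
        finally show "\<psi> (\<alpha> (x \<oplus>\<^bsub>N\<^esub> y)) = \<psi> (\<alpha> x \<oplus>\<^bsub>A\<^esub> \<alpha> y)" .
      qed (use x y al(1) in auto)
      moreover have "(\<lambda>b\<in>carrier A. \<mu> (bot b \<odot>\<^bsub>N\<^esub> (x \<oplus>\<^bsub>N\<^esub> y))) = dual_add K A (\<lambda>b\<in>carrier A. \<mu> (bot b \<odot>\<^bsub>N\<^esub> x)) (\<lambda>b\<in>carrier A. \<mu> (bot b \<odot>\<^bsub>N\<^esub> y))"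
        using x y by (auto simp: dual_add_def fun_eq_iff restrict_def mua N.smult_closed N.smult_r_distr)
      ultimately show ?thesis by (simp add: h_def duplicated_algebra_simps)
    qed
    show "h (d \<odot>\<^bsub>N\<^esub> x) = d \<odot>\<^bsub>col1\<^esub> h x" if d: "d \<in> carrier D" for d
    proof -
      obtain a \<phi> b where d': "d = (a, \<phi>, b)" "a \<in> carrier A" "\<phi> \<in> dual K A" "b \<in> carrier A"
        using d by (auto simp: carrier_D)
      have "\<alpha> (d \<odot>\<^bsub>N\<^esub> x) = a \<otimes>\<^bsub>A\<^esub> \<alpha> x"
      proof (rule A.dual_separates)
        fix \<psi> assume p: "\<psi> \<in> dual K A"
        have "\<psi> (\<alpha> (d \<odot>\<^bsub>N\<^esub> x)) = \<mu> ((low \<psi> \<otimes>\<^bsub>D\<^esub> d) \<odot>\<^bsub>N\<^esub> x)" using al(2)[OF N.smult_closed[OF d x] p] d x p by (simp add: N.smult_assoc1)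
        also have "\<dots> = dual_right A \<psi> a (\<alpha> x)" unfolding d'(1) low_mult[OF d'(2-4) p] using al(2)[OF x A.dual_ops_closed(3)[OF d'(2) p]] by simp
        also have "\<dots> = \<psi> (a \<otimes>\<^bsub>A\<^esub> \<alpha> x)" using al(1)[OF x] by simp
        finally show "\<psi> (\<alpha> (d \<odot>\<^bsub>N\<^esub> x)) = \<psi> (a \<otimes>\<^bsub>A\<^esub> \<alpha> x)" .
      qed (use al(1) x d d' N.smult_closed in auto)
      moreover have "(\<lambda>b\<in>carrier A. \<mu> (bot b \<odot>\<^bsub>N\<^esub> (d \<odot>\<^bsub>N\<^esub> x))) =
          dual_add K A (dual_right A \<phi> (\<alpha> x)) (dual_left A b (\<lambda>b\<in>carrier A. \<mu> (bot b \<odot>\<^bsub>N\<^esub> x)))"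
      proof (rule dual_ext[of _ K A])
        show "(\<lambda>b\<in>carrier A. \<mu> (bot b \<odot>\<^bsub>N\<^esub> (d \<odot>\<^bsub>N\<^esub> x))) \<in> dual K A" using dphi[OF N.smult_closed[OF d x]] .
        show "dual_add K A (dual_right A \<phi> (\<alpha> x)) (dual_left A b (\<lambda>b\<in>carrier A. \<mu> (bot b \<odot>\<^bsub>N\<^esub> x))) \<in> dual K A"
          by (intro A.dual_ops_closed(1,2,3) dphi[OF x] d' al(1)[OF x])
        fix y assume y: "y \<in> carrier A"
        have "\<mu> (bot y \<odot>\<^bsub>N\<^esub> (d \<odot>\<^bsub>N\<^esub> x)) = \<mu> ((bot y \<otimes>\<^bsub>D\<^esub> d) \<odot>\<^bsub>N\<^esub> x)" using d x y by (simp add: N.smult_assoc1)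
        also have "\<dots> = \<mu> (low (dual_left A y \<phi>) \<odot>\<^bsub>N\<^esub> x) \<oplus>\<^bsub>K\<^esub> \<mu> (bot (y \<otimes>\<^bsub>A\<^esub> b) \<odot>\<^bsub>N\<^esub> x)"
          unfolding d'(1) bot_mult_left[OF d'(2-4) y] using x y d' A.dual_ops_closed(2)[OF y d'(3)] by (simp add: N.smult_l_distr mua N.smult_closed)
        also have "\<mu> (low (dual_left A y \<phi>) \<odot>\<^bsub>N\<^esub> x) = \<phi> (\<alpha> x \<otimes>\<^bsub>A\<^esub> y)"
          using al(2)[OF x A.dual_ops_closed(2)[OF y d'(3)]] al(1)[OF x] by simp
        finally show "(\<lambda>b\<in>carrier A. \<mu> (bot b \<odot>\<^bsub>N\<^esub> (d \<odot>\<^bsub>N\<^esub> x))) y = dual_add K A (dual_right A \<phi> (\<alpha> x)) (dual_left A b (\<lambda>b\<in>carrier A. \<mu> (bot b \<odot>\<^bsub>N\<^esub> x))) y"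
          using y d'(4) by simp
      qed
      ultimately show ?thesis using d'(4) by (simp add: h_def d'(1) duplicated_algebra_simps)
    qed
  qed
  then show ?thesis using al(2) by (intro bexI[of _ h]) (auto simp: h_def)
qed

text \<open>The map \<open>g\<close> is turned into a functional \<nu>, which linear algebra extends
  along \<open>f\<close> and which is then turned back into a homomorphism. That the result
  restricts to \<open>g\<close> is checked for the two entries separately, for the upper one by
  testing against all functionals.\<close>

lemma injective_col1: "injective D col1"
  unfolding injective_def
proof (intro conjI allI impI fg_cols(1))
  fix M N :: "('k, 'a \<times> ('a \<Rightarrow> 'k) \<times> 'a) umod" and f g
  assume *: "fg_module D M \<and> fg_module D N \<and> f \<in> mod_hom D M N \<and> inj_on f (carrier M) \<and> g \<in> mod_hom D M col1"
  have f: "f \<in> mod_hom D M N" and inj: "inj_on f (carrier M)" and g: "g \<in> mod_hom D M col1" using * by auto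
  have lm: "left_module D M" "left_module D N" using * fg_left_module by auto
  interpret M: left_module D M by fact
  interpret N: left_module D N by fact
  have fN: "fg_module K (restrict_scalars D N)" using * D.fg_iff_fg_restrict_scalars by blast
  have lr: "left_module K (restrict_scalars D M)" "left_module K (restrict_scalars D N)" using lm D.left_module_restrict_scalars by auto
  have lK: "left_module K (regular_module K)" by (rule left_module_regular[OF A.K.ring_axioms])
  have gc: "\<exists>a\<in>carrier A. \<exists>\<phi>\<in>dual K A. g x = (a, \<phi>, \<zero>\<^bsub>A\<^esub>)" if "x \<in> carrier M" for x using hom_closed[OF g that] mem_col1 by blast
  define \<nu> where "\<nu> x = fst (snd (g x)) \<one>\<^bsub>A\<^esub>" for x
  have l0: "\<nu> \<in> mod_hom K (restrict_scalars D M) (regular_module K)"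
  proof (rule mod_homI)
    fix x assume "x \<in> carrier (restrict_scalars D M)"
    then have x: "x \<in> carrier M" by simp
    obtain a \<phi> where a: "a \<in> carrier A" "\<phi> \<in> dual K A" "g x = (a, \<phi>, \<zero>\<^bsub>A\<^esub>)" using gc[OF x] by blast
    show "\<nu> x \<in> carrier (regular_module K)" using a dual_closed[OF a(2) A.L.one_closed] by (simp add: \<nu>_def)
    show "\<nu> (x \<oplus>\<^bsub>restrict_scalars D M\<^esub> y) = \<nu> x \<oplus>\<^bsub>regular_module K\<^esub> \<nu> y" if "y \<in> carrier (restrict_scalars D M)" for y
    proof -
      obtain a' \<phi>' where "a' \<in> carrier A" "\<phi>' \<in> dual K A" "g y = (a', \<phi>', \<zero>\<^bsub>A\<^esub>)" using gc[of y] \<open>y \<in> _\<close> by auto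
      then show ?thesis using a x \<open>y \<in> _\<close> by (simp add: \<nu>_def hom_add[OF g] duplicated_algebra_simps)
    qed
    show "\<nu> (c \<odot>\<^bsub>restrict_scalars D M\<^esub> x) = c \<odot>\<^bsub>regular_module K\<^esub> \<nu> x" if c: "c \<in> carrier K" for c
    proof -
      have gD: "g x \<in> carrier D" using a by (simp add: carrier_D)
      have "g ((c \<odot>\<^bsub>D\<^esub> \<one>\<^bsub>D\<^esub>) \<odot>\<^bsub>M\<^esub> x) = c \<odot>\<^bsub>D\<^esub> g x"
        using hom_smult[OF g D.scalar_one_closed[OF c] x] D.scalar_left[OF c D.L.one_closed gD] gD by simp
      then show ?thesis using a by (simp add: \<nu>_def duplicated_algebra_simps)
    qed
  qed
  let ?U = "f ` carrier M"
  have sU: "is_submodule K (restrict_scalars D N) ?U"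
    using submodule_image[OF lr(1,2) D.hom_restrict_scalars[OF f] submodule_carrier[OF lr(1)]] by simp
  have b: "bij_betw f (carrier (restrict_scalars D M)) (carrier (submod (restrict_scalars D N) ?U))" using inj by (simp add: bij_betw_def)
  \<comment> \<open>Carries \<nu> over to the image of \<open>f\<close>, the subspace from which it
    is extended.\<close>
  have "inv_into (carrier M) f \<in> mod_hom K (submod (restrict_scalars D N) ?U) (restrict_scalars D M)"
    using hom_inv_into[OF hom_into_submod[OF D.hom_restrict_scalars[OF f]] b lr(1)] by simp
  from hom_extend[OF A.K_field fN lK sU hom_comp[OF this l0]]
  obtain \<mu> where mu: "\<mu> \<in> mod_hom K (restrict_scalars D N) (regular_module K)" "\<forall>y\<in>?U. \<mu> y = \<nu> (inv_into (carrier M) f y)" by blast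
  have muf: "\<mu> (f x) = \<nu> x" if "x \<in> carrier M" for x using mu(2) inj that by simp
  obtain h where h: "h \<in> mod_hom D N col1" "\<And>x a \<phi>. x \<in> carrier N \<Longrightarrow> h x = (a, \<phi>, \<zero>\<^bsub>A\<^esub>) \<Longrightarrow>
     (\<forall>b\<in>carrier A. \<phi> b = \<mu> (bot b \<odot>\<^bsub>N\<^esub> x)) \<and> (\<forall>\<psi>\<in>dual K A. \<psi> a = \<mu> (low \<psi> \<odot>\<^bsub>N\<^esub> x))"
    using functional_extends_to_hom_col1[OF lm(2) mu(1)] by blast
  show "\<exists>h\<in>mod_hom D N col1. \<forall>x\<in>carrier M. h (f x) = g x"
  proof (intro bexI[OF _ h(1)] ballI)
    fix x assume x: "x \<in> carrier M"
    have fx: "f x \<in> carrier N" using hom_closed[OF f x] .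
    obtain a \<phi> where a: "a \<in> carrier A" "\<phi> \<in> dual K A" "g x = (a, \<phi>, \<zero>\<^bsub>A\<^esub>)" using gc[OF x] by blast
    obtain a' \<phi>' where a': "a' \<in> carrier A" "\<phi>' \<in> dual K A" "h (f x) = (a', \<phi>', \<zero>\<^bsub>A\<^esub>)"
      using hom_closed[OF h(1) fx] mem_col1 by blast
    have "\<phi>' = \<phi>"
    proof (rule dual_ext[OF a'(2) a(2)])
      fix b assume b: "b \<in> carrier A"
      have "g (bot b \<odot>\<^bsub>M\<^esub> x) = bot b \<otimes>\<^bsub>D\<^esub> (a, \<phi>, \<zero>\<^bsub>A\<^esub>)" using hom_smult[OF g _ x] b a(3) by simp
      moreover have "\<phi>' b = \<nu> (bot b \<odot>\<^bsub>M\<^esub> x)"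
        using h(2)[OF fx a'(3)] b hom_smult[OF f _ x, of "bot b"] muf[OF M.smult_closed[OF _ x], of "bot b"] by simp
      ultimately show "\<phi>' b = \<phi> b" using a b by (simp add: \<nu>_def bot_def duplicated_algebra_simps dual_facts)
    qed
    moreover have "a' = a"
    proof (rule A.dual_separates[OF a'(1) a(1)])
      fix \<psi> assume p: "\<psi> \<in> dual K A"
      have "g (low \<psi> \<odot>\<^bsub>M\<^esub> x) = low (dual_right A \<psi> a)" using hom_smult[OF g _ x] p a(3) low_mult[OF a(1,2) _ p] by simp
      moreover have "\<psi> a' = \<nu> (low \<psi> \<odot>\<^bsub>M\<^esub> x)"
        using h(2)[OF fx a'(3)] p hom_smult[OF f _ x, of "low \<psi>"] muf[OF M.smult_closed[OF _ x], of "low \<psi>"] by simp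
      ultimately have "\<psi> a' = fst (snd (low (dual_right A \<psi> a))) \<one>\<^bsub>A\<^esub>" by (simp add: \<nu>_def)
      then show "\<psi> a' = \<psi> a" using a(1) by (simp add: low_def)
    qed
    ultimately show "h (f x) = g x" using a a' by simp
  qed
qed

text \<open>A lower module \<open>N\<close> embeds into a power of the first column via the coordinate functionals of \<open>N\<close>,
  but the first column has no nonzero homomorphism to \<open>N\<close>.\<close>

lemma lower_injective_zero:
  fixes N :: "('k, 'a \<times> ('a \<Rightarrow> 'k) \<times> 'a) umod"
  assumes "injective D N" "lower N"
  shows "carrier N = {\<zero>\<^bsub>N\<^esub>}"
proof -
  have fN: "fg_module D N" using assms(1) by (rule D.injective_fg)
  have lN: "left_module D N" using fN by (rule fg_left_module)
  interpret N: left_module D N by fact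
  have fK: "fg_module K (restrict_scalars D N)" using fN D.fg_iff_fg_restrict_scalars by blast
  interpret NK: left_module K "restrict_scalars D N" using fK by (rule fg_left_module)
  obtain n a l where al: "\<And>i. i < n \<Longrightarrow> a i \<in> carrier (restrict_scalars D N)"
    "\<And>i. i < n \<Longrightarrow> l i \<in> mod_hom K (restrict_scalars D N) (regular_module K)"
    "\<And>x. x \<in> carrier (restrict_scalars D N) \<Longrightarrow> x = (\<Oplus>\<^bsub>restrict_scalars D N\<^esub>i\<in>{..<n::nat}. l i x \<odot>\<^bsub>restrict_scalars D N\<^esub> a i)"
    by (rule dual_basis[OF A.K_field fK]) blast
  have "\<forall>i<n. \<exists>h\<in>mod_hom D N col1. \<forall>x\<in>carrier N. \<forall>a \<phi>. h x = (a, \<phi>, \<zero>\<^bsub>A\<^esub>) \<longrightarrow> (\<forall>b\<in>carrier A. \<phi> b = l i (bot b \<odot>\<^bsub>N\<^esub> x))"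
  proof (intro allI impI)
    fix i assume "i < n"
    from functional_extends_to_hom_col1[OF lN al(2)[OF this]]
    obtain h where "h \<in> mod_hom D N col1" "\<forall>x\<in>carrier N. \<forall>a \<phi>. h x = (a, \<phi>, \<zero>\<^bsub>A\<^esub>) \<longrightarrow>
      (\<forall>b\<in>carrier A. \<phi> b = l i (bot b \<odot>\<^bsub>N\<^esub> x)) \<and> (\<forall>\<psi>\<in>dual K A. \<psi> a = l i (low \<psi> \<odot>\<^bsub>N\<^esub> x))" by (elim bexE)
    then show "\<exists>h\<in>mod_hom D N col1. \<forall>x\<in>carrier N. \<forall>a \<phi>. h x = (a, \<phi>, \<zero>\<^bsub>A\<^esub>) \<longrightarrow> (\<forall>b\<in>carrier A. \<phi> b = l i (bot b \<odot>\<^bsub>N\<^esub> x))"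
      by (intro bexI[of _ h]) simp_all
  qed
  then obtain h where h: "\<And>i. i < n \<Longrightarrow> h i \<in> mod_hom D N col1"
    "\<And>i x a \<phi> b. i < n \<Longrightarrow> x \<in> carrier N \<Longrightarrow> h i x = (a, \<phi>, \<zero>\<^bsub>A\<^esub>) \<Longrightarrow> b \<in> carrier A \<Longrightarrow> \<phi> b = l i (bot b \<odot>\<^bsub>N\<^esub> x)"
    by metis
  let ?S = "dsum {..<n} (\<lambda>_. col1)"
  have fS: "fg_module D ?S" by (rule fg_dsum[OF D.L.ring_axioms fg_cols(1)])
  have lS: "left_module D ?S" using fS by (rule fg_left_module)
  define j where "j x = (\<lambda>i\<in>{..<n}. h i x)" for x
  have j: "j \<in> mod_hom D N ?S" unfolding j_def by (rule hom_dsum_tuple) (use h in auto)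
  have j0: "x = \<zero>\<^bsub>N\<^esub>" if x: "x \<in> carrier N" "j x = \<zero>\<^bsub>?S\<^esub>" for x
  proof -
    \<comment> \<open>At the unit the second entry of \<open>h i x\<close> is the coordinate
      \<open>l i x\<close>, because \<open>x\<close> is fixed by the second idempotent.\<close>
    have l0: "l i x = \<zero>\<^bsub>K\<^esub>" if i: "i < n" for i
    proof -
      have "h i x = \<zero>\<^bsub>D\<^esub>" using fun_cong[OF x(2), of i] i by (simp add: j_def)
      then have "h i x = (\<zero>\<^bsub>A\<^esub>, \<lambda>x\<in>carrier A. \<zero>\<^bsub>K\<^esub>, \<zero>\<^bsub>A\<^esub>)" by (simp add: duplicated_algebra_simps)
      from h(2)[OF i x(1) this A.L.one_closed] show ?thesis using lower_act(1)[OF lN assms(2) x(1)] by simp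
    qed
    have "(\<Oplus>\<^bsub>restrict_scalars D N\<^esub>i\<in>{..<n}. l i x \<odot>\<^bsub>restrict_scalars D N\<^esub> a i) = (\<Oplus>\<^bsub>restrict_scalars D N\<^esub>i\<in>{..<n}. \<zero>\<^bsub>restrict_scalars D N\<^esub>)"
      by (rule NK.M.finsum_cong'[OF refl]) (use l0 al(1) NK.smult_zero_left in \<open>auto simp del: restrict_scalars_simps(4)\<close>)
    also have "\<dots> = \<zero>\<^bsub>restrict_scalars D N\<^esub>" by (rule NK.M.finsum_zero)
    finally have "(\<Oplus>\<^bsub>restrict_scalars D N\<^esub>i\<in>{..<n}. l i x \<odot>\<^bsub>restrict_scalars D N\<^esub> a i) = \<zero>\<^bsub>N\<^esub>"
      unfolding restrict_scalars_simps(2) .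
    with al(3)[of x] x(1) show ?thesis unfolding restrict_scalars_simps(1) by (metis (no_types))
  qed
  obtain U :: "('k, 'a \<times> ('a \<Rightarrow> 'k) \<times> 'a) umod" where U: "fg_module D U" "mod_iso D ?S U" using D.umod_exists[OF fS] by blast
  have lU: "left_module D U" using U(1) by (rule fg_left_module)
  obtain u w where uw: "u \<in> mod_hom D ?S U" "w \<in> mod_hom D U ?S" "\<And>x. x \<in> carrier ?S \<Longrightarrow> w (u x) = x"
    by (rule mod_iso_inverse[OF U(2) lS]) blast
  have uj: "(\<lambda>x. u (j x)) \<in> mod_hom D N U" by (rule hom_comp[OF j uw(1)])
  have "inj_on (\<lambda>x. u (j x)) (carrier N)"
  proof (rule hom_injI[OF uj lN lU])
    fix x assume x: "x \<in> carrier N" "u (j x) = \<zero>\<^bsub>U\<^esub>"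
    then have "j x = w \<zero>\<^bsub>U\<^esub>" using uw(3)[OF hom_closed[OF j x(1)]] by simp
    then show "x = \<zero>\<^bsub>N\<^esub>" using j0[OF x(1)] hom_zero[OF uw(2) lU lS] by simp
  qed
  from D.injective_extend[OF assms(1) fN U(1) uj this hom_id]
  obtain r where r: "r \<in> mod_hom D U N" "\<And>x. x \<in> carrier N \<Longrightarrow> r (u (j x)) = x" by blast
  have "x = \<zero>\<^bsub>N\<^esub>" if x: "x \<in> carrier N" for x
  proof -
    have ru: "(\<lambda>s. r (u s)) \<in> mod_hom D ?S N" by (rule hom_comp[OF uw(1) r(1)])
    let ?inj = "\<lambda>i. (\<lambda>s. \<lambda>k\<in>{..<n}. if k = i then s else \<zero>\<^bsub>col1\<^esub>)"
    have inj: "?inj i \<in> mod_hom D col1 ?S" for i by (rule hom_dsum_inj) (rule left_module_cols(1))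
    have jc: "j x i \<in> carrier col1" if "i < n" for i using hom_closed[OF h(1)[OF that] x] that by (simp add: j_def)
    have "j x = (\<Oplus>\<^bsub>?S\<^esub>i\<in>{..<n}. ?inj i (j x i))"
      using dsum_decompose[OF D.L.ring_axioms left_module_cols(1) finite_lessThan hom_closed[OF j x]] by simp
    then have "r (u (j x)) = r (u (\<Oplus>\<^bsub>?S\<^esub>i\<in>{..<n}. ?inj i (j x i)))" by simp
    also have "\<dots> = (\<Oplus>\<^bsub>N\<^esub>i\<in>{..<n}. r (u (?inj i (j x i))))"
      by (rule hom_finsum[OF ru lS lN]) (use hom_closed[OF inj jc] in auto)
    also have "\<dots> = (\<Oplus>\<^bsub>N\<^esub>i\<in>{..<n}. \<zero>\<^bsub>N\<^esub>)"
      by (rule N.M.finsum_cong'[OF refl]) (use hom_col1_lower[OF hom_comp[OF inj ru] lN assms(2) jc] in auto)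
    finally show ?thesis using r(2)[OF x] by simp
  qed
  then show ?thesis using N.M.zero_closed by blast
qed

end

text \<open>Fixes a decomposition that witnesses \<open>proj_inj_sum\<close> for a module of the
  type used in the definitions; in the theorem this module is a copy of the given one.\<close>

locale proj_inj_duplicated = duplicated K A for K :: "'k ring" and A :: "('k, 'a) module" +
  fixes P :: "('k, 'a \<times> ('a \<Rightarrow> 'k) \<times> 'a) umod"
    and n :: nat and X :: "nat \<Rightarrow> ('k, 'a \<times> ('a \<Rightarrow> 'k) \<times> 'a) umod"
  assumes fg_P: "fg_module (duplicated_algebra K A) P"
    and X_indecomposable: "\<And>i. i < n \<Longrightarrow> indecomposable (duplicated_algebra K A) (X i)"
    and X_projective: "\<And>i. i < n \<Longrightarrow> projective (duplicated_algebra K A) (X i)"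
    and X_injective: "\<And>i. i < n \<Longrightarrow> injective (duplicated_algebra K A) (X i)"
    and X_pairwise: "pairwise_non_iso (duplicated_algebra K A) n X"
    and X_complete: "\<And>Z :: ('k, 'a \<times> ('a \<Rightarrow> 'k) \<times> 'a) umod. indecomposable (duplicated_algebra K A) Z \<Longrightarrow>
      projective (duplicated_algebra K A) Z \<Longrightarrow> injective (duplicated_algebra K A) Z \<Longrightarrow>
      \<exists>i<n. mod_iso (duplicated_algebra K A) Z (X i)"
    and P_iso: "mod_iso (duplicated_algebra K A) P (dsum {..<n} X)"
begin

lemma left_module_P: "left_module D P"
  using fg_P by (rule fg_left_module)

lemma left_module_X: "i < n \<Longrightarrow> left_module D (X i)"
  using D.projective_fg[OF X_projective] fg_left_module by blast

lemma projective_P: "projective D P" and injective_P: "injective D P"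
proof -
  have "factors_through D P n X" by (rule factors_through_dsum[OF P_iso left_module_P left_module_X])
  then show "projective D P" "injective D P"
    using D.projective_factors_through[OF fg_P _ X_projective] D.injective_factors_through[OF fg_P _ X_injective] by auto
qed

text \<open>Each \<open>X i\<close> is an indecomposable summand of the regular module, hence of one
  of its columns. A summand of \<open>col2\<close> would be \<open>lower\<close>, which
  \<open>lower_injective_zero\<close> excludes. So \<open>X i\<close> is a summand of
  \<open>col1\<close>, and \<open>hom_col1_lower\<close> applies.\<close>

lemma hom_P_lower:
  assumes "h \<in> mod_hom D P N" "left_module D N" "lower N" "x \<in> carrier P"
  shows "h x = \<zero>\<^bsub>N\<^esub>"
proof -
  interpret N: left_module D N by fact
  obtain u v where uv: "\<And>i. i < n \<Longrightarrow> u i \<in> mod_hom D (X i) P" "\<And>i. i < n \<Longrightarrow> v i \<in> mod_hom D P (X i)"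
    "\<And>w. w \<in> carrier P \<Longrightarrow> w = (\<Oplus>\<^bsub>P\<^esub>i\<in>{..<n}. u i (v i w))"
    by (rule mod_iso_dsum_factors[OF P_iso left_module_P left_module_X]; blast)
  have zero: "g y = \<zero>\<^bsub>N\<^esub>" if i: "i < n" and g: "g \<in> mod_hom D (X i) N" and y: "y \<in> carrier (X i)" for i g y
  proof -
    obtain m where "factors_through D (X i) m (\<lambda>_. regular_module D)" using D.projective_factors_through_regular[OF X_projective[OF i]] by blast
    then have "retract D (X i) (regular_module D)" using D.indecomposable_retract_of_factor[OF X_indecomposable[OF i]] by blast
    from factors_through_retract[OF this factors_through_cols left_module_X[OF i] left_module_regular_D]
    have "factors_through D (X i) 2 (\<lambda>i. if i = 0 then col1 else col2)" using left_module_cols by auto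
    from D.indecomposable_retract_of_factor[OF X_indecomposable[OF i] this]
    have "retract D (X i) col1 \<or> retract D (X i) col2" by (auto split: if_splits)
    moreover have "\<not> retract D (X i) col2"
    proof
      assume "retract D (X i) col2"
      from lower_retract[OF this lower_col2 left_module_X[OF i] left_module_cols(2)]
      show False using lower_injective_zero[OF X_injective[OF i]] X_indecomposable[OF i] by (simp add: indecomposable_def)
    qed
    ultimately obtain s t where st: "s \<in> mod_hom D (X i) col1" "t \<in> mod_hom D col1 (X i)" "\<And>x. x \<in> carrier (X i) \<Longrightarrow> t (s x) = x"
      unfolding retract_def by blast
    show ?thesis using hom_col1_lower[OF hom_comp[OF st(2) g] assms(2,3) hom_closed[OF st(1) y]] st(3)[OF y] by simp
  qed
  have vc: "v i x \<in> carrier (X i)" if "i < n" for i using hom_closed[OF uv(2)[OF that] assms(4)] .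
  have "h x = h (\<Oplus>\<^bsub>P\<^esub>i\<in>{..<n}. u i (v i x))" using uv(3)[OF assms(4)] by simp
  also have "\<dots> = (\<Oplus>\<^bsub>N\<^esub>i\<in>{..<n}. h (u i (v i x)))"
    by (rule hom_finsum[OF assms(1) left_module_P assms(2)]) (use hom_closed[OF uv(1) vc] in auto)
  also have "\<dots> = (\<Oplus>\<^bsub>N\<^esub>i\<in>{..<n}. \<zero>\<^bsub>N\<^esub>)"
    by (rule N.M.finsum_cong'[OF refl]) (use zero[OF _ hom_comp[OF uv(1) assms(1)] vc] in auto)
  finally show ?thesis by simp
qed

text \<open>Induction on the dimension: a decomposable module splits into smaller
  projective-injective modules, and an indecomposable one is some \<open>X i\<close> by
  completeness.\<close>

lemma proj_inj_factors_through_P: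
  fixes N :: "('k, 'a \<times> ('a \<Rightarrow> 'k) \<times> 'a) umod"
  assumes "projective D N" "injective D N"
  shows "\<exists>m. factors_through D N m (\<lambda>_. P)"
  using assms
proof (induct "mdim K D N" arbitrary: N rule: less_induct)
  case less
  have fN: "fg_module D N" using less(2) by (rule D.projective_fg)
  have lN: "left_module D N" using fN by (rule fg_left_module)
  show ?case
  proof (cases "carrier N = {\<zero>\<^bsub>N\<^esub>}")
    case True
    interpret N: left_module D N by fact
    have "factors_through D N 0 (\<lambda>_. P)" unfolding factors_through_def using True by simp
    then show ?thesis by blast
  next
    case nz: False
    show ?thesis
    proof (cases "indecomposable D N")
      case True
      obtain i where i: "i < n" "mod_iso D N (X i)" using X_complete[OF True less(2,3)] by blast
      obtain u v where uv: "\<And>i. i < n \<Longrightarrow> u i \<in> mod_hom D (X i) P" "\<And>i. i < n \<Longrightarrow> v i \<in> mod_hom D P (X i)"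
        "\<And>i x. i < n \<Longrightarrow> x \<in> carrier (X i) \<Longrightarrow> v i (u i x) = x"
        by (rule mod_iso_dsum_factors[OF P_iso left_module_P left_module_X]; blast)
      have "retract D (X i) P" by (rule retractI[OF uv(1)[OF i(1)] uv(2)[OF i(1)]]) (rule uv(3)[OF i(1)])
      then have "retract D N P" by (rule retract_trans[OF mod_iso_retract[OF i(2) lN]])
      then show ?thesis using factors_through_of_retract[OF _ lN] by blast
    next
      case False
      then obtain U V :: "('k, 'a \<times> ('a \<Rightarrow> 'k) \<times> 'a) umod" where UV: "fg_module D U" "fg_module D V" "mod_iso D N (dsum2 U V)"
        "carrier U \<noteq> {\<zero>\<^bsub>U\<^esub>}" "carrier V \<noteq> {\<zero>\<^bsub>V\<^esub>}" using fN nz unfolding indecomposable_def by blast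
      have lm: "left_module D U" "left_module D V" using UV fg_left_module by auto
      have lUV: "left_module D (dsum2 U V)" "left_module D (dsum2 V U)" using lm left_module_dsum2 by auto
      \<comment> \<open>\<open>mdim_summand_less\<close> bounds the first summand, so the second one
        is treated after a swap.\<close>
      have sw: "mod_iso D (dsum2 U V) (dsum2 V U)"
        by (rule mod_isoI'[OF hom_pair[OF hom_snd hom_fst] hom_pair[OF hom_snd hom_fst]]) auto
      have r: "retract D U N" "retract D V N"
        using retract_trans[OF retract_dsum2(1)[OF lm] mod_iso_retract[OF mod_iso_sym[OF UV(3) lN] lUV(1)]]
          retract_trans[OF retract_dsum2(2)[OF lm] mod_iso_retract[OF mod_iso_sym[OF UV(3) lN] lUV(1)]] by auto
      have "mdim K D U < mdim K D N" by (rule D.mdim_summand_less[OF fN UV(3) lm UV(5)])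
      from less(1)[OF this D.projective_retract[OF less(2) r(1) UV(1)] D.injective_retract[OF less(3) r(1) UV(1)]]
      obtain a where a: "factors_through D U a (\<lambda>_. P)" by blast
      have "mdim K D V < mdim K D N" by (rule D.mdim_summand_less[OF fN mod_iso_trans[OF UV(3) sw] lm(2,1) UV(4)])
      from less(1)[OF this D.projective_retract[OF less(2) r(2) UV(2)] D.injective_retract[OF less(3) r(2) UV(2)]]
      obtain b where b: "factors_through D V b (\<lambda>_. P)" by blast
      show ?thesis using factors_through_sum[OF UV(3) lN lm left_module_P a b] by blast
    qed
  qed
qed

text \<open>The column is projective and injective but has a carrier of another type, so the
  previous result is applied to a copy.\<close>

lemma col1_factors_through_P: "\<exists>m. factors_through D col1 m (\<lambda>_. P)"
proof -
  obtain U :: "('k, 'a \<times> ('a \<Rightarrow> 'k) \<times> 'a) umod" where U: "fg_module D U" "mod_iso D col1 U" using D.umod_exists[OF fg_cols(1)] by blast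
  have lU: "left_module D U" using U(1) by (rule fg_left_module)
  have r: "retract D U col1" by (rule mod_iso_retract[OF mod_iso_sym[OF U(2) left_module_cols(1)] lU])
  obtain m where "factors_through D U m (\<lambda>_. P)"
    using proj_inj_factors_through_P D.projective_retract[OF projective_col1 r U(1)] D.injective_retract[OF injective_col1 r U(1)] by blast
  from factors_through_retract[OF mod_iso_retract[OF U(2) left_module_cols(1)] this left_module_cols(1) lU left_module_P]
  show ?thesis by blast
qed

end

section \<open>Tilting modules over a duplicated algebra\<close>

lemma short_exact_iso:
  assumes "short_exact R X f E g Y" "mod_iso R X X'" "mod_iso R E E'" "mod_iso R Y Y'"
    "left_module R X" "left_module R E" "left_module R Y" "left_module R X'" "left_module R E'" "left_module R Y'"
  shows "\<exists>f' g'. short_exact R X' f' E' g' Y'"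
proof -
  note e = short_exactD[OF assms(1)]
  obtain u u' where u: "u \<in> mod_hom R X X'" "u' \<in> mod_hom R X' X" "\<And>x. x \<in> carrier X \<Longrightarrow> u' (u x) = x" "\<And>x. x \<in> carrier X' \<Longrightarrow> u (u' x) = x"
    by (rule mod_iso_inverse[OF assms(2,5)]) blast
  obtain v v' where v: "v \<in> mod_hom R E E'" "v' \<in> mod_hom R E' E" "\<And>x. x \<in> carrier E \<Longrightarrow> v' (v x) = x" "\<And>x. x \<in> carrier E' \<Longrightarrow> v (v' x) = x"
    by (rule mod_iso_inverse[OF assms(3,6)]) blast
  obtain w w' where w: "w \<in> mod_hom R Y Y'" "w' \<in> mod_hom R Y' Y" "\<And>x. x \<in> carrier Y \<Longrightarrow> w' (w x) = x" "\<And>x. x \<in> carrier Y' \<Longrightarrow> w (w' x) = x"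
    by (rule mod_iso_inverse[OF assms(4,7)]) blast
  have c: "\<And>x. x \<in> carrier X' \<Longrightarrow> u' x \<in> carrier X" "\<And>x. x \<in> carrier E' \<Longrightarrow> v' x \<in> carrier E" "\<And>x. x \<in> carrier E \<Longrightarrow> v x \<in> carrier E'"
    "\<And>x. x \<in> carrier X \<Longrightarrow> f x \<in> carrier E" "\<And>x. x \<in> carrier E \<Longrightarrow> g x \<in> carrier Y" "\<And>x. x \<in> carrier X \<Longrightarrow> u x \<in> carrier X'"
    "\<And>x. x \<in> carrier Y' \<Longrightarrow> w' x \<in> carrier Y"
    using hom_closed[OF u(2)] hom_closed[OF v(2)] hom_closed[OF v(1)] hom_closed[OF e(1)] hom_closed[OF e(2)] hom_closed[OF u(1)] hom_closed[OF w(2)] by auto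
  have f': "(\<lambda>x. v (f (u' x))) \<in> mod_hom R X' E'" by (rule hom_comp[OF hom_comp[OF u(2) e(1)] v(1)])
  have g': "(\<lambda>x. w (g (v' x))) \<in> mod_hom R E' Y'" by (rule hom_comp[OF hom_comp[OF v(2) e(2)] w(1)])
  have w0: "w y = \<zero>\<^bsub>Y'\<^esub> \<longleftrightarrow> y = \<zero>\<^bsub>Y\<^esub>" if "y \<in> carrier Y" for y
    using w(3)[OF that] hom_zero[OF w(1) assms(7,10)] hom_zero[OF w(2) assms(10,7)] by metis
  have "short_exact R X' (\<lambda>x. v (f (u' x))) E' (\<lambda>x. w (g (v' x))) Y'"
  proof (rule short_exactI[OF f' g'])
    show "inj_on (\<lambda>x. v (f (u' x))) (carrier X')"
    proof (rule inj_onI)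
      fix x y assume xy: "x \<in> carrier X'" "y \<in> carrier X'" "v (f (u' x)) = v (f (u' y))"
      then have "f (u' x) = f (u' y)" using v(3)[OF c(4)[OF c(1)[OF xy(1)]]] v(3)[OF c(4)[OF c(1)[OF xy(2)]]] by metis
      then have "u' x = u' y" using e(3) c(1) xy(1,2) by (meson inj_onD)
      then show "x = y" using u(4) xy(1,2) by metis
    qed
    show "(\<lambda>x. v (f (u' x))) ` carrier X' = {y \<in> carrier E'. w (g (v' y)) = \<zero>\<^bsub>Y'\<^esub>}"
    proof (intro equalityI subsetI)
      fix y assume "y \<in> (\<lambda>x. v (f (u' x))) ` carrier X'"
      then obtain x where x: "x \<in> carrier X'" "y = v (f (u' x))" by blast
      have "f (u' x) \<in> {e \<in> carrier E. g e = \<zero>\<^bsub>Y\<^esub>}" using e(4) c(1)[OF x(1)] by blast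
      then show "y \<in> {y \<in> carrier E'. w (g (v' y)) = \<zero>\<^bsub>Y'\<^esub>}" using x(2) v(3) c(3) hom_zero[OF w(1) assms(7,10)] by simp
    next
      fix y assume y: "y \<in> {y \<in> carrier E'. w (g (v' y)) = \<zero>\<^bsub>Y'\<^esub>}"
      then have "g (v' y) \<in> carrier Y" "w (g (v' y)) = \<zero>\<^bsub>Y'\<^esub>" using c(5)[OF c(2)] by auto
      then have "g (v' y) = \<zero>\<^bsub>Y\<^esub>" using w0 by blast
      then have "v' y \<in> f ` carrier X" using e(4) y c(2) by simp
      then obtain x where x: "x \<in> carrier X" "v' y = f x" by blast
      have "y = v (f (u' (u x)))" using x u(3) v(4)[of y] y by simp
      then show "y \<in> (\<lambda>x. v (f (u' x))) ` carrier X'" using c(6)[OF x(1)] by blast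
    qed
    show "(\<lambda>x. w (g (v' x))) ` carrier E' = carrier Y'"
    proof (intro equalityI subsetI)
      fix y assume y: "y \<in> carrier Y'"
      then have "w' y \<in> g ` carrier E" using e(5) c(7) by simp
      then obtain x where x: "x \<in> carrier E" "w' y = g x" by blast
      have "y = w (g (v' (v x)))" using x v(3) w(4)[OF y] by simp
      then show "y \<in> (\<lambda>x. w (g (v' x))) ` carrier E'" using c(3)[OF x(1)] by blast
    next
      fix y assume "y \<in> (\<lambda>x. w (g (v' x))) ` carrier E'"
      then show "y \<in> carrier Y'" using hom_closed[OF g'] by blast
    qed
  qed
  then show ?thesis by blast
qed

text \<open>The identity of \<open>Q\<close> is added to the middle and right terms, as needed for
  projective resolutions of sums.\<close>

lemma short_exact_add_right:
  assumes "short_exact R X f E g Y" "left_module R Q" "left_module R X" "left_module R E"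
  shows "short_exact R X (\<lambda>x. (f x, \<zero>\<^bsub>Q\<^esub>)) (dsum2 E Q) (\<lambda>z. (g (fst z), snd z)) (dsum2 Y Q)"
proof -
  note e = short_exactD[OF assms(1)]
  interpret Q: left_module R Q by fact
  show ?thesis
  proof (rule short_exactI)
    show "(\<lambda>x. (f x, \<zero>\<^bsub>Q\<^esub>)) \<in> mod_hom R X (dsum2 E Q)" by (rule hom_pair[OF e(1) hom_const_zero[OF assms(2)]])
    show "(\<lambda>z. (g (fst z), snd z)) \<in> mod_hom R (dsum2 E Q) (dsum2 Y Q)" by (rule hom_pair[OF hom_comp[OF hom_fst e(2)] hom_snd])
    show "inj_on (\<lambda>x. (f x, \<zero>\<^bsub>Q\<^esub>)) (carrier X)" using e(3) by (auto simp: inj_on_def)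
    show "(\<lambda>x. (f x, \<zero>\<^bsub>Q\<^esub>)) ` carrier X = {z \<in> carrier (dsum2 E Q). (g (fst z), snd z) = \<zero>\<^bsub>dsum2 Y Q\<^esub>}"
    proof -
      have "(\<lambda>x. (f x, \<zero>\<^bsub>Q\<^esub>)) ` carrier X = (\<lambda>y. (y, \<zero>\<^bsub>Q\<^esub>)) ` (f ` carrier X)" by (auto simp: image_image)
      then show ?thesis unfolding e(4) by auto
    qed
    show "(\<lambda>z. (g (fst z), snd z)) ` carrier (dsum2 E Q) = carrier (dsum2 Y Q)"
    proof (intro equalityI subsetI)
      fix z assume "z \<in> carrier (dsum2 Y Q)"
      then obtain y q where z: "z = (y, q)" "y \<in> carrier Y" "q \<in> carrier Q" by auto
      then obtain x where "x \<in> carrier E" "y = g x" using e(5) by blast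
      then show "z \<in> (\<lambda>z. (g (fst z), snd z)) ` carrier (dsum2 E Q)" using z by (intro image_eqI[of _ _ "(x, q)"]) auto
    qed (use hom_closed[OF e(2)] in auto)
  qed
qed

text \<open>The identity of \<open>Q\<close> is added to the left and middle terms;
  \<open>tilting_add_P\<close> uses it with \<open>Q\<close> the first column.\<close>

lemma short_exact_add_left:
  assumes "short_exact R X f E g Y" "left_module R Q"
  shows "short_exact R (dsum2 Q X) (\<lambda>z. (fst z, f (snd z))) (dsum2 Q E) (\<lambda>z. g (snd z)) Y"
proof -
  note e = short_exactD[OF assms(1)]
  interpret Q: left_module R Q by fact
  show ?thesis
  proof (rule short_exactI)
    show "(\<lambda>z. (fst z, f (snd z))) \<in> mod_hom R (dsum2 Q X) (dsum2 Q E)" by (rule hom_pair[OF hom_fst hom_comp[OF hom_snd e(1)]])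
    show gh: "(\<lambda>z. g (snd z)) \<in> mod_hom R (dsum2 Q E) Y" by (rule hom_comp[OF hom_snd e(2)])
    show "inj_on (\<lambda>z. (fst z, f (snd z))) (carrier (dsum2 Q X))" using e(3) by (auto simp: inj_on_def)
    show "(\<lambda>z. (fst z, f (snd z))) ` carrier (dsum2 Q X) = {z \<in> carrier (dsum2 Q E). g (snd z) = \<zero>\<^bsub>Y\<^esub>}"
    proof (intro equalityI subsetI)
      fix z assume "z \<in> (\<lambda>z. (fst z, f (snd z))) ` carrier (dsum2 Q X)"
      then obtain q x where z: "q \<in> carrier Q" "x \<in> carrier X" "z = (q, f x)" by auto
      have "f x \<in> {e \<in> carrier E. g e = \<zero>\<^bsub>Y\<^esub>}" using e(4) z(2) by blast
      then show "z \<in> {z \<in> carrier (dsum2 Q E). g (snd z) = \<zero>\<^bsub>Y\<^esub>}" using z by simp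
    next
      fix z assume z: "z \<in> {z \<in> carrier (dsum2 Q E). g (snd z) = \<zero>\<^bsub>Y\<^esub>}"
      then have "snd z \<in> f ` carrier X" using e(4) by auto
      then obtain x where "x \<in> carrier X" "snd z = f x" by blast
      then show "z \<in> (\<lambda>z. (fst z, f (snd z))) ` carrier (dsum2 Q X)"
        using z by (intro image_eqI[of _ _ "(fst z, x)"]) (auto simp: prod_eq_iff)
    qed
    show "(\<lambda>z. g (snd z)) ` carrier (dsum2 Q E) = carrier Y"
    proof (intro equalityI subsetI)
      fix y assume "y \<in> carrier Y"
      then obtain x where "x \<in> carrier E" "y = g x" using e(5) by blast
      then show "y \<in> (\<lambda>z. g (snd z)) ` carrier (dsum2 Q E)" by (intro image_eqI[of _ _ "(\<zero>\<^bsub>Q\<^esub>, x)"]) auto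
    qed (use hom_closed[OF gh] in blast)
  qed
qed

text \<open>Collects \<open>P\<close> and the complement of an exchanged summand into one new
  complement.\<close>

lemma mod_iso_dsum2_swap: "mod_iso R (dsum2 (dsum2 B C) Q) (dsum2 (dsum2 B Q) C)"
proof -
  have h: "(\<lambda>z. ((fst (fst z), snd z), snd (fst z))) \<in> mod_hom R (dsum2 (dsum2 B C) Q) (dsum2 (dsum2 B Q) C)" for B C Q
    by (rule hom_pair[OF hom_pair[OF hom_comp[OF hom_fst hom_fst] hom_snd] hom_comp[OF hom_fst hom_snd]])
  show ?thesis by (rule mod_isoI'[OF h h]) auto
qed

text \<open>Values are computed at chosen preimages, and the condition on the kernel makes them
  independent of the choice.\<close>

lemma hom_factor_surj:
  assumes "q \<in> mod_hom R M M'" "q ` carrier M = carrier M'" "h \<in> mod_hom R M N" "left_module R M" "left_module R M'" "left_module R N"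
    "\<And>x. x \<in> carrier M \<Longrightarrow> q x = \<zero>\<^bsub>M'\<^esub> \<Longrightarrow> h x = \<zero>\<^bsub>N\<^esub>"
  shows "\<exists>k\<in>mod_hom R M' N. \<forall>x\<in>carrier M. k (q x) = h x"
proof -
  interpret M: left_module R M by fact
  interpret M': left_module R M' by fact
  interpret N: left_module R N by fact
  define s where "s = inv_into (carrier M) q"
  have s: "s y \<in> carrier M" "q (s y) = y" if "y \<in> carrier M'" for y
    using that inv_into_into[of y q "carrier M"] f_inv_into_f[of y q "carrier M"] assms(2) by (auto simp: s_def)
  have eq: "h x = h y" if "x \<in> carrier M" "y \<in> carrier M" "q x = q y" for x y
  proof -
    have "q (x \<ominus>\<^bsub>M\<^esub> y) = \<zero>\<^bsub>M'\<^esub>" using that hom_closed[OF assms(1)] by (simp add: hom_minus[OF assms(1,4,5)] M'.minus_self)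
    then have "h x \<ominus>\<^bsub>N\<^esub> h y = \<zero>\<^bsub>N\<^esub>" using that assms(7)[of "x \<ominus>\<^bsub>M\<^esub> y"] by (simp add: hom_minus[OF assms(3,4,6)])
    then show ?thesis using that hom_closed[OF assms(3)] N.minus_eq_iff[of "h x" "h y" "\<zero>\<^bsub>N\<^esub>"] by simp
  qed
  note qc = hom_closed[OF assms(1)]
  show ?thesis
  proof (intro bexI[of _ "\<lambda>y. h (s y)"] ballI)
    show "h (s (q x)) = h x" if "x \<in> carrier M" for x by (rule eq[OF s(1)[OF qc[OF that]] that s(2)[OF qc[OF that]]])
    show "(\<lambda>y. h (s y)) \<in> mod_hom R M' N"
    proof (rule mod_homI)
      fix x y assume "x \<in> carrier M'" "y \<in> carrier M'"
      then show "h (s (x \<oplus>\<^bsub>M'\<^esub> y)) = h (s x) \<oplus>\<^bsub>N\<^esub> h (s y)"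
        using eq[of "s (x \<oplus>\<^bsub>M'\<^esub> y)" "s x \<oplus>\<^bsub>M\<^esub> s y"] s by (simp add: hom_add[OF assms(1)] hom_add[OF assms(3)])
    next
      fix a x assume "a \<in> carrier R" "x \<in> carrier M'"
      then show "h (s (a \<odot>\<^bsub>M'\<^esub> x)) = a \<odot>\<^bsub>N\<^esub> h (s x)"
        using eq[of "s (a \<odot>\<^bsub>M'\<^esub> x)" "a \<odot>\<^bsub>M\<^esub> s x"] s by (simp add: hom_smult[OF assms(1)] hom_smult[OF assms(3)] M.smult_closed M'.smult_closed)
    qed (use s hom_closed[OF assms(3)] in auto)
  qed
qed

context fd_algebra
begin

text \<open>Given an extension \<open>W \<rightarrow> E \<rightarrow> W\<close> of \<open>W = B \<oplus> C\<close> by itself, \<open>p\<^sub>C\<close> extends along the first map to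
  \<open>h : E \<rightarrow> C\<close> and the inclusion of \<open>C\<close> lifts along the second map \<open>g\<close>, so that the elements of \<open>E\<close> on
  which \<open>h\<close> and \<open>p\<^sub>C \<circ> g\<close> vanish form an extension of \<open>B\<close> by \<open>B\<close>, which splits.\<close>

lemma ext_vanishes_add_proj_inj:
  fixes W B C :: "('k, 'a) umod"
  assumes "ext_vanishes B B" "projective L C" "injective L C" "mod_iso L W (dsum2 B C)" "fg_module L W" "fg_module L B"
  shows "ext_vanishes W W"
  unfolding ext_vanishes_def
proof (intro allI impI)
  fix E :: "('k, 'a) umod" and f g assume E: "fg_module L E \<and> short_exact L W f E g W"
  note e = short_exactD[OF conjunct2[OF E]]
  have fC: "fg_module L C" using assms(2) by (rule projective_fg)
  have lm: "left_module L W" "left_module L B" "left_module L C" "left_module L E" using assms(5,6) fC E fg_left_module by auto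
  interpret W: left_module L W by fact
  interpret B: left_module L B by fact
  interpret C: left_module L C by fact
  interpret E: left_module L E by fact
  obtain iB pB iC pC where i: "iB \<in> mod_hom L B W" "pB \<in> mod_hom L W B" "iC \<in> mod_hom L C W" "pC \<in> mod_hom L W C"
    "\<And>b. b \<in> carrier B \<Longrightarrow> pB (iB b) = b" "\<And>c. c \<in> carrier C \<Longrightarrow> pC (iC c) = c"
    "\<And>b. b \<in> carrier B \<Longrightarrow> pC (iB b) = \<zero>\<^bsub>C\<^esub>" "\<And>c. c \<in> carrier C \<Longrightarrow> pB (iC c) = \<zero>\<^bsub>B\<^esub>"
    "\<And>w. w \<in> carrier W \<Longrightarrow> iB (pB w) \<oplus>\<^bsub>W\<^esub> iC (pC w) = w"
    by (rule mod_iso_dsum2E[OF assms(4) lm(1-3)]) blast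
  obtain h where h: "h \<in> mod_hom L E C" "\<And>w. w \<in> carrier W \<Longrightarrow> h (f w) = pC w"
    using injective_extend[OF assms(3,5) conjunct1[OF E] e(1,3) i(4)] by blast
  obtain s where s: "s \<in> mod_hom L C E" "\<And>c. c \<in> carrier C \<Longrightarrow> g (s c) = iC c"
    using projective_lift[OF assms(2) conjunct1[OF E] assms(5) e(2,5) i(3)] by blast
  note cl = hom_closed[OF i(1)] hom_closed[OF i(2)] hom_closed[OF i(3)] hom_closed[OF i(4)] hom_closed[OF h(1)] hom_closed[OF s(1)]
    hom_closed[OF e(1)] hom_closed[OF e(2)]
  have gf: "g (f w) = \<zero>\<^bsub>W\<^esub>" if "w \<in> carrier W" for w using e(4) that by blast
  note z = hom_zero[OF i(1) lm(2,1)] hom_zero[OF i(2) lm(1,2)] hom_zero[OF i(3) lm(3,1)] hom_zero[OF i(4) lm(1,3)]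
    hom_zero[OF h(1) lm(4,3)] hom_zero[OF s(1) lm(3,4)] hom_zero[OF e(1) lm(1,4)] hom_zero[OF e(2) lm(4,1)]
  \<comment> \<open>\<open>a\<close> removes the part detected by \<open>h\<close>. It subtracts an
    element of the image of \<open>f\<close>, so the image under \<open>g\<close> does not
    change.\<close>
  define a where "a x = x \<ominus>\<^bsub>E\<^esub> f (iC (h x))" for x
  have a: "a \<in> mod_hom L E E" unfolding a_def
    by (rule hom_diff[OF hom_id hom_comp[OF hom_comp[OF h(1) i(3)] e(1)] lm(4)])
  have ha: "h (a x) = \<zero>\<^bsub>C\<^esub>" "g (a x) = g x" if "x \<in> carrier E" for x
    using that cl by (simp_all add: a_def hom_minus[OF h(1) lm(4,3)] hom_minus[OF e(2) lm(4,1)] h(2) i(6) gf C.minus_self W.M.minus_eq)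
  \<comment> \<open>\<open>b\<close> also removes the \<open>C\<close>-part of the image under
    \<open>g\<close>. The lift \<open>s\<close> is itself corrected by \<open>a\<close>, so that
    \<open>h\<close> remains zero.\<close>
  define b where "b x = a x \<ominus>\<^bsub>E\<^esub> a (s (pC (g (a x))))" for x
  have b: "b \<in> mod_hom L E E" unfolding b_def
    by (rule hom_diff[OF a hom_comp[OF hom_comp[OF hom_comp[OF hom_comp[OF a e(2)] i(4)] s(1)] a] lm(4)])
  note ac = hom_closed[OF a]
  have hb: "h (b x) = \<zero>\<^bsub>C\<^esub>" "pC (g (b x)) = \<zero>\<^bsub>C\<^esub>" if x: "x \<in> carrier E" for x
    using x cl ac ha s(2) i(6) by (simp_all add: b_def hom_minus[OF h(1) lm(4,3)] hom_minus[OF e(2) lm(4,1)] hom_minus[OF i(4) lm(1,3)] C.minus_self)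
  let ?U = "{x \<in> carrier E. h x = \<zero>\<^bsub>C\<^esub>} \<inter> {x \<in> carrier E. pC (g x) = \<zero>\<^bsub>C\<^esub>}"
  have sU: "is_submodule L E ?U"
    by (rule submodule_Int[OF submodule_ker[OF lm(4,3) h(1)] submodule_ker[OF lm(4,3) hom_comp[OF e(2) i(4)]]])
  let ?E' = "submod E ?U"
  have bU: "b \<in> mod_hom L E ?E'" by (rule hom_into_submod[OF b]) (use hb hom_closed[OF b] in auto)
  have "short_exact L B (\<lambda>x. f (iB x)) ?E' (\<lambda>x. pB (g x)) B"
  proof (rule short_exactI)
    show "(\<lambda>x. f (iB x)) \<in> mod_hom L B ?E'"
      by (rule hom_into_submod[OF hom_comp[OF i(1) e(1)]]) (use cl h(2) gf i(7) z in auto)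
    show pg: "(\<lambda>x. pB (g x)) \<in> mod_hom L ?E' B"
      by (rule hom_restrict[OF hom_comp[OF e(2) i(2)]]) auto
    show "inj_on (\<lambda>x. f (iB x)) (carrier B)"
    proof (rule inj_onI)
      fix x y assume xy: "x \<in> carrier B" "y \<in> carrier B" "f (iB x) = f (iB y)"
      then have "iB x = iB y" using e(3) cl(1) by (meson inj_onD)
      then show "x = y" using i(5) xy(1,2) by metis
    qed
    show "(\<lambda>x. f (iB x)) ` carrier B = {x \<in> carrier ?E'. pB (g x) = \<zero>\<^bsub>B\<^esub>}"
    proof (intro equalityI subsetI)
      fix x assume "x \<in> (\<lambda>x. f (iB x)) ` carrier B"
      then show "x \<in> {x \<in> carrier ?E'. pB (g x) = \<zero>\<^bsub>B\<^esub>}" using cl h(2) gf i(7) z by auto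
    next
      fix x assume "x \<in> {x \<in> carrier ?E'. pB (g x) = \<zero>\<^bsub>B\<^esub>}"
      then have x: "x \<in> carrier E" "h x = \<zero>\<^bsub>C\<^esub>" "pC (g x) = \<zero>\<^bsub>C\<^esub>" "pB (g x) = \<zero>\<^bsub>B\<^esub>" by auto
      then have "g x = \<zero>\<^bsub>W\<^esub>" using i(9)[OF cl(8)[OF x(1)]] z by simp
      then have "x \<in> f ` carrier W" using x(1) e(4) by simp
      then obtain w where w: "w \<in> carrier W" "x = f w" by blast
      then have "pC w = \<zero>\<^bsub>C\<^esub>" using h(2) x(2) by simp
      then have "w = iB (pB w)" using i(9)[OF w(1)] cl(1)[OF cl(2)[OF w(1)]] z by simp
      then show "x \<in> (\<lambda>x. f (iB x)) ` carrier B" using w cl(2)[OF w(1)] by (metis image_eqI)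
    qed
    show "(\<lambda>x. pB (g x)) ` carrier ?E' = carrier B"
    proof (intro equalityI subsetI)
      fix y assume y: "y \<in> carrier B"
      then have "iB y \<in> g ` carrier E" using e(5) cl(1) by simp
      then obtain x where x: "x \<in> carrier E" "iB y = g x" by blast
      \<comment> \<open>Here \<open>a x\<close> is enough, since its image under \<open>g\<close> is
        \<open>iB y\<close>, which has no \<open>C\<close>-part.\<close>
      have "h (a x) = \<zero>\<^bsub>C\<^esub>" "g (a x) = iB y" using ha x by auto
      then have "a x \<in> carrier ?E'" "pB (g (a x)) = y" using ac[OF x(1)] i(5,7) y by auto
      then show "y \<in> (\<lambda>x. pB (g x)) ` carrier ?E'" by (intro image_eqI[of _ _ "a x"]) simp_all
    qed (use hom_closed[OF pg] in blast)
  qed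
  then obtain r where r: "r \<in> mod_hom L ?E' B" "\<And>x. x \<in> carrier B \<Longrightarrow> r (f (iB x)) = x"
    using assms(1) fg_submodule[OF conjunct1[OF E] sU] unfolding ext_vanishes_def by blast
  show "\<exists>r\<in>mod_hom L E W. \<forall>x\<in>carrier W. r (f x) = x"
  \<comment> \<open>The \<open>B\<close>-part of the retraction comes from the split subextension,
    reached by \<open>b\<close>; the \<open>C\<close>-part is \<open>h\<close>.\<close>
  proof (intro bexI[of _ "\<lambda>x. iB (r (b x)) \<oplus>\<^bsub>W\<^esub> iC (h x)"] ballI)
    show "(\<lambda>x. iB (r (b x)) \<oplus>\<^bsub>W\<^esub> iC (h x)) \<in> mod_hom L E W"
      by (rule hom_plus[OF hom_comp[OF hom_comp[OF bU r(1)] i(1)] hom_comp[OF h(1) i(3)] lm(1)])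
    fix w assume w: "w \<in> carrier W"
    have fw: "f w = f (iB (pB w)) \<oplus>\<^bsub>E\<^esub> f (iC (pC w))" using i(9)[OF w] w cl by (simp add: hom_add[OF e(1), symmetric])
    have aw: "a (f w) = f (iB (pB w))" 
      unfolding a_def h(2)[OF w] using fw w cl E.minus_eq_iff[of "f w" "f (iC (pC w))" "f (iB (pB w))"] by simp
    have "g (a (f w)) = \<zero>\<^bsub>W\<^esub>" using aw gf cl w by simp
    moreover have "a \<zero>\<^bsub>E\<^esub> = \<zero>\<^bsub>E\<^esub>" using hom_zero[OF a lm(4,4)] .
    ultimately have "b (f w) = f (iB (pB w))" using aw z w cl by (simp add: b_def E.M.minus_eq)
    then show "iB (r (b (f w))) \<oplus>\<^bsub>W\<^esub> iC (h (f w)) = w" using r(2) h(2)[OF w] i(9)[OF w] cl(2)[OF w] by simp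
  qed
qed

text \<open>The projective \<open>C\<close> is added to the middle and right terms of a resolution
  of \<open>B\<close>.\<close>

lemma pd_le_1_add_projective:
  fixes W B C :: "('k, 'a) umod"
  assumes "pd_le_1 B" "projective L C" "mod_iso L W (dsum2 B C)" "left_module L W" "left_module L B"
  shows "pd_le_1 W"
proof -
  obtain P0 P1 :: "('k, 'a) umod" and f g where P: "projective L P0" "projective L P1" and e: "short_exact L P1 f P0 g B"
    using assms(1) unfolding pd_le_1_def by blast
  have fC: "fg_module L C" "fg_module L P0" "fg_module L P1" using assms(2) P projective_fg by auto
  have lm: "left_module L C" "left_module L P0" "left_module L P1" using fC fg_left_module by auto
  have lD: "left_module L (dsum2 B C)" "left_module L (dsum2 P0 C)" using lm assms(5) left_module_dsum2 by auto
  obtain U :: "('k, 'a) umod" where U: "fg_module L U" "mod_iso L (dsum2 P0 C) U" using umod_exists[OF fg_dsum2[OF fC(2,1)]] by blast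
  have lU: "left_module L U" using U(1) by (rule fg_left_module)
  have "factors_through L U 2 (\<lambda>i. if i = 0 then P0 else C)"
    by (rule factors_through_dsum2[OF mod_iso_sym[OF U(2) lD(2)] lU lm(2,1)])
  then have pU: "projective L U" by (rule projective_factors_through[OF U(1)]) (use P(1) assms(2) in auto)
  from short_exact_iso[OF short_exact_add_right[OF e lm(1,3,2)] mod_iso_refl U(2) mod_iso_sym[OF assms(3,4)] lm(3) lD(2,1) lm(3) lU assms(4)]
  show ?thesis unfolding pd_le_1_def using pU P(2) by blast
qed

text \<open>Otherwise \<open>X\<close> would occur twice in \<open>W\<close>, once inside
  \<open>M\<close> and once beside it, against \<open>basic_multiplicity_free\<close>.\<close>

lemma basic_not_retract_of_complement:
  fixes M X :: "('k, 'a) umod"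
  assumes "basic L W" "mod_iso L W (dsum2 M X)" "indecomposable L X" "left_module L M"
  shows "\<not> retract L X M"
proof
  assume "retract L X M"
  then obtain i p where ip: "i \<in> mod_hom L X M" "p \<in> mod_hom L M X" "\<And>x. x \<in> carrier X \<Longrightarrow> p (i x) = x" unfolding retract_def by blast
  have lm: "left_module L W" "left_module L X" using assms(1,3) indecomposable_fg fg_left_module unfolding basic_def by auto
  obtain iM pM iX pX where *: "iM \<in> mod_hom L M W" "pM \<in> mod_hom L W M" "iX \<in> mod_hom L X W" "pX \<in> mod_hom L W X"
    "\<And>b. b \<in> carrier M \<Longrightarrow> pM (iM b) = b" "\<And>c. c \<in> carrier X \<Longrightarrow> pX (iX c) = c"
    "\<And>c. c \<in> carrier X \<Longrightarrow> pM (iX c) = \<zero>\<^bsub>M\<^esub>"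
    by (rule mod_iso_dsum2E[OF assms(2) lm(1) assms(4) lm(2)]) blast
  show False
    by (rule basic_multiplicity_free[OF assms(1,3) hom_comp[OF ip(1) *(1)] *(3) hom_comp[OF *(2) ip(2)] *(4)])
      (use ip(3) *(5,6,7) hom_closed[OF ip(1)] hom_zero[OF ip(2) assms(4) lm(2)] in auto)
qed

end

section \<open>Transfer between modules over A and lower modules\<close>

context duplicated
begin

text \<open>Moves finite sums between a module and its \<open>dup_embed\<close> or
  \<open>corner\<close>, which are different records with the same addition.\<close>

lemma finsum_transfer:
  assumes "abelian_monoid G" "abelian_monoid H" "carrier G = carrier H" "add G = add H" "zero G = zero H"
    "finite S" "f \<in> S \<rightarrow> carrier G"
  shows "finsum G f S = finsum H f S"
proof -
  interpret G: abelian_monoid G by fact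
  interpret H: abelian_monoid H by fact
  show ?thesis using assms(6,7)
    by (induct S rule: finite_induct) (use assms(3-5) in auto)
qed

lemma left_module_abelian_monoid: "left_module R M \<Longrightarrow> abelian_monoid M"
  by (simp add: left_module_def abelian_group_def)

lemma factors_through_dup_embed:
  assumes "factors_through A Z m (\<lambda>_. M)" "left_module A Z" "left_module A M"
  shows "factors_through D (dup_embed Z) m (\<lambda>_. dup_embed M)"
proof -
  obtain q p where qp: "\<And>i. i < m \<Longrightarrow> q i \<in> mod_hom A Z M" "\<And>i. i < m \<Longrightarrow> p i \<in> mod_hom A M Z"
    "\<And>x. x \<in> carrier Z \<Longrightarrow> x = (\<Oplus>\<^bsub>Z\<^esub>i\<in>{..<m}. p i (q i x))"
    by (rule factors_throughE[OF assms(1)]) blast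
  have sum: "(\<Oplus>\<^bsub>dup_embed Z :: ('a \<times> ('a \<Rightarrow> 'k) \<times> 'a, _) module\<^esub>i\<in>{..<m}. p i (q i x)) = (\<Oplus>\<^bsub>Z\<^esub>i\<in>{..<m}. p i (q i x))" if x: "x \<in> carrier Z" for x
    using finsum_transfer[OF left_module_abelian_monoid[OF left_module_dup_embed[OF assms(2)]] left_module_abelian_monoid[OF assms(2)],
        of "{..<m}" "\<lambda>i. p i (q i x)"] hom_closed[OF qp(2) hom_closed[OF qp(1) x]] by auto
  then show ?thesis unfolding factors_through_def mod_hom_dup_embed[OF assms(2,3)] mod_hom_dup_embed[OF assms(3,2)]
  proof (intro exI[of _ q] exI[of _ p] conjI allI impI ballI)
    fix x assume "x \<in> carrier (dup_embed Z)"
    then have x: "x \<in> carrier Z" by simp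
    show "x = (\<Oplus>\<^bsub>dup_embed Z :: ('a \<times> ('a \<Rightarrow> 'k) \<times> 'a, _) module\<^esub>i\<in>{..<m}. p i (q i x))" using qp(3)[OF x] sum[OF x] by (rule trans[OF _ sym])
  qed (use qp(1,2) in auto)
qed

lemma factors_through_corner:
  assumes "factors_through D Z m (\<lambda>_. M)" "left_module D Z" "left_module D M" "lower Z" "lower M"
  shows "factors_through A (corner Z) m (\<lambda>_. corner M)"
proof -
  note cZ = corner_lower[OF assms(2,4)]
  obtain q p where qp: "\<And>i. i < m \<Longrightarrow> q i \<in> mod_hom D Z M" "\<And>i. i < m \<Longrightarrow> p i \<in> mod_hom D M Z"
    "\<And>x. x \<in> carrier Z \<Longrightarrow> x = (\<Oplus>\<^bsub>Z\<^esub>i\<in>{..<m}. p i (q i x))"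
    by (rule factors_throughE[OF assms(1)]) blast
  have sum: "(\<Oplus>\<^bsub>corner Z\<^esub>i\<in>{..<m}. p i (q i x)) = (\<Oplus>\<^bsub>Z\<^esub>i\<in>{..<m}. p i (q i x))" if x: "x \<in> carrier Z" for x
    using finsum_transfer[OF left_module_abelian_monoid[OF left_module_corner[OF assms(2)]] left_module_abelian_monoid[OF assms(2)] cZ,
        of "{..<m}" "\<lambda>i. p i (q i x)"] hom_closed[OF qp(2) hom_closed[OF qp(1) x]] cZ by (auto simp del: corner_simps(1))
  then show ?thesis unfolding factors_through_def cZ mod_hom_corner[OF assms(2,3,4), symmetric] mod_hom_corner[OF assms(3,2,5), symmetric]
  proof (intro exI[of _ q] exI[of _ p] conjI allI impI ballI)
    fix x assume "x \<in> carrier Z"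
    then have x: "x \<in> carrier Z" .
    show "x = (\<Oplus>\<^bsub>corner Z\<^esub>i\<in>{..<m}. p i (q i x))" using qp(3)[OF x] sum[OF x] by (rule trans[OF _ sym])
  qed (use qp(1,2) in auto)
qed

lemma short_exact_dup_embed:
  assumes "short_exact A X f E g Y" "left_module A X" "left_module A E" "left_module A Y"
  shows "short_exact D (dup_embed X) f (dup_embed E) g (dup_embed Y)"
  using short_exactD[OF assms(1)] mod_hom_dup_embed[OF assms(2,3)] mod_hom_dup_embed[OF assms(3,4)]
  by (intro short_exactI) auto

lemma short_exact_corner:
  assumes "short_exact D X f E g Y" "left_module D X" "left_module D E" "left_module D Y" "lower X" "lower E" "lower Y"
  shows "short_exact A (corner X) f (corner E) g (corner Y)"
  using short_exactD[OF assms(1)] mod_hom_corner[OF assms(2,3,5)] mod_hom_corner[OF assms(3,4,6)]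
    corner_lower[OF assms(2,5)] corner_lower[OF assms(3,6)] corner_lower[OF assms(4,7)]
  by (intro short_exactI) (auto simp del: corner_simps(1))

text \<open>For \<open>x\<close> in \<open>E\<close> the element \<open>e1 \<odot> x\<close> becomes
  zero in \<open>Y\<close>, so it comes from \<open>X\<close>. There \<open>e1\<close> acts as zero,
  and since \<open>e1\<close> is idempotent, \<open>e1 \<odot> x\<close> itself vanishes.\<close>

lemma lower_extension:
  assumes "short_exact D X f E g Y" "left_module D X" "left_module D E" "left_module D Y" "lower X" "lower Y"
  shows "lower E"
  unfolding lower_def
proof
  note e = short_exactD[OF assms(1)]
  interpret E: left_module D E by fact
  fix x assume x: "x \<in> carrier E"
  have "g (e1 \<odot>\<^bsub>E\<^esub> x) = \<zero>\<^bsub>Y\<^esub>" using x assms(6) hom_closed[OF e(2) x] by (simp add: hom_smult[OF e(2)] lower_def)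
  then have "e1 \<odot>\<^bsub>E\<^esub> x \<in> f ` carrier X" using e(4) x by (simp add: E.smult_closed)
  then obtain y where y: "y \<in> carrier X" "e1 \<odot>\<^bsub>E\<^esub> x = f y" by blast
  have ee: "e1 \<otimes>\<^bsub>D\<^esub> e1 = e1" using mult_e1[of "\<one>\<^bsub>A\<^esub>" "\<lambda>x\<in>carrier A. \<zero>\<^bsub>K\<^esub>" "\<zero>\<^bsub>A\<^esub>"] A.dual_ops_closed(5) by (simp add: e1_def)
  have "e1 \<odot>\<^bsub>E\<^esub> x = e1 \<odot>\<^bsub>E\<^esub> (e1 \<odot>\<^bsub>E\<^esub> x)" using x by (simp add: E.smult_assoc1[symmetric] ee)
  also have "\<dots> = f (e1 \<odot>\<^bsub>X\<^esub> y)" using y by (simp add: hom_smult[OF e(1)])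
  also have "\<dots> = \<zero>\<^bsub>E\<^esub>" using assms(5) y(1) hom_zero[OF e(1) assms(2,3)] by (simp add: lower_def)
  finally show "e1 \<odot>\<^bsub>E\<^esub> x = \<zero>\<^bsub>E\<^esub>" .
qed

text \<open>The middle term of an extension of \<open>lower\<close> modules is \<open>lower\<close>,
  so the extension already lives over \<open>A\<close> and splits there.\<close>

lemma ext_vanishes_dup_embed:
  fixes T :: "('k, 'a) umod"
  assumes "A.ext_vanishes T T" "left_module A T"
  shows "D.ext_vanishes (dup_embed T) (dup_embed T)"
  unfolding D.ext_vanishes_def
proof (intro allI impI)
  fix E :: "('k, 'a \<times> ('a \<Rightarrow> 'k) \<times> 'a) umod" and f g
  assume *: "fg_module D E \<and> short_exact D (dup_embed T) f E g (dup_embed T)"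
  have lm: "left_module D (dup_embed T)" "left_module D E" using left_module_dup_embed[OF assms(2)] * fg_left_module by auto
  have low: "lower (dup_embed T)" "lower E"
    using lower_dup_embed[OF assms(2)] lower_extension[OF conjunct2[OF *] lm(1,2,1)] by auto
  interpret T: left_module A T by fact
  note e = short_exactD[OF conjunct2[OF *]]
  have "short_exact A T f (corner E) g T"
  proof (rule short_exactI)
    show "f \<in> mod_hom A T (corner E)" using e(1) corner_dup_embed_hom[OF assms(2) lm(2)] by simp
    have "mod_hom A (corner E) (corner (dup_embed T)) = mod_hom A (corner E) T"
      by (rule mod_hom_cong) (auto simp: bot_def T.smult_one)
    then show "g \<in> mod_hom A (corner E) T" using e(2) mod_hom_corner[OF lm(2,1) low(2)] by simp
  qed (use e(3-5) corner_lower[OF lm(2) low(2)] in \<open>auto simp del: corner_simps(1)\<close>)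
  then obtain r where r: "r \<in> mod_hom A (corner E) T" "\<forall>x\<in>carrier T. r (f x) = x"
    using assms(1) fg_corner[OF conjunct1[OF *]] unfolding A.ext_vanishes_def by blast
  have "mod_hom A (corner E) (corner (dup_embed T)) = mod_hom A (corner E) T"
    by (rule mod_hom_cong) (auto simp: bot_def T.smult_one)
  then have "r \<in> mod_hom D E (dup_embed T)" using r(1) mod_hom_corner[OF lm(2,1) low(2)] by simp
  then show "\<exists>r\<in>mod_hom D E (dup_embed T). \<forall>x\<in>carrier (dup_embed T). r (f x) = x" using r(2) by auto
qed

text \<open>The sum of the two columns, the second one being identified with the regular
  \<open>A\<close>-module through \<open>bot\<close>.\<close>

lemma regular_decomposition: "mod_iso D (dsum2 col1 (dup_embed (regular_module A))) (regular_module D)"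
proof (rule mod_isoI'[where f = "\<lambda>z. fst z \<oplus>\<^bsub>D\<^esub> bot (snd z)" and g = "\<lambda>x. (x \<otimes>\<^bsub>D\<^esub> e1, snd (snd x))"])
  have b: "bot \<in> mod_hom D (dup_embed (regular_module A)) (regular_module D)"
    by (rule mod_homI) (auto simp: bot_def duplicated_algebra_simps dual_facts intro!: dual_ext[of _ K A])
  have i: "(\<lambda>x. x) \<in> mod_hom D col1 (regular_module D)"
    unfolding col1_def by (rule hom_inclusion[OF submodule_subset[OF submodule_cols(1)]])
  show "(\<lambda>z. fst z \<oplus>\<^bsub>D\<^esub> bot (snd z)) \<in> mod_hom D (dsum2 col1 (dup_embed (regular_module A))) (regular_module D)"
    using hom_plus[OF hom_comp[OF hom_fst i] hom_comp[OF hom_snd b] left_module_regular_D] by simp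
  have 1: "(\<lambda>x. x \<otimes>\<^bsub>D\<^esub> e1) \<in> mod_hom D (regular_module D) col1"
    unfolding col1_def using hom_into_submod[OF hom_right_mult] by auto
  have 2: "(\<lambda>x. snd (snd x)) \<in> mod_hom D (regular_module D) (dup_embed (regular_module A))"
    by (rule mod_homI) (auto simp: duplicated_algebra_simps)
  show "(\<lambda>x. (x \<otimes>\<^bsub>D\<^esub> e1, snd (snd x))) \<in> mod_hom D (regular_module D) (dsum2 col1 (dup_embed (regular_module A)))"
    by (rule hom_pair[OF 1 2])
next
  fix z assume "z \<in> carrier (dsum2 col1 (dup_embed (regular_module A)))"
  then obtain a \<phi> b where z: "z = ((a, \<phi>, \<zero>\<^bsub>A\<^esub>), b)" "a \<in> carrier A" "\<phi> \<in> dual K A" "b \<in> carrier A"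
    by (cases z) (auto simp: mem_col1)
  have "(a, \<phi>, \<zero>\<^bsub>A\<^esub>) \<oplus>\<^bsub>D\<^esub> bot b = (a, \<phi>, b)" using z by (auto simp: bot_def duplicated_algebra_simps dual_facts intro!: dual_ext[of _ K A])
  then show "((fst z \<oplus>\<^bsub>D\<^esub> bot (snd z)) \<otimes>\<^bsub>D\<^esub> e1, snd (snd (fst z \<oplus>\<^bsub>D\<^esub> bot (snd z)))) = z" using z mult_e1 by simp
next
  fix x assume "x \<in> carrier (regular_module D)"
  then obtain a \<phi> b where x: "x = (a, \<phi>, b)" "a \<in> carrier A" "\<phi> \<in> dual K A" "b \<in> carrier A"
    by (cases x) (auto simp: carrier_D)
  have "(a, \<phi>, \<zero>\<^bsub>A\<^esub>) \<oplus>\<^bsub>D\<^esub> bot b = (a, \<phi>, b)" using x by (auto simp: bot_def duplicated_algebra_simps dual_facts intro!: dual_ext[of _ K A])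
  then show "fst (x \<otimes>\<^bsub>D\<^esub> e1, snd (snd x)) \<oplus>\<^bsub>D\<^esub> bot (snd (x \<otimes>\<^bsub>D\<^esub> e1, snd (snd x))) = x" using x mult_e1 by simp
qed

end

section \<open>Adding and cancelling the summand P\<close>

context proj_inj_duplicated
begin

text \<open>The summands of \<open>T\<close> stay indecomposable and pairwise non-isomorphic. None
  of them is isomorphic to an \<open>X j\<close>, which would otherwise be a nonzero injective
  \<open>lower\<close> module.\<close>

lemma basic_add_P:
  fixes T :: "('k, 'a) umod" and W :: "('k, 'a \<times> ('a \<Rightarrow> 'k) \<times> 'a) umod"
  assumes "basic A T" "fg_module D W" "mod_iso D W (dsum2 (dup_embed T) P)"
  shows "basic D W"
proof -
  obtain m and Y :: "nat \<Rightarrow> ('k, 'a) umod" where Y: "\<And>i. i < m \<Longrightarrow> indecomposable A (Y i)" "pairwise_non_iso A m Y"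
    "mod_iso A T (dsum {..<m} Y)" and fT: "fg_module A T" using assms(1) unfolding basic_def by blast
  have lT: "left_module A T" using fT by (rule fg_left_module)
  have lY: "left_module A (Y i)" if "i < m" for i using A.indecomposable_fg[OF Y(1)[OF that]] by (rule fg_left_module)
  have lS: "left_module A (dsum {..<m} Y)" by (rule left_module_dsum[OF A.L.ring_axioms]) (use lY in auto)
  let ?Z = "\<lambda>i. if i < m then dup_embed (Y i) else X (i - m)"
  have lE: "left_module D (dup_embed T)" using left_module_dup_embed[OF lT] .
  have "mod_iso D (dup_embed T) (dsum {..<m} (\<lambda>i. dup_embed (Y i)))"
    using mod_iso_trans[OF _ mod_iso_dup_embed_dsum] mod_iso_dup_embed[OF lT lS] Y(3) by blast
  then have "mod_iso D (dsum2 (dup_embed T) P) (dsum2 (dsum {..<m} (\<lambda>i. dup_embed (Y i))) (dsum {..<n} X))"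
    by (rule mod_iso_dsum2[OF _ P_iso lE left_module_P])
  then have iso: "mod_iso D W (dsum {..<m + n} ?Z)"
    using mod_iso_trans[OF assms(3) mod_iso_trans[OF _ mod_iso_dsum_append]] by blast
  have ne: "\<not> mod_iso D (dup_embed (Y i)) (X j)" "\<not> mod_iso D (X j) (dup_embed (Y i))" if i: "i < m" and j: "j < n" for i j
  proof -
    have "\<not> retract D (X j) (dup_embed (Y i))"
    proof
      assume "retract D (X j) (dup_embed (Y i))"
      then have "lower (X j)"
        by (rule lower_retract[OF _ lower_dup_embed[OF lY[OF i]] left_module_X[OF j] left_module_dup_embed[OF lY[OF i]]])
      then show False using lower_injective_zero[OF X_injective[OF j]] X_indecomposable[OF j] by (simp add: indecomposable_def)
    qed
    then show "\<not> mod_iso D (X j) (dup_embed (Y i))" "\<not> mod_iso D (dup_embed (Y i)) (X j)"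
      using mod_iso_retract left_module_X[OF j] mod_iso_sym[OF _ left_module_dup_embed[OF lY[OF i]]] by blast+
  qed
  have pw: "pairwise_non_iso D (m + n) ?Z" unfolding pairwise_non_iso_def
  proof (intro allI impI)
    fix i j assume ij: "i < m + n" "j < m + n" "i \<noteq> j"
    show "\<not> mod_iso D (?Z i) (?Z j)"
    proof (cases "i < m"; cases "j < m")
      assume "i < m" "j < m"
      then show ?thesis using Y(2) ij(3) mod_iso_dup_embed[OF lY lY] unfolding pairwise_non_iso_def by simp
    next
      assume "\<not> i < m" "\<not> j < m"
      then have "i - m < n" "j - m < n" "i - m \<noteq> j - m" using ij by auto
      then show ?thesis using X_pairwise \<open>\<not> i < m\<close> \<open>\<not> j < m\<close> unfolding pairwise_non_iso_def by simp
    next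
      assume "i < m" "\<not> j < m"
      then show ?thesis using ne(1)[of i "j - m"] ij by simp
    next
      assume "\<not> i < m" "j < m"
      then show ?thesis using ne(2)[of j "i - m"] ij by simp
    qed
  qed
  have ind: "\<forall>i<m + n. indecomposable D (?Z i)"
    using indecomposable_dup_embed[OF Y(1)] X_indecomposable by auto
  show ?thesis unfolding basic_def by (intro conjI exI[of _ "m + n"] exI[of _ ?Z] assms(2) ind pw iso)
qed

lemma retract_summands:
  fixes T :: "('k, 'a) umod" and W :: "('k, 'a \<times> ('a \<Rightarrow> 'k) \<times> 'a) umod"
  assumes "left_module A T" "left_module D W" "mod_iso D W (dsum2 (dup_embed T) P)"
  shows "retract D (dup_embed T) W" "retract D P W"
proof -
  have lT: "left_module D (dup_embed T)" using left_module_dup_embed[OF assms(1)] .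
  have "retract D (dsum2 (dup_embed T) P) W"
    by (rule mod_iso_retract[OF mod_iso_sym[OF assms(3,2)] left_module_dsum2[OF lT left_module_P]])
  then show "retract D (dup_embed T) W" "retract D P W"
    using retract_trans[OF retract_dsum2(1)[OF lT left_module_P]] retract_trans[OF retract_dsum2(2)[OF lT left_module_P]] by blast+
qed

text \<open>For the third tilting condition the identity of \<open>col1\<close> is added to the
  first two terms of the sequence from \<open>A\<close> to \<open>T0\<close> to \<open>T1\<close>.
  The left end becomes the regular \<open>D\<close>-module, and \<open>col1\<close> lies in add of
  \<open>P\<close>.\<close>

lemma tilting_add_P:
  fixes T :: "('k, 'a) umod" and W :: "('k, 'a \<times> ('a \<Rightarrow> 'k) \<times> 'a) umod"
  assumes "tilting A T" "fg_module D W" "mod_iso D W (dsum2 (dup_embed T) P)"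
  shows "tilting D W"
proof -
  obtain T0 T1 :: "('k, 'a) umod" and f g where T: "fg_module A T" "A.pd_le_1 T" "A.ext_vanishes T T"
    "in_add A T T0" "in_add A T T1" and ses: "short_exact A (regular_module A) f T0 g T1"
    using assms(1) unfolding A.tilting_iff by blast
  have lT: "left_module A T" using T(1) by (rule fg_left_module)
  have lE: "left_module D (dup_embed T)" using left_module_dup_embed[OF lT] .
  have lW: "left_module D W" using assms(2) by (rule fg_left_module)
  have fE: "fg_module D (dup_embed T)" using fg_dup_embed[OF T(1)] .
  have pdE: "D.pd_le_1 (dup_embed T)"
  proof -
    obtain P0 P1 :: "('k, 'a) umod" and f g where P: "projective A P0" "projective A P1" "short_exact A P1 f P0 g T"
      using T(2) unfolding A.pd_le_1_def by blast
    have lP: "left_module A P0" "left_module A P1" using P A.projective_fg fg_left_module by auto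
    show ?thesis unfolding D.pd_le_1_def
      using projective_dup_embed[OF P(1)] projective_dup_embed[OF P(2)] short_exact_dup_embed[OF P(3) lP(2,1) lT] by blast
  qed
  have pd: "D.pd_le_1 W" by (rule D.pd_le_1_add_projective[OF pdE projective_P assms(3) lW lE])
  have ext: "D.ext_vanishes W W"
    by (rule D.ext_vanishes_add_proj_inj[OF ext_vanishes_dup_embed[OF T(3) lT] projective_P injective_P assms(3,2) fE])
  note r = retract_summands[OF lT lW assms(3)]
  have add: "\<exists>m. factors_through D (dup_embed Z) m (\<lambda>_. W)" if Z: "in_add A T Z" for Z :: "('k, 'a) umod"
  proof -
    have fZ: "fg_module A Z" using Z A.in_add_iff[OF T(1)] by blast
    have lZ: "left_module A Z" using fZ by (rule fg_left_module)
    obtain m where "factors_through A Z m (\<lambda>_. T)" using Z A.in_add_iff[OF T(1)] by blast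
    from factors_through_comp_retract[OF factors_through_dup_embed[OF this lZ lT] r(1) left_module_dup_embed[OF lZ]]
    show ?thesis by blast
  qed
  have f01: "fg_module A T0" "fg_module A T1" using T(4,5) A.in_add_iff[OF T(1)] by auto
  have l01: "left_module A T0" "left_module A T1" using f01 fg_left_module by auto
  have d01: "left_module D (dup_embed T0)" "left_module D (dup_embed T1)" using left_module_dup_embed l01 by auto
  have fS: "fg_module D (dsum2 col1 (dup_embed T0))" by (rule fg_dsum2[OF fg_cols(1) fg_dup_embed[OF f01(1)]])
  have lS: "left_module D (dsum2 col1 (dup_embed T0))" using fS by (rule fg_left_module)
  obtain U :: "('k, 'a \<times> ('a \<Rightarrow> 'k) \<times> 'a) umod" where U: "fg_module D U" "mod_iso D (dsum2 col1 (dup_embed T0)) U"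
    using D.umod_exists[OF fS] by blast
  have lU: "left_module D U" using U(1) by (rule fg_left_module)
  have lRA: "left_module A (regular_module A)" by (rule left_module_regular[OF A.L.ring_axioms])
  have lRS: "left_module D (dsum2 col1 (dup_embed (regular_module A)))"
    by (rule left_module_dsum2[OF left_module_cols(1) left_module_dup_embed[OF lRA]])
  have "short_exact D (dup_embed (regular_module A)) f (dup_embed T0) g (dup_embed T1)"
    by (rule short_exact_dup_embed[OF ses lRA l01])
  from short_exact_iso[OF short_exact_add_left[OF this left_module_cols(1)] regular_decomposition U(2) mod_iso_refl lRS lS d01(2) left_module_regular_D lU d01(2)]
  obtain f' g' where ses': "short_exact D (regular_module D) f' U g' (dup_embed T1)" by blast
  obtain a where "factors_through D col1 a (\<lambda>_. P)" using col1_factors_through_P by blast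
  then have a: "factors_through D col1 a (\<lambda>_. W)" by (rule factors_through_comp_retract[OF _ r(2) left_module_cols(1)])
  obtain b where b: "factors_through D (dup_embed T0) b (\<lambda>_. W)" using add[OF T(4)] by blast
  have "factors_through D U (a + b) (\<lambda>_. W)"
    by (rule factors_through_sum[OF mod_iso_sym[OF U(2) lS] lU left_module_cols(1) d01(1) lW a b])
  then have U': "in_add D W U" using D.in_add_iff[OF assms(2)] U(1) by blast
  have "in_add D W (dup_embed T1)" using D.in_add_iff[OF assms(2)] add[OF T(5)] fg_dup_embed[OF f01(2)] by blast
  then show ?thesis unfolding D.tilting_iff using assms(2) pd ext U' ses' by blast
qed

text \<open>The common complement \<open>M\<close> is enlarged by \<open>P\<close>, and the exchange
  sequence is kept.\<close>

lemma tilting_arrow_add_P: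
  fixes T T' :: "('k, 'a) umod" and W W' :: "('k, 'a \<times> ('a \<Rightarrow> 'k) \<times> 'a) umod"
  assumes "tilting_arrow A T' T" "left_module A T" "left_module A T'"
    "mod_iso D W (dsum2 (dup_embed T) P)" "mod_iso D W' (dsum2 (dup_embed T') P)"
  shows "tilting_arrow D W' W"
proof -
  obtain M U V E :: "('k, 'a) umod" and f g where *: "fg_module A M" "indecomposable A U" "indecomposable A V"
    "mod_iso A T' (dsum2 M U)" "mod_iso A T (dsum2 M V)" "in_add A M E" and ses: "short_exact A U f E g V"
    using assms(1) unfolding tilting_arrow_def by blast
  have fE: "fg_module A E" using *(6) A.in_add_iff[OF *(1)] by blast
  have lm: "left_module A M" "left_module A U" "left_module A V" "left_module A E"
    using *(1-3) fE A.indecomposable_fg fg_left_module by auto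
  note dm = left_module_dup_embed[OF lm(1)] left_module_dup_embed[OF lm(2)] left_module_dup_embed[OF lm(3)] left_module_dup_embed[OF lm(4)]
  have fMP: "fg_module D (dsum2 (dup_embed M) P)" by (rule fg_dsum2[OF fg_dup_embed[OF *(1)] fg_P])
  have lMP: "left_module D (dsum2 (dup_embed M) P)" using fMP by (rule fg_left_module)
  obtain N :: "('k, 'a \<times> ('a \<Rightarrow> 'k) \<times> 'a) umod" where N: "fg_module D N" "mod_iso D (dsum2 (dup_embed M) P) N"
    using D.umod_exists[OF fMP] by blast
  have lN: "left_module D N" using N(1) by (rule fg_left_module)
  \<comment> \<open>Applied to both ends of the arrow; \<open>N\<close> is a copy of the enlarged
    complement.\<close>
  have iso: "mod_iso D Y (dsum2 N (dup_embed Z))" if Y: "mod_iso D Y (dsum2 (dup_embed S) P)" and S: "left_module A S" "left_module A Z" "mod_iso A S (dsum2 M Z)"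
    for S Z :: "('k, 'a) umod" and Y :: "('k, 'a \<times> ('a \<Rightarrow> 'k) \<times> 'a) umod"
  proof -
    have "mod_iso D (dup_embed S) (dsum2 (dup_embed M) (dup_embed Z))"
      using mod_iso_trans[OF _ mod_iso_dup_embed_dsum2] mod_iso_dup_embed[OF S(1) left_module_dsum2[OF lm(1) S(2)]] S(3) by blast
    then have "mod_iso D (dsum2 (dup_embed S) P) (dsum2 (dsum2 (dup_embed M) (dup_embed Z)) P)"
      by (rule mod_iso_dsum2[OF _ mod_iso_refl left_module_dup_embed[OF S(1)] left_module_P])
    then have "mod_iso D Y (dsum2 (dsum2 (dup_embed M) P) (dup_embed Z))"
      using mod_iso_trans[OF Y mod_iso_trans[OF _ mod_iso_dsum2_swap]] by blast
    then show ?thesis using mod_iso_trans[OF _ mod_iso_dsum2[OF N(2) mod_iso_refl lMP left_module_dup_embed[OF S(2)]]] by blast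
  qed
  obtain m where "factors_through A E m (\<lambda>_. M)" using *(6) A.in_add_iff[OF *(1)] by blast
  then have "factors_through D (dup_embed E) m (\<lambda>_. dup_embed M)" by (rule factors_through_dup_embed[OF _ lm(4,1)])
  then have "factors_through D (dup_embed E) m (\<lambda>_. N)"
    by (rule factors_through_comp_retract[OF _ retract_trans[OF retract_dsum2(1)[OF dm(1) left_module_P] mod_iso_retract[OF N(2) lMP]] dm(4)])
  then have "in_add D N (dup_embed E)" using D.in_add_iff[OF N(1)] fg_dup_embed[OF fE] by blast
  then show ?thesis unfolding tilting_arrow_def
    using N(1) indecomposable_dup_embed[OF *(2)] indecomposable_dup_embed[OF *(3)] iso[OF assms(5,3) lm(2) *(4)]
      iso[OF assms(4,2) lm(3) *(5)] short_exact_dup_embed[OF ses lm(2,4,3)] by blast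
qed

text \<open>Both \<open>S\<close> and \<open>M' \<oplus> Z\<close> are the largest quotient of \<open>W\<close> that is annihilated by \<open>e1\<close>.\<close>

lemma lower_quotient_unique:
  fixes W M M' Z S :: "('k, 'a \<times> ('a \<Rightarrow> 'k) \<times> 'a) umod"
  assumes "mod_iso D W (dsum2 S P)" "mod_iso D W (dsum2 M Z)"
    "left_module D W" "left_module D S" "left_module D M" "left_module D M'" "left_module D Z" "lower S" "lower M'" "lower Z"
    "q \<in> mod_hom D M M'" "q ` carrier M = carrier M'"
    "\<And>(N :: ('k, 'a \<times> ('a \<Rightarrow> 'k) \<times> 'a) umod) h x. left_module D N \<Longrightarrow> lower N \<Longrightarrow> h \<in> mod_hom D M N \<Longrightarrow> x \<in> carrier M \<Longrightarrow>
      q x = \<zero>\<^bsub>M'\<^esub> \<Longrightarrow> h x = \<zero>\<^bsub>N\<^esub>"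
  shows "mod_iso D S (dsum2 M' Z)"
proof -
  interpret W: left_module D W by fact
  interpret M: left_module D M by fact
  interpret M': left_module D M' by fact
  interpret Z: left_module D Z by fact
  interpret S: left_module D S by fact
  obtain iS pS iP pP where i: "iS \<in> mod_hom D S W" "pS \<in> mod_hom D W S" "iP \<in> mod_hom D P W" "pP \<in> mod_hom D W P"
    "\<And>b. b \<in> carrier S \<Longrightarrow> pS (iS b) = b"
    "\<And>w. w \<in> carrier W \<Longrightarrow> iS (pS w) \<oplus>\<^bsub>W\<^esub> iP (pP w) = w"
    by (rule mod_iso_dsum2E[OF assms(1,3,4) left_module_P]) blast
  obtain iM pM iZ pZ where j: "iM \<in> mod_hom D M W" "pM \<in> mod_hom D W M" "iZ \<in> mod_hom D Z W" "pZ \<in> mod_hom D W Z"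
    "\<And>b. b \<in> carrier M \<Longrightarrow> pM (iM b) = b" "\<And>c. c \<in> carrier Z \<Longrightarrow> pZ (iZ c) = c"
    "\<And>b. b \<in> carrier M \<Longrightarrow> pZ (iM b) = \<zero>\<^bsub>Z\<^esub>" "\<And>c. c \<in> carrier Z \<Longrightarrow> pM (iZ c) = \<zero>\<^bsub>M\<^esub>"
    "\<And>w. w \<in> carrier W \<Longrightarrow> iM (pM w) \<oplus>\<^bsub>W\<^esub> iZ (pZ w) = w"
    by (rule mod_iso_dsum2E[OF assms(2,3,5,7)]) blast
  note cl = hom_closed[OF i(1)] hom_closed[OF i(2)] hom_closed[OF i(3)] hom_closed[OF i(4)]
    hom_closed[OF j(1)] hom_closed[OF j(2)] hom_closed[OF j(3)] hom_closed[OF j(4)] hom_closed[OF assms(11)]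
  define \<alpha> where "\<alpha> s = (q (pM (iS s)), pZ (iS s))" for s
  have al: "\<alpha> \<in> mod_hom D S (dsum2 M' Z)" unfolding \<alpha>_def
    by (rule hom_pair[OF hom_comp[OF hom_comp[OF i(1) j(2)] assms(11)] hom_comp[OF i(1) j(4)]])
  have lD: "left_module D (dsum2 M' Z)" using left_module_dsum2[OF assms(6,7)] .
  have inj: "inj_on \<alpha> (carrier S)"
  proof (rule hom_injI[OF al assms(4) lD])
    fix s assume s: "s \<in> carrier S" "\<alpha> s = \<zero>\<^bsub>dsum2 M' Z\<^esub>"
    have w: "iS s \<in> carrier W" using cl(1)[OF s(1)] .
    \<comment> \<open>The composite of \<open>iM\<close> and \<open>pS\<close> leads from
      \<open>M\<close> to a \<open>lower\<close> module, so it vanishes on the kernel of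
      \<open>q\<close>.\<close>
    have "pS (iM (pM (iS s))) = \<zero>\<^bsub>S\<^esub>"
      by (rule assms(13)[OF assms(4,8) hom_comp[OF j(1) i(2)] cl(6)[OF w]]) (use s in \<open>simp add: \<alpha>_def\<close>)
    moreover have "iM (pM (iS s)) = iS s" using j(9)[OF w] s hom_zero[OF j(3) assms(7,3)] cl(5)[OF cl(6)[OF w]] by (simp add: \<alpha>_def)
    ultimately show "s = \<zero>\<^bsub>S\<^esub>" using i(5)[OF s(1)] by simp
  qed
  have surj: "\<alpha> ` carrier S = carrier (dsum2 M' Z)"
  proof (intro equalityI subsetI)
    fix y assume "y \<in> carrier (dsum2 M' Z)"
    then obtain m' z where y: "y = (m', z)" "m' \<in> carrier M'" "z \<in> carrier Z" by auto
    obtain m where m: "m \<in> carrier M" "m' = q m" using y(2) assms(12) by blast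
    \<comment> \<open>The preimage is the \<open>S\<close>-part of a lift \<open>w\<close> to
      \<open>W\<close>; the \<open>P\<close>-part of \<open>w\<close> contributes nothing, because
      it is mapped into \<open>lower\<close> modules.\<close>
    define w where "w = iM m \<oplus>\<^bsub>W\<^esub> iZ z"
    have w: "w \<in> carrier W" using m(1) y(3) cl by (simp add: w_def)
    have pMw: "pM w = m" "pZ w = z" unfolding w_def
      using m(1) y(3) cl j(5-8) by (simp_all add: hom_add[OF j(2)] hom_add[OF j(4)])
    have P0: "q (pM (iP (pP w))) = \<zero>\<^bsub>M'\<^esub>" "pZ (iP (pP w)) = \<zero>\<^bsub>Z\<^esub>"
      using hom_P_lower[OF hom_comp[OF hom_comp[OF i(3) j(2)] assms(11)] assms(6,9) cl(4)[OF w]]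
        hom_P_lower[OF hom_comp[OF i(3) j(4)] assms(7,10) cl(4)[OF w]] by auto
    have sw: "iS (pS w) \<in> carrier W" "iP (pP w) \<in> carrier W" using cl w by auto
    have "q m = q (pM (iS (pS w)))"
      using arg_cong[OF i(6)[OF w], of "\<lambda>v. q (pM v)"] sw cl(6)[OF sw(1)] cl(6)[OF sw(2)] cl(9)[OF cl(6)[OF sw(1)]] P0 pMw
      by (simp add: hom_add[OF j(2)] hom_add[OF assms(11)])
    moreover have "z = pZ (iS (pS w))"
      using arg_cong[OF i(6)[OF w], of pZ] sw cl(8)[OF sw(1)] P0 pMw by (simp add: hom_add[OF j(4)])
    ultimately have "\<alpha> (pS w) = y" using y m by (simp add: \<alpha>_def)
    then show "y \<in> \<alpha> ` carrier S" using cl(2)[OF w] by blast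
  next
    fix y assume "y \<in> \<alpha> ` carrier S" then show "y \<in> carrier (dsum2 M' Z)" using hom_closed[OF al] by blast
  qed
  show ?thesis using mod_isoI[OF al] inj surj by (simp add: bij_betw_def)
qed

text \<open>Cancelling \<open>P\<close> from \<open>W\<close> and from \<open>W'\<close> has to
  produce the same complement for both. This is why a quotient of \<open>M\<close> with a universal
  property is used instead of a choice of summands.\<close>

lemma tilting_arrow_cancel_P:
  fixes T T' :: "('k, 'a) umod" and W W' :: "('k, 'a \<times> ('a \<Rightarrow> 'k) \<times> 'a) umod"
  assumes "tilting_arrow D W' W" "basic D W" "basic D W'" "fg_module A T" "fg_module A T'"
    "mod_iso D W (dsum2 (dup_embed T) P)" "mod_iso D W' (dsum2 (dup_embed T') P)"
  shows "tilting_arrow A T' T"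
proof -
  obtain M U V E :: "('k, 'a \<times> ('a \<Rightarrow> 'k) \<times> 'a) umod" and f g where *: "fg_module D M" "indecomposable D U" "indecomposable D V"
    "mod_iso D W' (dsum2 M U)" "mod_iso D W (dsum2 M V)" "in_add D M E" and ses: "short_exact D U f E g V"
    using assms(1) unfolding tilting_arrow_def by blast
  have fE: "fg_module D E" using *(6) D.in_add_iff[OF *(1)] by blast
  have lm: "left_module D M" "left_module D U" "left_module D V" "left_module D E"
    using *(1-3) fE D.indecomposable_fg fg_left_module by auto
  have lW: "left_module D W" "left_module D W'" using assms(2,3) fg_left_module by (auto simp: basic_def)
  have lA: "left_module A T" "left_module A T'" using assms(4,5) fg_left_module by auto
  note lT = left_module_dup_embed[OF lA(1)] left_module_dup_embed[OF lA(2)]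
  note low = lower_dup_embed[OF lA(1)] lower_dup_embed[OF lA(2)]
  obtain k where k: "factors_through D E k (\<lambda>_. M)" using *(6) D.in_add_iff[OF *(1)] by blast
  \<comment> \<open>An indecomposable summand of \<open>E\<close> is a summand of \<open>M\<close>,
    because \<open>E\<close> lies in add of \<open>M\<close>; basicness forbids this for the
    exchanged summands.\<close>
  have nrM: "\<not> retract D Z E" if "indecomposable D Z" "basic D Y" "mod_iso D Y (dsum2 M Z)"
    for Y Z :: "('k, 'a \<times> ('a \<Rightarrow> 'k) \<times> 'a) umod"
  proof
    assume "retract D Z E"
    from factors_through_retract[OF this k fg_left_module[OF D.indecomposable_fg[OF that(1)]] lm(4,1)]
    have "retract D Z M" using D.indecomposable_retract_of_factor[OF that(1)] by blast
    then show False using D.basic_not_retract_of_complement[OF that(2,3,1) lm(1)] by blast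
  qed
  \<comment> \<open>By locality an indecomposable summand of \<open>Y\<close> is a summand of the
    embedded \<open>A\<close>-module or of \<open>P\<close>.\<close>
  have low_summand: "lower Z"
    if Z: "indecomposable D Z" "mod_iso D Y (dsum2 M Z)" "\<not> retract D Z P" and Y: "left_module D Y" "mod_iso D Y (dsum2 (dup_embed S) P)" "left_module A S"
    for S :: "('k, 'a) umod" and Y Z :: "('k, 'a \<times> ('a \<Rightarrow> 'k) \<times> 'a) umod"
  proof -
    have lZ: "left_module D Z" using D.indecomposable_fg[OF Z(1)] by (rule fg_left_module)
    note lS = left_module_dup_embed[OF Y(3)]
    have "retract D Z Y" by (rule retract_trans[OF retract_dsum2(2)[OF lm(1) lZ] mod_iso_retract[OF mod_iso_sym[OF Z(2) Y(1)] left_module_dsum2[OF lm(1) lZ]]])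
    from factors_through_retract[OF this factors_through_dsum2[OF Y(2,1) lS left_module_P] lZ Y(1)]
    have "factors_through D Z 2 (\<lambda>i. if i = 0 then dup_embed S else P)" using lS left_module_P by auto
    from D.indecomposable_retract_of_factor[OF Z(1) this]
    have "retract D Z (dup_embed S)" using Z(3) by (auto split: if_splits)
    then show ?thesis using lower_retract[OF _ lower_dup_embed[OF Y(3)] lZ lS] by blast
  qed
  have U: "lower U"
  proof (rule low_summand[OF *(2,4) _ lW(2) assms(7) lA(2)])
    show "\<not> retract D U P"
    proof
      assume "retract D U P"
      then have "injective D U" using D.injective_retract[OF injective_P _ D.indecomposable_fg[OF *(2)]] by blast
      then show False using D.split_mono_injective[OF ses _ fE] nrM[OF *(2) assms(3) *(4)] by blast
    qed
  qed
  have V: "lower V"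
  proof (rule low_summand[OF *(3,5) _ lW(1) assms(6) lA(1)])
    show "\<not> retract D V P"
    proof
      assume "retract D V P"
      then have "projective D V" using D.projective_retract[OF projective_P _ D.indecomposable_fg[OF *(3)]] by blast
      then show False using D.split_epi_projective[OF ses _ fE] nrM[OF *(3) assms(2) *(5)] by blast
    qed
  qed
  have E: "lower E" by (rule lower_extension[OF ses lm(2,4,3) U V])
  interpret W': left_module D W' by (rule lW(2))
  obtain iT pT iP pP where i: "iT \<in> mod_hom D (dup_embed T') W'" "pT \<in> mod_hom D W' (dup_embed T')" "iP \<in> mod_hom D P W'" "pP \<in> mod_hom D W' P"
    "\<And>w. w \<in> carrier W' \<Longrightarrow> iT (pT w) \<oplus>\<^bsub>W'\<^esub> iP (pP w) = w"
    by (rule mod_iso_dsum2E[OF assms(7) lW(2) lT(2) left_module_P]) blast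
  obtain iM pM where j: "iM \<in> mod_hom D M W'" "pM \<in> mod_hom D W' M" "\<And>b. b \<in> carrier M \<Longrightarrow> pM (iM b) = b"
    by (rule mod_iso_dsum2E[OF *(4) lW(2) lm(1,2)]) blast
  \<comment> \<open>The largest \<open>lower\<close> quotient of \<open>M\<close> is realised as the
    image of \<open>M\<close> in the \<open>T'\<close>-part of \<open>W'\<close>. Its universal
    property \<open>kills\<close> speaks of \<open>M\<close> alone, so the same quotient serves for
    \<open>T\<close>.\<close>
  define q where "q x = pT (iM x)" for x
  have q: "q \<in> mod_hom D M (dup_embed T')" unfolding q_def by (rule hom_comp[OF j(1) i(2)])
  let ?N = "submod (dup_embed T') (q ` carrier M)"
  have sN: "is_submodule D (dup_embed T') (q ` carrier M)" by (rule submodule_image[OF lm(1) lT(2) q submodule_carrier[OF lm(1)]])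
  have fN: "fg_module D ?N" by (rule D.fg_submodule[OF fg_dup_embed[OF assms(5)] sN])
  have lN: "left_module D ?N" using fN by (rule fg_left_module)
  have lowN: "lower ?N" using low(2) submodule_subset[OF sN] by (auto simp: lower_def)
  have qN: "q \<in> mod_hom D M ?N" "q ` carrier M = carrier ?N" using hom_into_submod[OF q] by auto
  \<comment> \<open>An element killed by \<open>q\<close> lies in the \<open>P\<close>-part of
    \<open>W'\<close>, and maps from \<open>P\<close> to \<open>lower\<close> modules
    vanish.\<close>
  have kills: "h x = \<zero>\<^bsub>N\<^esub>" if N: "left_module D N" "lower N" and h: "h \<in> mod_hom D M N" and x: "x \<in> carrier M" "q x = \<zero>\<^bsub>?N\<^esub>"
    for N :: "('k, 'a \<times> ('a \<Rightarrow> 'k) \<times> 'a) umod" and h x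
  proof -
    interpret N: left_module D N by (rule N(1))
    let ?w = "iM x"
    have w: "?w \<in> carrier W'" using hom_closed[OF j(1) x(1)] .
    have "iT (pT ?w) = \<zero>\<^bsub>W'\<^esub>" using x(2) hom_zero[OF i(1) lT(2) lW(2)] by (simp add: q_def)
    then have "?w = iP (pP ?w)" using i(5)[OF w] hom_closed[OF i(3) hom_closed[OF i(4) w]] by simp
    then have "h x = h (pM (iP (pP ?w)))" using j(3)[OF x(1)] by simp
    then show ?thesis using hom_P_lower[OF hom_comp[OF hom_comp[OF i(3) j(2)] h] N hom_closed[OF i(4) w]] by simp
  qed
  have iso: "mod_iso A S (dsum2 (corner ?N) (corner Z))"
    if "mod_iso D Y (dsum2 (dup_embed S) P)" "mod_iso D Y (dsum2 M Z)" "left_module D Y" "left_module A S" "left_module D Z" "lower Z"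
    for S :: "('k, 'a) umod" and Y Z :: "('k, 'a \<times> ('a \<Rightarrow> 'k) \<times> 'a) umod"
  proof -
    have lc: "left_module A (corner ?N)" "left_module A (corner Z)" using left_module_corner lN that(5) by auto
    have "mod_iso D (dup_embed S) (dsum2 ?N Z)"
      by (rule lower_quotient_unique[OF that(1,2,3) left_module_dup_embed[OF that(4)] lm(1) lN that(5) lower_dup_embed[OF that(4)] lowN that(6) qN]) (rule kills)
    moreover have "mod_iso D (dsum2 ?N Z) (dsum2 (dup_embed (corner ?N)) (dup_embed (corner Z)))"
      by (rule mod_iso_dsum2[OF mod_iso_dup_embed_corner[OF lN lowN] mod_iso_dup_embed_corner[OF that(5,6)] lN that(5)])
    moreover have "mod_iso D (dsum2 (dup_embed (corner ?N)) (dup_embed (corner Z))) (dup_embed (dsum2 (corner ?N) (corner Z)))"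
      by (rule mod_iso_sym[OF mod_iso_dup_embed_dsum2 left_module_dup_embed[OF left_module_dsum2[OF lc]]])
    ultimately have "mod_iso D (dup_embed S) (dup_embed (dsum2 (corner ?N) (corner Z)))" using mod_iso_trans by blast
    then show ?thesis using mod_iso_dup_embed[OF that(4) left_module_dsum2[OF lc]] by blast
  qed
  \<comment> \<open>As \<open>E\<close> is \<open>lower\<close>, the maps from \<open>M\<close> to
    \<open>E\<close> that exhibit it in add of \<open>M\<close> factor through the quotient.\<close>
  have "factors_through D E k (\<lambda>_. ?N)"
  proof -
    obtain u v where uv: "\<And>i. i < k \<Longrightarrow> u i \<in> mod_hom D E M" "\<And>i. i < k \<Longrightarrow> v i \<in> mod_hom D M E"
      "\<And>x. x \<in> carrier E \<Longrightarrow> x = (\<Oplus>\<^bsub>E\<^esub>i\<in>{..<k}. v i (u i x))"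
      by (rule factors_throughE[OF k]) blast
    have "\<forall>i<k. \<exists>v'\<in>mod_hom D ?N E. \<forall>x\<in>carrier M. v' (q x) = v i x"
    proof (intro allI impI)
      fix i assume "i < k"
      show "\<exists>v'\<in>mod_hom D ?N E. \<forall>x\<in>carrier M. v' (q x) = v i x"
        by (rule hom_factor_surj[OF qN uv(2)[OF \<open>i < k\<close>] lm(1) lN lm(4)]) (rule kills[OF lm(4) E uv(2)[OF \<open>i < k\<close>]])
    qed
    then obtain v' where v': "\<And>i. i < k \<Longrightarrow> v' i \<in> mod_hom D ?N E" "\<And>i x. i < k \<Longrightarrow> x \<in> carrier M \<Longrightarrow> v' i (q x) = v i x" by metis
    interpret E: left_module D E by (rule lm(4))
    show ?thesis unfolding factors_through_def
    proof (rule exI[of _ "\<lambda>i x. q (u i x)"], rule exI[of _ v'], intro conjI allI impI ballI)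
      fix x assume x: "x \<in> carrier E"
      have "(\<Oplus>\<^bsub>E\<^esub>i\<in>{..<k}. v' i (q (u i x))) = (\<Oplus>\<^bsub>E\<^esub>i\<in>{..<k}. v i (u i x))"
        by (rule E.M.finsum_cong'[OF refl]) (use v'(2) hom_closed[OF uv(1) x] hom_closed[OF uv(2)] in auto)
      then show "x = (\<Oplus>\<^bsub>E\<^esub>i\<in>{..<k}. v' i (q (u i x)))" using uv(3)[OF x] by (rule trans[OF _ sym, rotated])
    qed (use v'(1) hom_comp[OF uv(1) qN(1)] in auto)
  qed
  then have "factors_through A (corner E) k (\<lambda>_. corner ?N)" by (rule factors_through_corner[OF _ lm(4) lN E lowN])
  then have add: "in_add A (corner ?N) (corner E)" using A.in_add_iff[OF fg_corner[OF fN]] fg_corner[OF fE] by blast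
  show ?thesis unfolding tilting_arrow_def
    using fg_corner[OF fN] indecomposable_corner[OF *(2) U] indecomposable_corner[OF *(3) V]
      iso[OF assms(7) *(4) lW(2) lA(2) lm(2) U] iso[OF assms(6) *(5) lW(1) lA(1) lm(3) V] add
      short_exact_corner[OF ses lm(2,4,3) U E V] by blast
qed

end

section \<open>The tilting quiver\<close>

lemma dominates_tilting_quiver:
  fixes L :: "('k, 'a) module"
  shows "dominates (tilting_quiver L) x y \<longleftrightarrow> (\<exists>(T' :: ('k, 'a) umod) (T :: ('k, 'a) umod).
     x = iso_class L T' \<and> y = iso_class L T \<and> basic L T' \<and> tilting L T' \<and> basic L T \<and> tilting L T \<and> tilting_arrow L T' T)"
  unfolding arcs_ends_def arc_to_ends_def tilting_quiver_def by auto

lemma iso_class_eq: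
  assumes "mod_iso R M N" "left_module R M" shows "iso_class R M = iso_class R N"
  unfolding iso_class_def using mod_iso_trans[OF _ assms(1)] mod_iso_trans[OF _ mod_iso_sym[OF assms]] by blast

lemma iso_class_eqD:
  fixes R :: "('k, 'a) module" and M :: "('k, 'a) umod"
  assumes "iso_class R M = iso_class R N" "fg_module R M" shows "mod_iso R M N"
  using assms mod_iso_refl unfolding iso_class_def by blast

text \<open>Arrows join isomorphism classes, so an arrow only yields representatives that are
  isomorphic to the given modules and have the type of the definitions. Both directions pass to such
  representatives and to a copy \<open>P0\<close> of \<open>P\<close>, apply the results on adding
  and cancelling it, and return.\<close>

theorem theorem4p1:
  fixes K :: "'k ring"
    and Q :: "('v, 'e) pre_digraph"
    and A :: "('k, 'v \<times> 'e list \<Rightarrow> 'k) module"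
    and A1 :: "('k, ('v \<times> 'e list \<Rightarrow> 'k) \<times> (('v \<times> 'e list \<Rightarrow> 'k) \<Rightarrow> 'k) \<times> ('v \<times> 'e list \<Rightarrow> 'k)) module"
    and P :: "(('v \<times> 'e list \<Rightarrow> 'k) \<times> (('v \<times> 'e list \<Rightarrow> 'k) \<Rightarrow> 'k) \<times> ('v \<times> 'e list \<Rightarrow> 'k), 'p) module"
    and T :: "('v \<times> 'e list \<Rightarrow> 'k, 't) module"
    and T' :: "('v \<times> 'e list \<Rightarrow> 'k, 's) module"
  assumes "field K"
    and "fin_digraph Q"
    and "A = path_algebra K Q"
    and "fg_module K A"  \<comment> \<open>\<open>A\<close> is finite dimensional over \<open>K\<close>\<close>
    and "A1 = duplicated_algebra K A"
    and "proj_inj_sum A1 P"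
    and "basic A T" and "tilting A T"
    and "basic A T'" and "tilting A T'"
  shows "dominates (tilting_quiver A) (iso_class A T') (iso_class A T) \<longleftrightarrow>
     dominates (tilting_quiver A1)
       (iso_class A1 (dsum2 (dup_embed T') P)) (iso_class A1 (dsum2 (dup_embed T) P))"
proof -
  interpret dup: duplicated K A
    unfolding duplicated_def assms(3) by (rule fd_algebra_path_algebra[OF assms(1,2) assms(4)[unfolded assms(3)]])
  have A1: "A1 = duplicated_algebra K A" by (rule assms(5))
  have fP: "fg_module A1 P" using assms(6) by (simp add: proj_inj_sum_def)
  have lP: "left_module A1 P" using fP by (rule fg_left_module)
  obtain P0 :: "('k, ('v \<times> 'e list \<Rightarrow> 'k) \<times> (('v \<times> 'e list \<Rightarrow> 'k) \<Rightarrow> 'k) \<times> ('v \<times> 'e list \<Rightarrow> 'k)) umod"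
    where P0: "fg_module A1 P0" "mod_iso A1 P P0" using dup.D.umod_exists[OF fP[unfolded A1]] unfolding A1 by blast
  have lP0: "left_module A1 P0" using P0(1) by (rule fg_left_module)
  obtain n X where X: "\<forall>i<n. indecomposable A1 (X i) \<and> projective A1 (X i) \<and> injective A1 (X i)"
      "pairwise_non_iso A1 n X"
      "\<forall>Z :: ('k, ('v \<times> 'e list \<Rightarrow> 'k) \<times> (('v \<times> 'e list \<Rightarrow> 'k) \<Rightarrow> 'k) \<times> ('v \<times> 'e list \<Rightarrow> 'k)) umod.
        indecomposable A1 Z \<and> projective A1 Z \<and> injective A1 Z \<longrightarrow> (\<exists>i<n. mod_iso A1 Z (X i))"
      "mod_iso A1 P (dsum {..<n} (X :: nat \<Rightarrow> ('k, ('v \<times> 'e list \<Rightarrow> 'k) \<times> (('v \<times> 'e list \<Rightarrow> 'k) \<Rightarrow> 'k) \<times> ('v \<times> 'e list \<Rightarrow> 'k)) umod))"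
    using assms(6) unfolding proj_inj_sum_def by blast
  interpret dup: proj_inj_duplicated K A P0 n X
    by unfold_locales
      (use X P0(1) mod_iso_trans[OF mod_iso_sym[OF P0(2) lP] X(4)] in \<open>auto simp: A1\<close>)
  have fT: "fg_module A T" "fg_module A T'" using assms(7,9) by (auto simp: basic_def)
  have lT: "left_module A T" "left_module A T'" using fT fg_left_module by auto
  have sum_iso: "mod_iso A1 (dsum2 (dup_embed S) P0) (dsum2 (dup_embed S') P)"
    if "mod_iso A S S'" "left_module A S" "left_module A S'"
    for S :: "('k, 'v \<times> 'e list \<Rightarrow> 'k) umod" and S' :: "('v \<times> 'e list \<Rightarrow> 'k, 'x) module"
    unfolding A1
    by (rule mod_iso_dsum2[OF _ mod_iso_sym[OF P0(2)[unfolded A1] lP[unfolded A1]] dup.left_module_dup_embed[OF that(2)] dup.left_module_P])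
      (use that dup.mod_iso_dup_embed in blast)
  show ?thesis
  proof
    assume "dominates (tilting_quiver A) (iso_class A T') (iso_class A T)"
    then obtain S' S :: "('k, 'v \<times> 'e list \<Rightarrow> 'k) umod" where S: "iso_class A T' = iso_class A S'" "iso_class A T = iso_class A S"
      "basic A S'" "tilting A S'" "basic A S" "tilting A S" "tilting_arrow A S' S"
      unfolding dominates_tilting_quiver by blast
    have fS: "fg_module A S" "fg_module A S'" using S(3,5) by (auto simp: basic_def)
    have lS: "left_module A S" "left_module A S'" using fS fg_left_module by auto
    have iS: "mod_iso A S T" "mod_iso A S' T'" using iso_class_eqD[OF S(2)[symmetric] fS(1)] iso_class_eqD[OF S(1)[symmetric] fS(2)] by auto
    have fW: "fg_module A1 (dsum2 (dup_embed S) P0)" "fg_module A1 (dsum2 (dup_embed S') P0)"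
      unfolding A1 using fg_dsum2 dup.fg_dup_embed fS dup.fg_P by blast+
    obtain W :: "('k, ('v \<times> 'e list \<Rightarrow> 'k) \<times> (('v \<times> 'e list \<Rightarrow> 'k) \<Rightarrow> 'k) \<times> ('v \<times> 'e list \<Rightarrow> 'k)) umod"
      where W: "fg_module A1 W" "mod_iso A1 (dsum2 (dup_embed S) P0) W" using dup.D.umod_exists[OF fW(1)[unfolded A1]] unfolding A1 by blast
    obtain W' :: "('k, ('v \<times> 'e list \<Rightarrow> 'k) \<times> (('v \<times> 'e list \<Rightarrow> 'k) \<Rightarrow> 'k) \<times> ('v \<times> 'e list \<Rightarrow> 'k)) umod"
      where W': "fg_module A1 W'" "mod_iso A1 (dsum2 (dup_embed S') P0) W'" using dup.D.umod_exists[OF fW(2)[unfolded A1]] unfolding A1 by blast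
    have lW: "left_module A1 W" "left_module A1 W'" using W(1) W'(1) fg_left_module by auto
    have iW: "mod_iso A1 W (dsum2 (dup_embed S) P0)" "mod_iso A1 W' (dsum2 (dup_embed S') P0)"
      using mod_iso_sym[OF W(2) fg_left_module[OF fW(1)]] mod_iso_sym[OF W'(2) fg_left_module[OF fW(2)]] by auto
    have "iso_class A1 (dsum2 (dup_embed T) P) = iso_class A1 W"
      by (rule iso_class_eq[OF mod_iso_trans[OF iW(1) sum_iso[OF iS(1) lS(1) lT(1)]] lW(1), symmetric])
    moreover have "iso_class A1 (dsum2 (dup_embed T') P) = iso_class A1 W'"
      by (rule iso_class_eq[OF mod_iso_trans[OF iW(2) sum_iso[OF iS(2) lS(2) lT(2)]] lW(2), symmetric])
    moreover have "basic A1 W" "basic A1 W'"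
      using dup.basic_add_P[OF S(5) W(1)[unfolded A1] iW(1)[unfolded A1]] dup.basic_add_P[OF S(3) W'(1)[unfolded A1] iW(2)[unfolded A1]] by (auto simp: A1)
    moreover have "tilting A1 W" "tilting A1 W'"
      using dup.tilting_add_P[OF S(6) W(1)[unfolded A1] iW(1)[unfolded A1]] dup.tilting_add_P[OF S(4) W'(1)[unfolded A1] iW(2)[unfolded A1]] by (auto simp: A1)
    moreover have "tilting_arrow A1 W' W"
      using dup.tilting_arrow_add_P[OF S(7) lS iW[unfolded A1]] by (simp add: A1)
    ultimately show "dominates (tilting_quiver A1) (iso_class A1 (dsum2 (dup_embed T') P)) (iso_class A1 (dsum2 (dup_embed T) P))"
      unfolding dominates_tilting_quiver by blast
  next
    assume "dominates (tilting_quiver A1) (iso_class A1 (dsum2 (dup_embed T') P)) (iso_class A1 (dsum2 (dup_embed T) P))"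
    then obtain W' W :: "('k, ('v \<times> 'e list \<Rightarrow> 'k) \<times> (('v \<times> 'e list \<Rightarrow> 'k) \<Rightarrow> 'k) \<times> ('v \<times> 'e list \<Rightarrow> 'k)) umod"
      where W: "iso_class A1 (dsum2 (dup_embed T') P) = iso_class A1 W'" "iso_class A1 (dsum2 (dup_embed T) P) = iso_class A1 W"
      "basic A1 W'" "basic A1 W" "tilting_arrow A1 W' W"
      unfolding dominates_tilting_quiver by blast
    obtain S :: "('k, 'v \<times> 'e list \<Rightarrow> 'k) umod" where S: "fg_module A S" "mod_iso A T S" using dup.A.umod_exists[OF fT(1)] by blast
    obtain S' :: "('k, 'v \<times> 'e list \<Rightarrow> 'k) umod" where S': "fg_module A S'" "mod_iso A T' S'" using dup.A.umod_exists[OF fT(2)] by blast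
    have lS: "left_module A S" "left_module A S'" using S(1) S'(1) fg_left_module by auto
    have iS: "mod_iso A S T" "mod_iso A S' T'" using mod_iso_sym[OF S(2) lT(1)] mod_iso_sym[OF S'(2) lT(2)] by auto
    have fW: "fg_module A1 W" "fg_module A1 W'" using W(3,4) by (auto simp: basic_def)
    have l0: "left_module A1 (dsum2 (dup_embed S) P0)" "left_module A1 (dsum2 (dup_embed S') P0)"
      unfolding A1 using left_module_dsum2 dup.left_module_dup_embed lS dup.left_module_P by blast+
    have iW: "mod_iso A1 W (dsum2 (dup_embed S) P0)"
      using mod_iso_trans[OF iso_class_eqD[OF W(2)[symmetric] fW(1)] mod_iso_sym[OF sum_iso[OF iS(1) lS(1) lT(1)] l0(1)]] .
    have iW': "mod_iso A1 W' (dsum2 (dup_embed S') P0)"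
      using mod_iso_trans[OF iso_class_eqD[OF W(1)[symmetric] fW(2)] mod_iso_sym[OF sum_iso[OF iS(2) lS(2) lT(2)] l0(2)]] .
    have "tilting_arrow A S' S"
      by (rule dup.tilting_arrow_cancel_P[OF W(5,4,3)[unfolded A1] S(1) S'(1) iW[unfolded A1] iW'[unfolded A1]])
    \<comment> \<open>These properties are inherited from \<open>T\<close> and \<open>T'\<close>,
      not derived from \<open>W\<close> and \<open>W'\<close>.\<close>
    moreover have "tilting A S" "tilting A S'"
      using dup.A.tilting_iso[OF assms(8) S(2,1)] dup.A.tilting_iso[OF assms(10) S'(2,1)] by auto
    moreover have "basic A S" "basic A S'"
      using dup.A.basic_iso[OF assms(7) S(2,1)] dup.A.basic_iso[OF assms(9) S'(2,1)] by auto
    moreover have "iso_class A T = iso_class A S" "iso_class A T' = iso_class A S'"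
      using iso_class_eq[OF S(2) lT(1)] iso_class_eq[OF S'(2) lT(2)] by auto
    ultimately show "dominates (tilting_quiver A) (iso_class A T') (iso_class A T)"
      unfolding dominates_tilting_quiver by blast
  qed
qed



end
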